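(* Let $\hbar=\frac1d$ for $d\in\{1,2,\ldots\}$, and consider the $d\to\infty$ behavior of the random anisotropic profile $f_\lambda(c\,|\,\overline{\varepsilon},\hbar)$ for $\lambda$ sampled from the Jack–Plancherel measure $M_d^{\rm PL}$ on partitions of size $d$. Let $v_{\rm PL}=\{1,0,0,\ldots\}$. The regimes are: Regime I ($\overline{\varepsilon}<0$ fixed); Regime II ($\overline{\varepsilon}=0$, or $\overline{\varepsilon},\hbar\to0$ at a comparable rate $\overline{\varepsilon}^2/\hbar=\gamma$ with $\gamma$ fixed, i.e. with fixed Jack parameter $\alpha=\varepsilon_1/(-\varepsilon_2)>0$ and $\gamma=(\sqrt\alpha-\frac1{\sqrt\alpha})^2$); and Regime III ($\overline{\varepsilon}>0$ fixed). Then in Regimes I, II, and III: (1) The limit shape theorem for the Poissonized Jack–Plancherel measures $M(v_{\rm PL},v_{\rm PL})$ still holds for $M_d^{\rm PL}$ with the same limit shapes: for every $p\in\mathbb{N}$, as $d\to\infty$, $$\int_{-\infty}^{+\infty}c^p\,\tfrac12f_\lambda''(c|\overline{\varepsilon},\hbar)\,dc\ \to\ \int_{-\infty}^{+\infty}c^p\,\tfrac12\mathbf f''(c|v_{\rm PL};\overline{\varepsilon})\,dc$$ in probability, where in Regime II (including $\overline{\varepsilon}\to0$ at a comparable rate) the limit is the one given by $\mathbf f(c|v_{\rm PL};0)$. (2) The Gaussian fluctuation theorem for $M(v_{\rm PL},v_{\rm PL})$ still holds for $M_d^{\rm PL}$, except that the Gaussian process is different due to the conditioning $|\lambda|=d$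 before $d\to\infty$: for $p\in\mathbb{N}$, as $d\to\infty$, the random variables $$\int_{-\infty}^{+\infty}c^p\,\Big(\frac{\tfrac12f_\lambda''(c|\overline{\varepsilon},\hbar)-\tfrac12\mathbf f''(c|v_{\rm PL};\overline{\varepsilon})}{\hbar^{1/2}}\Big)dc$$ converge weakly jointly to Gaussian random variables $\int_{-\infty}^{+\infty}c^p\,\tfrac12(\cdot)''dc$ given by a mean zero Gaussian process (plus, when $\overline{\varepsilon},\hbar\to0$ at the comparable rate $\gamma$ in Regime II, the deterministic mean shift $\sqrt\gamma\,\mathbf X(c|v_{\rm PL};0)$), this mean zero process being different from the process $\mathbf G(c|v_{\rm PL};\overline{\varepsilon})$ for $M(v_{\rm PL},v_{\rm PL})$. In Regime II, the mean shift $\mathbf X(c\,|\,v_{\rm PL};0)$ is the same as for $M(v_{\rm PL},v_{\rm PL})$, and the mean zero Gaussian process is $\mathbf G(c\,|\,v_{\rm PL};0)$ conditioned on the event $\int_{-\infty}^{+\infty}\mathbf G(c\,|\,v_{\rm PL};0)\,dc=0$.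
   Context: Parameters. Given $\overline{\varepsilon}\in\mathbb{R}$ and $\hbar>0$, let $\varepsilon_2<0<\varepsilon_1$ be the unique reals with $\varepsilon_1+\varepsilon_2=\overline{\varepsilon}$, $-\varepsilon_1\varepsilon_2=\hbar$. Jack–Plancherel measure. For a partition $\lambda$ of size $d$ with transpose $\lambda'$ and length $l(\lambda)$, $$M^{\rm PL}_d(\lambda)=\hbar^dd!\prod_{i=1}^{l(\lambda)}\prod_{j=1}^{\lambda_i}\frac1{\big(-\varepsilon_2(\lambda_j'-i)+\varepsilon_1(\lambda_i-j)+\varepsilon_1\big)\big(-\varepsilon_2(\lambda'_j-i)+\varepsilon_1(\lambda_i-j)-\varepsilon_2\big)}.$$ The Poissonized Jack–Plancherel measure $M(v_{\rm PL},v_{\rm PL})$ is the mixture of the $M^{\rm PL}_d$ by a Poisson distribution in $d$ of intensity $1/\hbar$. Profiles. The anisotropic profile $f_\lambda(c|\overline{\varepsilon},\hbar)$ is the piecewise-linear function of $c\in\mathbb{R}$ with slopes $\pm1$ such that $\{(c,y):|c|\le y\le f_\lambda(c|\overline{\varepsilon},\hbar)\}$ is tiled by $|\lambda|$ rectangles with side lengths $-\varepsilon_2\sqrt2$, $\varepsilon_1\sqrt2$, one for each $(i,j)$ with $1\le j\le\lambda_i$: the rectangle of $(i,j)$ has lowest corner with $c$-coordinate $\varepsilon_2(i-1)+\varepsilon_1(j-1)$ and sides given by the vectors $(\varepsilon_2,-\varepsilon_2)$ and $(\varepsilon_1,\varepsilon_1)$. Second derivatives in $c$ are distributional. Action profiles.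 For a sequence $v=\{V_k\}_{k=1}^\infty$ of complex numbers with bounded symbol $v(x)=\sum_{k\ge1}(V_ke^{-ikx}+\overline{V_k}e^{ikx})$, let $L_\bullet(v;\overline{\varepsilon})$ be the infinite matrix indexed by $j,k\ge0$ with $(j,k)$ entry $V_{j-k}$ if $j>k$, $\overline{V_{k-j}}$ if $j<k$, $\overline{\varepsilon}j$ if $j=k$, essentially self-adjoint on finitely supported sequences in $\ell^2$. The action profile $\mathbf f(c|v;\overline{\varepsilon})$ is the unique function with $\mathbf f(c|v;\overline{\varepsilon})\sim|c|$ as $c\to\pm\infty$ and $\langle\psi_0,(u-L_\bullet(v;\overline{\varepsilon}))^{-1}\psi_0\rangle=\exp(\int_{-\infty}^{+\infty}\log[\frac1{u-c}]\frac12\mathbf f''(c|v;\overline{\varepsilon})dc)$ for all $u\in\mathbb{C}\setminus\mathbb{R}$, where $\psi_0$ is the $0$th standard basis vector. For $v_{\rm PL}$ and $\overline{\varepsilon}=0$ it is the Vershik–Kerov Logan–Shepp curve $\frac2\pi(c\arcsin\frac c2+\sqrt{4-c^2})$ for $|c|\le2$, $|c|$ for $|c|\ge2$. Poissonized Gaussian limits. $\mathbf G(c|v_{\rm PL};\overline{\varepsilon})$ is the mean zero Gaussian process whose linear statistics $\int c^p\frac12\mathbf G''(c|v_{\rm PL};\overline{\varepsilon})dc$ have covariances $\sum_{k\ge1}k\,\frac{\partial\mathbf O_{p_1}}{\partial\overline{V_k}}\frac{\partial\mathbf O_{p_2}}{\partial V_k}\big|_{v=v_{\rm PL}}$ with $\mathbf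 O_p(v)=\int c^p\frac12\mathbf f''(c|v;\overline{\varepsilon})dc$ and Wirtinger derivatives. It is the limit of the profile fluctuations at scale $\hbar^{1/2}$ for $M(v_{\rm PL},v_{\rm PL})$ as $\hbar\to0$ with $\overline{\varepsilon}$ fixed; when $\overline{\varepsilon},\hbar\to0$ with $\overline{\varepsilon}^2/\hbar=\gamma$ the limit is $\mathbf G(c|v_{\rm PL};0)+\sqrt\gamma\,\mathbf X(c|v_{\rm PL};0)$, where $\mathbf X(c|v_{\rm PL};0)$ is the deterministic function with $\int c^p\frac12\mathbf X''(c|v_{\rm PL};0)dc=\frac{d}{d\overline{\varepsilon}}\int c^p\frac12\mathbf f''(c|v_{\rm PL};\overline{\varepsilon})dc\,|_{\overline{\varepsilon}=0}$ for all $p$.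
   Formalization: In Regime II at the comparable rate, fluctuations are centered at the limit shape f(c|v_PL;0) (centering at the moving ε̄ would absorb the shift), and the mean shift is sgn(α−1)√γ X, since for α<1 (ε̄<0) the shift √γ X as written has the wrong sign. *)

theory Defs
  imports "HOL-Probability.Probability"
begin

section \<open>Parameters\<close>

definition eps1 :: "real \<Rightarrow> real \<Rightarrow> real" where
  "eps1 e h = (e + sqrt (e\<^sup>2 + 4 * h)) / 2"

definition eps2 :: "real \<Rightarrow> real \<Rightarrow> real" where
  "eps2 e h = (e - sqrt (e\<^sup>2 + 4 * h)) / 2"

lemma eps_unique:
  assumes "h > 0"
  shows "x2 < 0 \<and> 0 < x1 \<and> x1 + x2 = e \<and> - (x1 * x2) = h
         \<longleftrightarrow> x1 = eps1 e h \<and> x2 = eps2 e h"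
proof -
  have pos: "eps1 e h > 0" "eps2 e h < 0"
  proof -
    have "sqrt (e\<^sup>2) < sqrt (e\<^sup>2 + 4 * h)"
      using assms by (intro real_sqrt_less_mono) simp
    then have "\<bar>e\<bar> < sqrt (e\<^sup>2 + 4 * h)" by simp
    then show "eps1 e h > 0" "eps2 e h < 0" by (auto simp: eps1_def eps2_def)
  qed
  have sum: "eps1 e h + eps2 e h = e" by (simp add: eps1_def eps2_def field_simps)
  have "sqrt (e\<^sup>2 + 4 * h) * sqrt (e\<^sup>2 + 4 * h) = e\<^sup>2 + 4 * h"
    using assms by (simp add: add_nonneg_nonneg)
  then have prod: "- (eps1 e h * eps2 e h) = h"
    by (simp add: eps1_def eps2_def field_simps power2_eq_square)
  show ?thesis
  proof
    assume A: "x2 < 0 \<and> 0 < x1 \<and> x1 + x2 = e \<and> - (x1 * x2) = h"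
    have "(x1 - eps1 e h) * (x1 - eps2 e h)
        = x1 * x1 - x1 * (eps1 e h + eps2 e h) + eps1 e h * eps2 e h"
      by (simp add: algebra_simps)
    also have "\<dots> = x1 * x1 - x1 * (x1 + x2) + x1 * x2" using sum prod A by simp
    also have "\<dots> = 0" by (simp add: algebra_simps)
    finally have "x1 = eps1 e h" using A pos by (auto simp: mult_eq_0_iff)
    then show "x1 = eps1 e h \<and> x2 = eps2 e h" using A sum by auto
  qed (use pos sum prod in auto)
qed

definition jack_parameter :: "real \<Rightarrow> real \<Rightarrow> real" where
  "jack_parameter e h = eps1 e h / (- eps2 e h)"

lemma jack_parameter_rate:
  assumes "h > 0" and "a = jack_parameter e h"
  shows "a > 0" and "e / sqrt h = sqrt a - 1 / sqrt a"
    and "e\<^sup>2 / h = (sqrt a - 1 / sqrt a)\<^sup>2"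
proof -
  let ?x = "eps1 e h" and ?y = "- eps2 e h"
  have E: "?y > 0" "?x > 0" "?x - ?y = e" "?x * ?y = h"
    using eps_unique[OF assms(1), of "eps2 e h" "eps1 e h" e] by auto
  show a: "a > 0" using E(1,2) unfolding assms(2) jack_parameter_def by (rule divide_pos_pos[rotated])
  define s t where "s = sqrt ?x" and "t = sqrt ?y"
  have st: "s > 0" "t > 0" using E by (auto simp: s_def t_def)
  have sa: "sqrt a = s / t"
    unfolding assms(2) jack_parameter_def s_def t_def by (rule real_sqrt_divide)
  have sh: "sqrt h = s * t" unfolding s_def t_def using E(4) real_sqrt_mult by metis
  have e: "e = s * s - t * t" using E by (simp add: s_def t_def)
  show *: "e / sqrt h = sqrt a - 1 / sqrt a" unfolding sa sh e using st by (simp add: field_simps)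
  have "e\<^sup>2 / h = (e / sqrt h)\<^sup>2" using assms(1) by (simp add: power_divide)
  then show "e\<^sup>2 / h = (sqrt a - 1 / sqrt a)\<^sup>2" using * by simp
qed

lemma jack_parameter_0: "h > 0 \<Longrightarrow> jack_parameter 0 h = 1"
  by (simp add: jack_parameter_def eps1_def eps2_def)

section \<open>Partitions and the Jack--Plancherel measure\<close>

definition partitions :: "nat \<Rightarrow> nat list set" where
  "partitions d = {l. sorted_wrt (\<ge>) l \<and> 0 \<notin> set l \<and> sum_list l = d}"

text \<open>Rows, columns and boxes are numbered from 1.\<close>

definition row :: "nat list \<Rightarrow> nat \<Rightarrow> nat" where
  "row l i = l ! (i - 1)"

definition col :: "nat list \<Rightarrow> nat \<Rightarrow> nat" where
  "col l j = card {i. 1 \<le> i \<and> i \<le> length l \<and> j \<le> row l i}"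

definition boxes :: "nat list \<Rightarrow> (nat \<times> nat) set" where
  "boxes l = {(i, j). 1 \<le> i \<and> i \<le> length l \<and> 1 \<le> j \<and> j \<le> row l i}"

definition jack_plancherel_weight :: "real \<Rightarrow> real \<Rightarrow> nat \<Rightarrow> nat list \<Rightarrow> real" where
  "jack_plancherel_weight e h d l = h ^ d * fact d *
    (\<Prod>i = 1..length l. \<Prod>j = 1..row l i.
      1 / ((- eps2 e h * (real (col l j) - real i) + eps1 e h * (real (row l i) - real j) + eps1 e h)
         * (- eps2 e h * (real (col l j) - real i) + eps1 e h * (real (row l i) - real j) - eps2 e h)))"

definition jack_plancherel :: "real \<Rightarrow> real \<Rightarrow> nat \<Rightarrow> nat list measure" where
  "jack_plancherel e h d =
     point_measure (partitions d) (\<lambda>l. ennreal (jack_plancherel_weight e h d l))"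

section \<open>Anisotropic profiles\<close>

definition box_rectangle :: "real \<Rightarrow> real \<Rightarrow> nat \<Rightarrow> nat \<Rightarrow> (real \<times> real) set" where
  "box_rectangle e h i j =
    {(eps2 e h * (real i - 1) + eps1 e h * (real j - 1) + s * eps2 e h + t * eps1 e h,
      - eps2 e h * (real i - 1) + eps1 e h * (real j - 1) - s * eps2 e h + t * eps1 e h) | s t.
      0 \<le> s \<and> s \<le> 1 \<and> 0 \<le> t \<and> t \<le> 1}"

definition profile :: "nat list \<Rightarrow> real \<Rightarrow> real \<Rightarrow> real \<Rightarrow> real" where
  "profile l e h c =
     Sup (insert \<bar>c\<bar> {y. \<exists>(i, j) \<in> boxes l. (c, y) \<in> box_rectangle e h i j})"

lemma box_rectangle_iff:
  assumes "h > 0"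
  shows "(c, y) \<in> box_rectangle e h i j \<longleftrightarrow>
      real i - 1 \<le> (y - c) / (- 2 * eps2 e h) \<and> (y - c) / (- 2 * eps2 e h) \<le> real i \<and>
      real j - 1 \<le> (y + c) / (2 * eps1 e h) \<and> (y + c) / (2 * eps1 e h) \<le> real j"
    (is "?L \<longleftrightarrow> ?R")
proof -
  have p: "eps2 e h < 0" "eps1 e h > 0"
    using eps_unique[OF assms, of "eps2 e h" "eps1 e h" e] by auto
  show ?thesis
  proof
    assume ?L
    then obtain s t where st: "0 \<le> s" "s \<le> 1" "0 \<le> t" "t \<le> 1"
      and c: "c = eps2 e h * (real i - 1) + eps1 e h * (real j - 1) + s * eps2 e h + t * eps1 e h"
      and y: "y = - eps2 e h * (real i - 1) + eps1 e h * (real j - 1) - s * eps2 e h + t * eps1 e h"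
      by (auto simp: box_rectangle_def)
    have "y - c = (- 2 * eps2 e h) * (real i - 1 + s)" "y + c = (2 * eps1 e h) * (real j - 1 + t)"
      by (auto simp: c y algebra_simps)
    then have "(y - c) / (- 2 * eps2 e h) = real i - 1 + s" "(y + c) / (2 * eps1 e h) = real j - 1 + t"
      using p by auto
    then show ?R using st by auto
  next
    assume R: ?R
    define s where "s = (y - c) / (- 2 * eps2 e h) - (real i - 1)"
    define t where "t = (y + c) / (2 * eps1 e h) - (real j - 1)"
    have st: "0 \<le> s" "s \<le> 1" "0 \<le> t" "t \<le> 1" using R by (auto simp: s_def t_def)
    have 1: "y - c = (- 2 * eps2 e h) * (real i - 1 + s)" using p by (simp add: s_def)
    have 2: "y + c = (2 * eps1 e h) * (real j - 1 + t)" using p by (simp add: t_def)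
    have "2 * c = 2 * (eps2 e h * (real i - 1) + eps1 e h * (real j - 1) + s * eps2 e h + t * eps1 e h)"
      using 1 2 by (simp add: algebra_simps)
    moreover have "2 * y = 2 * (- eps2 e h * (real i - 1) + eps1 e h * (real j - 1) - s * eps2 e h + t * eps1 e h)"
      using 1 2 by (simp add: algebra_simps)
    ultimately show ?L using st unfolding box_rectangle_def by force
  qed
qed

text \<open>The region below the profile is the union of the rectangles.\<close>

lemma profile_region:
  assumes h: "h > 0" and l: "l \<in> partitions d"
  shows "{(c, y). \<bar>c\<bar> \<le> y \<and> y \<le> profile l e h c}
       = {(c, y). y = \<bar>c\<bar>} \<union> (\<Union>(i, j) \<in> boxes l. box_rectangle e h i j)"
proof -
  have p: "eps2 e h < 0" "eps1 e h > 0"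
    using eps_unique[OF h, of "eps2 e h" "eps1 e h" e] by auto
  let ?a = "\<lambda>c y. (y - c) / (- 2 * eps2 e h)" and ?b = "\<lambda>c y. (y + c) / (2 * eps1 e h)"
  define S where "S c = insert \<bar>c\<bar> {y. \<exists>(i, j) \<in> boxes l. (c, y) \<in> box_rectangle e h i j}" for c
  have fin: "finite (boxes l)"
  proof (rule finite_subset)
    show "boxes l \<subseteq> (\<Union>i \<in> {1..length l}. {i} \<times> {1..row l i})" by (auto simp: boxes_def)
  qed auto
  have slice: "{y. (c, y) \<in> box_rectangle e h i j} \<subseteq> {..2 * eps1 e h * real j - c}"
    "closed {y. (c, y) \<in> box_rectangle e h i j}" for c i j
  proof -
    show "{y. (c, y) \<in> box_rectangle e h i j} \<subseteq> {..2 * eps1 e h * real j - c}"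
      using p by (auto simp: box_rectangle_iff[OF h] field_simps)
    show "closed {y. (c, y) \<in> box_rectangle e h i j}"
      unfolding box_rectangle_iff[OF h]
      by (intro closed_Collect_conj closed_Collect_le continuous_intros) (use p in auto)
  qed
  have S: "S c = insert \<bar>c\<bar> (\<Union>z \<in> boxes l. {y. (c, y) \<in> box_rectangle e h (fst z) (snd z)})" for c
    by (auto simp: S_def)
  have clo: "closed (S c)" for c unfolding S by (intro closed_insert closed_UN fin ballI slice(2))
  have bdd: "bdd_above (S c)" for c
    unfolding S bdd_above_insert bdd_above_UN[OF fin]
    by (intro ballI bdd_above_mono[OF bdd_above_Iic slice(1)])
  have prof: "profile l e h c = Sup (S c)" for c by (simp add: profile_def S_def)
  have inS: "profile l e h c \<in> S c" for c
    unfolding prof by (rule closed_contains_Sup[OF _ bdd clo]) (simp add: S_def)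
  show ?thesis
  proof (intro set_eqI iffI; clarify)
    fix c y assume A: "\<bar>c\<bar> \<le> y" "y \<le> profile l e h c"
      and B: "(c, y) \<notin> (\<Union>(i, j) \<in> boxes l. box_rectangle e h i j)"
    show "y = \<bar>c\<bar>"
    proof (rule ccontr)
      assume ne: "y \<noteq> \<bar>c\<bar>"
      define Y where "Y = profile l e h c"
      have "Y \<noteq> \<bar>c\<bar>" "y \<le> Y" using A ne by (auto simp: Y_def)
      with inS[of c] obtain i j where ij: "(i, j) \<in> boxes l" and R: "(c, Y) \<in> box_rectangle e h i j"
        by (auto simp: S_def Y_def)
      have mono: "?a c y \<le> ?a c Y" "?b c y \<le> ?b c Y"
        using p \<open>y \<le> Y\<close> by (simp_all add: divide_right_mono_neg divide_right_mono)
      have up: "?a c y \<le> real i" "?b c y \<le> real j"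
        using mono R by (auto simp: box_rectangle_iff[OF h])
      have nn: "0 \<le> ?a c y" "0 \<le> ?b c y" 
        by (rule divide_nonneg_pos, use A p in simp, use p in simp)+
      have ge1: "1 \<le> i" "1 \<le> j" using ij by (auto simp: boxes_def)
      have pick: "\<exists>k. 1 \<le> k \<and> k \<le> n \<and> real k - 1 \<le> x \<and> x \<le> real k"
        if "0 \<le> x" "x \<le> real n" "1 \<le> n" for x :: real and n :: nat
      proof (cases "x \<le> 1")
        case True then show ?thesis using that by (intro exI[of _ 1]) auto
      next
        case False
        then show ?thesis using that
          by (intro exI[of _ "nat \<lceil>x\<rceil>"]) (simp; linarith)
      qed
      obtain i' where i': "1 \<le> i'" "i' \<le> i" "real i' - 1 \<le> ?a c y" "?a c y \<le> real i'"
        using pick[OF nn(1) up(1) ge1(1)] by auto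
      obtain j' where j': "1 \<le> j'" "j' \<le> j" "real j' - 1 \<le> ?b c y" "?b c y \<le> real j'"
        using pick[OF nn(2) up(2) ge1(2)] by auto
      have "row l i \<le> row l i'"
      proof (cases "i' = i")
        case False
        have "sorted_wrt (\<ge>) l" using l by (simp add: partitions_def)
        then show ?thesis unfolding row_def
          by (rule sorted_wrt_nth_less) (use False i' ij in \<open>auto simp: boxes_def\<close>)
      qed simp
      then have "(i', j') \<in> boxes l" using ij i' j' by (auto simp: boxes_def)
      moreover have "(c, y) \<in> box_rectangle e h i' j'"
        using i' j' by (simp only: box_rectangle_iff[OF h])
      ultimately show False using B by auto
    qed
  next
    fix c y assume "(c, y) \<in> {(c, y). y = \<bar>c\<bar>} \<union> (\<Union>(i, j) \<in> boxes l. box_rectangle e h i j)"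
    then have yS: "y \<in> S c" by (auto simp: S_def)
    have "y \<le> profile l e h c" unfolding prof by (rule cSup_upper[OF yS bdd])
    moreover have "\<bar>c\<bar> \<le> y"
    proof (cases "y = \<bar>c\<bar>")
      case False
      then obtain i j where ij: "(i, j) \<in> boxes l" "(c, y) \<in> box_rectangle e h i j"
        using yS by (auto simp: S_def)
      then have "0 \<le> ?a c y" "0 \<le> ?b c y" by (auto simp: box_rectangle_iff[OF h] boxes_def)
      then show ?thesis using p by (auto simp: zero_le_divide_iff divide_le_0_iff)
    qed simp
    ultimately show "\<bar>c\<bar> \<le> y \<and> y \<le> profile l e h c" by simp
  qed
qed

section \<open>Pairing with the distributional second derivative\<close>

text \<open>
  For \<^term>\<open>g\<close> decaying at infinity, \<open>half_dd g \<phi>\<close> is \<open>\<integral> \<phi>(c) (1/2) g''(c) dc\<close>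
  with \<open>g''\<close> the distributional derivative.  For a profile \<open>f\<close>, asymptotic to \<open>\<bar>c\<bar>\<close>,
  write \<open>f = \<bar>c\<bar> + (f - \<bar>c\<bar>)\<close> and use \<open>(1/2) \<bar>c\<bar>'' = \<delta>\<^sub>0\<close>.  The measure \<open>f''\<close> of an
  action profile need not have finite total variation, so its moments are meant in this sense.
\<close>

definition half_dd :: "(real \<Rightarrow> real) \<Rightarrow> (real \<Rightarrow> 'a::{banach, second_countable_topology}) \<Rightarrow> 'a" where
  "half_dd g \<phi> = (1/2) *\<^sub>R
     (\<integral>c. g c *\<^sub>R vector_derivative (\<lambda>x. vector_derivative \<phi> (at x)) (at c) \<partial>lborel)"

definition half_dd_profile :: "(real \<Rightarrow> real) \<Rightarrow> (real \<Rightarrow> 'a::{banach, second_countable_topology}) \<Rightarrow> 'a" where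
  "half_dd_profile f \<phi> = \<phi> 0 + half_dd (\<lambda>c. f c - \<bar>c\<bar>) \<phi>"

section \<open>Action profiles\<close>

text \<open>A sequence \<open>V\<^sub>1, V\<^sub>2, \<dots>\<close> is a function on \<^typ>\<open>nat\<close> whose value at \<open>0\<close> is never used.\<close>

definition lax :: "(nat \<Rightarrow> complex) \<Rightarrow> real \<Rightarrow> nat \<Rightarrow> nat \<Rightarrow> complex" where
  "lax v e j k = (if j > k then v (j - k) else if j < k then cnj (v (k - j))
                  else complex_of_real (e * real j))"

definition ell2_tendsto :: "(nat \<Rightarrow> nat \<Rightarrow> complex) \<Rightarrow> (nat \<Rightarrow> complex) \<Rightarrow> bool" where
  "ell2_tendsto xs x \<longleftrightarrow> (\<forall>n. summable (\<lambda>j. (cmod (xs n j - x j))\<^sup>2)) \<and>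
     (\<lambda>n. \<Sum>j. (cmod (xs n j - x j))\<^sup>2) \<longlonglongrightarrow> 0"

text \<open>Graph of the closure in \<open>\<ell>\<^sup>2\<close> of the operator on finitely supported sequences.\<close>

definition lax_closure :: "(nat \<Rightarrow> complex) \<Rightarrow> real \<Rightarrow> ((nat \<Rightarrow> complex) \<times> (nat \<Rightarrow> complex)) set" where
  "lax_closure v e = {(x, y).
     summable (\<lambda>j. (cmod (x j))\<^sup>2) \<and> summable (\<lambda>j. (cmod (y j))\<^sup>2) \<and>
     (\<exists>xs. (\<forall>n. finite {k. xs n k \<noteq> 0}) \<and> ell2_tendsto xs x \<and>
        ell2_tendsto (\<lambda>n j. \<Sum>k | xs n k \<noteq> 0. lax v e j k * xs n k) y)}"

text \<open>
  \<open>\<langle>\<psi>\<^sub>0, (u - L)\<^sup>-\<^sup>1 \<psi>\<^sub>0\<rangle>\<close> is the entry at \<open>0\<close> of the vector \<open>x\<close>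
  in the domain of the closure with \<open>L x = u x - \<psi>\<^sub>0\<close>.
\<close>

definition resolvent00 :: "(nat \<Rightarrow> complex) \<Rightarrow> real \<Rightarrow> complex \<Rightarrow> complex" where
  "resolvent00 v e u =
     (THE x. (x, \<lambda>j. u * x j - (if j = 0 then 1 else 0)) \<in> lax_closure v e) 0"

text \<open>
  The asymptotics \<open>f \<sim> \<bar>c\<bar>\<close> must mean that the difference tends to \<open>0\<close>, as the
  resolvent only determines \<open>f\<close> up to an additive constant; continuity fixes the
  representative of a function known almost everywhere.
\<close>

definition is_action_profile :: "(nat \<Rightarrow> complex) \<Rightarrow> real \<Rightarrow> (real \<Rightarrow> real) \<Rightarrow> bool" where
  "is_action_profile v e f \<longleftrightarrow> continuous_on UNIV f \<and>
     ((\<lambda>c. f c - \<bar>c\<bar>) \<longlongrightarrow> 0) at_top \<and> ((\<lambda>c. f c - \<bar>c\<bar>) \<longlongrightarrow> 0) at_bot \<and>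
     (\<forall>u. u \<notin> \<real> \<longrightarrow>
        resolvent00 v e u = exp (half_dd_profile f (\<lambda>c. Ln (1 / (u - complex_of_real c)))))"

definition action_profile :: "(nat \<Rightarrow> complex) \<Rightarrow> real \<Rightarrow> real \<Rightarrow> real" where
  "action_profile v e = (THE f. is_action_profile v e f)"

definition action_moment :: "real \<Rightarrow> nat \<Rightarrow> (nat \<Rightarrow> complex) \<Rightarrow> real" where
  "action_moment e p v = half_dd_profile (action_profile v e) (\<lambda>c. c ^ p)"

definition v_PL :: "nat \<Rightarrow> complex" where
  "v_PL k = (if k = 1 then 1 else 0)"

section \<open>Gaussian processes\<close>

definition wirtinger :: "((nat \<Rightarrow> complex) \<Rightarrow> real) \<Rightarrow> nat \<Rightarrow> (nat \<Rightarrow> complex) \<Rightarrow> complex" where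
  "wirtinger F k v =
     (complex_of_real (deriv (\<lambda>t::real. F (v(k := v k + complex_of_real t))) 0)
      - \<i> * complex_of_real (deriv (\<lambda>t::real. F (v(k := v k + \<i> * complex_of_real t))) 0)) / 2"

definition wirtinger_bar :: "((nat \<Rightarrow> complex) \<Rightarrow> real) \<Rightarrow> nat \<Rightarrow> (nat \<Rightarrow> complex) \<Rightarrow> complex" where
  "wirtinger_bar F k v =
     (complex_of_real (deriv (\<lambda>t::real. F (v(k := v k + complex_of_real t))) 0)
      + \<i> * complex_of_real (deriv (\<lambda>t::real. F (v(k := v k + \<i> * complex_of_real t))) 0)) / 2"

text \<open>
  A random (generalized) function \<open>G(c)\<close> enters only through its integrals against
  polynomials.  It is represented by the law, on \<^typ>\<open>nat \<Rightarrow> real\<close> with the product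
  topology, of the sequence \<open>g q = \<integral> c^q G(c) dc\<close>; its linear statistics
  \<open>\<integral> c^p (1/2) G''(c) dc\<close> are then given by \<open>linear_statistic\<close>, the formula
  of \<^const>\<open>half_dd\<close> for \<open>\<phi>(c) = c^p\<close>.
\<close>

definition linear_statistic :: "nat \<Rightarrow> (nat \<Rightarrow> real) \<Rightarrow> real" where
  "linear_statistic p g = (1/2) * (real p * (real p - 1)) * g (p - 2)"

text \<open>Degenerate laws are included: fixing \<open>\<bar>\<lambda>\<bar> = d\<close> makes one statistic constant.\<close>

definition normal_law :: "real \<Rightarrow> real \<Rightarrow> real measure" where
  "normal_law m var = (if var = 0 then return borel m
                       else density lborel (\<lambda>x. ennreal (normal_density m (sqrt var) x)))"

definition centered_gaussian :: "(nat \<Rightarrow> real) measure \<Rightarrow> bool" where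
  "centered_gaussian N \<longleftrightarrow> prob_space N \<and> sets N = sets borel \<and>
     (\<forall>J a. finite J \<longrightarrow>
        (\<exists>var\<ge>0. distr N borel (\<lambda>g. \<Sum>q\<in>J. a q * g q) = normal_law 0 var))"

definition poissonized_gaussian :: "real \<Rightarrow> (nat \<Rightarrow> real) measure \<Rightarrow> bool" where
  "poissonized_gaussian e G \<longleftrightarrow> centered_gaussian G \<and>
     (\<forall>p1 p2. complex_of_real (\<integral>g. linear_statistic p1 g * linear_statistic p2 g \<partial>G)
        = (\<Sum>k. of_nat k * wirtinger_bar (action_moment e p1) k v_PL
                        * wirtinger (action_moment e p2) k v_PL))"

definition mean_shift :: "(real \<Rightarrow> real) \<Rightarrow> bool" where
  "mean_shift X \<longleftrightarrow> (\<forall>q. integrable lborel (\<lambda>c. c ^ q * X c)) \<and>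
     (\<forall>p. ((\<lambda>e. action_moment e p v_PL) has_real_derivative half_dd X (\<lambda>c. c ^ p)) (at 0))"

text \<open>Weak convergence of all finite-dimensional marginals.\<close>

definition joint_weak_conv ::
  "('i \<Rightarrow> (nat \<Rightarrow> real) measure) \<Rightarrow> (nat \<Rightarrow> real) measure \<Rightarrow> 'i filter \<Rightarrow> bool" where
  "joint_weak_conv \<mu> \<nu> F \<longleftrightarrow>
     (\<forall>J \<phi> :: (nat \<Rightarrow> real) \<Rightarrow> real. finite J \<and> continuous_on UNIV \<phi> \<and> bounded (range \<phi>) \<longrightarrow>
        ((\<lambda>i. \<integral>x. \<phi> (\<lambda>p. if p \<in> J then x p else 0) \<partial>\<mu> i)
          \<longlongrightarrow> (\<integral>x. \<phi> (\<lambda>p. if p \<in> J then x p else 0) \<partial>\<nu>)) F)"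

text \<open>
  Conditioning on the null event \<open>\<integral> G(c) dc = 0\<close>, as the limit of conditioning
  on \<open>\<bar>\<integral> G(c) dc\<bar> < \<delta>\<close>.
\<close>

definition conditioned_on_zero_integral ::
  "(nat \<Rightarrow> real) measure \<Rightarrow> (nat \<Rightarrow> real) measure \<Rightarrow> bool" where
  "conditioned_on_zero_integral G N \<longleftrightarrow> prob_space N \<and> sets N = sets borel \<and>
     joint_weak_conv (\<lambda>\<delta>. uniform_measure G {g \<in> space G. \<bar>g 0\<bar> < \<delta>}) N (at_right (0::real))"

section \<open>Limit theorems\<close>

text \<open>
  With \<open>\<hbar> = 1/d\<close>, \<open>e d\<close> is the value of \<open>\<epsilon>\<close>-bar used at size \<open>d\<close>,
  and \<open>e0\<close> the parameter of the limit shape.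
\<close>

definition limit_shape_theorem :: "(nat \<Rightarrow> real) \<Rightarrow> real \<Rightarrow> bool" where
  "limit_shape_theorem e e0 \<longleftrightarrow> (\<forall>p::nat. \<forall>\<eta>>0.
     (\<lambda>d. measure (jack_plancherel (e d) (1 / real d) d)
        {l \<in> partitions d.
           \<bar>half_dd_profile (profile l (e d) (1 / real d)) (\<lambda>c. c ^ p)
             - half_dd_profile (action_profile v_PL e0) (\<lambda>c. c ^ p)\<bar> > \<eta>}) \<longlonglongrightarrow> 0)"

definition fluctuation :: "real \<Rightarrow> real \<Rightarrow> real \<Rightarrow> nat list \<Rightarrow> nat \<Rightarrow> real" where
  "fluctuation e0 e h l p =
     (half_dd_profile (profile l e h) (\<lambda>c. c ^ p)
       - half_dd_profile (action_profile v_PL e0) (\<lambda>c. c ^ p)) / sqrt h"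

text \<open>The limit process is the sum of the random \<open>N\<close> and the deterministic \<open>Y\<close>.\<close>

definition fluctuation_theorem ::
  "(nat \<Rightarrow> real) \<Rightarrow> real \<Rightarrow> (nat \<Rightarrow> real) measure \<Rightarrow> (real \<Rightarrow> real) \<Rightarrow> bool" where
  "fluctuation_theorem e e0 N Y \<longleftrightarrow>
     joint_weak_conv
       (\<lambda>d. distr (jack_plancherel (e d) (1 / real d) d) borel (fluctuation e0 (e d) (1 / real d)))
       (distr N borel (\<lambda>g p. linear_statistic p g + half_dd Y (\<lambda>c. c ^ p)))
       sequentially"

end

(*
 A Jack-Plancherel diagram of size d is grown box by box with Kerov's transition
 probabilities, so expectations of functions of its moments obey an exact one-step recursion. At size
 n = t d the moments concentrate around those of the Lax matrix with V_1 = sqrt t, and their rescaled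
 deviations form an approximately linear Markov chain. Transporting a test functional backwards along
 the linear drift turns its characteristic function into a product of factors 1 - sigma / (2 d). The
 vectors dv solving the drift equation diagonalise the covariance: with independent standard normals
 xi_m the Poissonized process is the sum over m of dv_m xi_m / sqrt (m + 1), and fixing the size d
 deletes the term m = 0, which is proportional to the integral of G. Action profiles are obtained
 as limits of the profiles of truncated Lax matrices; uniqueness is that of a Poisson integral.
*)
theory Submission
 imports Defs "HOL-Complex_Analysis.Complex_Analysis" "HOL-Computational_Algebra.Computational_Algebra"
begin

text \<open>Profiles enter only through their moments, which are power sums, while transition
  probabilities and the Lax matrix yield complete homogeneous functions h_j = <psi_0, L^j psi_0>;
  Newton's identities are the dictionary on both sides. All regimes are one statement about
  parameters \<open>ed d\<close> tending to \<open>es\<close>: the chain is centred at the moments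
  for \<open>ed d\<close>, and recentring at \<open>es\<close> costs nothing for constant
  \<open>ed\<close> and produces the mean shift when \<open>ed d\<close> is of order 1 / sqrt d. The
  obstacle is a drift of size 1 / d that is linear in the deviations and adds up to order one over d
  steps; once it is moved into the coefficients of the functional, the conditional second moment of
  a step is deterministic to leading order. The mode m = 0 disappears because a step contributes a
  covariance: subtracting the product of the means removes exactly the vacuum term of <L^j psi_0,
  L^l psi_0>. No spectral theorem is used: finite truncations are handled by a minimal annihilating
  polynomial, the infinite matrix by averages of truncated solutions.\<close>

abbreviation (input) sequence_limit :: "(nat => 'a::topological_space) => 'a => bool"  (infix "---->" 60)
 where "X ----> L \<equiv> (X \<longlongrightarrow> L) sequentially"

section \<open>Newton's identities\<close>

text \<open>Complete homogeneous functions \<open>h\<close> and power sums \<open>s\<close> as a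
  relation between sequences: \<open>h\<close> will be a sequence of moments of a matrix or of a
  transition probability, so neither side comes from a fixed finite set of variables.
  \<open>s 0\<close> is left unconstrained.\<close>

definition newton :: "(nat => 'a::field_char_0) => (nat => 'a) => bool" where
 "newton h s \<longleftrightarrow> h 0 = 1 & (ALL k. of_nat k * h k = (\<Sum>q=1..k. s q * h (k - q)))"

fun hom_of_pow :: "(nat => 'a::field_char_0) => nat => 'a" where
 "hom_of_pow s 0 = 1"
| "hom_of_pow s (Suc k) = (\<Sum>q\<le>k. s (Suc q) * hom_of_pow s (k - q)) / of_nat (Suc k)"

fun pow_of_hom :: "(nat => 'a::field_char_0) => nat => 'a" where
 "pow_of_hom h p = of_nat p * h p - (\<Sum>q\<in>{1..<p}. pow_of_hom h q * h (p - q))"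

declare hom_of_pow.simps(2)[simp del] pow_of_hom.simps[simp del]

lemma newton_hom_of_pow: "newton (hom_of_pow s) s"
 unfolding newton_def
proof (intro conjI allI)
 fix k show "of_nat k * hom_of_pow s k = (\<Sum>q=1..k. s q * hom_of_pow s (k - q))"
 proof (cases k)
  case (Suc m)
  have "(\<Sum>q=1..Suc m. s q * hom_of_pow s (Suc m - q)) = (\<Sum>q\<le>m. s (Suc q) * hom_of_pow s (m - q))"
   by (rule sum.reindex_bij_witness[of _ Suc "%q. q - 1"]) auto
  then show ?thesis by (simp add: Suc hom_of_pow.simps(2) del: of_nat_Suc)
 qed simp
qed simp

lemma newton_pow_of_hom: "h 0 = 1 ==> newton h (pow_of_hom h)"
 unfolding newton_def
proof (intro conjI allI)
 fix k assume h0: "h 0 = 1"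
 show "of_nat k * h k = (\<Sum>q=1..k. pow_of_hom h q * h (k - q))"
 proof (cases "k = 0")
  case False
  then have "{1..k} = insert k {1..<k}" by auto
  then have "(\<Sum>q=1..k. pow_of_hom h q * h (k - q)) = pow_of_hom h k + (\<Sum>q\<in>{1..<k}. pow_of_hom h q * h (k - q))"
   by (simp add: h0)
  then show ?thesis by (simp add: pow_of_hom.simps[of h k])
 qed simp
qed

lemma sum_1_last: "1 <= (p::nat) ==> (\<Sum>q=1..p. f q) = f p + sum f {1..<p}"
 by (cases p) (simp_all add: atLeastLessThanSuc_atLeastAtMost add.commute)

text \<open>Identities of order up to \<open>n\<close> involve \<open>h\<close> only up to
  \<open>n\<close>. The cutoff is what gets used: a truncated Lax matrix shares only finitely many
  moments with the infinite one.\<close>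

lemma newton_pow_unique:
 assumes "newton h s" "newton h' s'" "!!j. j <= n ==> h j = h' j" "1 <= p" "p <= n"
 shows "s p = s' p"
 using assms(4,5)
proof (induction p rule: less_induct)
 case (less p)
 note 1 = sum_1_last[OF less.prems(1)]
 have "of_nat p * h p = s p + (\<Sum>q\<in>{1..<p}. s q * h (p - q))"
  using assms(1)[unfolded newton_def] 1[of "%q. s q * h (p - q)"] by simp
 moreover have "of_nat p * h' p = s' p + (\<Sum>q\<in>{1..<p}. s' q * h' (p - q))"
  using assms(2)[unfolded newton_def] 1[of "%q. s' q * h' (p - q)"] by simp
 moreover have "(\<Sum>q\<in>{1..<p}. s q * h (p - q)) = (\<Sum>q\<in>{1..<p}. s' q * h' (p - q))"
  using less assms(3) by (intro sum.cong) auto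
 ultimately show ?case using assms(3)[of p] less.prems by simp
qed

lemma newton_hom_unique:
 assumes "newton h s" "newton h' s'" "!!j. 1 <= j ==> j <= n ==> s j = s' j" "p <= n"
 shows "h p = h' p"
 using assms(4)
proof (induction p rule: less_induct)
 case (less p)
 show ?case
 proof (cases "p = 0")
  case False
  have "of_nat p * h p = (\<Sum>q=1..p. s q * h (p - q))" using assms(1) by (auto simp: newton_def)
  also have "... = (\<Sum>q=1..p. s' q * h' (p - q))" using less assms(3) by (intro sum.cong) auto
  also have "... = of_nat p * h' p" using assms(2) by (auto simp: newton_def)
  finally show ?thesis using False by simp
 qed (use assms(1,2) in "auto simp: newton_def")
qed

lemma newton_fps:
 "newton h s \<longleftrightarrow> h 0 = 1 &
   fps_X * fps_deriv (Abs_fps h) = Abs_fps (%q. if q = 0 then 0 else s q) * Abs_fps h"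
proof -
 have "(\<Sum>q=0..k. (if q = 0 then 0 else s q) * h (k - q)) = (\<Sum>q=1..k. s q * h (k - q))" for k
  by (rule sum.mono_neutral_cong_right) auto
 moreover have "(fps_X * fps_deriv (Abs_fps h)) $ k = of_nat k * h k" for k
  by (cases k) (auto simp: fps_X_mult_nth)
 ultimately show ?thesis by (simp add: newton_def fps_eq_iff fps_mult_nth)
qed

lemma fps_XD_mult:
 fixes A B :: "'a::comm_ring_1 fps"
 shows "fps_X * fps_deriv (A * B) = (fps_X * fps_deriv A) * B + A * (fps_X * fps_deriv B)"
 by (simp add: algebra_simps)

lemma fps_XD_prod_linear:
 fixes x :: "'b => 'a::comm_ring_1"
 assumes "finite I"
 shows "fps_X * fps_deriv (\<Prod>i\<in>I. 1 - fps_const (x i) * fps_X)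
  = - (\<Sum>i\<in>I. Abs_fps (%n. if n = 0 then 0 else x i ^ n)) * (\<Prod>i\<in>I. 1 - fps_const (x i) * fps_X)"
 using assms
proof induction
 case (insert i I)
 let ?G = "%c :: 'a. Abs_fps (%n. if n = 0 then 0 else c ^ n)"
 let ?L = "%c :: 'a. 1 - fps_const c * fps_X"
 have G: "fps_X * fps_deriv (?L c) = - (?G c) * ?L c" for c
 proof (rule fps_ext)
  fix n
  have "(- (?G c) * ?L c) $ n = - ?G c $ n + c * (fps_X * ?G c) $ n"
   by (simp add: right_diff_distrib mult.left_commute mult.commute[of "?G c"] mult.assoc)
  then show "(fps_X * fps_deriv (?L c)) $ n = (- (?G c) * ?L c) $ n"
   by (cases n) (auto simp: fps_X_mult_nth split: if_splits)
 qed
 have "(- a) * b * c + b * ((- a') * c) = - (a + a') * (b * c)" for a b c a' :: "'a fps"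
  by (simp add: algebra_simps)
 then show ?case unfolding prod.insert[OF insert.hyps] sum.insert[OF insert.hyps] fps_XD_mult G insert.IH
  by blast
qed simp

lemma prod_nth0: "(\<Prod>i\<in>I. f i) $ 0 = (\<Prod>i\<in>I. (f i :: 'a::comm_ring_1 fps) $ 0)"
 by (induction I rule: infinite_finite_induct) (simp_all only: prod.infinite prod.empty prod.insert fps_mult_nth_0 fps_one_nth if_True simp_thms)

text \<open>Newton's identities say that the series of \<open>s\<close> is X times the logarithmic
  derivative of the series of \<open>h\<close>, so a quotient of products of linear factors yields a
  difference of power sums. In \<open>E\<close> the denominator is cleared to stay inside power
  series.\<close>

lemma newton_quotient:
 fixes h :: "nat => 'a::field_char_0"
 assumes I: "finite I" and J: "finite J"
  and E: "Abs_fps h * (\<Prod>i\<in>I. 1 - fps_const (x i) * fps_X) = (\<Prod>i\<in>J. 1 - fps_const (y i) * fps_X)"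
 shows "newton h (%p. (\<Sum>i\<in>I. x i ^ p) - (\<Sum>i\<in>J. y i ^ p))"
proof -
 let ?G = "%c :: 'a. Abs_fps (%n. if n = 0 then 0 else c ^ n)"
 let ?L = "%c :: 'a. 1 - fps_const c * fps_X"
 let ?H = "Abs_fps h" and ?A = "\<Prod>i\<in>I. ?L (x i)" and ?B = "\<Prod>i\<in>J. ?L (y i)"
 have A0: "?A $ 0 = 1" "?B $ 0 = 1"
  unfolding prod_nth0 fps_sub_nth fps_mult_nth_0 fps_X_nth fps_one_nth by simp_all
 have alg: "X * A + H * (- U * A) = - V * (H * A) ==> X * A = (U - V) * H * A" for X A H U V :: "'a fps"
 proof -
  assume "X * A + H * (- U * A) = - V * (H * A)"
  then have "X * A = - V * (H * A) - H * (- U * A)" by (simp only: eq_diff_eq)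
  also have "... = (U - V) * H * A" by (simp add: ring_distribs ac_simps)
  finally show ?thesis .
 qed
 have "fps_X * fps_deriv (?H * ?A) = fps_X * fps_deriv ?B" unfolding E ..
 then have eq1: "(fps_X * fps_deriv ?H) * ?A = ((\<Sum>i\<in>I. ?G (x i)) - (\<Sum>i\<in>J. ?G (y i))) * ?H * ?A"
  unfolding fps_XD_mult fps_XD_prod_linear[OF I] fps_XD_prod_linear[OF J] unfolding E[symmetric] by (rule alg)
 have nz: "?A ~= 0" using A0 by (metis fps_zero_nth zero_neq_one)
 have eq2: "fps_X * fps_deriv ?H = ((\<Sum>i\<in>I. ?G (x i)) - (\<Sum>i\<in>J. ?G (y i))) * ?H"
  using eq1 unfolding mult_right_cancel[OF nz] .
 have eq3: "(\<Sum>i\<in>I. ?G (x i)) - (\<Sum>i\<in>J. ?G (y i))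
   = Abs_fps (%q. if q = 0 then 0 else (\<Sum>i\<in>I. x i ^ q) - (\<Sum>i\<in>J. y i ^ q))"
  by (rule fps_ext) (simp add: fps_sum_nth)
 have "h 0 = 1" using arg_cong[OF E, of "%f. fps_nth f 0"] unfolding fps_mult_nth_0 A0 by simp
 then show ?thesis using eq2 unfolding newton_fps eq3 by (rule conjI)
qed

text \<open>If the \<open>h j\<close> vary, the logarithmic derivative of their generating series gives that of the power sums.\<close>

lemma newton_deriv:
 fixes h s :: "real => nat => real"
 assumes N: "!!t. newton (h t) (s t)"
  and d: "!!j. ((%t. h t j) has_real_derivative d j) (at t)"
  and R: "Abs_fps d = Abs_fps (h t) * R" and p: "p >= 1"
 shows "((%t. s t p) has_real_derivative real p * R $ p) (at t)"
proof -
 have s_eq: "s t p = real p * h t p - (\<Sum>q\<in>{1..<p}. s t q * h t (p - q))" if "p >= 1" for t p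
 proof -
  have "real p * h t p = (\<Sum>q=1..p. s t q * h t (p - q))" "h t 0 = 1"
   using N[of t] unfolding newton_def by auto
  then show ?thesis unfolding sum_1_last[OF that] by simp
 qed
 \<comment> \<open>Differentiability comes first, by recursion on \<open>p\<close>; the value is
   then read off by differentiating the identities as power series.\<close>
 have "EX D. ((%t. s t p) has_real_derivative D) (at t)" if "p >= 1" for p
  using that
 proof (induction p rule: less_induct)
  case (less p)
  have "ALL q:{1..<p}. EX D. ((%t. s t q) has_real_derivative D) (at t)" using less by auto
  then obtain D where D: "!!q. q \<in> {1..<p} ==> ((%t. s t q) has_real_derivative D q) (at t)" by metis
  have "((%t. real p * h t p - (\<Sum>q\<in>{1..<p}. s t q * h t (p - q))) has_real_derivative
    real p * d p - (\<Sum>q\<in>{1..<p}. D q * h t (p - q) + d (p - q) * s t q)) (at t)"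
   by (intro DERIV_diff DERIV_sum DERIV_mult DERIV_cmult d D)
  then show ?case using s_eq[OF less.prems] by auto
 qed
 then obtain D0 where D0: "!!p. p >= 1 ==> ((%t. s t p) has_real_derivative D0 p) (at t)" by metis
 \<comment> \<open>\<open>s t 0\<close> is unconstrained, so no derivative is available at index 0;
   the value 0 matches the constant term of \<open>fps_X * fps_deriv R\<close>.\<close>
 define D where "D p = (if p = 0 then 0 else D0 p)" for p
 have D: "p >= 1 ==> ((%t. s t p) has_real_derivative D p) (at t)" for p using D0 by (simp add: D_def)
 have rel: "real k * d k = (\<Sum>q=1..k. D q * h t (k - q) + s t q * d (k - q))" for k
 proof -
  have "((%t. \<Sum>q=1..k. s t q * h t (k - q)) has_real_derivative
    (\<Sum>q=1..k. D q * h t (k - q) + s t q * d (k - q))) (at t)"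
   by (auto intro!: derivative_eq_intros sum.cong D d)
  moreover have "(%t. \<Sum>q=1..k. s t q * h t (k - q)) = (%t. real k * h t k)"
   using N by (auto simp: newton_def)
  moreover have "((%t. real k * h t k) has_real_derivative real k * d k) (at t)"
   by (intro DERIV_cmult d)
  ultimately show ?thesis using DERIV_unique by fastforce
 qed
 let ?H = "Abs_fps (h t)" and ?S = "Abs_fps (%q. if q = 0 then 0 else s t q)"
 have "fps_X * fps_deriv (Abs_fps d) = Abs_fps D * ?H + Abs_fps d * ?S"
 proof (rule fps_ext)
  fix k
  have "(\<Sum>q=1..k. D q * h t (k - q)) = (\<Sum>q=0..k. D q * h t (k - q))"
   by (rule sum.mono_neutral_left) (auto simp: D_def)
  moreover have "(\<Sum>q=1..k. s t q * d (k - q)) = (\<Sum>q=0..k. (if q = 0 then 0 else s t q) * d (k - q))"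
   by (rule sum.mono_neutral_cong_left) auto
  moreover have "(fps_X * fps_deriv (Abs_fps d)) $ k = real k * d k"
   by (cases k) (auto simp: fps_X_mult_nth)
  ultimately show "(fps_X * fps_deriv (Abs_fps d)) $ k = (Abs_fps D * ?H + Abs_fps d * ?S) $ k"
   unfolding mult.commute[of "Abs_fps d" ?S] by (simp add: rel sum.distrib fps_mult_nth)
 qed
 moreover have "fps_X * fps_deriv (Abs_fps d) = ?H * ?S * R + ?H * (fps_X * fps_deriv R)"
 proof -
  have "fps_X * fps_deriv ?H = ?S * ?H" using N[of t] unfolding newton_fps by auto
  then have "(fps_X * fps_deriv ?H) * R = ?S * ?H * R" by simp
  then show ?thesis unfolding R by (simp add: algebra_simps)
 qed
 moreover have "X = D' * H + H * R * S ==> X = H * S * R + H * Q ==> H * Q = H * D'"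
  for X D' H S Q :: "real fps" by (simp add: mult.commute mult.left_commute)
 ultimately have "?H * (fps_X * fps_deriv R) = ?H * Abs_fps D" unfolding R by blast
 moreover have nz: "?H ~= 0" using N[of t] unfolding newton_def
  by (metis fps_nth_Abs_fps fps_zero_nth zero_neq_one)
 ultimately have "fps_X * fps_deriv R = Abs_fps D" by (simp only: mult_left_cancel[OF nz])
 then have "D p = real p * R $ p"
  using p by (cases p) (auto simp: fps_eq_iff fps_X_mult_nth dest!: spec[of _ p])
 then show ?thesis using D[OF p] by simp
qed

section \<open>Interpolation at interlacing nodes\<close>

lemma degree_prod_linear:
 fixes x :: "'b => 'a::idom"
 shows "degree (\<Prod>r\<in>I. [:- x r, 1:]) = card I"
 by (cases "finite I") (auto simp: degree_prod_eq_sum_degree)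

lemma lead_coeff_prod_linear:
 fixes x :: "'b => 'a::idom"
 shows "coeff (\<Prod>r\<in>I. [:- x r, 1:]) (card I) = 1"
proof -
 have "lead_coeff (\<Prod>r\<in>I. [:- x r, 1:]) = (\<Prod>r\<in>I. 1)" unfolding lead_coeff_prod by simp
 then show ?thesis by (simp add: degree_prod_linear)
qed

lemma fps_of_poly_prod_rev:
 fixes x :: "'b => 'a::field"
 shows "fps_of_poly (\<Prod>r\<in>I. [:1, - x r:]) = (\<Prod>r\<in>I. 1 - fps_const (x r) * fps_X)"
 by (simp add: fps_of_poly_prod fps_of_poly_pCons mult.commute fps_const_neg[symmetric] del: fps_const_neg)

lemma poly_prod_rev:
 fixes z :: "'a::field"
 assumes "z ~= 0" "finite I"
 shows "poly (\<Prod>r\<in>I. [:1, - w r:]) z = z ^ card I * poly (\<Prod>r\<in>I. [:- w r, 1:]) (1 / z)"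
 using assms(2)
proof induction
 case (insert i I)
 have "poly [:1, - w i:] z = z * poly [:- w i, 1:] (1 / z)" using assms(1) by (simp add: field_simps)
 then show ?case unfolding prod.insert[OF insert.hyps] poly_mult insert.IH card_insert_disjoint[OF insert.hyps]
  by (simp only: power_Suc ac_simps)
qed simp

lemma poly_eq_except_0:
 fixes p q :: "'a::{idom,ring_char_0} poly"
 assumes "!!z. z ~= 0 ==> poly p z = poly q z"
 shows "p = q"
proof -
 have "[:0, 1:] * p = [:0, 1:] * q"
 proof (rule poly_ext)
  fix z show "poly ([:0, 1:] * p) z = poly ([:0, 1:] * q) z"
   using assms[of z] by (cases "z = 0") auto
 qed
 then show ?thesis by simp
qed

lemma fps_geometric_const: "(1 - fps_const (c::'a::field) * fps_X) * Abs_fps (%k. c ^ k) = 1"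
proof (rule fps_ext)
 fix n show "((1 - fps_const c * fps_X) * Abs_fps (%k. c ^ k)) $ n = 1 $ n"
  by (cases n) (simp_all add: left_diff_distrib mult.assoc)
qed

lemma fps_partial_fractions:
 fixes x :: "'b => 'a::field"
 assumes "finite I"
 shows "Abs_fps (%k. \<Sum>i\<in>I. p i * x i ^ k) * (\<Prod>r\<in>I. 1 - fps_const (x r) * fps_X)
  = (\<Sum>i\<in>I. fps_const (p i) * (\<Prod>r\<in>I - {i}. 1 - fps_const (x r) * fps_X))"
proof -
 have "Abs_fps (%k. \<Sum>i\<in>I. p i * x i ^ k) = (\<Sum>i\<in>I. fps_const (p i) * Abs_fps (%k. x i ^ k))"
  by (rule fps_ext) (simp add: fps_sum_nth)
 moreover have "Abs_fps (%k. x i ^ k) * (\<Prod>r\<in>I. 1 - fps_const (x r) * fps_X)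
   = (\<Prod>r\<in>I - {i}. 1 - fps_const (x r) * fps_X)" if "i \<in> I" for i
  unfolding prod.remove[OF assms that] mult.left_commute[of "Abs_fps _"] mult.assoc[symmetric]
   mult.commute[of "Abs_fps _" "1 - _"] fps_geometric_const by (rule mult_1_left)
 ultimately show ?thesis by (simp add: sum_distrib_right mult.assoc)
qed

text \<open>Both statements are partial fraction expansions at \<open>u = 1/z\<close>, of \<open>B/A\<close> and of \<open>A/B\<close>,
 with \<open>A = \<Prod>(u - x i)\<close> and \<open>B = \<Prod>(u - y r)\<close>.\<close>

lemma interpolation_fps:
 fixes x y :: "nat => 'a::field_char_0"
 assumes inj: "inj_on x {..N}"
 defines "p \<equiv> %i. (\<Prod>r<N. x i - y r) / (\<Prod>r\<in>{..N} - {i}. x i - x r)"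
 shows "Abs_fps (%k. \<Sum>i\<le>N. p i * x i ^ k) * (\<Prod>r\<le>N. 1 - fps_const (x r) * fps_X)
   = (\<Prod>r<N. 1 - fps_const (y r) * fps_X)"
proof -
 define B where "B = (\<Prod>r<N. [:- y r, 1:])"
 define L where "L i = (\<Prod>r\<in>{..N} - {i}. [:- x r, 1:])" for i
 \<comment> \<open>Lagrange interpolation: both sides have degree at most \<open>N\<close> and agree
   at the \<open>N + 1\<close> nodes \<open>x i\<close>.\<close>
 have B: "B = (\<Sum>i\<le>N. smult (p i) (L i))"
 proof (rule poly_eqI_degree[where A = "x ` {..N}"])
  have c: "card (x ` {..N}) = Suc N" using inj by (simp add: card_image)
  show "degree B < card (x ` {..N})" unfolding c by (simp add: B_def degree_prod_linear)
  show "degree (\<Sum>i\<le>N. smult (p i) (L i)) < card (x ` {..N})" unfolding c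
   by (intro degree_sum_less) (auto simp: L_def degree_prod_linear)
  fix u assume "u \<in> x ` {..N}"
  then obtain k where k: "k <= N" "u = x k" by auto
  have "poly (\<Sum>i\<le>N. smult (p i) (L i)) u = (\<Sum>i\<le>N. p i * poly (L i) (x k))"
   by (simp add: poly_sum k)
  also have "... = p k * poly (L k) (x k)"
  proof (rule sum.remove[of "{..N}" k, THEN trans])
   have "poly (L i) (x k) = 0" if "i \<in> {..N} - {k}" for i
    unfolding L_def poly_prod using that k by (intro prod_zero bexI[of _ k]) auto
   then show "p k * poly (L k) (x k) + (\<Sum>i\<in>{..N} - {k}. p i * poly (L i) (x k)) = p k * poly (L k) (x k)"
    by simp
  qed (use k in auto)
  also have "poly (L k) (x k) ~= 0"
   using inj k by (auto simp: L_def poly_prod inj_on_def)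
  then have "p k * poly (L k) (x k) = poly B u"
   by (simp add: p_def L_def B_def poly_prod k)
  finally show "poly B u = poly (\<Sum>i\<le>N. smult (p i) (L i)) u" by simp
 qed
 have "(\<Prod>r<N. [:1, - y r:]) = (\<Sum>i\<le>N. smult (p i) (\<Prod>r\<in>{..N} - {i}. [:1, - x r:]))"
 proof (rule poly_eq_except_0)
  fix z :: 'a assume z: "z ~= 0"
  note * = poly_prod_rev[OF z]
  have c: "card ({..N} - {i}) = N" if "i <= N" for i using that by simp
  have "poly (\<Prod>r<N. [:1, - y r:]) z = z ^ N * poly B (1 / z)" by (simp add: * B_def)
  also have "... = (\<Sum>i\<le>N. p i * (z ^ N * poly (L i) (1 / z)))"
   unfolding B by (simp add: poly_sum sum_distrib_left mult.left_commute)
  also have "... = (\<Sum>i\<le>N. p i * poly (\<Prod>r\<in>{..N} - {i}. [:1, - x r:]) z)"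
   by (intro sum.cong refl) (simp add: * L_def c)
  finally show "poly (\<Prod>r<N. [:1, - y r:]) z
   = poly (\<Sum>i\<le>N. smult (p i) (\<Prod>r\<in>{..N} - {i}. [:1, - x r:])) z" by (simp add: poly_sum)
 qed
 from arg_cong[OF this, of fps_of_poly]
 have "(\<Prod>r<N. 1 - fps_const (y r) * fps_X)
   = (\<Sum>i\<le>N. fps_const (p i) * (\<Prod>r\<in>{..N} - {i}. 1 - fps_const (x r) * fps_X))"
  by (simp only: fps_of_poly_prod_rev fps_of_poly_sum fps_of_poly_smult)
 then show "Abs_fps (%k. \<Sum>i\<le>N. p i * x i ^ k) * (\<Prod>r\<le>N. 1 - fps_const (x r) * fps_X)
   = (\<Prod>r<N. 1 - fps_const (y r) * fps_X)" by (simp add: fps_partial_fractions)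
qed

lemma interpolation_inverse:
 fixes x y :: "nat => 'a::field_char_0"
 assumes inj: "inj_on y {..<N}"
 defines "a \<equiv> %i. - (\<Prod>r\<le>N. y i - x r) / (\<Prod>r\<in>{..<N} - {i}. y i - y r)"
 assumes h: "Abs_fps h * (\<Prod>r\<le>N. 1 - fps_const (x r) * fps_X) = (\<Prod>r<N. 1 - fps_const (y r) * fps_X)"
  and h1: "h 0 = 1" "h 1 = 0"
 shows "(\<Sum>i<N. a i) = h 2"
proof -
 define A where "A = (\<Prod>r\<le>N. [:- x r, 1:])"
 define B where "B = (\<Prod>r<N. [:- y r, 1:])"
 define L where "L i = (\<Prod>r\<in>{..<N} - {i}. [:- y r, 1:])" for i
 \<comment> \<open>Division of A by B in the form A = (u - \<kappa>) B - (sum of the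
   \<open>smult (a i) (L i)\<close>): in \<open>D\<close> the leading coefficients cancel, and it
   vanishes at every \<open>y i\<close>, hence it is a multiple of \<open>B\<close>.\<close>
 define D where "D = [:0, 1:] * B - A - (\<Sum>i<N. smult (a i) (L i))"
 have dB: "degree B = N" "coeff B N = 1" unfolding B_def
  using degree_prod_linear[of y "{..<N}"] lead_coeff_prod_linear[of y "{..<N}"] by simp_all
 have dA: "degree A = Suc N" "coeff A (Suc N) = 1" unfolding A_def
  using degree_prod_linear[of x "{..N}"] lead_coeff_prod_linear[of x "{..N}"] by simp_all
 have dL: "degree (\<Sum>i<N. smult (a i) (L i)) <= N"
  by (intro degree_sum_le) (auto simp: L_def degree_prod_linear intro: order_trans[OF degree_smult_le])
 have degD: "degree D <= N"
 proof (rule degree_le, intro allI impI)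
  fix k assume k: "N < k"
  show "coeff D k = 0"
  proof (cases "k = Suc N")
   case True
   then show ?thesis using dB dA dL by (simp add: D_def coeff_eq_0)
  next
   case False
   then have "coeff B (k - 1) = 0" "coeff A k = 0" "coeff (\<Sum>i<N. smult (a i) (L i)) k = 0"
    using k dB(1) dA(1) dL by (auto intro!: coeff_eq_0)
   then show ?thesis using k by (cases k) (simp_all add: D_def)
  qed
 qed
 define \<kappa> where "\<kappa> = coeff D N"
 have D: "D = smult \<kappa> B"
 proof (cases "N = 0")
  case True
  then have "degree D = 0" "B = 1" using degD by (simp_all add: B_def)
  then show ?thesis using True by (auto simp: \<kappa>_def elim: degree_eq_zeroE)
 next
  case False
  have "D - smult \<kappa> B = 0"
  proof (rule poly_eqI_degree[where A = "y ` {..<N}"])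
   have c: "card (y ` {..<N}) = N" using inj by (simp add: card_image)
   have "degree (D - smult \<kappa> B) <= N - 1"
   proof (rule degree_le, intro allI impI)
    fix k assume "N - 1 < k"
    then consider "k = N" | "k > N" by linarith
    then show "coeff (D - smult \<kappa> B) k = 0"
     using dB degD by cases (auto simp: \<kappa>_def coeff_eq_0)
   qed
   then show "degree (D - smult \<kappa> B) < card (y ` {..<N})" using False c by simp
   show "degree (0 :: 'a poly) < card (y ` {..<N})" using False c by simp
   fix u assume "u \<in> y ` {..<N}"
   then obtain k where k: "k < N" "u = y k" by auto
   have "poly (\<Sum>i<N. smult (a i) (L i)) u = (\<Sum>i<N. a i * poly (L i) (y k))"
    by (simp add: poly_sum k)
   also have "... = a k * poly (L k) (y k)"
   proof (rule sum.remove[of "{..<N}" k, THEN trans])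
    have "poly (L i) (y k) = 0" if "i \<in> {..<N} - {k}" for i
     unfolding L_def poly_prod using that k by (intro prod_zero bexI[of _ k]) auto
    then show "a k * poly (L k) (y k) + (\<Sum>i\<in>{..<N} - {k}. a i * poly (L i) (y k)) = a k * poly (L k) (y k)"
     by simp
   qed (use k in auto)
   also have "poly (L k) (y k) ~= 0"
    using inj k by (auto simp: L_def poly_prod inj_on_def)
   then have "a k * poly (L k) (y k) = - poly A u"
    by (simp add: a_def L_def A_def poly_prod k)
   finally have "poly (\<Sum>i<N. smult (a i) (L i)) u = - poly A u" .
   moreover have "poly B u = 0" unfolding B_def poly_prod using k by (intro prod_zero bexI[of _ k]) auto
   ultimately show "poly (D - smult \<kappa> B) u = poly 0 u" by (simp add: D_def)
  qed
  then show ?thesis by simp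
 qed
 have "(\<Prod>r\<le>N. [:1, - x r:]) = [:1, - \<kappa>:] * (\<Prod>r<N. [:1, - y r:])
    - [:0, 0, 1:] * (\<Sum>i<N. smult (a i) (\<Prod>r\<in>{..<N} - {i}. [:1, - y r:]))"
 proof (rule poly_eq_except_0)
  fix z :: 'a assume z: "z ~= 0"
  note * = poly_prod_rev[OF z]
  have c: "z ^ card ({..<N} - {i}) * z = z ^ N" if "i < N" for i
   using that by (cases N) (auto simp: mult.commute)
  have A: "A = [:0, 1:] * B - smult \<kappa> B - (\<Sum>i<N. smult (a i) (L i))"
   unfolding D[symmetric] by (simp add: D_def)
  have "poly (\<Prod>r\<le>N. [:1, - x r:]) z = z ^ Suc N * poly A (1 / z)" by (simp add: * A_def)
  also have "... = (1 - \<kappa> * z) * (z ^ N * poly B (1 / z)) - z * (\<Sum>i<N. a i * (z ^ N * poly (L i) (1 / z)))"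
   unfolding A using z by (simp add: poly_sum sum_distrib_left algebra_simps)
  also have "z ^ N * poly B (1 / z) = poly (\<Prod>r<N. [:1, - y r:]) z" by (simp add: * B_def)
  also have "(\<Sum>i<N. a i * (z ^ N * poly (L i) (1 / z)))
    = (\<Sum>i<N. z * (a i * poly (\<Prod>r\<in>{..<N} - {i}. [:1, - y r:]) z))"
   by (intro sum.cong refl) (simp add: * L_def c[symmetric] ac_simps)
  finally show "poly (\<Prod>r\<le>N. [:1, - x r:]) z = poly ([:1, - \<kappa>:] * (\<Prod>r<N. [:1, - y r:])
    - [:0, 0, 1:] * (\<Sum>i<N. smult (a i) (\<Prod>r\<in>{..<N} - {i}. [:1, - y r:]))) z"
   by (simp add: poly_sum sum_distrib_left algebra_simps)
 qed
 from arg_cong[OF this, of fps_of_poly]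
 have E: "(\<Prod>r\<le>N. 1 - fps_const (x r) * fps_X) = (1 - fps_const \<kappa> * fps_X) * (\<Prod>r<N. 1 - fps_const (y r) * fps_X)
   - fps_X * fps_X * (\<Sum>i<N. fps_const (a i) * (\<Prod>r\<in>{..<N} - {i}. 1 - fps_const (y r) * fps_X))"
  by (simp add: fps_of_poly_prod_rev fps_of_poly_sum fps_of_poly_smult fps_of_poly_mult fps_of_poly_diff
     fps_of_poly_pCons mult.commute fps_const_neg[symmetric] del: mult_pCons_left fps_const_neg)
 let ?Y = "\<Prod>r<N. 1 - fps_const (y r) * fps_X" and ?S = "Abs_fps (%k. \<Sum>i<N. a i * y i ^ k)"
 have "(\<Prod>r\<le>N. 1 - fps_const (x r) * fps_X) = ((1 - fps_const \<kappa> * fps_X) - fps_X * fps_X * ?S) * ?Y"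
  unfolding E fps_partial_fractions[OF finite_lessThan, symmetric] by (simp only: left_diff_distrib mult.assoc)
 then have "(Abs_fps h * ((1 - fps_const \<kappa> * fps_X) - fps_X * fps_X * ?S)) * ?Y = 1 * ?Y"
  using h by (simp only: mult.assoc mult_1_left)
 moreover have nz: "?Y ~= 0"
 proof
  assume "?Y = 0"
  then have "?Y $ 0 = 0" by simp
  then show False unfolding prod_nth0 fps_sub_nth fps_mult_nth_0 fps_X_nth fps_one_nth by simp
 qed
 ultimately have "Abs_fps h * ((1 - fps_const \<kappa> * fps_X) - fps_X * fps_X * ?S) = 1"
  by (simp only: mult_right_cancel[OF nz])
 then have one: "Abs_fps h - fps_X * (fps_const \<kappa> * Abs_fps h) - fps_X * (fps_X * (?S * Abs_fps h)) = 1"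
  by (simp only: right_diff_distrib mult_1_right mult_1_left ac_simps)
 \<comment> \<open>Coefficient 1 of the continued fraction step \<open>one\<close> shows that
   \<kappa> equals \<open>h 1\<close>, which is 0; coefficient 2 then isolates the sum of the
   \<open>a i\<close>.\<close>
 have "h 1 - \<kappa> * h 0 = 0" using arg_cong[OF one, of "%f. fps_nth f 1"] by (simp add: fps_X_mult_nth)
 then have "\<kappa> = 0" using h1 by simp
 then have "h 2 - (\<Sum>i<N. a i) = 0"
  using arg_cong[OF one, of "%f. fps_nth f 2"] h1 by (simp add: fps_X_mult_nth)
 then show ?thesis by simp
qed

section \<open>Growth of Young diagrams\<close>

text \<open>A Young diagram is the sequence of its row lengths, padded with zeros; rows and columns are
 numbered from 0 here.\<close>

definition diagrams :: "nat => (nat => nat) set" where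
 "diagrams n = {f. antimono f & (ALL i>=n. f i = 0) & sum f {..<n} = n}"

definition colf :: "(nat => nat) => nat => nat" where
 "colf f j = card {i. j < f i}"

text \<open>\<open>xc\<close> is the c-coordinate of the lowest corner of a box added to row
  \<open>i\<close>; for a nonempty row \<open>yc\<close> is that of the top corner of its last box.
  Every row is listed, also those that admit no box: there \<open>xc\<close> at \<open>i\<close>
  equals \<open>yc\<close> at \<open>i - 1\<close>, and the pair cancels in all quotients, so the
  index sets need not depend on the diagram.\<close>

definition xc :: "real => real => (nat => nat) => nat => real" where
 "xc a b f i = b * real i + a * real (f i)"

definition yc :: "real => real => (nat => nat) => nat => real" where
 "yc a b f i = b * real (Suc i) + a * real (f i)"

definition hookf :: "real => real => (nat => nat) => nat => nat => real" where
 "hookf a b f i j = (a * (real (f i) - real j) - b * (real (colf f j) - real i - 1))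
          * (a * (real (f i) - real j - 1) - b * (real (colf f j) - real i))"

definition hooks :: "real => real => nat => (nat => nat) => real" where
 "hooks a b N f = (\<Prod>i<N. \<Prod>j<f i. hookf a b f i j)"

text \<open>With A the product of the factors u - \<open>xc\<close> and B that of the factors u -
  \<open>yc\<close>, these are the residues of B/A, and \<open>down_weight\<close> gives minus those
  of A/B. The first are Kerov's transition probabilities; the second add up to -(a b) n rather than
  to 1.\<close>

definition up_weight :: "real => real => nat => (nat => nat) => nat => real" where
 "up_weight a b N f i = (\<Prod>r<N. xc a b f i - yc a b f r) / (\<Prod>r\<in>{..N} - {i}. xc a b f i - xc a b f r)"

definition down_weight :: "real => real => nat => (nat => nat) => nat => real" where
 "down_weight a b N f i = - (\<Prod>r\<le>N. yc a b f i - xc a b f r) / (\<Prod>r\<in>{..<N} - {i}. yc a b f i - yc a b f r)"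

abbreviation add_box :: "(nat => nat) => nat => nat => nat" where
 "add_box f i \<equiv> f(i := Suc (f i))"

definition addable :: "(nat => nat) => nat => bool" where
 "addable f i \<longleftrightarrow> i = 0 | f i < f (i - 1)"

lemma less_colf_iff:
 assumes "antimono f" "!!i. i >= N ==> f i = 0"
 shows "i < colf f j \<longleftrightarrow> j < f i"
proof -
 let ?S = "{i. j < f i}"
 have fin: "finite ?S" by (rule finite_subset[of _ "{..<N}"]) (auto intro: ccontr simp: assms(2) not_less)
 have down: "k \<in> ?S" if "i \<in> ?S" "k <= i" for i k
  using that assms(1) by (auto simp: antimono_def intro: less_le_trans)
 have "?S = {..<card ?S}"
 proof (cases "?S = {}")
  case False
  have "?S = {..Max ?S}" using down[OF Max_in[OF fin False]] Max_ge[OF fin] by blast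
  then show ?thesis by (metis card_atMost lessThan_Suc_atMost)
 qed auto
 then show ?thesis unfolding colf_def by blast
qed

lemma interlacing:
 assumes ab: "a > 0" "b < 0" and f: "antimono f"
 shows "i < r ==> xc a b f r < xc a b f i" "i < r ==> yc a b f r < yc a b f i"
  "i < r ==> xc a b f r <= yc a b f i" "i <= r ==> yc a b f r < xc a b f i"
  "i < r ==> f r < f i ==> xc a b f r < yc a b f i"
proof -
 have m: "a * real (f r) <= a * real (f i)" if "i <= r" for i r
  using ab f that by (auto simp: antimono_def)
 have n: "b * real r < b * real i" if "i < r" for i r using ab that by simp
 have n': "b * real r <= b * real i" if "i <= r" for i r using ab that by simp
 have S: "b * real (Suc i) = b * real i + b" for i by (simp add: algebra_simps)
 show "xc a b f r < xc a b f i" "yc a b f r < yc a b f i" if "i < r"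
  using that m[of i r] n[of i r] ab unfolding xc_def yc_def S by linarith+
 show "xc a b f r <= yc a b f i" if "i < r"
  using that m[of i r] n'[of "Suc i" r] unfolding xc_def yc_def by linarith
 show "yc a b f r < xc a b f i" if "i <= r"
  using that m[of i r] n'[of i r] ab unfolding xc_def yc_def S by linarith
 show "xc a b f r < yc a b f i" if "i < r" "f r < f i"
 proof -
  have "a * real (f r) < a * real (f i)" using ab that by simp
  then show ?thesis using that n'[of "Suc i" r] unfolding xc_def yc_def by linarith
 qed
qed

lemma inj_on_xc: "a > 0 ==> b < 0 ==> antimono f ==> inj_on (xc a b f) I"
 using interlacing(1) by (intro linorder_inj_onI') fastforce+

lemma inj_on_yc: "a > 0 ==> b < 0 ==> antimono f ==> inj_on (yc a b f) I"
 using interlacing(2) by (intro linorder_inj_onI') fastforce+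

text \<open>Pair the factor of \<open>yc\<close> at r with that of \<open>xc\<close> at r for r < i
  and with that of \<open>xc\<close> at r + 1 for r >= i: by interlacing, numerator and denominator
  of a quotient never have opposite signs.\<close>

lemma up_weight_nonneg:
 assumes ab: "a > 0" "b < 0" and f: "antimono f" and i: "i <= N"
 shows "up_weight a b N f i >= 0"
proof -
 let ?x = "xc a b f" and ?y = "yc a b f"
 have "(\<Prod>r\<in>{..N} - {i}. ?x i - ?x r) = (\<Prod>r<N. ?x i - ?x (if r < i then r else Suc r))"
  by (rule prod.reindex_bij_witness[of _ "%r. if r < i then r else Suc r" "%r. if r < i then r else r - 1"])
    (use i in "auto split: if_splits")
 then have "up_weight a b N f i = (\<Prod>r<N. (?x i - ?y r) / (?x i - ?x (if r < i then r else Suc r)))"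
  by (simp add: up_weight_def prod_dividef)
 also have "... >= 0"
 proof (rule prod_nonneg)
  fix r assume "r \<in> {..<N}"
  show "(?x i - ?y r) / (?x i - ?x (if r < i then r else Suc r)) >= 0"
  proof (cases "r < i")
   case True
   then show ?thesis using interlacing(1,3)[OF ab f True] by (simp add: divide_nonpos_neg)
  next
   case False
   then show ?thesis using interlacing(1)[OF ab f, of i "Suc r"] interlacing(4)[OF ab f, of i r] by simp
  qed
 qed
 finally show ?thesis .
qed

lemma up_weight_eq_0: "~ addable f i ==> antimono f ==> i <= N ==> up_weight a b N f i = 0"
proof -
 assume A: "~ addable f i" "antimono f" "i <= N"
 then have "f i = f (i - 1)" "0 < i" by (auto simp: addable_def antimono_def intro!: antisym)
 then have "xc a b f i = yc a b f (i - 1)" "i - 1 < N" using A by (auto simp: xc_def yc_def)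
 then show ?thesis by (auto simp: up_weight_def intro!: prod_zero bexI[of _ "i - 1"])
qed

lemma down_weight_eq_0: "f i = f (Suc i) ==> i < N ==> down_weight a b N f i = 0"
 unfolding down_weight_def by (auto intro!: prod_zero bexI[of _ "Suc i"] simp: xc_def yc_def)

text \<open>The boundary of the diagram is a lattice path; both sides telescope along it.\<close>

lemma boundary_telescope:
 fixes psi :: "nat => nat => 'a::comm_monoid_mult"
 assumes f: "antimono f" "!!i. i >= N ==> f i = 0" and i: "i <= N"
 shows "(\<Prod>j<f i. psi (colf f j) (Suc j)) * (\<Prod>r\<in>{i<..N}. psi r (f r))
    = (\<Prod>j<f i. psi (colf f j) j) * (\<Prod>r\<in>{i..<N}. psi (Suc r) (f r))"
 using i
proof (induction i rule: inc_induct)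
 case base
 then show ?case by (simp add: f(2))
next
 case (step i)
 have le: "f (Suc i) <= f i" using f(1) by (simp add: antimono_def)
 have split: "(\<Prod>j<f i. g j) = (\<Prod>j<f (Suc i). g j) * (\<Prod>j\<in>{f (Suc i)..<f i}. g j)" for g :: "nat => 'a"
  using le by (subst prod.union_disjoint[symmetric]) (auto intro: prod.cong)
 have col: "colf f j = Suc i" if "j \<in> {f (Suc i)..<f i}" for j
  using less_colf_iff[of f N i j] less_colf_iff[of f N "Suc i" j] f that by auto
 have tel: "(\<Prod>j\<in>{m..<n}. psi (Suc i) (Suc j)) * psi (Suc i) m = (\<Prod>j\<in>{m..<n}. psi (Suc i) j) * psi (Suc i) n"
  if "m <= n" for m n using that
 proof (induction n rule: dec_induct)
  case (step k)
  let ?g = "psi (Suc i)"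
  have "(\<Prod>j\<in>{m..<Suc k}. ?g (Suc j)) * ?g m = ((\<Prod>j\<in>{m..<k}. ?g (Suc j)) * ?g m) * ?g (Suc k)"
   using step(1) by (simp add: mult.commute mult.left_commute)
  then show ?case unfolding step.IH using step(1) by (simp add: mult.assoc)
 qed simp
 have "{i<..N} = insert (Suc i) {Suc i<..N}" "{i..<N} = insert i {Suc i..<N}" using step by auto
 then have I: "(\<Prod>r\<in>{i<..N}. psi r (f r)) = psi (Suc i) (f (Suc i)) * (\<Prod>r\<in>{Suc i<..N}. psi r (f r))"
   "(\<Prod>r\<in>{i..<N}. psi (Suc r) (f r)) = psi (Suc i) (f i) * (\<Prod>r\<in>{Suc i..<N}. psi (Suc r) (f r))" by auto
 have c: "(\<Prod>j\<in>{f (Suc i)..<f i}. psi (colf f j) (g j)) = (\<Prod>j\<in>{f (Suc i)..<f i}. psi (Suc i) (g j))" for g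
  by (intro prod.cong refl) (simp add: col)
 have "(\<Prod>j<f i. psi (colf f j) (Suc j)) * (\<Prod>r\<in>{i<..N}. psi r (f r))
   = ((\<Prod>j\<in>{f (Suc i)..<f i}. psi (Suc i) (Suc j)) * psi (Suc i) (f (Suc i)))
    * ((\<Prod>j<f (Suc i). psi (colf f j) (Suc j)) * (\<Prod>r\<in>{Suc i<..N}. psi r (f r)))"
  unfolding split[of "%j. psi (colf f j) (Suc j)"] I c by (simp only: ac_simps)
 also have "... = ((\<Prod>j\<in>{f (Suc i)..<f i}. psi (Suc i) j) * psi (Suc i) (f i))
    * ((\<Prod>j<f (Suc i). psi (colf f j) j) * (\<Prod>r\<in>{Suc i..<N}. psi (Suc r) (f r)))"
  unfolding tel[OF le] step.IH ..
 also have "... = (\<Prod>j<f i. psi (colf f j) j) * (\<Prod>r\<in>{i..<N}. psi (Suc r) (f r))"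
  unfolding split[of "%j. psi (colf f j) j"] I c by (simp only: ac_simps)
 finally show ?case .
qed

lemma colf_add_box:
 assumes f: "antimono f" "!!i. i >= N ==> f i = 0" and i: "addable f i"
 shows "colf (add_box f i) j = (if j = f i then Suc i else colf f j)" "colf f (f i) = i"
proof -
 show c: "colf f (f i) = i"
 proof (rule antisym)
  show "colf f (f i) <= i" using less_colf_iff[of f N i "f i"] f by auto
  show "i <= colf f (f i)" using less_colf_iff[of f N "i - 1" "f i"] f i by (auto simp: addable_def)
 qed
 show "colf (add_box f i) j = (if j = f i then Suc i else colf f j)"
 proof (cases "j = f i")
  case True
  have "{k. j < f k} = {..<i}" using less_colf_iff[of f N _ j] f c True by auto
  then have "{k. j < add_box f i k} = insert i {..<i}" using True by (auto split: if_splits)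
  then show ?thesis using True by (simp add: colf_def)
 next
  case False
  then have "{k. j < add_box f i k} = {k. j < f k}" by (auto split: if_splits)
  then show ?thesis using False by (simp add: colf_def)
 qed
qed

text \<open>Only the hooks in the row and the column of the new box change. Above the box the leg
  grows by one, which turns the value of \<open>psi\<close> at \<open>yc\<close> into that at
  \<open>xc\<close>; in the row of the box the change telescopes along the boundary into the rows
  below. The factor -(a b) is the hook of the new box itself.\<close>

lemma hook_ratio:
 fixes a b :: real and f :: "nat => nat"
 assumes f: "antimono f" "!!i. i >= N ==> f i = 0" and i: "addable f i" "i < N"
 defines "x \<equiv> xc a b f i"
 shows "hooks a b N (add_box f i) * (\<Prod>r<N. (x - yc a b f r) * (x + a + b - yc a b f r))
    = - (a * b) * hooks a b N f * (\<Prod>r\<in>{..N} - {i}. (x - xc a b f r) * (x + a + b - xc a b f r))"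
proof -
 let ?f = "add_box f i"
 define psi where "psi u = (x - u) * (x + a + b - u)" for u
 define R where "R f r = (\<Prod>j<f r. hookf a b f r j)" for f r
 note col = colf_add_box[OF f i(1)]
 have below: "R ?f r = R f r" if "i < r" for r
 proof -
  have "f r <= f i" using f(1) that by (auto simp: antimono_def)
  then show ?thesis using that by (auto simp: R_def hookf_def col intro!: prod.cong)
 qed
 have above: "R ?f r * psi (yc a b f r) = R f r * psi (xc a b f r)" if r: "r < i" for r
 proof -
  have "f (i - 1) <= f r" using f(1) r by (auto simp: antimono_def)
  then have lt: "f i \<in> {..<f r}" using i r by (auto simp: addable_def)
  have 1: "R g r = hookf a b g r (f i) * (\<Prod>j\<in>{..<f r} - {f i}. hookf a b g r j)" if "g r = f r" for g
   unfolding R_def that by (rule prod.remove[OF _ lt]) simp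
  have 2: "(\<Prod>j\<in>{..<f r} - {f i}. hookf a b ?f r j) = (\<Prod>j\<in>{..<f r} - {f i}. hookf a b f r j)"
   using r by (intro prod.cong refl) (auto simp: hookf_def col)
  have 3: "hookf a b ?f r (f i) = psi (xc a b f r)" "hookf a b f r (f i) = psi (yc a b f r)"
   using r by (simp_all add: hookf_def col psi_def x_def xc_def yc_def algebra_simps)
  show ?thesis using r by (simp add: 1 2 3)
 qed
 let ?P = "%r j. psi (b * real r + a * real j)"
 have row: "R ?f i * (\<Prod>r\<in>{i..<N}. psi (yc a b f r)) = - (a * b) * R f i * (\<Prod>r\<in>{i<..N}. psi (xc a b f r))"
 proof -
  have 1: "R f i = (\<Prod>j<f i. ?P (colf f j) (Suc j))"
   unfolding R_def by (intro prod.cong refl) (simp add: hookf_def psi_def x_def xc_def algebra_simps)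
  have 2: "R ?f i = - (a * b) * (\<Prod>j<f i. ?P (colf f j) j)"
  proof -
   have "R ?f i = hookf a b ?f i (f i) * (\<Prod>j<f i. hookf a b ?f i j)" by (simp add: R_def)
   moreover have "hookf a b ?f i (f i) = - (a * b)" by (simp add: hookf_def col)
   moreover have "(\<Prod>j<f i. hookf a b ?f i j) = (\<Prod>j<f i. ?P (colf f j) j)"
    by (intro prod.cong refl) (simp add: hookf_def col psi_def x_def xc_def algebra_simps)
   ultimately show ?thesis by simp
  qed
  show ?thesis using boundary_telescope[OF f, where i = i and psi = ?P] i(2) unfolding 1 2 by (simp add: xc_def yc_def)
 qed
 have split: "(\<Prod>r<N. g r) = (\<Prod>r<i. g r) * g i * (\<Prod>r\<in>{i<..<N}. g r)" for g :: "nat => real"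
 proof -
  have "{..<N} = {..<i} \<union> insert i {i<..<N}" using i by auto
  then have "(\<Prod>r<N. g r) = prod g ({..<i} \<union> insert i {i<..<N})" by simp
  also have "... = prod g {..<i} * prod g (insert i {i<..<N})" by (rule prod.union_disjoint) auto
  finally show ?thesis by (simp add: mult.assoc)
 qed
 have "hooks a b N ?f * (\<Prod>r<N. psi (yc a b f r))
   = (\<Prod>r<i. R ?f r * psi (yc a b f r)) * (R ?f i * (\<Prod>r\<in>{i..<N}. psi (yc a b f r))) * (\<Prod>r\<in>{i<..<N}. R ?f r)"
 proof -
  have "{i..<N} = insert i {i<..<N}" using i by auto
  then show ?thesis unfolding hooks_def split R_def[symmetric] by (simp add: prod.distrib ac_simps)
 qed
 also have "... = (\<Prod>r<i. R f r * psi (xc a b f r)) * (- (a * b) * R f i * (\<Prod>r\<in>{i<..N}. psi (xc a b f r)))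
   * (\<Prod>r\<in>{i<..<N}. R f r)"
 proof -
  have "(\<Prod>r<i. R ?f r * psi (yc a b f r)) = (\<Prod>r<i. R f r * psi (xc a b f r))"
   by (intro prod.cong refl) (simp add: above)
  moreover have "(\<Prod>r\<in>{i<..<N}. R ?f r) = (\<Prod>r\<in>{i<..<N}. R f r)"
   by (intro prod.cong refl) (simp add: below)
  ultimately show ?thesis unfolding row by simp
 qed
 also have "... = - (a * b) * hooks a b N f * ((\<Prod>r<i. psi (xc a b f r)) * (\<Prod>r\<in>{i<..N}. psi (xc a b f r)))"
  unfolding hooks_def split R_def[symmetric] by (simp add: prod.distrib)
 also have "(\<Prod>r<i. psi (xc a b f r)) * (\<Prod>r\<in>{i<..N}. psi (xc a b f r)) = (\<Prod>r\<in>{..N} - {i}. psi (xc a b f r))"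
 proof -
  have "{..N} - {i} = {..<i} \<union> {i<..N}" using i by auto
  then have "(\<Prod>r\<in>{..N} - {i}. psi (xc a b f r)) = (\<Prod>r\<in>{..<i} \<union> {i<..N}. psi (xc a b f r))" by simp
  also have "... = (\<Prod>r<i. psi (xc a b f r)) * (\<Prod>r\<in>{i<..N}. psi (xc a b f r))"
   by (rule prod.union_disjoint) auto
  finally show ?thesis by simp
 qed
 finally show ?thesis unfolding psi_def .
qed

lemma antimono_add_box: "antimono f ==> addable f i ==> antimono (add_box f i)"
proof (rule antimonoI)
 fix j k :: nat assume A: "antimono f" "addable f i" "j <= k"
 have "f k <= f j" using A by (auto simp: antimono_def)
 moreover have "f i < f j" if "j < i" using A that
  by (auto simp: addable_def antimono_def intro: less_le_trans)
 ultimately show "add_box f i k <= add_box f i j" using A(3) by (auto simp: Suc_le_eq)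
qed

text \<open>Detailed balance. Each factor in \<open>hook_ratio\<close> is a product of two terms
  whose arguments differ by a + b; one half forms the up weight of \<open>f\<close>, the other the
  down weight of the larger diagram, whose corner \<open>yc\<close> in row \<open>i\<close> is
  \<open>xc a b f i + a + b\<close>.\<close>

lemma up_down:
 assumes ab: "a > 0" "b < 0" and f: "antimono f" "!!i. i >= N ==> f i = 0" and i: "addable f i" "i < N"
 shows "hooks a b N (add_box f i) * up_weight a b N f i = hooks a b N f * down_weight a b N (add_box f i) i"
proof -
 let ?f = "add_box f i" and ?x = "xc a b f" and ?y = "yc a b f"
 let ?I = "{..N} - {i}" and ?J = "{..<N} - {i}"
 define X where "X = (\<Prod>r\<in>?I. ?x i - ?x r)"
 define X' where "X' = (\<Prod>r\<in>?I. ?x i + a + b - ?x r)"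
 define Y where "Y = (\<Prod>r<N. ?x i - ?y r)"
 define Y' where "Y' = (\<Prod>r\<in>?J. ?x i + a + b - ?y r)"
 have y': "yc a b ?f i = ?x i + a + b" by (simp add: xc_def yc_def algebra_simps)
 have X: "X ~= 0" using inj_on_xc[OF ab f(1), of UNIV] by (auto simp: X_def inj_on_def)
 have Y': "Y' ~= 0"
 proof -
  have "yc a b ?f r ~= yc a b ?f i" if "r ~= i" for r
   using inj_on_yc[OF ab antimono_add_box[OF f(1) i(1)], of UNIV] that by (auto simp: inj_on_def)
  then have "?x i + a + b ~= ?y r" if "r ~= i" for r
   using that y' by (metis fun_upd_other yc_def)
  then show ?thesis by (auto simp: Y'_def)
 qed
 have "(\<Prod>r<N. ?x i + a + b - ?y r) = (?x i + a + b - ?y i) * Y'"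
  unfolding Y'_def by (rule prod.remove) (use i in auto)
 also have "?x i + a + b - ?y i = a" by (simp add: xc_def yc_def algebra_simps)
 finally have YY: "(\<Prod>r<N. ?x i + a + b - ?y r) = a * Y'" .
 have up: "up_weight a b N f i = Y / X" by (simp add: up_weight_def X_def Y_def)
 have "down_weight a b N ?f i = - ((yc a b ?f i - xc a b ?f i) * X') / Y'"
 proof -
  have "(\<Prod>r\<le>N. yc a b ?f i - xc a b ?f r) = (yc a b ?f i - xc a b ?f i) * (\<Prod>r\<in>?I. yc a b ?f i - xc a b ?f r)"
   by (rule prod.remove) (use i in auto)
  moreover have "(\<Prod>r\<in>?I. yc a b ?f i - xc a b ?f r) = X'" unfolding X'_def y'
   by (intro prod.cong refl) (auto simp: xc_def)
  moreover have "(\<Prod>r\<in>?J. yc a b ?f i - yc a b ?f r) = Y'" unfolding Y'_def y'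
   by (intro prod.cong refl) (auto simp: yc_def)
  ultimately show ?thesis by (simp add: down_weight_def)
 qed
 also have "yc a b ?f i - xc a b ?f i = b" by (simp add: xc_def yc_def algebra_simps)
 finally have dn: "down_weight a b N ?f i = - (b * X') / Y'" .
 have "hooks a b N ?f * (Y * (a * Y')) = - (a * b) * hooks a b N f * (X * X')"
  using hook_ratio[OF f i, of a b] unfolding prod.distrib YY by (simp add: X_def X'_def Y_def)
 then have "a * (hooks a b N ?f * (Y * Y')) = a * (- b * hooks a b N f * (X * X'))" by algebra
 moreover have a0: "a ~= 0" using ab by simp
 ultimately have "hooks a b N ?f * (Y * Y') = - b * hooks a b N f * (X * X')"
  by (simp only: mult_left_cancel[OF a0])
 then show ?thesis using X Y' unfolding up dn by (simp add: field_simps)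
qed

lemma hooks_pos:
 assumes ab: "a > 0" "b < 0" and f: "antimono f" "!!i. i >= N ==> f i = 0"
 shows "hooks a b M f > 0"
 unfolding hooks_def
proof (intro prod_pos ballI)
 fix i j assume "j \<in> {..<f i}"
 then have "j < f i" "i < colf f j" using less_colf_iff[of f N] f by auto
 then have "0 < a * (real (f i) - real j)" "0 <= a * (real (f i) - real j - 1)"
   "b * (real (colf f j) - real i - 1) <= 0" "b * (real (colf f j) - real i) < 0"
  using ab by (auto intro!: mult_nonneg_nonneg mult_nonpos_nonneg mult_neg_pos)
 then show "0 < hookf a b f i j" unfolding hookf_def by (intro mult_pos_pos) linarith+
qed

text \<open>Contribution of the box at \<open>c\<close> to \<open>\<integral> c^p (1/2) f'' dc\<close>.\<close>

definition box_pow :: "real => real => nat => real => real" where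
 "box_pow a b p c = (c + a) ^ p + (c + b) ^ p - c ^ p - (c + a + b) ^ p"

text \<open>The term \<open>0 ^ p\<close> is the moment of the unit mass at 0, which comes from the
  summand |c| of the profile.\<close>

definition shape_moment :: "real => real => (nat => nat) => nat => real" where
 "shape_moment a b f p = 0 ^ p + (\<Sum>i | f i ~= 0. \<Sum>j<f i. box_pow a b p (b * real i + a * real j))"

lemma shape_moment_N:
 assumes "!!i. i >= N ==> f i = 0"
 shows "shape_moment a b f p = 0 ^ p + (\<Sum>i<N. \<Sum>j<f i. box_pow a b p (b * real i + a * real j))"
proof -
 have "(\<Sum>i | f i ~= 0. \<Sum>j<f i. box_pow a b p (b * real i + a * real j))
   = (\<Sum>i<N. \<Sum>j<f i. box_pow a b p (b * real i + a * real j))"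
  by (rule sum.mono_neutral_left) (auto intro: ccontr simp: assms not_less)
 then show ?thesis by (simp add: shape_moment_def)
qed

text \<open>Box contributions telescope along each row; what remains at the first column telescopes
  in \<open>i\<close>, and its end point supplies the extra node \<open>xc a b f N\<close>.\<close>

lemma shape_moment_eq:
 assumes "!!i. i >= N ==> f i = 0"
 shows "shape_moment a b f p = (\<Sum>i\<le>N. xc a b f i ^ p) - (\<Sum>i<N. yc a b f i ^ p)"
proof -
 have row: "(\<Sum>j<m. box_pow a b p (c + a * real j))
   = ((c + a * real m) ^ p - c ^ p) - ((c + b + a * real m) ^ p - (c + b) ^ p)" for c m
  by (induction m) (auto simp: box_pow_def algebra_simps)
 have "(\<Sum>i<N. \<Sum>j<f i. box_pow a b p (b * real i + a * real j))
   = (\<Sum>i<N. xc a b f i ^ p - yc a b f i ^ p + ((b * real (Suc i)) ^ p - (b * real i) ^ p))"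
  by (intro sum.cong refl, subst row) (simp add: xc_def yc_def algebra_simps)
 also have "... = (\<Sum>i<N. xc a b f i ^ p) - (\<Sum>i<N. yc a b f i ^ p) + ((b * real N) ^ p - 0 ^ p)"
  unfolding sum.distrib sum_subtractf
  using sum_lessThan_telescope[of "%i. (b * real i) ^ p" N] by (simp add: sum_subtractf)
 also have "(\<Sum>i<N. xc a b f i ^ p) + (b * real N) ^ p = (\<Sum>i\<le>N. xc a b f i ^ p)"
  using assms[of N] by (simp add: xc_def lessThan_Suc_atMost[symmetric])
 then have "(\<Sum>i<N. xc a b f i ^ p) = (\<Sum>i\<le>N. xc a b f i ^ p) - (b * real N) ^ p" by simp
 finally show ?thesis by (simp add: shape_moment_N[OF assms])
qed

lemma shape_moment_add_box:
 assumes "!!i. i >= N ==> f i = 0"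
 shows "shape_moment a b (add_box f i) p = shape_moment a b f p + box_pow a b p (xc a b f i)"
proof -
 let ?M = "max N (Suc i)"
 let ?r = "%f i. \<Sum>j<f i. box_pow a b p (b * real i + a * real j)"
 have i: "i \<in> {..<?M}" by simp
 have "shape_moment a b (add_box f i) p = 0 ^ p + (\<Sum>k<?M. ?r (add_box f i) k)"
  by (rule shape_moment_N) (use assms in auto)
 also have "(\<Sum>k<?M. ?r (add_box f i) k) = ?r (add_box f i) i + (\<Sum>k\<in>{..<?M} - {i}. ?r f k)"
  unfolding sum.remove[OF finite_lessThan i] by auto
 also have "?r (add_box f i) i = ?r f i + box_pow a b p (xc a b f i)" by (simp add: xc_def)
 also have "0 ^ p + (?r f i + box_pow a b p (xc a b f i) + (\<Sum>k\<in>{..<?M} - {i}. ?r f k))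
   = 0 ^ p + (\<Sum>k<?M. ?r f k) + box_pow a b p (xc a b f i)"
  unfolding sum.remove[OF finite_lessThan i, of "?r f"] by simp
 also have "0 ^ p + (\<Sum>k<?M. ?r f k) = shape_moment a b f p"
  by (rule shape_moment_N[symmetric]) (use assms in auto)
 finally show ?thesis .
qed

lemma shape_moment_1: "shape_moment a b f 1 = 0"
 by (simp add: shape_moment_def box_pow_def)

lemma shape_moment_2:
 assumes "f \<in> diagrams n"
 shows "shape_moment a b f 2 = - 2 * a * b * real n"
proof -
 have "box_pow a b 2 c = - 2 * a * b" for c by (simp add: box_pow_def power2_eq_square algebra_simps)
 then have "shape_moment a b f 2 = (\<Sum>i<n. real (f i) * (- 2 * a * b))"
  using assms by (subst shape_moment_N[of n]) (auto simp: diagrams_def)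
 also have "... = real (sum f {..<n}) * (- 2 * a * b)" by (simp only: of_nat_sum sum_distrib_right)
 finally show ?thesis using assms by (simp del: of_nat_sum add: diagrams_def)
qed

lemma up_moments:
 assumes ab: "a > 0" "b < 0" and f: "antimono f" "!!i. i >= N ==> f i = 0"
 shows "(\<Sum>i\<le>N. up_weight a b N f i * xc a b f i ^ k) = hom_of_pow (shape_moment a b f) k"
proof -
 have "newton (%k. \<Sum>i\<le>N. up_weight a b N f i * xc a b f i ^ k) (shape_moment a b f)"
 proof -
  have sm: "shape_moment a b f = (%p. (\<Sum>i\<le>N. xc a b f i ^ p) - (\<Sum>i<N. yc a b f i ^ p))"
   by (rule ext) (rule shape_moment_eq[OF f(2)])
  show ?thesis using newton_quotient[OF finite_atMost finite_lessThan interpolation_fps[OF inj_on_xc[OF ab f(1)], where N = N and y = "yc a b f"]]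
   unfolding up_weight_def sm .
 qed
 from newton_hom_unique[OF this newton_hom_of_pow, where n = k and p = k] show ?thesis by simp
qed

text \<open>Expanding A/B at infinity gives \<open>h 2\<close>, and since the first power sum
  vanishes this is half of the second one, that is, -(a b) times the number of boxes.\<close>

lemma down_weight_sum:
 assumes ab: "a > 0" "b < 0" and f: "f \<in> diagrams n" and N: "n <= N"
 shows "(\<Sum>i<N. down_weight a b N f i) = - (a * b) * real n"
proof -
 have f': "antimono f" "!!i. i >= N ==> f i = 0" using f N by (auto simp: diagrams_def)
 define h where "h k = (\<Sum>i\<le>N. up_weight a b N f i * xc a b f i ^ k)" for k
 have nh: "newton h (shape_moment a b f)"
 proof -
  have "h = hom_of_pow (shape_moment a b f)" unfolding h_def by (rule ext) (rule up_moments[OF ab f'])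
  then show ?thesis by (simp add: newton_hom_of_pow)
 qed
 have h: "h 0 = 1" "h 1 = 0" "2 * h 2 = shape_moment a b f 2"
 proof -
  show 0: "h 0 = 1" using nh by (simp add: newton_def)
  have rel: "real k * h k = (\<Sum>q=1..k. shape_moment a b f q * h (k - q))" for k using nh by (simp add: newton_def)
  show 1: "h 1 = 0" using rel[of 1] shape_moment_1[of a b f] 0 by simp
  show "2 * h 2 = shape_moment a b f 2"
   using rel[of 2] shape_moment_1[of a b f] 0 1 by (simp add: numeral_2_eq_2)
 qed
 have "Abs_fps h * (\<Prod>r\<le>N. 1 - fps_const (xc a b f r) * fps_X) = (\<Prod>r<N. 1 - fps_const (yc a b f r) * fps_X)"
  using interpolation_fps[OF inj_on_xc[OF ab f'(1)], where N = N and y = "yc a b f"] unfolding h_def up_weight_def .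
 from interpolation_inverse[OF inj_on_yc[OF ab f'(1)] this h(1,2)]
 show ?thesis using h(3) shape_moment_2[OF f, of a b] by (simp add: down_weight_def)
qed

definition jp_weight :: "real => real => nat => (nat => nat) => real" where
 "jp_weight a b n f = (- (a * b)) ^ n * fact n / hooks a b n f"

text \<open>Vector valued, so that one recursion serves moments as well as characteristic
  functions.\<close>

definition jp_sum :: "real => real => nat => ((nat => nat) => 'b::real_vector) => 'b" where
 "jp_sum a b n F = (\<Sum>f\<in>diagrams n. jp_weight a b n f *\<^sub>R F f)"

lemma hooks_N: "(!!i. i >= n ==> f i = 0) ==> n <= N ==> hooks a b N f = hooks a b n f"
 unfolding hooks_def by (rule prod.mono_neutral_right) auto

lemma finite_diagrams: "finite (diagrams n)"
proof (rule finite_subset)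
 show "diagrams n \<subseteq> {f. ALL i. (i \<in> {..<n} --> f i \<in> {..n}) & (i ~: {..<n} --> f i = 0)}"
 proof (intro subsetI CollectI allI conjI impI)
  fix f i assume f: "f \<in> diagrams n"
  show "f i \<in> {..n}" if "i \<in> {..<n}"
   using f member_le_sum[of i "{..<n}" f] that by (auto simp: diagrams_def)
  show "f i = 0" if "i ~: {..<n}" using f that by (auto simp: diagrams_def)
 qed
 show "finite {f. ALL i. (i \<in> {..<n} --> f i \<in> {..n}) & (i ~: {..<n} --> f i = (0::nat))}"
  by (rule finite_set_of_finite_funs) auto
qed

lemma add_box_diagrams:
 assumes "f \<in> diagrams n" "i <= n" "addable f i"
 shows "add_box f i \<in> diagrams (Suc n)"
proof -
 have f: "antimono f" "!!i. i >= n ==> f i = 0" "sum f {..<n} = n" using assms by (auto simp: diagrams_def)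
 have "sum (add_box f i) {..<Suc n} = Suc (f i) + sum f ({..<Suc n} - {i})"
  using assms(2) by (subst sum.remove[of _ i]) auto
 also have "... = Suc (sum f {..<Suc n})" using assms(2) by (subst sum.remove[of "{..<Suc n}" i f]) auto
 finally have "sum (add_box f i) {..<Suc n} = Suc n" using f by simp
 then show ?thesis using antimono_add_box[OF f(1) assms(3)] f(2) assms(2) unfolding diagrams_def by auto
qed

lemma remove_box_diagrams:
 assumes f': "f \<in> diagrams (Suc n)" and i: "i <= n" "f (Suc i) < f i"
 shows "f(i := f i - 1) \<in> diagrams n" "addable (f(i := f i - 1)) i"
proof -
 let ?g = "f(i := f i - 1)"
 have f: "antimono f" "!!i. i >= Suc n ==> f i = 0" "sum f {..<Suc n} = Suc n"
  using f' by (auto simp: diagrams_def)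
 have "f i <= f (i - 1)" using f(1) by (simp add: antimono_def)
 then show "addable ?g i" using i by (auto simp: addable_def)
 have anti: "antimono ?g"
 proof (rule antimonoI)
  fix j k :: nat assume "j <= k"
  have "f k <= f j" using f(1) \<open>j <= k\<close> by (simp add: antimono_def)
  moreover have "f k <= f (Suc i)" if "i < k" using f(1) that by (simp add: antimono_def)
  ultimately show "?g k <= ?g j" using \<open>j <= k\<close> i by (cases "j = i"; cases "k = i") auto
 qed
 have "sum f {..<Suc n} = f i + sum f ({..<Suc n} - {i})" by (rule sum.remove) (use i in auto)
 moreover have "sum ?g {..<Suc n} = (f i - 1) + sum f ({..<Suc n} - {i})"
  using i by (subst sum.remove[of _ i]) auto
 ultimately have s: "sum ?g {..<Suc n} = n" using f(3) i by simp
 \<comment> \<open>Otherwise the rows 0 to \<open>n\<close> would all be nonempty and hold at least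
   n + 1 boxes.\<close>
 have gn: "?g n = 0"
 proof (rule ccontr)
  assume "?g n ~= 0"
  then have "1 <= ?g j" if "j <= n" for j using anti that unfolding antimono_def
   by (metis One_nat_def Suc_leI gr0I le_trans)
  then have "sum (%_. 1) {..<Suc n} <= sum ?g {..<Suc n}" by (intro sum_mono) auto
  then show False using s by simp
 qed
 then have "ALL k>=n. ?g k = 0" using anti unfolding antimono_def by (metis le_zero_eq)
 moreover have "sum ?g {..<n} = n" using s gn by simp
 ultimately show "?g \<in> diagrams n" using anti unfolding diagrams_def by blast
qed

text \<open>Pairs (diagram, row to be enlarged) are reindexed by (enlarged diagram, row to be
  shortened). By detailed balance the measure on n boxes times up weights becomes the measure on n +
  1 boxes times down weights divided by -(a b) (n + 1), and these sum to 1.\<close>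

lemma jp_sum_Suc:
 fixes F :: "(nat => nat) => 'b::real_vector"
 assumes ab: "a > 0" "b < 0"
 shows "jp_sum a b (Suc n) F = jp_sum a b n (%f. \<Sum>i\<le>n. up_weight a b (Suc n) f i *\<^sub>R F (add_box f i))"
proof -
 let ?N = "Suc n" and ?h = "- (a * b)"
 let ?S = "SIGMA f:diagrams n. {i. i <= n & addable f i}"
 let ?T = "SIGMA f:diagrams ?N. {i. i <= n & f (Suc i) < f i}"
 have h: "?h > 0" using ab by (simp add: mult_pos_neg)
 have D: "antimono f" "!!i. i >= m ==> f i = 0" if "f \<in> diagrams m" for f m
  using that by (auto simp: diagrams_def)
 have "jp_sum a b n (%f. \<Sum>i\<le>n. up_weight a b ?N f i *\<^sub>R F (add_box f i))
   = (\<Sum>f\<in>diagrams n. \<Sum>i | i <= n & addable f i. (jp_weight a b n f * up_weight a b ?N f i) *\<^sub>R F (add_box f i))"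
  unfolding jp_sum_def scaleR_sum_right scaleR_scaleR
  by (intro sum.cong refl sum.mono_neutral_right) (auto simp: up_weight_eq_0 D)
 also have "... = (\<Sum>(f, i)\<in>?S. (jp_weight a b n f * up_weight a b ?N f i) *\<^sub>R F (add_box f i))"
  by (rule sum.Sigma) (auto simp: finite_diagrams)
 also have "... = (\<Sum>(f, i)\<in>?T. (jp_weight a b ?N f * down_weight a b ?N f i / (?h * ?N)) *\<^sub>R F f)"
 proof (rule sum.reindex_bij_witness[of _ "%(f, i). (f(i := f i - 1), i)" "%(f, i). (add_box f i, i)"])
  fix z assume z: "z \<in> ?S"
  then obtain f i where fi: "z = (f, i)" "f \<in> diagrams n" "i <= n" "addable f i" by auto
  note f = D[OF fi(2)]
  have "f (Suc i) <= f i" using f(1) by (simp add: antimono_def)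
  then show "(case z of (f, i) => (add_box f i, i)) \<in> ?T"
   using fi add_box_diagrams[of f n i] by (auto simp: fi(1))
  have N: "!!i. i >= ?N ==> f i = 0" using f(2) by simp
  have iN: "i < ?N" using fi by simp
  note ud = up_down[OF ab f(1) N fi(4) iN]
  have pos: "hooks a b n f > 0" "hooks a b ?N (add_box f i) > 0"
   using hooks_pos[OF ab f, of n] hooks_pos[OF ab antimono_add_box[OF f(1) fi(4)], of ?N ?N] N iN by auto
  have hN: "hooks a b ?N f = hooks a b n f" using hooks_N[of n f ?N a b] f(2) by simp
  have "jp_weight a b n f * up_weight a b ?N f i
    = ?h ^ n * fact n / hooks a b n f * (hooks a b n f * down_weight a b ?N (add_box f i) i / hooks a b ?N (add_box f i))"
   using ud pos unfolding jp_weight_def hN by (simp add: field_simps)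
  also have "... = ?h ^ n * fact n * down_weight a b ?N (add_box f i) i / hooks a b ?N (add_box f i)"
   using pos by simp
  also have "... = jp_weight a b ?N (add_box f i) * down_weight a b ?N (add_box f i) i / (?h * ?N)"
  proof -
   have "?h ^ ?N * fact ?N = (?h * ?N) * (?h ^ n * fact n)" by simp
   then have "jp_weight a b ?N (add_box f i) = (?h * ?N) * (?h ^ n * fact n / hooks a b ?N (add_box f i))"
    unfolding jp_weight_def by simp
   then show ?thesis using ab by simp
  qed
  finally show "(case case z of (f, i) => (add_box f i, i) of (f, i) =>
    (jp_weight a b ?N f * down_weight a b ?N f i / (?h * ?N)) *\<^sub>R F f)
   = (case z of (f, i) => (jp_weight a b n f * up_weight a b ?N f i) *\<^sub>R F (add_box f i))" by (simp add: fi(1))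
 next
  fix z assume z: "z \<in> ?T"
  then obtain f i where fi: "z = (f, i)" "f \<in> diagrams ?N" "i <= n" "f (Suc i) < f i" by auto
  show "(case z of (f, i) => (f(i := f i - 1), i)) \<in> ?S"
   using remove_box_diagrams[OF fi(2-4)] fi by auto
  show "(case case z of (f, i) => (f(i := f i - 1), i) of (f, i) => (add_box f i, i)) = z"
   using fi by auto
 qed auto
 also have "... = (\<Sum>f\<in>diagrams ?N. \<Sum>i | i <= n & f (Suc i) < f i.
   (jp_weight a b ?N f * down_weight a b ?N f i / (?h * ?N)) *\<^sub>R F f)"
  by (rule sum.Sigma[symmetric]) (auto simp: finite_diagrams)
 also have "... = (\<Sum>f\<in>diagrams ?N. \<Sum>i<?N. (jp_weight a b ?N f * down_weight a b ?N f i / (?h * ?N)) *\<^sub>R F f)"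
 proof (rule sum.cong[OF refl], rule sum.mono_neutral_left; (intro ballI)?)
  fix f i assume "f \<in> diagrams ?N" "i \<in> {..<?N} - {i. i <= n & f (Suc i) < f i}"
  moreover from this have "f (Suc i) <= f i" using D(1) by (auto simp: antimono_def)
  ultimately have "down_weight a b ?N f i = 0" by (intro down_weight_eq_0) auto
  then show "(jp_weight a b ?N f * down_weight a b ?N f i / (?h * ?N)) *\<^sub>R F f = 0" by simp
 qed auto
 also have "... = jp_sum a b ?N F"
  unfolding jp_sum_def
 proof (intro sum.cong refl)
  fix f assume f: "f \<in> diagrams ?N"
  have "(\<Sum>i<?N. jp_weight a b ?N f * down_weight a b ?N f i / (?h * ?N))
    = jp_weight a b ?N f * (\<Sum>i<?N. down_weight a b ?N f i) / (?h * ?N)"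
   by (simp only: sum_distrib_left sum_divide_distrib)
  also have "... = jp_weight a b ?N f" unfolding down_weight_sum[OF ab f order_refl] using ab by simp
  finally show "(\<Sum>i<?N. (jp_weight a b ?N f * down_weight a b ?N f i / (?h * ?N)) *\<^sub>R F f) = jp_weight a b ?N f *\<^sub>R F f"
   unfolding scaleR_sum_left[symmetric] by simp
 qed
 finally show ?thesis by simp
qed

lemma diagrams_0: "diagrams 0 = {%_. 0}"
 by (auto simp: diagrams_def antimono_def)

lemma jp_sum_0: "jp_sum a b 0 F = F (%_. 0)"
 by (simp add: jp_sum_def diagrams_0 jp_weight_def hooks_def)

lemma jp_weight_pos: "a > 0 ==> b < 0 ==> f \<in> diagrams n ==> jp_weight a b n f > 0"
 using hooks_pos[of a b f n n] unfolding jp_weight_def diagrams_def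
 by (intro divide_pos_pos mult_pos_pos zero_less_power) (auto simp: mult_pos_neg)

section \<open>The limit shape along the growth\<close>

text \<open>\<open>wv t e j\<close> is the first column of \<open>L^j\<close> for \<open>L = t A + B + e D\<close> with \<open>A\<close>, \<open>B\<close> the lowering and raising shifts
 and \<open>D\<close> the number operator; this \<open>L\<close> is conjugate to the Lax matrix with the single coefficient \<open>V\<^sub>1 = \<surd>t\<close>.\<close>

fun wv :: "real => real => nat => nat => real" where
 "wv t e 0 k = (if k = 0 then 1 else 0)"
| "wv t e (Suc j) k = t * wv t e j (Suc k) + (if k = 0 then 0 else wv t e j (k - 1)) + e * real k * wv t e j k"

definition hv :: "real => real => nat => real" where
 "hv t e j = wv t e j 0"

definition ov :: "real => real => nat => real" where
 "ov t e = pow_of_hom (hv t e)"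

text \<open>First column of ((L + e)^n - L^n) / e, expanded so that e = 0 makes sense.\<close>

definition rv :: "real => real => nat => nat => real" where
 "rv t e n k = (\<Sum>l<n. real (n choose l) * e ^ (n - l - 1) * wv t e l k)"

lemma hv_0 [simp]: "hv t e 0 = 1" by (simp add: hv_def)

lemma newton_ov: "newton (hv t e) (ov t e)"
 unfolding ov_def by (rule newton_pow_of_hom) simp

lemma rv_Suc:
 "rv t e (Suc n) k = t * rv t e n (Suc k) + (if k = 0 then 0 else rv t e n (k - 1)) + e * real k * rv t e n k
   + e * rv t e n k + wv t e n k"
proof -
 have L: "t * rv t e n (Suc k) + (if k = 0 then 0 else rv t e n (k - 1)) + e * real k * rv t e n k
   = (\<Sum>l<n. real (n choose l) * e ^ (n - l - 1) * wv t e (Suc l) k)"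
  by (simp add: rv_def sum.distrib[symmetric] sum_distrib_left algebra_simps)
 define g where "g l = wv t e l k" for l
 have 1: "(\<Sum>l<n. real (n choose l) * e ^ (n - l - 1) * g (Suc l)) + g n
   = (\<Sum>l\<le>n. (if l = 0 then 0 else real (n choose (l - 1)) * e ^ (n - l) * g l)) + g n"
  unfolding lessThan_Suc_atMost[symmetric] sum.lessThan_Suc_shift by (auto intro!: sum.cong)
 have 2: "e * rv t e n k = (\<Sum>l<n. real (n choose l) * e ^ (n - l) * g l)"
  unfolding rv_def sum_distrib_left g_def
 proof (rule sum.cong[OF refl])
  fix l assume "l \<in> {..<n}"
  then have "n - l = Suc (n - l - 1)" by auto
  then have "e ^ (n - l) = e * e ^ (n - l - 1)" by (metis power_Suc)
  then show "e * (real (n choose l) * e ^ (n - l - 1) * wv t e l k) = real (n choose l) * e ^ (n - l) * wv t e l k"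
   by simp
 qed
 have "rv t e (Suc n) k = (\<Sum>l\<le>n. real (Suc n choose l) * e ^ (n - l) * g l)"
  by (simp add: rv_def lessThan_Suc_atMost g_def)
 also have "... = (\<Sum>l\<le>n. (if l = 0 then 0 else real (n choose (l - 1)) * e ^ (n - l) * g l)
   + real (n choose l) * e ^ (n - l) * g l)"
 proof (rule sum.cong[OF refl])
  fix l show "real (Suc n choose l) * e ^ (n - l) * g l
   = (if l = 0 then 0 else real (n choose (l - 1)) * e ^ (n - l) * g l) + real (n choose l) * e ^ (n - l) * g l"
   by (cases l) (auto simp: algebra_simps)
 qed
 also have "... = (\<Sum>l<n. real (n choose l) * e ^ (n - l - 1) * g (Suc l)) + e * rv t e n k + g n"
  unfolding sum.distrib 2 using 1 by (simp add: lessThan_Suc_atMost[symmetric])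
 finally show ?thesis unfolding L g_def by simp
qed

text \<open>With \<open>R\<close> the generating series of \<open>hv\<close>, that of \<open>wv\<close> in column \<open>k\<close> is \<open>R(u) R(u - e) ... R(u - k e)\<close>.\<close>

lemma wv_shift: "wv t e j (Suc k) = (\<Sum>a<j. hv t e a * (wv t e (j - 1 - a) k + e * rv t e (j - 1 - a) k))"
proof (induction j arbitrary: k)
 case (Suc j)
 \<comment> \<open>\<open>s n\<close> is the first column of (L + e)^n. Deleting row and column 0 of
   L and renumbering gives L + e, so the claim splits a path at its last visit to 0.\<close>
 define s where "s n k = wv t e n k + e * rv t e n k" for n k
 define F where "F k = (\<Sum>a<j. hv t e a * s (j - 1 - a) k)" for k
 have s: "s (Suc n) k = t * s n (Suc k) + (if k = 0 then 0 else s n (k - 1)) + e * real k * s n k + e * s n k" for n k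
  unfolding s_def rv_Suc by (simp add: algebra_simps)
 have "(\<Sum>a<Suc j. hv t e a * s (Suc j - 1 - a) k) = (\<Sum>a<j. hv t e a * s (Suc (j - 1 - a)) k) + hv t e j * s 0 k"
  by (simp add: Suc_diff_Suc)
 also have "... = t * F (Suc k) + (if k = 0 then 0 else F (k - 1)) + e * real k * F k + e * F k + hv t e j * s 0 k"
  unfolding F_def s by (simp add: distrib_left sum.distrib sum_distrib_left mult_ac)
 also have "... = wv t e (Suc j) (Suc k)"
  using Suc.IH[folded s_def] by (cases k) (auto simp: F_def s_def rv_def hv_def algebra_simps)
 finally show ?case by (simp add: s_def)
qed simp

text \<open>Differentiating the recursion produces the extra term \<open>wv t e j (Suc k)\<close>;
  by \<open>wv_shift\<close> it is a sum, weighted by \<open>hv\<close>, of exactly the terms by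
  which \<open>rv_Suc\<close> differs from L applied to \<open>rv\<close>.\<close>

lemma wv_deriv: "((%t. wv t e j k) has_real_derivative (\<Sum>a<j. hv t e a * rv t e (j - 1 - a) k)) (at t)"
proof (induction j arbitrary: k)
 case (Suc j)
 define F where "F k = (\<Sum>a<j. hv t e a * rv t e (j - 1 - a) k)" for k
 have "((%t. wv t e (Suc j) k) has_real_derivative
   wv t e j (Suc k) + t * F (Suc k) + (if k = 0 then 0 else F (k - 1)) + e * real k * F k) (at t)"
  using Suc.IH unfolding F_def[symmetric] by (cases k) (auto intro!: derivative_eq_intros)
 moreover have "(\<Sum>a<Suc j. hv t e a * rv t e (Suc j - 1 - a) k)
   = wv t e j (Suc k) + t * F (Suc k) + (if k = 0 then 0 else F (k - 1)) + e * real k * F k"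
 proof -
  have "(\<Sum>a<Suc j. hv t e a * rv t e (Suc j - 1 - a) k) = (\<Sum>a<j. hv t e a * rv t e (Suc (j - 1 - a)) k)"
   by (simp add: Suc_diff_Suc rv_def[of t e 0])
  then show ?thesis unfolding rv_Suc wv_shift F_def
   by (simp add: distrib_left sum.distrib sum_distrib_left mult_ac)
 qed
 ultimately show ?case by simp
qed simp

lemma hv_deriv:
 "((%t. hv t e j) has_real_derivative (\<Sum>a<j. rv t e (j - 1 - a) 0 * hv t e a)) (at t)"
 using wv_deriv[of e j 0 t] by (simp add: hv_def mult.commute)

section \<open>Increments of the power sums when a box is added\<close>

fun pw :: "real => real => nat => real" where
 "pw e h 0 = 2"
| "pw e h (Suc 0) = e"
| "pw e h (Suc (Suc m)) = e * pw e h (Suc m) + h * pw e h m"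

text \<open>With a + b = e and -(a b) = h, \<open>pw\<close> is a^m + b^m and \<open>nu\<close> is
  (a^m + b^m - 0^m - (a + b)^m) / h. The recursions exhibit both as polynomials in e and h, so
  nothing is divided when h tends to 0.\<close>

fun nu :: "real => real => nat => real" where
 "nu e h 0 = 0"
| "nu e h (Suc 0) = 0"
| "nu e h (Suc (Suc m)) = e * nu e h (Suc m) + pw e h m"

definition bcoef :: "real => real => nat => nat => real" where
 "bcoef e h p j = real (p choose j) * nu e h (p - j)"

lemma pw_eq: "a ^ m + b ^ m = pw (a + b) (- (a * b)) m"
proof (induction "a + b" "- (a * b)" m rule: pw.induct)
 case (3 m)
 have "a ^ Suc (Suc m) + b ^ Suc (Suc m) = (a + b) * (a ^ Suc m + b ^ Suc m) + - (a * b) * (a ^ m + b ^ m)"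
  by (simp add: algebra_simps)
 also have "... = pw (a + b) (- (a * b)) (Suc (Suc m))" by (simp only: 3 pw.simps)
 finally show ?case .
qed auto

lemma nu_eq: "a ^ m + b ^ m - 0 ^ m - (a + b) ^ m = - (a * b) * nu (a + b) (- (a * b)) m"
proof (induction "a + b" "- (a * b)" m rule: nu.induct)
 case (3 m)
 have "a ^ Suc (Suc m) + b ^ Suc (Suc m) - (a + b) ^ Suc (Suc m)
   = (a + b) * (a ^ Suc m + b ^ Suc m - 0 ^ Suc m - (a + b) ^ Suc m) - (a * b) * (a ^ m + b ^ m)"
  by (simp add: algebra_simps)
 also have "... = (a + b) * (- (a * b) * nu (a + b) (- (a * b)) (Suc m)) - (a * b) * pw (a + b) (- (a * b)) m"
  unfolding 3 unfolding pw_eq ..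
 also have "... = - (a * b) * nu (a + b) (- (a * b)) (Suc (Suc m))" by (simp add: algebra_simps)
 finally show ?case by simp
qed auto

lemma box_pow_eq: "box_pow a b p c = - (a * b) * (\<Sum>j\<le>p. bcoef (a + b) (- (a * b)) p j * c ^ j)"
proof -
 have "c ^ p = (c + 0) ^ p" by simp
 then have "box_pow a b p c = (\<Sum>j\<le>p. real (p choose j) * c ^ j * (a ^ (p - j) + b ^ (p - j) - 0 ^ (p - j) - (a + b) ^ (p - j)))"
  unfolding box_pow_def add.assoc[of c a b]
  by (simp only: binomial_ring sum.distrib[symmetric] sum_subtractf[symmetric] distrib_left right_diff_distrib)
 also have "... = - (a * b) * (\<Sum>j\<le>p. bcoef (a + b) (- (a * b)) p j * c ^ j)"
  unfolding nu_eq sum_distrib_left bcoef_def by (intro sum.cong) auto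
 finally show ?thesis .
qed

lemma pw_h0: "pw e 0 (Suc m) = e ^ Suc m"
 by (induction m) auto

lemma nu_h0: "nu e 0 (Suc (Suc m)) = real (Suc (Suc m)) * e ^ m"
 by (induction m) (auto simp: pw_h0 algebra_simps)

lemma bcoef_eq_0: "p <= Suc j ==> bcoef e h p j = 0"
proof -
 assume "p <= Suc j"
 then have "p - j = 0 | p - j = Suc 0" by linarith
 then show ?thesis by (auto simp: bcoef_def)
qed

text \<open>At h = 0 the increment polynomial is p ((c + e)^(p - 1) - c^(p - 1)) / e, the same shape
  as in \<open>rv\<close>.\<close>

lemma bcoef_sum:
 assumes p: "p >= 1"
 shows "(\<Sum>j\<le>p. bcoef e 0 p j * g j) = real p * (\<Sum>l<p - 1. real (p - 1 choose l) * e ^ (p - 1 - l - 1) * g l)"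
proof -
 have "(\<Sum>j\<le>p. bcoef e 0 p j * g j) = (\<Sum>l<p - 1. bcoef e 0 p l * g l)"
  by (rule sum.mono_neutral_right) (auto simp: bcoef_eq_0)
 also have "... = (\<Sum>l<p - 1. real p * (real (p - 1 choose l) * e ^ (p - 1 - l - 1) * g l))"
 proof (rule sum.cong[OF refl])
  fix l assume l: "l \<in> {..<p - 1}"
  then obtain m where m: "p - l = Suc (Suc m)" by (metis Suc_diff_Suc less_diff_conv add.commute lessThan_iff less_imp_Suc_add plus_1_eq_Suc diff_add_inverse2 add_Suc_right)
  have "p * (p - 1 choose l) = (p - l) * (p choose l)"
   using binomial_absorb_comp[of p l] by simp
  then have "real (p * (p - 1 choose l)) * e ^ m = real (p choose l) * nu e 0 (p - l)"
   unfolding m nu_h0 by (simp only: of_nat_mult mult.assoc mult.left_commute)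
  moreover have "p - 1 - l - 1 = m" using m by simp
  ultimately show "bcoef e 0 p l * g l = real p * (real (p - 1 choose l) * e ^ (p - 1 - l - 1) * g l)"
   by (simp add: bcoef_def)
 qed
 finally show ?thesis by (simp only: sum_distrib_left)
qed

text \<open>The deterministic evolution: the limiting moments move at the rate of the mean
  increment. By \<open>hv_deriv\<close> the logarithmic derivative in t of the series of
  \<open>hv\<close> has the coefficients \<open>rv\<close>, shifted by one.\<close>

lemma ov_deriv:
 assumes p: "p >= 1"
 shows "((%t. ov t e p) has_real_derivative (\<Sum>j\<le>p. bcoef e 0 p j * hv t e j)) (at t)"
proof -
 define R where "R = Abs_fps (%k. if k = 0 then 0 else rv t e (k - 1) 0)"
 have "((%t. ov t e p) has_real_derivative real p * R $ p) (at t)"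
 proof (rule newton_deriv[OF newton_ov hv_deriv _ p])
  show "Abs_fps (%j. \<Sum>a<j. rv t e (j - 1 - a) 0 * hv t e a) = Abs_fps (hv t e) * R"
  proof (rule fps_ext)
   fix n
   have "(\<Sum>a<n. rv t e (n - 1 - a) 0 * hv t e a) = (\<Sum>i=0..n. hv t e i * R $ (n - i))"
    by (rule sum.mono_neutral_cong_left) (auto simp: R_def)
   then show "Abs_fps (%j. \<Sum>a<j. rv t e (j - 1 - a) 0 * hv t e a) $ n = (Abs_fps (hv t e) * R) $ n"
    by (simp add: fps_mult_nth)
  qed
 qed
 then show ?thesis using p by (simp add: bcoef_sum R_def rv_def hv_def)
qed

section \<open>Continuity and uniform estimates in time and parameter\<close>

lemma continuous_on_pow_of_hom:
 fixes h :: "'x::topological_space => nat => real"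
 assumes "!!j. continuous_on S (%z. h z j)"
 shows "continuous_on S (%z. pow_of_hom (h z) p)"
proof (induction p rule: less_induct)
 case (less p)
 show ?case unfolding pow_of_hom.simps[of _ p] by (intro continuous_intros assms less) auto
qed

lemma continuous_on_wv: "continuous_on UNIV (%z. wv (fst z) (snd z) j k)"
proof (induction j arbitrary: k)
 case (Suc j)
 then show ?case by (cases k) (auto intro!: continuous_intros)
qed simp

lemma continuous_on_hv: "continuous_on UNIV (%z. hv (fst z) (snd z) j)"
 unfolding hv_def by (rule continuous_on_wv)

lemma continuous_on_ov: "continuous_on UNIV (%z. ov (fst z) (snd z) p)"
 unfolding ov_def by (rule continuous_on_pow_of_hom) (rule continuous_on_hv)

lemma continuous_on_rv: "continuous_on UNIV (%z. rv (fst z) (snd z) n k)"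
 unfolding rv_def by (intro continuous_intros continuous_on_wv)

lemma continuous_on_pw: "continuous_on UNIV (%z. pw (fst z) (snd z) m)"
proof -
 have "continuous_on UNIV (%z. pw (fst z) (snd z) m) & continuous_on UNIV (%z. pw (fst z) (snd z) (Suc m))"
  by (induction m) (auto intro!: continuous_intros)
 then show ?thesis ..
qed

lemma continuous_on_nu: "continuous_on UNIV (%z. nu (fst z) (snd z) m)"
proof -
 have "continuous_on UNIV (%z. nu (fst z) (snd z) m) & continuous_on UNIV (%z. nu (fst z) (snd z) (Suc m))"
  by (induction m) (auto intro!: continuous_intros continuous_on_pw)
 then show ?thesis ..
qed

lemma continuous_on_bcoef: "continuous_on UNIV (%z. bcoef (fst z) (snd z) p j)"
 unfolding bcoef_def by (intro continuous_intros continuous_on_nu)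

lemma bounded_on_box:
 fixes F :: "real \<times> real => real"
 assumes "continuous_on UNIV F"
 shows "EX C. ALL t e. t \<in> {0..1} --> \<bar>e\<bar> <= M --> \<bar>F (t, e)\<bar> <= C"
proof -
 have "compact (F ` ({0..1} \<times> {-M..M}))"
  by (intro compact_continuous_image compact_Times compact_Icc continuous_on_subset[OF assms]) auto
 then obtain C where "ALL x:F ` ({0..1} \<times> {-M..M}). \<bar>x\<bar> <= C"
  using compact_imp_bounded bounded_real by metis
 then show ?thesis by (intro exI[of _ C]) (auto simp: abs_le_iff)
qed

text \<open>The difference is h times a continuous function of (h, e), found by running the
  recursions; compactness gives the constant.\<close>

lemma nu_lipschitz_h: "EX C. ALL h e. h \<in> {0..1} --> \<bar>e\<bar> <= M --> \<bar>nu e h m - nu e 0 m\<bar> <= C * h"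
proof -
 have P: "EX F. continuous_on UNIV F & (ALL e h. pw e h m - pw e 0 m = h * F (h, e))" for m
 proof (induction m rule: less_induct)
  case (less m)
  consider "m = 0" | "m = Suc 0" | n where "m = Suc (Suc n)" by (metis not0_implies_Suc)
  then show ?case
  proof cases
   case 3
   obtain F where F: "continuous_on UNIV F" "!!e h. pw e h (Suc n) - pw e 0 (Suc n) = h * F (h, e)"
    using less[of "Suc n"] 3 by auto
   have "continuous_on UNIV (%z. pw (snd z) (fst z) n)"
   proof -
    have "continuous_on UNIV (%z :: real \<times> real. (snd z, fst z))" by (intro continuous_intros)
    from continuous_on_compose2[OF continuous_on_pw[of n] this] show ?thesis by simp
   qed
   moreover have "pw e h m - pw e 0 m = h * (e * F (h, e) + pw e h n)" for e h
   proof -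
    have "pw e h m - pw e 0 m = e * (pw e h (Suc n) - pw e 0 (Suc n)) + h * pw e h n"
     unfolding 3 by (simp add: right_diff_distrib)
    then show ?thesis unfolding F(2) by (simp add: algebra_simps)
   qed
   ultimately show ?thesis using F(1)
    by (intro exI[of _ "%z. snd z * F z + pw (snd z) (fst z) n"]) (auto intro!: continuous_intros)
  qed (auto intro!: exI[of _ "%_. 0"])
 qed
 have "EX F. continuous_on UNIV F & (ALL e h. nu e h m - nu e 0 m = h * F (h, e))" for m
 proof (induction m rule: less_induct)
  case (less m)
  consider "m = 0" | "m = Suc 0" | n where "m = Suc (Suc n)" by (metis not0_implies_Suc)
  then show ?case
  proof cases
   case 3
   obtain F where F: "continuous_on UNIV F" "!!e h. nu e h (Suc n) - nu e 0 (Suc n) = h * F (h, e)"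
    using less[of "Suc n"] 3 by auto
   obtain G where G: "continuous_on UNIV G" "!!e h. pw e h n - pw e 0 n = h * G (h, e)"
    using P[of n] by blast
   have "nu e h m - nu e 0 m = h * (e * F (h, e) + G (h, e))" for e h
   proof -
    have "nu e h m - nu e 0 m = e * (nu e h (Suc n) - nu e 0 (Suc n)) + (pw e h n - pw e 0 n)"
     unfolding 3 by (simp add: right_diff_distrib)
    then show ?thesis unfolding F(2) G(2) by (simp add: algebra_simps)
   qed
   then show ?thesis using F(1) G(1)
    by (intro exI[of _ "%z. snd z * F z + G z"]) (auto intro!: continuous_intros)
  qed (auto intro!: exI[of _ "%_. 0"])
 qed
 then obtain F where F: "continuous_on UNIV F" "!!e h. nu e h m - nu e 0 m = h * F (h, e)" by blast
 obtain C where C: "!!h e. h \<in> {0..1} ==> \<bar>e\<bar> <= M ==> \<bar>F (h, e)\<bar> <= C"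
  using bounded_on_box[OF F(1), of M] by blast
 show ?thesis unfolding F(2)
  by (intro exI[of _ C]) (auto simp: abs_mult mult.commute[of C] intro!: mult_left_mono C)
qed

text \<open>The mean value theorem is applied twice; the second derivative \<open>b'\<close> is
  continuous in (t, e), hence bounded for t in [0, 1] and bounded e.\<close>

lemma ov_taylor:
 assumes p: "p >= 1"
 shows "EX C. ALL t u e. t \<in> {0..1} --> u \<in> {0..1} --> t < u --> \<bar>e\<bar> <= M -->
   \<bar>ov u e p - ov t e p - (u - t) * (\<Sum>j\<le>p. bcoef e 0 p j * hv t e j)\<bar> <= C * (u - t)^2"
proof -
 define b where "b t e = (\<Sum>j\<le>p. bcoef e 0 p j * hv t e j)" for t e
 define b' where "b' t e = (\<Sum>j\<le>p. bcoef e 0 p j * (\<Sum>a<j. rv t e (j - 1 - a) 0 * hv t e a))" for t e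
 have bb: "((%t. b t e) has_real_derivative b' t e) (at t)" for t e
  unfolding b_def b'_def by (intro DERIV_sum DERIV_cmult hv_deriv)
 have "continuous_on UNIV (%z :: real \<times> real. bcoef (snd z) 0 p j)" for j
 proof -
  have "continuous_on UNIV (%z :: real \<times> real. (snd z, 0 :: real))" by (intro continuous_intros)
  from continuous_on_compose2[OF continuous_on_bcoef[of p j] this] show ?thesis by simp
 qed
 then have "continuous_on UNIV (%z. b' (fst z) (snd z))"
  unfolding b'_def by (intro continuous_intros continuous_on_rv continuous_on_hv) auto
 from bounded_on_box[OF this, of M] obtain C where
  C: "!!t e. t \<in> {0..1} ==> \<bar>e\<bar> <= M ==> \<bar>b' t e\<bar> <= C" by auto
 have "\<bar>ov u e p - ov t e p - (u - t) * b t e\<bar> <= C * (u - t)^2"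
  if tu: "t \<in> {0..1}" "u \<in> {0..1}" "t < u" and e: "\<bar>e\<bar> <= M" for t u e
 proof -
  obtain z where z: "t < z" "z < u" "ov u e p - ov t e p = (u - t) * b z e"
   using MVT2[OF tu(3), of "%t. ov t e p" "%t. b t e"] ov_deriv[OF p] unfolding b_def by blast
  obtain y where y: "t < y" "y < z" "b z e - b t e = (z - t) * b' y e"
   using MVT2[OF z(1), of "%t. b t e" "%t. b' t e"] bb by blast
  have "ov u e p - ov t e p - (u - t) * b t e = (u - t) * (b z e - b t e)"
   unfolding z(3) by (simp only: right_diff_distrib)
  also have "... = (u - t) * (z - t) * b' y e" unfolding y(3) by simp
  finally have "ov u e p - ov t e p - (u - t) * b t e = (u - t) * (z - t) * b' y e" .
  moreover have "\<bar>(u - t) * (z - t) * b' y e\<bar> <= (u - t) * (u - t) * C"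
   unfolding abs_mult using y z tu e by (intro mult_mono C) auto
  ultimately show ?thesis by (simp add: power2_eq_square mult.commute)
 qed
 then show ?thesis unfolding b_def by blast
qed

section \<open>Moments of the fluctuations\<close>

text \<open>Only a bound on the parameters is assumed: all moment estimates are uniform in
  \<open>ed d\<close>, and convergence of \<open>ed\<close> matters only for the limit law.\<close>

locale jp_chain =
 fixes ed :: "nat => real" and M :: real
 assumes ed_bound: "!!d. d >= 1 ==> \<bar>ed d\<bar> <= M"
begin

definition ad :: "nat => real" where "ad d = eps1 (ed d) (1 / real d)"
definition bd :: "nat => real" where "bd d = eps2 (ed d) (1 / real d)"
definition ep :: "nat => real" where "ep d = 1 / sqrt (real d)"

lemma ab: "d >= 1 ==> ad d > 0" "d >= 1 ==> bd d < 0" "d >= 1 ==> ad d + bd d = ed d"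
 "d >= 1 ==> - (ad d * bd d) = 1 / real d"
 using eps_unique[of "1 / real d" "bd d" "ad d" "ed d"] by (auto simp: ad_def bd_def)

lemma ep: "d >= 1 ==> ep d > 0" "ep d >= 0" "d >= 1 ==> ep d <= 1" "ep d * ep d = 1 / real d"
 "d >= 1 ==> ep d * sqrt (real d) = 1"
 by (auto simp: ep_def)

text \<open>The parameters are those of size \<open>d\<close> throughout, while \<open>n\<close> is
  the number of boxes so far and n / d the time.\<close>

definition EE :: "nat => nat => ((nat => nat) => 'b::real_vector) => 'b" where
 "EE d n F = jp_sum (ad d) (bd d) n F"

text \<open>Conditional expectation, given \<open>f\<close>, over the position of the next
  box.\<close>

definition TT :: "nat => nat => (nat => nat) => (real => 'b::real_vector) => 'b" where
 "TT d n f F = (\<Sum>i\<le>n. up_weight (ad d) (bd d) (Suc n) f i *\<^sub>R F (xc (ad d) (bd d) f i))"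

definition Om :: "nat => (nat => nat) => nat => real" where
 "Om d f p = shape_moment (ad d) (bd d) f p"

definition Y :: "nat => nat => nat => (nat => nat) => real" where
 "Y d n p f = (Om d f p - ov (real n / real d) (ed d) p) * sqrt (real d)"

definition hh :: "nat => nat => nat => real" where
 "hh d n j = hv (real n / real d) (ed d) j"

definition bc :: "nat => nat => nat => real" where
 "bc d p j = bcoef (ed d) (1 / real d) p j"

text \<open>\<open>Y (Suc n) p\<close> is \<open>Y n p + ep * D n p x\<close> if a box is added at \<open>x\<close>.\<close>

definition D :: "nat => nat => nat => real => real" where
 "D d n p x = (\<Sum>j\<le>p. bc d p j * x ^ j)
   - real d * (ov (real (Suc n) / real d) (ed d) p - ov (real n / real d) (ed d) p)"

lemma Om_Y: "d >= 1 ==> Om d f p = ov (real n / real d) (ed d) p + ep d * Y d n p f"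
 by (simp add: Y_def ep_def)

lemma diagramsD:
 assumes "f \<in> diagrams n"
 shows "antimono f" "!!i. i >= n ==> f i = 0" "!!i. i >= Suc n ==> f i = 0"
 using assms by (auto simp: diagrams_def)

lemma TT_pow:
 assumes "d >= 1" "f \<in> diagrams n"
 shows "TT d n f (%x. x ^ k) = hom_of_pow (Om d f) k"
proof -
 \<comment> \<open>No box fits into row n + 1 (counted from 0), so including it completes the range
   of \<open>up_moments\<close> without changing the sum.\<close>
 have "up_weight (ad d) (bd d) (Suc n) f (Suc n) = 0"
  by (rule up_weight_eq_0) (use diagramsD[OF assms(2)] in "auto simp: addable_def")
 then have "TT d n f (%x. x ^ k) = (\<Sum>i\<le>Suc n. up_weight (ad d) (bd d) (Suc n) f i * xc (ad d) (bd d) f i ^ k)"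
  by (simp add: TT_def)
 also have "... = hom_of_pow (Om d f) k" unfolding Om_def
  using up_moments[OF ab(1,2)[OF assms(1)] diagramsD(1)[OF assms(2)], of "Suc n" k]
   diagramsD(3)[OF assms(2)] by simp
 finally show ?thesis .
qed

lemma TT_add: "TT d n f (%x. F x + G x) = TT d n f F + TT d n f G"
 by (simp add: TT_def scaleR_add_right sum.distrib)

lemma TT_cmult: "TT d n f (%x. c * F x) = c * TT d n f F" for c :: real
 by (simp add: TT_def sum_distrib_left mult.left_commute)

lemma TT_sum: "TT d n f (%x. \<Sum>k\<in>K. F k x) = (\<Sum>k\<in>K. TT d n f (F k))"
 unfolding TT_def scaleR_sum_right by (rule sum.swap)

lemma TT_1: "d >= 1 ==> f \<in> diagrams n ==> TT d n f (%x. 1 :: real) = 1"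
 using TT_pow[of d f n 0] by simp

lemma TT_const: "d >= 1 ==> f \<in> diagrams n ==> TT d n f (%x. c) = c"
 using TT_1[of d f n] by (simp add: TT_def scaleR_sum_left[symmetric])

lemma TT_mono:
 assumes "d >= 1" "f \<in> diagrams n" "!!x. F x <= G x"
 shows "TT d n f F <= (TT d n f G :: real)"
 unfolding TT_def
 by (intro sum_mono scaleR_left_mono assms up_weight_nonneg ab) (auto intro: assms diagramsD)

lemma norm_TT_le:
 fixes F :: "real => 'b::real_normed_vector"
 assumes "d >= 1" "f \<in> diagrams n"
 shows "norm (TT d n f F) <= TT d n f (%x. norm (F x))"
 unfolding TT_def
proof (rule order_trans[OF norm_sum], rule sum_mono)
 fix i assume "i \<in> {..n}"
 then have "up_weight (ad d) (bd d) (Suc n) f i >= 0"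
  by (intro up_weight_nonneg ab assms diagramsD(1)[OF assms(2)]) auto
 then show "norm (up_weight (ad d) (bd d) (Suc n) f i *\<^sub>R F (xc (ad d) (bd d) f i))
   <= up_weight (ad d) (bd d) (Suc n) f i *\<^sub>R norm (F (xc (ad d) (bd d) f i))" by simp
qed

lemma EE_Suc:
 assumes "d >= 1" and F: "!!f i. f \<in> diagrams n ==> F (add_box f i) = G f (xc (ad d) (bd d) f i)"
 shows "EE d (Suc n) F = EE d n (%f. TT d n f (G f))"
 unfolding EE_def jp_sum_Suc[OF ab(1,2)[OF assms(1)]]
 unfolding TT_def jp_sum_def
 by (intro sum.cong refl arg_cong[where f = "%x. _ *\<^sub>R x"]) (auto simp: F)

lemma EE_0: "EE d 0 F = F (%_. 0)"
 by (simp add: EE_def jp_sum_0)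

lemma EE_cong: "(!!f. f \<in> diagrams n ==> F f = G f) ==> EE d n F = EE d n G"
 unfolding EE_def jp_sum_def by (intro sum.cong) auto

lemma EE_add: "EE d n (%f. F f + G f) = EE d n F + EE d n G"
 by (simp add: EE_def jp_sum_def scaleR_add_right sum.distrib)

lemma EE_diff: "EE d n (%f. F f - G f) = EE d n F - EE d n G"
 by (simp add: EE_def jp_sum_def scaleR_diff_right sum_subtractf)

lemma EE_cmult: "EE d n (%f. c * F f) = c * EE d n F" for c :: "'b::real_algebra"
 by (simp add: EE_def jp_sum_def sum_distrib_left)

lemma EE_mono:
 assumes "d >= 1" "!!f. f \<in> diagrams n ==> F f <= G f"
 shows "EE d n F <= (EE d n G :: real)"
 unfolding EE_def jp_sum_def
 by (intro sum_mono scaleR_left_mono assms less_imp_le jp_weight_pos ab) (auto intro: assms)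

lemma norm_EE_le:
 fixes F :: "(nat => nat) => 'b::real_normed_vector"
 assumes "d >= 1"
 shows "norm (EE d n F) <= EE d n (%f. norm (F f))"
 unfolding EE_def jp_sum_def
proof (rule order_trans[OF norm_sum], rule sum_mono)
 fix f assume "f \<in> diagrams n"
 then have "jp_weight (ad d) (bd d) n f > 0" by (intro jp_weight_pos ab assms)
 then show "norm (jp_weight (ad d) (bd d) n f *\<^sub>R F f) <= jp_weight (ad d) (bd d) n f *\<^sub>R norm (F f)" by simp
qed

lemma EE_1: "d >= 1 ==> EE d n (%f. 1 :: real) = 1"
proof (induction n)
 case (Suc n)
 have "EE d (Suc n) (%f. 1 :: real) = EE d n (%f. TT d n f (%x. 1 :: real))"
  by (rule EE_Suc) (use Suc in auto)
 also have "... = EE d n (%f. 1 :: real)" by (rule EE_cong) (use Suc in "auto simp: TT_1")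
 finally show ?case using Suc by simp
qed (simp add: EE_0)

lemma Y_Suc:
 assumes "d >= 1" "f \<in> diagrams n"
 shows "Y d (Suc n) p (add_box f i) = Y d n p f + ep d * D d n p (xc (ad d) (bd d) f i)"
proof -
 have "Om d (add_box f i) p = Om d f p + box_pow (ad d) (bd d) p (xc (ad d) (bd d) f i)"
  unfolding Om_def by (rule shape_moment_add_box[OF diagramsD(2)[OF assms(2)]])
 also have "box_pow (ad d) (bd d) p x = 1 / real d * (\<Sum>j\<le>p. bc d p j * x ^ j)" for x
  unfolding box_pow_eq ab(3,4)[OF assms(1)] bc_def ..
 finally have O': "Om d (add_box f i) p = Om d f p + 1 / real d * (\<Sum>j\<le>p. bc d p j * xc (ad d) (bd d) f i ^ j)" .
 have s: "sqrt (real d) * (1 / real d) = ep d" "sqrt (real d) = ep d * real d"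
  using assms(1) by (simp_all add: ep_def real_div_sqrt real_sqrt_divide field_simps)
 have "Y d (Suc n) p (add_box f i) = Y d n p f + (sqrt (real d) * (1 / real d)) * (\<Sum>j\<le>p. bc d p j * xc (ad d) (bd d) f i ^ j)
   - (ov (real (Suc n) / real d) (ed d) p - ov (real n / real d) (ed d) p) * sqrt (real d)"
 proof -
  have "(A + u * S - v') * s = (A - v) * s + (s * u) * S - (v' - v) * s" for A u S v v' s :: real by algebra
  then show ?thesis unfolding Y_def O' .
 qed
 then show ?thesis unfolding s(1) unfolding s(2) D_def by (simp add: right_diff_distrib mult.commute mult.left_commute)
qed

section \<open>Polynomials in the fluctuations with uniformly bounded coefficients\<close>

definition bdc :: "(nat => nat => real) => bool" where
 "bdc c \<longleftrightarrow> (EX C. ALL d>=1. ALL n<d. \<bar>c d n\<bar> <= C)"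

lemma bdcI: "(!!d n. d >= 1 ==> n < d ==> \<bar>c d n\<bar> <= C) ==> bdc c"
 by (auto simp: bdc_def)

lemma bdcE:
 assumes "bdc c"
 obtains C where "!!d n. d >= 1 ==> n < d ==> \<bar>c d n\<bar> <= C"
 using assms unfolding bdc_def by (elim exE) (rule that, blast)

lemma bdc_mult: "bdc c ==> bdc c' ==> bdc (%d n. c d n * c' d n)"
proof -
 assume c: "bdc c" "bdc c'"
 obtain C where C: "!!d n. d >= 1 ==> n < d ==> \<bar>c d n\<bar> <= C" by (fact bdcE[OF c(1)])
 obtain C' where C': "!!d n. d >= 1 ==> n < d ==> \<bar>c' d n\<bar> <= C'" by (fact bdcE[OF c(2)])
 show ?thesis
 proof (rule bdcI)
  fix d n :: nat assume A: "d >= 1" "n < d"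
  show "\<bar>c d n * c' d n\<bar> <= C * C'"
   unfolding abs_mult using C[OF A] C'[OF A] by (intro mult_mono) linarith+
 qed
qed

lemma bdc_add: "bdc c ==> bdc c' ==> bdc (%d n. c d n + c' d n)"
proof -
 assume c: "bdc c" "bdc c'"
 obtain C where C: "!!d n. d >= 1 ==> n < d ==> \<bar>c d n\<bar> <= C" by (fact bdcE[OF c(1)])
 obtain C' where C': "!!d n. d >= 1 ==> n < d ==> \<bar>c' d n\<bar> <= C'" by (fact bdcE[OF c(2)])
 show ?thesis
 proof (rule bdcI)
  fix d n :: nat assume A: "d >= 1" "n < d"
  show "\<bar>c d n + c' d n\<bar> <= C + C'" using C[OF A] C'[OF A] by linarith
 qed
qed

lemma bdc_const: "bdc (%_ _. c)" by (intro bdcI[of _ "\<bar>c\<bar>"]) auto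

lemma bdc_uminus: "bdc c ==> bdc (%d n. - c d n)" by (simp add: bdc_def)

lemma bdc_sum: "(!!i. i \<in> I ==> bdc (c i)) ==> bdc (%d n. \<Sum>i\<in>I. c i d n)"
 by (induction I rule: infinite_finite_induct) (auto intro: bdc_add bdc_const)

lemma bdc_ep: "bdc (%d n. ep d)"
 by (intro bdcI[of _ 1]) (auto simp: ep)

lemma in01: "d >= 1 ==> n <= d ==> real n / real d \<in> {0..1}"
 by auto

lemma bdc_cont: "continuous_on UNIV F ==> bdc (%d n. F (real n / real d, ed d))"
proof -
 assume "continuous_on UNIV F"
 then obtain C where "!!t e. t \<in> {0..1} ==> \<bar>e\<bar> <= M ==> \<bar>F (t, e)\<bar> <= C"
  using bounded_on_box[of F M] by blast
 then show ?thesis by (intro bdcI[of _ C]) (auto simp: ed_bound)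
qed

lemma bdc_hh: "bdc (%d n. hh d n j)"
 using bdc_cont[OF continuous_on_hv] by (simp add: hh_def)

lemma bdc_ov: "bdc (%d n. ov (real n / real d) (ed d) p)"
 using bdc_cont[OF continuous_on_ov] by simp

lemma bdc_bc: "bdc (%d n. bc d p j)"
proof -
 have "continuous_on UNIV (%z :: real \<times> real. (snd z, fst z))" by (intro continuous_intros)
 from continuous_on_compose2[OF continuous_on_bcoef this]
 have "continuous_on UNIV (%z. bcoef (snd z) (fst z) p j)" by simp
 from bounded_on_box[OF this, of M] obtain C
  where "!!t e. t \<in> {0..1} ==> \<bar>e\<bar> <= M ==> \<bar>bcoef e t p j\<bar> <= C" by auto
 then show ?thesis unfolding bc_def by (intro bdcI[of _ C]) (auto simp: ed_bound)
qed

definition mon :: "nat => nat => (nat => nat) => nat list => real" where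
 "mon d n f \<mu> = prod_list (map (%p. Y d n p f) \<mu>)"

text \<open>\<open>Q w\<close>: polynomials of weight at most \<open>w\<close> in the \<open>Y p\<close> (weight \<open>p\<close>) and in \<open>x\<close> (weight 1), with
 coefficients bounded uniformly in \<open>d\<close> and \<open>n < d\<close>.\<close>

inductive Q :: "nat => (nat => nat => (nat => nat) => real => real) => bool" for w where
 Q_mon: "bdc c ==> ALL p:set \<mu>. 2 <= p ==> sum_list \<mu> + k <= w ==>
  (!!d n f x. d >= 1 ==> n < d ==> f \<in> diagrams n ==> F d n f x = c d n * mon d n f \<mu> * x ^ k) ==> Q w F"
| Q_add': "Q w F ==> Q w G ==>
  (!!d n f x. d >= 1 ==> n < d ==> f \<in> diagrams n ==> H d n f x = F d n f x + G d n f x) ==> Q w H"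

lemma Q_cong:
 assumes "Q w F" "!!d n f x. d >= 1 ==> n < d ==> f \<in> diagrams n ==> F d n f x = G d n f x"
 shows "Q w G"
 using assms
proof (induction arbitrary: G)
 case (Q_mon c \<mu> k F)
 show ?case
 proof (rule Q.Q_mon[OF Q_mon.hyps(1-3)])
  fix d n f x assume A: "d >= 1" "n < d" "f \<in> diagrams n"
  show "G d n f x = c d n * mon d n f \<mu> * x ^ k"
   using Q_mon.hyps(4)[OF A, of x] Q_mon.prems[OF A, of x] by simp
 qed
next
 case (Q_add' F G' H)
 show ?case
 proof (rule Q.Q_add'[OF Q_add'.hyps(1,2)])
  fix d n f x assume A: "d >= 1" "n < d" "f \<in> diagrams n"
  show "G d n f x = F d n f x + G' d n f x"
   using Q_add'.hyps(3)[OF A, of x] Q_add'.prems[OF A, of x] by simp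
 qed
qed

lemma Q_mono: "Q w F ==> w <= w' ==> Q w' F"
proof (induction rule: Q.induct)
 case (Q_mon c \<mu> k F)
 show ?case by (rule Q.Q_mon[OF Q_mon.hyps(1,2) order_trans[OF Q_mon.hyps(3) Q_mon.prems] Q_mon.hyps(4)])
next
 case (Q_add' F G H)
 show ?case by (rule Q.Q_add'[OF Q_add'.IH(1)[OF Q_add'.prems] Q_add'.IH(2)[OF Q_add'.prems] Q_add'.hyps(3)])
qed

lemma Q_add: "Q w F ==> Q w G ==> Q w (%d n f x. F d n f x + G d n f x)"
 by (rule Q_add'[of w F G]) (assumption | rule refl)+

lemma Q_const: "bdc c ==> Q w (%d n f x. c d n)"
 by (rule Q_mon[of c "[]" 0]) (auto simp: mon_def)

lemma Q_Y: "2 <= p ==> p <= w ==> Q w (%d n f x. Y d n p f)"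
 by (rule Q_mon[of "%_ _. 1" "[p]" 0]) (auto simp: mon_def bdc_const)

lemma Q_X: "k <= w ==> Q w (%d n f x. x ^ k)"
 by (rule Q_mon[of "%_ _. 1" "[]" k]) (auto simp: mon_def bdc_const)

lemma Q_mult':
 assumes "Q v F" "Q w G"
 shows "Q (v + w) (%d n f x. F d n f x * G d n f x)"
 using assms(1)
proof induction
 case F: (Q_mon c \<mu> k F)
 show ?case using assms(2)
 proof induction
  case (Q_mon c' \<mu>' k' G)
  show ?case
  proof (rule Q.Q_mon[OF bdc_mult[OF F(1) Q_mon(1)], of "\<mu> @ \<mu>'" "k + k'"])
   show "ALL p:set (\<mu> @ \<mu>'). 2 <= p" using F(2) Q_mon(2) by auto
   show "sum_list (\<mu> @ \<mu>') + (k + k') <= v + w" using F(3) Q_mon(3) by simp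
   fix d n f x assume A: "d >= 1" "n < d" "f \<in> diagrams n"
   show "F d n f x * G d n f x = c d n * c' d n * mon d n f (\<mu> @ \<mu>') * x ^ (k + k')"
    unfolding F(4)[OF A] Q_mon(4)[OF A] by (simp add: mon_def power_add)
  qed
 next
  case (Q_add' G G' H)
  show ?case
  proof (rule Q.Q_add'[OF Q_add'.IH])
   fix d n f x assume A: "d >= 1" "n < d" "f \<in> diagrams n"
   show "F d n f x * H d n f x = F d n f x * G d n f x + F d n f x * G' d n f x"
    unfolding Q_add'.hyps(3)[OF A] by (rule distrib_left)
  qed
 qed
next
 case (Q_add' F F' H)
 show ?case
 proof (rule Q.Q_add'[OF Q_add'.IH])
  fix d n f x assume A: "d >= 1" "n < d" "f \<in> diagrams n"
  show "H d n f x * G d n f x = F d n f x * G d n f x + F' d n f x * G d n f x"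
   unfolding Q_add'.hyps(3)[OF A] by (rule distrib_right)
 qed
qed

lemma Q_mult: "Q v F ==> Q w G ==> v + w <= u ==> Q u (%d n f x. F d n f x * G d n f x)"
 using Q_mult' Q_mono by blast

lemma Q_cmult: "bdc c ==> Q w F ==> Q w (%d n f x. c d n * F d n f x)"
 by (rule Q_mult[of 0]) (auto intro: Q_const)

lemma Q_diff: "Q w F ==> Q w G ==> Q w (%d n f x. F d n f x - G d n f x)"
 using Q_add[of w F "%d n f x. (-1) * G d n f x"] Q_cmult[OF bdc_const[of "-1"], of w G] by simp

lemma Q_sum: "(!!i. i \<in> I ==> Q w (F i)) ==> Q w (%d n f x. \<Sum>i\<in>I. F i d n f x)"
 by (induction I rule: infinite_finite_induct) (auto intro: Q_add Q_const bdc_const)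

lemma Q_mon_list: "ALL p:set \<mu>. 2 <= p ==> sum_list \<mu> <= w ==> Q w (%d n f x. mon d n f \<mu>)"
 by (rule Q_mon[of "%_ _. 1" \<mu> 0]) (auto simp: bdc_const)

lemma ov_1: "ov t e (Suc 0) = 0"
proof -
 have "hv t e 1 = 0" by (simp add: hv_def)
 then show ?thesis unfolding ov_def by (subst pow_of_hom.simps) simp
qed

text \<open>First order expansion of the complete homogeneous functions around the limit shape.\<close>

definition lin :: "nat => nat => (nat => nat) => nat => real" where
 "lin d n f j = (\<Sum>q=2..j. hh d n (j - q) / real q * Y d n q f)"

lemma Q_lin: "j <= w ==> Q w (%d n f x. lin d n f j)"
 unfolding lin_def
proof (rule Q_sum)
 fix q assume "j <= w" "q \<in> {2..j}"
 moreover have "bdc (%d n. hh d n (j - q) / real q)"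
  using bdc_mult[OF bdc_hh[of "j - q"] bdc_const[of "1 / real q"]] by simp
 ultimately show "Q w (%d n f x. hh d n (j - q) / real q * Y d n q f)" by (intro Q_cmult Q_Y) auto
qed

lemma sum_triangle_swap:
 "(\<Sum>r=1..j. \<Sum>q=1..j - r. g r q) = (\<Sum>q=1..j. \<Sum>r=1..j - q. g r q)" for j :: nat
proof -
 have "(\<Sum>r=1..j. \<Sum>q=1..j - r. g r q) = (\<Sum>r=1..j. sum (g r) {q\<in>{1..j}. r + q <= j})"
  by (intro sum.cong) auto
 also have "... = (\<Sum>q=1..j. sum (%r. g r q) {r\<in>{1..j}. r + q <= j})"
  by (rule sum.swap_restrict) auto
 also have "... = (\<Sum>q=1..j. \<Sum>r=1..j - q. g r q)" by (intro sum.cong) auto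
 finally show ?thesis .
qed

text \<open>Linearised Newton identities: the derivative of h_j in the power sum s_q is h_(j - q) /
  q. Exchanging the double sum lets Newton's identities for \<open>hh\<close> act on the inner
  one.\<close>

lemma lin_rec:
 assumes Y1: "Y d n 1 f = 0"
 shows "real j * lin d n f j = (\<Sum>q=1..j. Y d n q f * hh d n (j - q) + ov (real n / real d) (ed d) q * lin d n f (j - q))"
proof -
 let ?o = "ov (real n / real d) (ed d)" and ?y = "%q. Y d n q f" and ?h = "hh d n"
 have nw: "real k * ?h k = (\<Sum>r=1..k. ?o r * ?h (k - r))" for k
  using newton_ov unfolding hh_def newton_def by blast
 have lin1: "lin d n f k = (\<Sum>q=1..k. ?h (k - q) / real q * ?y q)" for k
  unfolding lin_def by (rule sum.mono_neutral_left) (use Y1 in "auto simp: not_le less_Suc_eq numeral_2_eq_2")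
 have "(\<Sum>r=1..j. ?o r * lin d n f (j - r)) = (\<Sum>r=1..j. \<Sum>q=1..j - r. ?o r * (?h (j - r - q) / real q * ?y q))"
  by (simp add: lin1 sum_distrib_left)
 also have "... = (\<Sum>q=1..j. \<Sum>r=1..j - q. ?o r * (?h (j - r - q) / real q * ?y q))"
  by (rule sum_triangle_swap)
 also have "... = (\<Sum>q=1..j. (real (j - q) * ?h (j - q)) / real q * ?y q)"
 proof (rule sum.cong[OF refl])
  fix q
  show "(\<Sum>r=1..j - q. ?o r * (?h (j - r - q) / real q * ?y q)) = (real (j - q) * ?h (j - q)) / real q * ?y q"
   unfolding nw by (simp add: sum_distrib_right sum_divide_distrib add.commute[of q] mult.assoc)
 qed
 finally have "(\<Sum>q=1..j. ?y q * ?h (j - q) + ?o q * lin d n f (j - q))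
   = (\<Sum>q=1..j. ?y q * ?h (j - q) + (real (j - q) * ?h (j - q)) / real q * ?y q)"
  by (simp add: sum.distrib)
 also have "... = (\<Sum>q=1..j. real j * (?h (j - q) / real q * ?y q))"
  by (rule sum.cong) (auto simp: field_simps of_nat_diff)
 finally show ?thesis by (simp add: lin1 sum_distrib_left)
qed

lemma Y1: "Y d n (Suc 0) f = 0"
 using shape_moment_1[of "ad d" "bd d" f] by (simp add: Y_def Om_def ov_1)

text \<open>Induction along Newton's identities. The remainder is recorded together with its weight,
  again at most \<open>j\<close>, because the moment bounds are proved by induction on the
  weight.\<close>

lemma hom_expansion:
 "EX K. Q j (%d n f x. K d n f) & (ALL d>=1. ALL n<d. ALL f:diagrams n.
   hom_of_pow (Om d f) j = hh d n j + ep d * lin d n f j + ep d * ep d * K d n f)"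
proof (induction j rule: less_induct)
 case (less j)
 show ?case
 proof (cases j)
  case 0
  then show ?thesis by (intro exI[of _ "%_ _ _. 0"]) (auto simp: Q_const bdc_const hh_def lin_def)
 next
  case (Suc m)
  have "ALL q:{1..j}. EX K. Q (j - q) (%d n f x. K d n f) & (ALL d>=1. ALL n<d. ALL f:diagrams n.
   hom_of_pow (Om d f) (j - q) = hh d n (j - q) + ep d * lin d n f (j - q) + ep d * ep d * K d n f)"
   using less Suc by auto
  from bchoice[OF this] obtain K where
   K: "!!q. q \<in> {1..j} ==> Q (j - q) (%d n f x. K q d n f)"
   "!!q d n f. q \<in> {1..j} ==> d >= 1 ==> n < d ==> f \<in> diagrams n ==>
    hom_of_pow (Om d f) (j - q) = hh d n (j - q) + ep d * lin d n f (j - q) + ep d * ep d * K q d n f"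
   by blast
  define K' where "K' d n f = (\<Sum>q=1..j. (1 / real j) * (ov (real n / real d) (ed d) q * K q d n f
    + Y d n q f * (lin d n f (j - q) + ep d * K q d n f)))" for d n f
  have "Q j (%d n f x. K' d n f)"
   unfolding K'_def
  proof (intro Q_sum Q_cmult[OF bdc_const] Q_add)
   fix q assume q: "q \<in> {1..j}"
   show "Q j (%d n f x. ov (real n / real d) (ed d) q * K q d n f)"
    by (intro Q_cmult bdc_ov Q_mono[OF K(1)[OF q]]) auto
   have L: "Q (j - q) (%d n f x. lin d n f (j - q) + ep d * K q d n f)"
    by (intro Q_add Q_lin Q_cmult bdc_ep K(1)[OF q]) auto
   show "Q j (%d n f x. Y d n q f * (lin d n f (j - q) + ep d * K q d n f))"
   proof (cases "q = 1")
    case True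
    then show ?thesis using Y1 by (simp add: Q_const bdc_const)
   next
    case False
    then show ?thesis using q by (intro Q_mult[OF Q_Y[of q q] L]) auto
   qed
  qed
  moreover have "hom_of_pow (Om d f) j = hh d n j + ep d * lin d n f j + ep d * ep d * K' d n f"
   if A: "d >= 1" "n < d" "f \<in> diagrams n" for d n f
  proof -
   let ?o = "ov (real n / real d) (ed d)"
   have "real j * hom_of_pow (Om d f) j = (\<Sum>q=1..j. Om d f q * hom_of_pow (Om d f) (j - q))"
    using newton_hom_of_pow[of "Om d f"] by (simp add: newton_def)
   also have "... = (\<Sum>q=1..j. (?o q + ep d * Y d n q f) * (hh d n (j - q) + ep d * lin d n f (j - q) + ep d * ep d * K q d n f))"
   proof (rule sum.cong[OF refl])
    fix q assume q: "q \<in> {1..j}"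
    show "Om d f q * hom_of_pow (Om d f) (j - q) = (?o q + ep d * Y d n q f)
      * (hh d n (j - q) + ep d * lin d n f (j - q) + ep d * ep d * K q d n f)"
     unfolding K(2)[OF q A] Om_Y[OF A(1), of f q n] ..
   qed
   also have "... = (\<Sum>q=1..j. ?o q * hh d n (j - q)) + ep d * (\<Sum>q=1..j. Y d n q f * hh d n (j - q) + ?o q * lin d n f (j - q))
     + ep d * ep d * (\<Sum>q=1..j. ?o q * K q d n f + Y d n q f * (lin d n f (j - q) + ep d * K q d n f))"
    unfolding sum_distrib_left sum.distrib[symmetric] by (rule sum.cong) (auto simp: algebra_simps)
   also have "(\<Sum>q=1..j. ?o q * hh d n (j - q)) = real j * hh d n j"
    using newton_ov unfolding hh_def newton_def by metis
   also have "(\<Sum>q=1..j. Y d n q f * hh d n (j - q) + ?o q * lin d n f (j - q)) = real j * lin d n f j"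
    using lin_rec[of d n f j] Y1[of d n f] by simp
   also have "(\<Sum>q=1..j. ?o q * K q d n f + Y d n q f * (lin d n f (j - q) + ep d * K q d n f)) = real j * K' d n f"
    unfolding K'_def sum_distrib_left using Suc by (intro sum.cong) (auto simp del: of_nat_Suc)
   finally have "real j * hom_of_pow (Om d f) j = real j * (hh d n j + ep d * lin d n f j + ep d * ep d * K' d n f)"
    by (simp add: algebra_simps)
   then show ?thesis using Suc by simp
  qed
  ultimately show ?thesis by blast
 qed
qed

lemma Q_hom: "Q k (%d n f x. hom_of_pow (Om d f) k)"
proof -
 obtain K where K: "Q k (%d n f x. K d n f)" "ALL d>=1. ALL n<d. ALL f:diagrams n.
   hom_of_pow (Om d f) k = hh d n k + ep d * lin d n f k + (ep d * ep d) * K d n f"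
  using hom_expansion[of k] by (elim exE conjE) (rule that)
 have "Q k (%d n f x. hh d n k + ep d * lin d n f k + (ep d * ep d) * K d n f)"
  by (intro Q_add Q_const Q_cmult bdc_hh bdc_mult bdc_ep Q_lin K(1) order_refl)
 then show ?thesis by (rule Q_cong) (simp add: K(2))
qed

text \<open>Averaging replaces \<open>x ^ k\<close> by \<open>hom_of_pow (Om d f) k\<close>, a
  polynomial of weight \<open>k\<close>; this is why x is given weight 1.\<close>

lemma Q_TT:
 assumes "Q w F"
 shows "Q w (%d n f x. TT d n f (F d n f))"
 using assms
proof induction
 case (Q_mon c \<mu> k F)
 have "Q w (%d n f x. (c d n * mon d n f \<mu>) * hom_of_pow (Om d f) k)"
 proof (rule Q_mult[OF _ Q_hom])
  show "Q (sum_list \<mu>) (%d n f x. c d n * mon d n f \<mu>)"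
   by (intro Q_cmult Q_mon_list) (use Q_mon in auto)
 qed (use Q_mon in auto)
 then show ?case
 proof (rule Q_cong)
  fix d n f and x :: real assume A: "d >= 1" "n < d" "f \<in> diagrams n"
  then have "F d n f = (%x. (c d n * mon d n f \<mu>) * x ^ k)" using Q_mon by auto
  then show "c d n * mon d n f \<mu> * hom_of_pow (Om d f) k = TT d n f (F d n f)"
   using A by (simp only: TT_cmult TT_pow)
 qed
next
 case (Q_add' F G H)
 show ?case
 proof (rule Q_cong[OF Q_add[OF Q_add'.IH]])
  fix d n f and x :: real assume A: "d >= 1" "n < d" "f \<in> diagrams n"
  then have "H d n f = (%x. F d n f x + G d n f x)" using Q_add' by auto
  then show "TT d n f (F d n f) + TT d n f (G d n f) = TT d n f (H d n f)" by (simp only: TT_add)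
 qed
qed

end

section \<open>Mean and covariance of a single step\<close>

context jp_chain
begin

text \<open>\<open>Bm\<close> is the matrix by which the mean increment depends linearly on the
  deviations \<open>Y\<close>; \<open>Sm\<close> is the covariance of the increments when the
  position of the box has the limiting moments \<open>hh\<close>.\<close>

definition Bm :: "nat => nat => nat => nat => real" where
 "Bm d n p q = (\<Sum>j\<in>{q..p}. bc d p j * hh d n (j - q)) / real q"

definition Sm :: "nat => nat => nat => nat => real" where
 "Sm d n p q = (\<Sum>j\<le>p. \<Sum>l\<le>q. bc d p j * bc d q l * (hh d n (j + l) - hh d n j * hh d n l))"

lemma bc_eq_0: "p <= Suc j ==> bc d p j = 0"
 by (simp add: bc_def bcoef_eq_0)

lemma bdc_Bm: "bdc (%d n. Bm d n p q)"
proof -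
 have "bdc (%d n. (1 / real q) * (\<Sum>j\<in>{q..p}. bc d p j * hh d n (j - q)))"
  by (intro bdc_mult bdc_sum bdc_const bdc_bc bdc_hh)
 then show ?thesis by (simp add: Bm_def)
qed

text \<open>Two errors of order 1 / d: the second order Taylor term of \<open>ov\<close>, and the
  replacement of h = 1 / d by h = 0 in the coefficients.\<close>

lemma drift_error:
 assumes p: "p >= 1"
 shows "EX r. bdc r & (ALL d>=1. ALL n<d.
  real d * (ov (real (Suc n) / real d) (ed d) p - ov (real n / real d) (ed d) p)
   = (\<Sum>j\<le>p. bc d p j * hh d n j) + ep d * ep d * r d n)"
proof -
 define G where "G d n = real d * (ov (real (Suc n) / real d) (ed d) p - ov (real n / real d) (ed d) p)
   - (\<Sum>j\<le>p. bc d p j * hh d n j)" for d n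
 define r where "r d n = real d * G d n" for d n
 obtain C1 where C1: "!!t u e. t \<in> {0..1} ==> u \<in> {0..1} ==> t < u ==> \<bar>e\<bar> <= M ==>
   \<bar>ov u e p - ov t e p - (u - t) * (\<Sum>j\<le>p. bcoef e 0 p j * hv t e j)\<bar> <= C1 * (u - t)^2"
  using ov_taylor[OF p, of M] by blast
 have "ALL m. EX C. ALL h e. h \<in> {0..1} --> \<bar>e\<bar> <= M --> \<bar>nu e h m - nu e 0 m\<bar> <= C * h"
  using nu_lipschitz_h by blast
 then obtain C2 where C2: "!!m h e. h \<in> {0..1} ==> \<bar>e\<bar> <= M ==> \<bar>nu e h m - nu e 0 m\<bar> <= C2 m * h"
  by metis
 have "ALL j. EX C. ALL d>=1. ALL n<d. \<bar>hh d n j\<bar> <= C" using bdc_hh unfolding bdc_def by blast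
 then obtain C3 where C3: "!!j d n. d >= 1 ==> n < d ==> \<bar>hh d n j\<bar> <= C3 j" by metis
 define C where "C = C1 + (\<Sum>j\<le>p. real (p choose j) * C2 (p - j) * C3 j)"
 have "\<bar>r d n\<bar> <= C" if A: "d >= 1" "n < d" for d n
 proof -
  let ?t = "real n / real d" and ?u = "real (Suc n) / real d"
  have ut: "?u - ?t = 1 / real d" using A by (simp add: field_simps)
  have "\<bar>ov ?u (ed d) p - ov ?t (ed d) p - (?u - ?t) * (\<Sum>j\<le>p. bcoef (ed d) 0 p j * hv ?t (ed d) j)\<bar> <= C1 * (?u - ?t)^2"
   using A ut by (intro C1 ed_bound) (auto simp: field_simps)
  then have 1: "\<bar>ov ?u (ed d) p - ov ?t (ed d) p - 1 / real d * (\<Sum>j\<le>p. bcoef (ed d) 0 p j * hh d n j)\<bar> <= C1 / (real d)^2"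
   unfolding ut hh_def by (simp add: power_divide)
  have bb: "\<bar>bc d p j - bcoef (ed d) 0 p j\<bar> <= real (p choose j) * (C2 (p - j) / real d)" for j
  proof -
   have "\<bar>nu (ed d) (1 / real d) (p - j) - nu (ed d) 0 (p - j)\<bar> <= C2 (p - j) * (1 / real d)"
    using A by (intro C2 ed_bound) auto
   then show ?thesis unfolding bc_def bcoef_def right_diff_distrib[symmetric] abs_mult
    by (intro mult_mono) auto
  qed
  have 2: "\<bar>(\<Sum>j\<le>p. bcoef (ed d) 0 p j * hh d n j) - (\<Sum>j\<le>p. bc d p j * hh d n j)\<bar>
    <= (\<Sum>j\<le>p. real (p choose j) * (C2 (p - j) / real d) * C3 j)"
   unfolding sum_subtractf[symmetric] left_diff_distrib[symmetric]
  proof (rule order_trans[OF sum_abs], rule sum_mono)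
   fix j
   have "\<bar>bc d p j - bcoef (ed d) 0 p j\<bar> * \<bar>hh d n j\<bar> <= real (p choose j) * (C2 (p - j) / real d) * C3 j"
    by (rule mult_mono[OF bb C3[OF A]]) (use order_trans[OF abs_ge_zero bb] in auto)
   then show "\<bar>(bcoef (ed d) 0 p j - bc d p j) * hh d n j\<bar> <= real (p choose j) * (C2 (p - j) / real d) * C3 j"
    by (simp only: abs_mult abs_minus_commute)
  qed
  have Geq: "G d n = real d * (ov ?u (ed d) p - ov ?t (ed d) p - 1 / real d * (\<Sum>j\<le>p. bcoef (ed d) 0 p j * hh d n j))
    + ((\<Sum>j\<le>p. bcoef (ed d) 0 p j * hh d n j) - (\<Sum>j\<le>p. bc d p j * hh d n j))"
   using A by (simp add: G_def right_diff_distrib)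
  have "\<bar>real d * (ov ?u (ed d) p - ov ?t (ed d) p - 1 / real d * (\<Sum>j\<le>p. bcoef (ed d) 0 p j * hh d n j))\<bar>
    <= real d * (C1 / (real d)^2)"
   unfolding abs_mult by (rule mult_mono[OF _ 1]) auto
  then have "\<bar>G d n\<bar> <= real d * (C1 / (real d)^2) + (\<Sum>j\<le>p. real (p choose j) * (C2 (p - j) / real d) * C3 j)"
   unfolding Geq using 2 by linarith
  also have "... = C / real d"
   using A by (simp add: C_def power2_eq_square add_divide_distrib sum_divide_distrib)
  finally have "\<bar>G d n\<bar> <= C / real d" .
  then show ?thesis using A by (simp add: r_def abs_mult field_simps)
 qed
 then have "bdc r" by (rule bdcI)
 moreover have "real d * (ov (real (Suc n) / real d) (ed d) p - ov (real n / real d) (ed d) p)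
   = (\<Sum>j\<le>p. bc d p j * hh d n j) + ep d * ep d * r d n" if "d >= 1" for d n
  using that by (simp add: r_def G_def ep(4))
 ultimately show ?thesis by blast
qed

lemma D_expansion:
 assumes p: "p >= 1"
 shows "EX r. bdc r & (ALL d>=1. ALL n<d. ALL x. D d n p x = (\<Sum>j\<le>p. bc d p j * (x ^ j - hh d n j)) + ep d * ep d * r d n)"
proof -
 obtain r where r: "bdc r" "!!d n. d >= 1 ==> n < d ==>
   real d * (ov (real (Suc n) / real d) (ed d) p - ov (real n / real d) (ed d) p)
   = (\<Sum>j\<le>p. bc d p j * hh d n j) + ep d * ep d * r d n"
  using drift_error[OF p] by (elim exE conjE) (rule that, auto)
 have "D d n p x = (\<Sum>j\<le>p. bc d p j * (x ^ j - hh d n j)) + ep d * ep d * (- r d n)" if "d >= 1" "n < d" for d n x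
  unfolding D_def r(2)[OF that] by (simp add: right_diff_distrib sum_subtractf)
 moreover have "bdc (%d n. - r d n)" by (rule bdc_uminus[OF r(1)])
 ultimately show ?thesis by (intro exI[of _ "%d n. - r d n"]) auto
qed

text \<open>Coefficients with j >= p - 1 vanish, so exchanging a factor \<open>Y p\<close> for its
  increment loses two units of weight. The moment bounds rest on this loss.\<close>

lemma Q_D:
 assumes p: "p >= 2"
 shows "Q (p - 2) (%d n f x. D d n p x)"
proof -
 obtain r where r: "bdc r" "ALL d>=1. ALL n<d. ALL x. D d n p x = (\<Sum>j\<le>p. bc d p j * (x ^ j - hh d n j)) + ep d * ep d * r d n"
  using D_expansion[OF order_trans[OF one_le_numeral p]] by (elim exE conjE) (rule that)
 have "Q (p - 2) (%d n f x. (\<Sum>j\<in>{..p - 2}. bc d p j * (x ^ j - hh d n j)) + ep d * ep d * r d n)"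
  by (intro Q_add Q_sum Q_cmult bdc_bc Q_diff Q_X Q_const bdc_mult bdc_ep bdc_hh r(1)) auto
 then show ?thesis
 proof (rule Q_cong)
  fix d n :: nat and f and x :: real assume A: "d >= 1" "n < d"
  have "(\<Sum>j\<le>p. bc d p j * (x ^ j - hh d n j)) = (\<Sum>j\<in>{..p - 2}. bc d p j * (x ^ j - hh d n j))"
   by (rule sum.mono_neutral_right) (use p in "auto simp: bc_eq_0")
  then show "(\<Sum>j\<in>{..p - 2}. bc d p j * (x ^ j - hh d n j)) + ep d * ep d * r d n = D d n p x"
   using r(2) A by simp
 qed
qed

text \<open>Averaging cancels the centring, since \<open>x ^ j\<close> has mean
  \<open>hh d n j\<close> to leading order; what is left at order \<open>ep d\<close> is the linear
  drift.\<close>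

lemma TT_D:
 assumes p: "p >= 2"
 shows "EX G. Q (p - 2) (%d n f x. G d n f) & (ALL d>=1. ALL n<d. ALL f:diagrams n.
   TT d n f (D d n p) = ep d * (\<Sum>q=2..p. Bm d n p q * Y d n q f) + ep d * ep d * G d n f)"
proof -
 obtain r where r: "bdc r" "ALL d>=1. ALL n<d. ALL x. D d n p x = (\<Sum>j\<le>p. bc d p j * (x ^ j - hh d n j)) + ep d * ep d * r d n"
  using D_expansion[OF order_trans[OF one_le_numeral p]] by (elim exE conjE) (rule that)
 have "ALL j. EX K. Q j (%d n f x. K d n f) & (ALL d>=1. ALL n<d. ALL f:diagrams n.
   hom_of_pow (Om d f) j = hh d n j + ep d * lin d n f j + ep d * ep d * K d n f)"
  using hom_expansion by blast
 from choice[OF this] obtain K where K: "ALL j. Q j (%d n f x. K j d n f) & (ALL d>=1. ALL n<d. ALL f:diagrams n.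
   hom_of_pow (Om d f) j = hh d n j + ep d * lin d n f j + ep d * ep d * K j d n f)" ..
 define G where "G d n f = (\<Sum>j\<in>{..p - 2}. bc d p j * K j d n f) + r d n" for d n f
 have "Q (p - 2) (%d n f x. G d n f)" unfolding G_def
 proof (intro Q_add Q_sum Q_cmult bdc_bc Q_const r(1))
  fix j assume "j \<in> {..p - 2}"
  then show "Q (p - 2) (%d n f x. K j d n f)" using K Q_mono by blast
 qed
 moreover have "TT d n f (D d n p) = ep d * (\<Sum>q=2..p. Bm d n p q * Y d n q f) + ep d * ep d * G d n f"
  if A: "d >= 1" "n < d" "f \<in> diagrams n" for d n f
 proof -
  have Deq: "D d n p = (%x. (\<Sum>j\<le>p. bc d p j * (x ^ j + (- hh d n j))) + ep d * ep d * r d n)"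
   using r(2) A by (auto simp: fun_eq_iff)
  have "TT d n f (D d n p) = (\<Sum>j\<le>p. bc d p j * (hom_of_pow (Om d f) j + (- hh d n j))) + ep d * ep d * r d n"
   unfolding Deq TT_add TT_sum TT_cmult TT_pow[OF A(1,3)] TT_const[OF A(1,3)] ..
  also have "(\<Sum>j\<le>p. bc d p j * (hom_of_pow (Om d f) j + (- hh d n j)))
    = ep d * (\<Sum>j\<le>p. bc d p j * lin d n f j) + ep d * ep d * (\<Sum>j\<le>p. bc d p j * K j d n f)"
   unfolding sum_distrib_left sum.distrib[symmetric]
   by (rule sum.cong[OF refl]) (use K A in "simp add: algebra_simps")
  also have "(\<Sum>j\<le>p. bc d p j * lin d n f j) = (\<Sum>q=2..p. Bm d n p q * Y d n q f)"
  proof -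
   have "(\<Sum>j\<le>p. bc d p j * lin d n f j) = (\<Sum>j\<le>p. \<Sum>q\<in>{2..j}. bc d p j * (hh d n (j - q) / real q * Y d n q f))"
    by (simp add: lin_def sum_distrib_left)
   also have "... = (\<Sum>j\<le>p. sum (%q. bc d p j * (hh d n (j - q) / real q * Y d n q f)) {q\<in>{2..p}. q <= j})"
    by (intro sum.cong) auto
   also have "... = (\<Sum>q=2..p. sum (%j. bc d p j * (hh d n (j - q) / real q * Y d n q f)) {j\<in>{..p}. q <= j})"
    by (rule sum.swap_restrict) auto
   also have "... = (\<Sum>q=2..p. Bm d n p q * Y d n q f)"
   proof (rule sum.cong[OF refl])
    fix q
    have "{j\<in>{..p}. q <= j} = {q..p}" by auto
    then show "sum (%j. bc d p j * (hh d n (j - q) / real q * Y d n q f)) {j\<in>{..p}. q <= j} = Bm d n p q * Y d n q f"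
     by (simp add: Bm_def sum_distrib_right sum_divide_distrib mult.assoc)
   qed
   finally show ?thesis .
  qed
  also have "(\<Sum>j\<le>p. bc d p j * K j d n f) = (\<Sum>j\<in>{..p - 2}. bc d p j * K j d n f)"
   by (rule sum.mono_neutral_right) (use p in "auto simp: bc_eq_0")
  finally show ?thesis by (simp add: G_def algebra_simps)
 qed
 ultimately show ?thesis by blast
qed

lemma TT_DD:
 assumes p: "p >= 2" "q >= 2"
 shows "EX w G. Q w (%d n f x. G d n f) & (ALL d>=1. ALL n<d. ALL f:diagrams n.
   TT d n f (%x. D d n p x * D d n q x) = Sm d n p q + ep d * G d n f)"
proof -
 obtain r where r: "bdc r" "ALL d>=1. ALL n<d. ALL x. D d n p x = (\<Sum>j\<le>p. bc d p j * (x ^ j - hh d n j)) + ep d * ep d * r d n"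
  using D_expansion[OF order_trans[OF one_le_numeral p(1)]] by (elim exE conjE) (rule that)
 obtain s where s: "bdc s" "ALL d>=1. ALL n<d. ALL x. D d n q x = (\<Sum>j\<le>q. bc d q j * (x ^ j - hh d n j)) + ep d * ep d * s d n"
  using D_expansion[OF order_trans[OF one_le_numeral p(2)]] by (elim exE conjE) (rule that)
 have "ALL j. EX K. Q j (%d n f x. K d n f) & (ALL d>=1. ALL n<d. ALL f:diagrams n.
   hom_of_pow (Om d f) j = hh d n j + ep d * K d n f)"
 proof
  fix j
  obtain K where K: "Q j (%d n f x. K d n f)" "ALL d>=1. ALL n<d. ALL f:diagrams n.
   hom_of_pow (Om d f) j = hh d n j + ep d * lin d n f j + ep d * ep d * K d n f"
   using hom_expansion[of j] by (elim exE conjE) (rule that)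
  have "Q j (%d n f x. lin d n f j + ep d * K d n f)" by (intro Q_add Q_lin Q_cmult bdc_ep K(1) order_refl)
  then show "EX K. Q j (%d n f x. K d n f) & (ALL d>=1. ALL n<d. ALL f:diagrams n.
   hom_of_pow (Om d f) j = hh d n j + ep d * K d n f)"
   using K(2) by (intro exI[of _ "%d n f. lin d n f j + ep d * K d n f"]) (auto simp: algebra_simps)
 qed
 from choice[OF this] obtain K where K: "ALL j. Q j (%d n f x. K j d n f) & (ALL d>=1. ALL n<d. ALL f:diagrams n.
   hom_of_pow (Om d f) j = hh d n j + ep d * K j d n f)" ..
 define D0 where "D0 p d n x = (\<Sum>j\<le>p. bc d p j * (x ^ j - hh d n j))" for p d n and x :: real
 define H where "H d n f = (\<Sum>j\<le>p. \<Sum>l\<le>q. bc d p j * bc d q l * (K (j + l) d n f - hh d n l * K j d n f - hh d n j * K l d n f))" for d n f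
 define R where "R d n x = r d n * D0 q d n x + s d n * D0 p d n x + ep d * ep d * r d n * s d n" for d n and x :: real
 define w where "w = p + q"
 have QD0: "Q w (%d n f x. D0 m d n x)" if "m <= w" for m
  unfolding D0_def using that by (intro Q_sum Q_cmult bdc_bc Q_diff Q_X Q_const bdc_hh) auto
 have "Q w (%d n f x. H d n f)" unfolding H_def
 proof (intro Q_sum Q_cmult bdc_mult bdc_bc Q_diff bdc_hh)
  fix j l assume "j \<in> {..p}" "l \<in> {..q}"
  then have "j + l <= w" "j <= w" "l <= w" by (auto simp: w_def)
  then show "Q w (%d n f x. K (j + l) d n f)" "Q w (%d n f x. K j d n f)" "Q w (%d n f x. K l d n f)"
   using K Q_mono by blast+
 qed
 moreover have "Q w (%d n f x. TT d n f (R d n))"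
  unfolding R_def by (rule Q_TT) (intro Q_add Q_cmult Q_const QD0 r(1) s(1) bdc_mult bdc_ep, auto simp: w_def)
 ultimately have "Q w (%d n f x. H d n f + ep d * TT d n f (R d n))"
  by (intro Q_add Q_cmult bdc_ep)
 moreover have "TT d n f (%x. D d n p x * D d n q x) = Sm d n p q + ep d * (H d n f + ep d * TT d n f (R d n))"
  if A: "d >= 1" "n < d" "f \<in> diagrams n" for d n f
 proof -
  have "(%x. D d n p x * D d n q x) = (%x. D0 p d n x * D0 q d n x + (ep d * ep d) * R d n x)"
  proof (rule ext)
   fix x
   have "D d n p x = D0 p d n x + ep d * ep d * r d n" "D d n q x = D0 q d n x + ep d * ep d * s d n"
    using r(2) s(2) A by (simp_all add: D0_def)
   then show "D d n p x * D d n q x = D0 p d n x * D0 q d n x + (ep d * ep d) * R d n x"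
    by (simp add: R_def algebra_simps)
  qed
  moreover have "D0 p d n x * D0 q d n x = (\<Sum>j\<le>p. \<Sum>l\<le>q. bc d p j * bc d q l *
    (x ^ (j + l) + (- hh d n l) * x ^ j + (- hh d n j) * x ^ l + hh d n j * hh d n l))" for x
   unfolding D0_def sum_product by (intro sum.cong refl) (simp add: power_add algebra_simps)
  ultimately have "TT d n f (%x. D d n p x * D d n q x) = (\<Sum>j\<le>p. \<Sum>l\<le>q. bc d p j * bc d q l *
    (hom_of_pow (Om d f) (j + l) + (- hh d n l) * hom_of_pow (Om d f) j + (- hh d n j) * hom_of_pow (Om d f) l + hh d n j * hh d n l))
    + (ep d * ep d) * TT d n f (R d n)"
   by (simp only: TT_add TT_sum TT_cmult TT_pow[OF A(1,3)] TT_const[OF A(1,3)])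
  also have "(\<Sum>j\<le>p. \<Sum>l\<le>q. bc d p j * bc d q l *
    (hom_of_pow (Om d f) (j + l) + (- hh d n l) * hom_of_pow (Om d f) j + (- hh d n j) * hom_of_pow (Om d f) l + hh d n j * hh d n l))
   = Sm d n p q + ep d * H d n f"
   unfolding Sm_def H_def sum_distrib_left sum.distrib[symmetric]
   by (intro sum.cong refl) (use K A in "simp add: algebra_simps")
  finally show ?thesis by (simp add: algebra_simps)
 qed
 ultimately show ?thesis by (intro exI[of _ w] exI[of _ "%d n f. H d n f + ep d * TT d n f (R d n)"]) auto
qed

text \<open>All joint moments of the \<open>Y p\<close> stay bounded: the mean increment of a monomial is \<open>1/d\<close> times a
 polynomial of smaller weight.\<close>

lemma mon_step:
 assumes "ALL p:set \<mu>. 2 <= p"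
 shows "EX B G R. Q (sum_list \<mu>) B & Q (sum_list \<mu> - 1) (%d n f x. G d n f) & Q (sum_list \<mu> - 1) R &
   (\<mu> = [] --> B = (%d n f x. 0) & G = (%d n f. 0) & R = (%d n f x. 0)) &
   (ALL d>=1. ALL n<d. ALL f:diagrams n. TT d n f (B d n f) = ep d * G d n f &
    (ALL x. prod_list (map (%p. Y d n p f + ep d * D d n p x) \<mu>)
     = mon d n f \<mu> + ep d * B d n f x + ep d * ep d * R d n f x))"
 using assms
proof (induction \<mu>)
 case Nil
 show ?case
  by (rule exI[of _ "%d n f x. 0"], rule exI[of _ "%d n f. 0"], rule exI[of _ "%d n f x. 0"])
    (auto simp: Q_const bdc_const mon_def TT_const TT_def)
next
 case (Cons p \<mu>)
 then obtain B G R where B: "Q (sum_list \<mu>) B" and G: "Q (sum_list \<mu> - 1) (%d n f x. G d n f)"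
  and R: "Q (sum_list \<mu> - 1) R"
  and nil: "\<mu> = [] --> B = (%d n f x. 0) & G = (%d n f. 0) & R = (%d n f x. 0)"
  and eq: "ALL d>=1. ALL n<d. ALL f:diagrams n. TT d n f (B d n f) = ep d * G d n f &
    (ALL x. prod_list (map (%p. Y d n p f + ep d * D d n p x) \<mu>)
     = mon d n f \<mu> + ep d * B d n f x + ep d * ep d * R d n f x)"
  by fastforce
 have p: "2 <= p" and \<mu>: "ALL p:set \<mu>. 2 <= p" using Cons.prems by auto
 obtain g where g: "Q (p - 2) (%d n f x. g d n f)" "ALL d>=1. ALL n<d. ALL f:diagrams n.
   TT d n f (D d n p) = ep d * (\<Sum>q=2..p. Bm d n p q * Y d n q f) + ep d * ep d * g d n f"
  using TT_D[OF p] by (elim exE conjE) (rule that)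
 \<comment> \<open>Entries of \<open>Bm\<close> with q >= p - 1 vanish, so the drift of
   \<open>Y p\<close> has weight at most p - 2.\<close>
 define g' where "g' d n f = (\<Sum>q\<in>{2..p - 2}. Bm d n p q * Y d n q f) + ep d * g d n f" for d n f
 have g': "Q (p - 2) (%d n f x. g' d n f)" unfolding g'_def
  by (intro Q_add Q_sum Q_cmult bdc_Bm Q_Y bdc_ep g(1)) auto
 have Bm0: "Bm d n p q = 0" if "p <= Suc q" for d n q
  using that by (auto simp: Bm_def bc_eq_0)
 have g'_eq: "TT d n f (D d n p) = ep d * g' d n f" if "d >= 1" "n < d" "f \<in> diagrams n" for d n f
 proof -
  have "(\<Sum>q=2..p. Bm d n p q * Y d n q f) = (\<Sum>q\<in>{2..p - 2}. Bm d n p q * Y d n q f)"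
   by (rule sum.mono_neutral_right) (use p in "auto simp: Bm0")
  then show ?thesis using g(2) that by (simp add: g'_def algebra_simps)
 qed
 define B' where "B' d n f x = mon d n f \<mu> * D d n p x + Y d n p f * B d n f x" for d n f x
 define G' where "G' d n f = g' d n f * mon d n f \<mu> + Y d n p f * G d n f" for d n f
 define R' where "R' d n f x = D d n p x * B d n f x + ep d * (D d n p x * R d n f x) + Y d n p f * R d n f x" for d n f x
 let ?w = "p + sum_list \<mu>"
 \<comment> \<open>For empty \<mu> the bound \<open>sum_list \<mu> - 1\<close> is truncated to 0,
   and a factor \<open>Y p\<close> would raise it to p instead of p - 1; the clause for the empty
   list disposes of that case.\<close>
 have YG: "Q (?w - 1) (%d n f x. Y d n p f * F d n f x)" if "Q (sum_list \<mu> - 1) F" "\<mu> = [] --> F = (%d n f x. 0)" for F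
 proof (cases "\<mu> = []")
  case True then show ?thesis using that by (simp add: Q_const bdc_const)
 next
  case False
  then have "2 <= sum_list \<mu>" using \<mu> by (cases \<mu>) auto
  then show ?thesis by (intro Q_mult[OF Q_Y[OF p order_refl] that(1)]) auto
 qed
 have "Q ?w B'" unfolding B'_def
  by (intro Q_add Q_mult[OF Q_mon_list[OF \<mu> order_refl] Q_D[OF p]] Q_mult[OF Q_Y[OF p order_refl] B]) auto
 moreover have "Q (?w - 1) (%d n f x. G' d n f)" unfolding G'_def
  by (intro Q_add YG G Q_mult[OF g' Q_mon_list[OF \<mu> order_refl]]) (use p nil in auto)
 moreover have "Q (?w - 1) R'" unfolding R'_def
  by (intro Q_add YG R Q_cmult bdc_ep Q_mult[OF Q_D[OF p] B] Q_mult[OF Q_D[OF p] R]) (use p nil in auto)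
 moreover have "TT d n f (B' d n f) = ep d * G' d n f &
    (ALL x. prod_list (map (%p. Y d n p f + ep d * D d n p x) (p # \<mu>))
     = mon d n f (p # \<mu>) + ep d * B' d n f x + ep d * ep d * R' d n f x)"
  if A: "d >= 1" "n < d" "f \<in> diagrams n" for d n f
 proof
  show "TT d n f (B' d n f) = ep d * G' d n f"
   unfolding B'_def TT_add TT_cmult g'_eq[OF A] using eq A by (simp add: G'_def algebra_simps)
  have mm: "mon d n f (p # \<mu>) = Y d n p f * mon d n f \<mu>" by (simp add: mon_def)
  show "ALL x. prod_list (map (%p. Y d n p f + ep d * D d n p x) (p # \<mu>))
     = mon d n f (p # \<mu>) + ep d * B' d n f x + ep d * ep d * R' d n f x"
  proof
   fix x
   have "prod_list (map (%p. Y d n p f + ep d * D d n p x) \<mu>)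
     = mon d n f \<mu> + ep d * B d n f x + ep d * ep d * R d n f x" using eq A by blast
   then show "prod_list (map (%p. Y d n p f + ep d * D d n p x) (p # \<mu>))
     = mon d n f (p # \<mu>) + ep d * B' d n f x + ep d * ep d * R' d n f x"
    unfolding mm B'_def R'_def by (simp add: algebra_simps)
  qed
 qed
 ultimately show ?case
  by (intro exI[of _ B'] exI[of _ G'] exI[of _ R']) simp
qed

lemma EE_Q_bounded:
 assumes "!!\<mu>. ALL p:set \<mu>. 2 <= p ==> sum_list \<mu> <= w ==> EX C. ALL d>=1. ALL n<=d. \<bar>EE d n (%f. mon d n f \<mu>)\<bar> <= C"
  and "Q w (%d n f x. F d n f)"
 shows "EX C. ALL d>=1. ALL n<d. \<bar>EE d n (F d n)\<bar> <= C"
proof -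
 \<comment> \<open>The function of interest does not depend on x, so the induction over
   \<open>Q\<close> may evaluate everything at x = 0.\<close>
 have "EX C. ALL d>=1. ALL n<d. \<bar>EE d n (%f. F d n f 0)\<bar> <= C" if "Q w F" for F
  using that
 proof induction
  case (Q_mon c \<mu> k F)
  obtain C1 where C1: "!!d n. d >= 1 ==> n < d ==> \<bar>c d n\<bar> <= C1" by (fact bdcE[OF Q_mon(1)])
  obtain C2 where C2: "ALL d>=1. ALL n<=d. \<bar>EE d n (%f. mon d n f \<mu>)\<bar> <= C2"
   using assms(1)[of \<mu>] Q_mon(2,3) by auto
  have "\<bar>EE d n (%f. F d n f 0)\<bar> <= C1 * C2" if A: "d >= 1" "n < d" for d n
  proof -
   have "EE d n (%f. F d n f 0) = EE d n (%f. (c d n * 0 ^ k) * mon d n f \<mu>)"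
    by (rule EE_cong) (simp add: Q_mon(4)[OF A])
   also have "\<bar>...\<bar> = \<bar>c d n * 0 ^ k\<bar> * \<bar>EE d n (%f. mon d n f \<mu>)\<bar>" unfolding EE_cmult abs_mult ..
   also have "... <= C1 * C2"
   proof (rule mult_mono)
    show "\<bar>c d n * 0 ^ k\<bar> <= C1" using C1[OF A] by (cases k) auto
    show "\<bar>EE d n (%f. mon d n f \<mu>)\<bar> <= C2" using C2 A by simp
   qed (use C1[OF A] in auto)
   finally show ?thesis .
  qed
  then show ?case by blast
 next
  case (Q_add' F G H)
  obtain C1 where C1: "ALL d>=1. ALL n<d. \<bar>EE d n (%f. F d n f 0)\<bar> <= C1" using Q_add'.IH(1) by blast
  obtain C2 where C2: "ALL d>=1. ALL n<d. \<bar>EE d n (%f. G d n f 0)\<bar> <= C2" using Q_add'.IH(2) by blast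
  have "\<bar>EE d n (%f. H d n f 0)\<bar> <= C1 + C2" if A: "d >= 1" "n < d" for d n
  proof -
   have "EE d n (%f. H d n f 0) = EE d n (%f. F d n f 0 + G d n f 0)"
    by (rule EE_cong) (simp add: Q_add'(3)[OF A])
   moreover have "\<bar>EE d n (%f. F d n f 0)\<bar> <= C1" "\<bar>EE d n (%f. G d n f 0)\<bar> <= C2" using C1 C2 A by auto
   ultimately show ?thesis unfolding EE_add by linarith
  qed
  then show ?case by blast
 qed
 from this[OF assms(2)] show ?thesis .
qed

lemma hv_t0: "hv 0 e j = (if j = 0 then 1 else 0)"
proof -
 show ?thesis by (cases j) (simp_all add: hv_def)
qed

lemma ov_t0: "p >= 1 ==> ov 0 e p = 0"
proof -
 assume p: "p >= 1"
 have "newton (hv 0 e) (%_. 0)" unfolding newton_def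
  by (auto simp: hv_t0)
 from newton_pow_unique[OF newton_ov this _ p, of p] show ?thesis by simp
qed

lemma Y_0: "d >= 1 ==> p >= 1 ==> Y d 0 p (%_. 0) = 0"
 by (simp add: Y_def Om_def ov_t0 shape_moment_def)

lemma mon_bounded: "ALL p:set \<mu>. 2 <= p ==> EX C. ALL d>=1. ALL n<=d. \<bar>EE d n (%f. mon d n f \<mu>)\<bar> <= C"
proof (induction "sum_list \<mu>" arbitrary: \<mu> rule: less_induct)
 case less
 show ?case
 proof (cases "\<mu> = []")
  case True
  then show ?thesis by (intro exI[of _ 1]) (auto simp: mon_def EE_1)
 next
  case False
  then have pos: "sum_list \<mu> > 0" using less.prems by (cases \<mu>) auto
  obtain B G R where G: "Q (sum_list \<mu> - 1) (%d n f x. G d n f)" and R: "Q (sum_list \<mu> - 1) R"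
   and eq: "ALL d>=1. ALL n<d. ALL f:diagrams n. TT d n f (B d n f) = ep d * G d n f &
    (ALL x. prod_list (map (%p. Y d n p f + ep d * D d n p x) \<mu>)
     = mon d n f \<mu> + ep d * B d n f x + ep d * ep d * R d n f x)"
   using mon_step[OF less.prems] by (elim exE conjE) (rule that)
  define F where "F d n f = G d n f + TT d n f (R d n f)" for d n f
  have "Q (sum_list \<mu> - 1) (%d n f x. F d n f)" unfolding F_def by (intro Q_add G Q_TT[OF R])
  from EE_Q_bounded[OF _ this] less.hyps pos obtain C where
   C: "ALL d>=1. ALL n<d. \<bar>EE d n (F d n)\<bar> <= C" by (metis One_nat_def Suc_pred less_Suc_eq_le)
  \<comment> \<open>The increment of order \<open>ep d\<close> averages to order 1 / d, so that d
    steps change the expectation by a bounded amount.\<close>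
  have step: "EE d (Suc n) (%f. mon d (Suc n) f \<mu>) = EE d n (%f. mon d n f \<mu>) + (1 / real d) * EE d n (F d n)"
   if A: "d >= 1" "n < d" for d n
  proof -
   have "EE d (Suc n) (%f. mon d (Suc n) f \<mu>)
     = EE d n (%f. TT d n f (%x. prod_list (map (%p. Y d n p f + ep d * D d n p x) \<mu>)))"
    by (rule EE_Suc[OF A(1)]) (simp add: mon_def Y_Suc[OF A(1)] cong: map_cong)
   also have "... = EE d n (%f. mon d n f \<mu> + (1 / real d) * F d n f)"
   proof (rule EE_cong)
    fix f assume f: "f \<in> diagrams n"
    have "(%x. prod_list (map (%p. Y d n p f + ep d * D d n p x) \<mu>))
     = (%x. mon d n f \<mu> + ep d * B d n f x + (ep d * ep d) * R d n f x)"
     using eq A f by auto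
    moreover have "TT d n f (B d n f) = ep d * G d n f" using eq A f by blast
    ultimately show "TT d n f (%x. prod_list (map (%p. Y d n p f + ep d * D d n p x) \<mu>))
      = mon d n f \<mu> + (1 / real d) * F d n f"
     by (simp only: TT_add TT_cmult TT_const[OF A(1) f] F_def ep(4)[symmetric]) (simp only: distrib_left mult.assoc add.assoc)
   qed
   finally show ?thesis unfolding EE_add EE_cmult .
  qed
  have "\<bar>EE d n (%f. mon d n f \<mu>)\<bar> <= real n * (C / real d)" if "d >= 1" "n <= d" for d n
   using that(2)
  proof (induction n)
   case 0
   obtain p \<mu>' where "\<mu> = p # \<mu>'" using False by (cases \<mu>) auto
   then show ?case using less.prems Y_0[OF that(1), of p] by (simp add: EE_0 mon_def)
  next
   case (Suc n)
   have n: "n < d" using Suc.prems by simp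
   have "\<bar>EE d n (F d n)\<bar> <= C" using C that(1) n by blast
   then have "\<bar>(1 / real d) * EE d n (F d n)\<bar> <= C / real d" using that(1) by (simp add: abs_mult divide_right_mono)
   moreover have "real (Suc n) * (C / real d) = real n * (C / real d) + C / real d" by (simp add: distrib_right add_divide_distrib)
   moreover have "\<bar>EE d n (%f. mon d n f \<mu>)\<bar> <= real n * (C / real d)" using Suc.IH n by simp
   ultimately show ?case unfolding step[OF that(1) n] by linarith
  qed
  moreover have "real n * (C / real d) <= \<bar>C\<bar>" if "d >= 1" "n <= d" for d n
  proof -
   have "real n * (C / real d) = (real n / real d) * C" by simp
   also have "... <= (real n / real d) * \<bar>C\<bar>" by (intro mult_left_mono) auto
   also have "... <= 1 * \<bar>C\<bar>" using that by (intro mult_right_mono) auto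
   finally show ?thesis by simp
  qed
  ultimately show ?thesis by (intro exI[of _ "\<bar>C\<bar>"]) (meson order_trans)
 qed
qed

lemma Q_bounded:
 assumes "Q w (%d n f x. F d n f)"
 shows "EX C. ALL d>=1. ALL n<d. \<bar>EE d n (F d n)\<bar> <= C"
 using EE_Q_bounded[OF mon_bounded assms] .

lemma Q_abs_bounded:
 assumes "Q w (%d n f x. F d n f)"
 shows "EX C. ALL d>=1. ALL n<d. EE d n (%f. \<bar>F d n f\<bar>) <= C"
proof -
 have "Q (w + w) (%d n f x. F d n f * F d n f)" by (rule Q_mult[OF assms assms]) simp
 then have "Q (w + w) (%d n f x. 1 + F d n f * F d n f)" by (intro Q_add Q_const bdc_const)
 from Q_bounded[OF this] obtain C where C: "ALL d>=1. ALL n<d. \<bar>EE d n (%f. 1 + F d n f * F d n f)\<bar> <= C" by blast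
 have "EE d n (%f. \<bar>F d n f\<bar>) <= C" if A: "d >= 1" "n < d" for d n
 proof -
  have ineq: "\<bar>y\<bar> <= 1 + y * y" for y :: real
  proof (cases "\<bar>y\<bar> <= 1")
   case False
   then have "\<bar>y\<bar> * 1 <= \<bar>y\<bar> * \<bar>y\<bar>" by (intro mult_left_mono) auto
   then show ?thesis by simp
  next
   case True
   have "0 <= y * y" by simp
   then show ?thesis using True by linarith
  qed
  have "EE d n (%f. \<bar>F d n f\<bar>) <= EE d n (%f. 1 + F d n f * F d n f)" by (rule EE_mono[OF A(1) ineq])
  then show ?thesis using C A by (meson abs_le_D1 order_trans)
 qed
 then show ?thesis by blast
qed

lemma Y_second_moment:
 assumes "2 <= p"
 shows "EX C. ALL d>=1. EE d d (%f. (Y d d p f)^2) <= C"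
proof -
 obtain C where "ALL d>=1. ALL n<=d. \<bar>EE d n (%f. mon d n f [p, p])\<bar> <= C" using mon_bounded[of "[p, p]"] assms by auto
 then show ?thesis by (intro exI[of _ C]) (auto simp: mon_def power2_eq_square dest: abs_le_D1)
qed

end

section \<open>The central limit theorem\<close>

text \<open>\<open>Bs\<close> and \<open>Ss\<close> are the limits of \<open>Bm\<close> and
  \<open>Sm\<close> at time t, with parameter \<open>es\<close> and h = 0.\<close>

definition Bs :: "real => real => nat => nat => real" where
 "Bs es t p q = (\<Sum>j\<in>{q..p}. bcoef es 0 p j * hv t es (j - q)) / real q"

definition Ss :: "real => real => nat => nat => real" where
 "Ss es t p q = (\<Sum>j\<le>p. \<Sum>l\<le>q. bcoef es 0 p j * bcoef es 0 q l * (hv t es (j + l) - hv t es j * hv t es l))"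

lemma Bs_eq_0: "p <= Suc q ==> Bs es t p q = 0"
 by (auto simp: Bs_def bcoef_eq_0)

lemma norm_cis_taylor2: "norm (cis y - (1 + \<i> * of_real y - of_real (y^2 / 2))) <= \<bar>y\<bar> ^ 3"
proof -
 have "(\<Sum>k\<le>2. (\<i> * of_real y) ^ k / fact k) = 1 + \<i> * of_real y - (of_real (y^2 / 2) :: complex)"
  by (simp add: numeral_2_eq_2 power2_eq_square mult_ac)
 then have "norm (cis y - (1 + \<i> * of_real y - of_real (y^2 / 2))) <= \<bar>y\<bar> ^ Suc 2 / fact (Suc 2)"
  using iexp_approx1[of y 2] by (simp add: cis_conv_exp)
 also have "... <= \<bar>y\<bar> ^ Suc 2 / 1" by (rule divide_left_mono) (auto simp: fact_ge_1)
 finally show ?thesis by simp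
qed

section \<open>Diagonalising drift and covariance\<close>

definition dv :: "real => real => nat => nat => real" where
 "dv t e p m = (\<Sum>j\<le>p. bcoef e 0 p j * wv t e j m)"

lemma wv_support: "j < m ==> wv t e j m = 0"
 by (induction j arbitrary: m) auto

lemma rv_support: "n <= m ==> rv t e n m = 0"
 unfolding rv_def by (intro sum.neutral) (auto simp: wv_support)

lemma dv_rv: "p >= 1 ==> dv t e p m = real p * rv t e (p - 1) m"
 unfolding dv_def rv_def by (rule bcoef_sum)

lemma dv_support: "p <= Suc m ==> dv t e p m = 0"
 by (cases "p = 0") (auto simp: dv_rv rv_support, simp add: dv_def bcoef_def)

definition lop :: "real => real => (nat => real) => nat => real" where
 "lop t e x k = t * x (Suc k) + (if k = 0 then 0 else x (k - 1)) + e * real k * x k"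

lemma wv_lop: "wv t e (Suc j) = lop t e (wv t e j)"
 by (simp add: lop_def fun_eq_iff)

text \<open>The weights t^m make L symmetric: t times the lowering shift becomes adjoint to the
  raising shift. The hypotheses remove the boundary terms at row \<open>M\<close>.\<close>

lemma lop_sym:
 assumes "a M = 0" "b M = 0 | a (M - 1) = 0"
 shows "(\<Sum>m<M. t ^ m * (lop t e a m * b m)) = (\<Sum>m<M. t ^ m * (a m * lop t e b m))"
proof (cases M)
 case (Suc K)
 have 1: "(\<Sum>m<M. t ^ m * (t * a (Suc m) * b m)) = (\<Sum>m<M. t ^ m * (a m * (if m = 0 then 0 else b (m - 1))))"
  if "a M = 0" for a b
 proof -
  have "(\<Sum>m<M. t ^ m * (a m * (if m = 0 then 0 else b (m - 1)))) = (\<Sum>m<K. t ^ Suc m * (a (Suc m) * b m))"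
   unfolding Suc sum.lessThan_Suc_shift by simp
  moreover have "(\<Sum>m<M. t ^ m * (t * a (Suc m) * b m)) = (\<Sum>m<K. t ^ Suc m * (a (Suc m) * b m))"
   using that by (simp add: Suc mult_ac)
  ultimately show ?thesis by simp
 qed
 have 2: "(\<Sum>m<M. t ^ m * ((if m = 0 then 0 else a (m - 1)) * b m)) = (\<Sum>m<M. t ^ m * (a m * (t * b (Suc m))))"
 proof -
  have "(\<Sum>m<M. t ^ m * ((if m = 0 then 0 else a (m - 1)) * b m)) = (\<Sum>m<K. t ^ Suc m * (a m * b (Suc m)))"
   unfolding Suc sum.lessThan_Suc_shift by simp
  moreover have "(\<Sum>m<M. t ^ m * (a m * (t * b (Suc m)))) = (\<Sum>m<K. t ^ Suc m * (a m * b (Suc m)))"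
   using assms(2) by (auto simp: Suc mult_ac)
  ultimately show ?thesis by simp
 qed
 show ?thesis using 1[of a b, OF assms(1)] 2 unfolding lop_def
  by (simp add: distrib_left distrib_right sum.distrib mult_ac)
qed simp

text \<open>The right side is <L^j psi_0, L^l psi_0> in the weighted inner product; powers of L are
  moved across one at a time.\<close>

lemma hv_add: "j < M ==> hv t e (j + l) = (\<Sum>m<M. t ^ m * (wv t e j m * wv t e l m))"
proof (induction j arbitrary: l)
 case 0
 have "(\<Sum>m<M. t ^ m * (wv t e 0 m * wv t e l m)) = (\<Sum>m<M. if m = 0 then wv t e l 0 else 0)"
  by (intro sum.cong) auto
 then show ?case using 0 by (simp add: hv_def)
next
 case (Suc j)
 have "(\<Sum>m<M. t ^ m * (wv t e (Suc j) m * wv t e l m)) = (\<Sum>m<M. t ^ m * (wv t e j m * wv t e (Suc l) m))"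
  unfolding wv_lop by (rule lop_sym) (use Suc.prems in "auto simp: wv_support")
 then show ?case using Suc.IH[of "Suc l"] Suc.prems by simp
qed

text \<open>\<open>wv_deriv\<close> gives products of \<open>hv\<close> and \<open>rv\<close>, and
  by \<open>dv_rv\<close> the latter are again of the form \<open>dv t e q m / real q\<close>, so
  the columns \<open>dv\<close> solve the linear drift equation.\<close>

lemma dv_deriv: "((%t. dv t e p m) has_real_derivative (\<Sum>q=2..p. Bs e t p q * dv t e q m)) (at t)"
proof -
 have "((%t. dv t e p m) has_real_derivative (\<Sum>j\<le>p. bcoef e 0 p j * (\<Sum>a<j. hv t e a * rv t e (j - 1 - a) m))) (at t)"
  unfolding dv_def by (intro DERIV_sum DERIV_cmult wv_deriv)
 moreover have "(\<Sum>a<j. hv t e a * rv t e (j - 1 - a) m) = (\<Sum>q=2..p. if q <= j then hv t e (j - q) * dv t e q m / real q else 0)"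
  if "j <= p" for j
 proof -
  have "(\<Sum>a<j. hv t e a * rv t e (j - 1 - a) m) = (\<Sum>q=1..j. hv t e (j - q) * (dv t e q m / real q))"
   by (rule sum.reindex_bij_witness[of _ "%q. j - q" "%a. j - a"]) (auto simp: dv_rv)
  also have "... = (\<Sum>q=2..p. if q <= j then hv t e (j - q) * dv t e q m / real q else 0)"
   by (rule sum.mono_neutral_cong) (use that in "auto simp: dv_support not_le less_Suc_eq numeral_2_eq_2")
  finally show ?thesis .
 qed
 moreover have "(\<Sum>j\<le>p. bcoef e 0 p j * (\<Sum>q=2..p. if q <= j then hv t e (j - q) * dv t e q m / real q else 0))
   = (\<Sum>q=2..p. Bs e t p q * dv t e q m)"
 proof -
  have "(\<Sum>j\<le>p. bcoef e 0 p j * (if q <= j then hv t e (j - q) * dv t e q m / real q else 0)) = Bs e t p q * dv t e q m" for q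
  proof -
   have "(\<Sum>j\<le>p. bcoef e 0 p j * (if q <= j then hv t e (j - q) * dv t e q m / real q else 0))
     = (\<Sum>j\<in>{q..p}. bcoef e 0 p j * (hv t e (j - q) * dv t e q m / real q))"
    by (rule sum.mono_neutral_cong_right) auto
   then show ?thesis by (simp add: Bs_def sum_distrib_right sum_divide_distrib mult.assoc)
  qed
  then show ?thesis unfolding sum_distrib_left by (subst sum.swap) simp
 qed
 ultimately show ?thesis by simp
qed

text \<open>t^(m + 1) / (m + 1) is the integral of the weight t^m. Starting at m = 1 expresses that
  the size is fixed.\<close>

definition cov :: "real => real => nat => nat => real" where
 "cov e t p q = (\<Sum>m=1..p + q. t ^ Suc m / real (Suc m) * (dv t e p m * dv t e q m))"

lemma cov_eq: "p <= M ==> cov e t p q = (\<Sum>m=1..M. t ^ Suc m / real (Suc m) * (dv t e p m * dv t e q m))"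
 unfolding cov_def by (rule sum.mono_neutral_cong) (auto simp: dv_support not_le)

text \<open>The m = 0 term of \<open>hv_add\<close> is \<open>hv t e j * hv t e l\<close>, exactly
  the product of means subtracted in \<open>Ss\<close>.\<close>

lemma Ss_eq: "Ss e t p q = (\<Sum>m=1..p + q. t ^ m * (dv t e p m * dv t e q m))"
proof -
 let ?M = "Suc (p + q)"
 have h: "hv t e (j + l) - hv t e j * hv t e l = (\<Sum>m=1..p + q. t ^ m * (wv t e j m * wv t e l m))" if "j <= p" for j l
 proof -
  have "{..<?M} = insert 0 {1..p + q}" by auto
  moreover have "hv t e (j + l) = (\<Sum>m<?M. t ^ m * (wv t e j m * wv t e l m))" by (rule hv_add) (use that in simp)
  ultimately show ?thesis by (simp add: hv_def)
 qed
 have "Ss e t p q = (\<Sum>j\<le>p. \<Sum>l\<le>q. \<Sum>m=1..p + q. bcoef e 0 p j * bcoef e 0 q l * (t ^ m * (wv t e j m * wv t e l m)))"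
  unfolding Ss_def by (intro sum.cong refl) (simp add: h sum_distrib_left)
 also have "... = (\<Sum>m=1..p + q. \<Sum>j\<le>p. \<Sum>l\<le>q. bcoef e 0 p j * bcoef e 0 q l * (t ^ m * (wv t e j m * wv t e l m)))"
  by (subst sum.swap) (subst sum.swap, simp add: sum.swap[of _ "{..q}"])
 also have "... = (\<Sum>m=1..p + q. t ^ m * (dv t e p m * dv t e q m))"
  unfolding dv_def sum_product unfolding sum_distrib_left by (intro sum.cong refl) (simp add: mult_ac)
 finally show ?thesis .
qed

lemma sum_quadratic:
 fixes a :: "'a => 'b => real"
 shows "(\<Sum>p\<in>J. \<Sum>q\<in>J. s p * s q * (\<Sum>m\<in>K. c m * (a p m * a q m))) = (\<Sum>m\<in>K. c m * (\<Sum>p\<in>J. s p * a p m)^2)"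
proof -
 have "(\<Sum>p\<in>J. \<Sum>q\<in>J. s p * s q * (\<Sum>m\<in>K. c m * (a p m * a q m)))
  = (\<Sum>p\<in>J. \<Sum>m\<in>K. \<Sum>q\<in>J. c m * ((s p * a p m) * (s q * a q m)))"
  unfolding sum_distrib_left by (subst sum.swap[of _ K]) (simp add: mult_ac)
 also have "... = (\<Sum>m\<in>K. \<Sum>p\<in>J. \<Sum>q\<in>J. c m * ((s p * a p m) * (s q * a q m)))" by (rule sum.swap)
 finally show ?thesis unfolding power2_eq_square sum_product unfolding sum_distrib_left .
qed

lemma Ss_eq_le: "p <= M ==> Ss e t p q = (\<Sum>m=1..M. t ^ m * (dv t e p m * dv t e q m))"
 unfolding Ss_eq by (rule sum.mono_neutral_cong) (auto simp: dv_support not_le)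

section \<open>Convergence uniform in the number of boxes\<close>

locale jp_clt = jp_chain +
 fixes es :: real
 assumes ed_lim: "ed ----> es"
begin

definition unif0 :: "(nat => nat => real) => bool" where
 "unif0 c \<longleftrightarrow> (ALL eps>0. EX N. ALL d>=N. ALL n<d. \<bar>c d n\<bar> < eps)"

lemma unif0_add: "unif0 a ==> unif0 b ==> unif0 (%d n. a d n + b d n)"
 unfolding unif0_def
proof (intro allI impI)
 fix eps :: real
 assume A: "ALL eps>0. EX N. ALL d>=N. ALL n<d. \<bar>a d n\<bar> < eps" "ALL eps>0. EX N. ALL d>=N. ALL n<d. \<bar>b d n\<bar> < eps" "eps > 0"
 then have "eps / 2 > 0" by simp
 obtain N1 where N1: "ALL d>=N1. ALL n<d. \<bar>a d n\<bar> < eps / 2" using A(1) \<open>eps / 2 > 0\<close> by blast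
 obtain N2 where N2: "ALL d>=N2. ALL n<d. \<bar>b d n\<bar> < eps / 2" using A(2) \<open>eps / 2 > 0\<close> by blast
 have "\<bar>a d n + b d n\<bar> < eps" if "d >= max N1 N2" "n < d" for d n
 proof -
  have "\<bar>a d n\<bar> < eps / 2" "\<bar>b d n\<bar> < eps / 2" using N1 N2 that by auto
  then show ?thesis by linarith
 qed
 then show "EX N. ALL d>=N. ALL n<d. \<bar>a d n + b d n\<bar> < eps" by blast
qed

lemma unif0_mult: "bdc c ==> unif0 a ==> unif0 (%d n. c d n * a d n)"
 unfolding unif0_def
proof (intro allI impI)
 fix eps :: real
 assume c: "bdc c" and A: "ALL eps>0. EX N. ALL d>=N. ALL n<d. \<bar>a d n\<bar> < eps" "eps > 0"
 obtain C where C: "!!d n. d >= 1 ==> n < d ==> \<bar>c d n\<bar> <= C" by (fact bdcE[OF c])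
 have e: "eps / (\<bar>C\<bar> + 1) > 0" using A(2) by simp
 obtain N where N: "ALL d>=N. ALL n<d. \<bar>a d n\<bar> < eps / (\<bar>C\<bar> + 1)" using A(1) e by blast
 have "\<bar>c d n * a d n\<bar> < eps" if "d >= max N 1" "n < d" for d n
 proof -
  have 1: "\<bar>c d n\<bar> < \<bar>C\<bar> + 1" "\<bar>a d n\<bar> < eps / (\<bar>C\<bar> + 1)" using C[of d n] N that by auto
  have "\<bar>c d n\<bar> * \<bar>a d n\<bar> < (\<bar>C\<bar> + 1) * (eps / (\<bar>C\<bar> + 1))"
   by (rule mult_strict_mono'[OF 1]) auto
  then show ?thesis by (simp add: abs_mult)
 qed
 then show "EX N. ALL d>=N. ALL n<d. \<bar>c d n * a d n\<bar> < eps" by blast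
qed

lemma unif0_zero: "unif0 (%_ _. 0)" by (simp add: unif0_def)

lemma unif0_uminus: "unif0 a ==> unif0 (%d n. - a d n)" by (simp add: unif0_def)

lemma unif0_diff: "unif0 a ==> unif0 b ==> unif0 (%d n. a d n - b d n)"
 using unif0_add[OF _ unif0_uminus] by fastforce

lemma unif0_sum: "(!!i. i \<in> I ==> unif0 (c i)) ==> unif0 (%d n. \<Sum>i\<in>I. c i d n)"
 by (induction I rule: infinite_finite_induct) (auto intro: unif0_add unif0_zero)

lemma unif0_seq: "c ----> 0 ==> unif0 (%d n. c d)"
 unfolding unif0_def LIMSEQ_def by (simp add: dist_real_def) blast

lemma unif0_uniformly_continuous:
 fixes F :: "real \<times> real => real"
 assumes "continuous_on UNIV F"
 shows "unif0 (%d n. F (real n / real d, ed d) - F (real n / real d, es))"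
 unfolding unif0_def
proof (intro allI impI)
 fix eps :: real assume e: "eps > 0"
 let ?K = "{0..1} \<times> {es - 1..es + 1} :: (real \<times> real) set"
 have "uniformly_continuous_on ?K F"
  by (intro compact_uniformly_continuous compact_Times compact_Icc continuous_on_subset[OF assms]) auto
 then obtain \<delta> where \<delta>: "\<delta> > 0" "!!x y. x \<in> ?K ==> y \<in> ?K ==> dist y x < \<delta> ==> dist (F y) (F x) < eps"
  using e unfolding uniformly_continuous_on_def by metis
 obtain N where N: "!!d. d >= N ==> dist (ed d) es < min \<delta> 1"
  using ed_lim \<delta>(1) unfolding LIMSEQ_def by (metis min_less_iff_conj zero_less_one)
 have "\<bar>F (real n / real d, ed d) - F (real n / real d, es)\<bar> < eps" if "d >= max N 1" "n < d" for d n
 proof -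
  have dd: "dist (ed d) es < \<delta>" "dist (ed d) es < 1" using N[of d] that by auto
  have "dist (F (real n / real d, ed d)) (F (real n / real d, es)) < eps"
   using dd that in01[of d n] by (intro \<delta>(2)) (auto simp: dist_prod_def dist_real_def abs_less_iff)
  then show ?thesis by (simp add: dist_real_def)
 qed
 then show "EX N. ALL d>=N. ALL n<d. \<bar>F (real n / real d, ed d) - F (real n / real d, es)\<bar> < eps" by blast
qed

lemma bdc_cont1: "continuous_on {0..1} F ==> bdc (%d n. F (real n / real d))"
proof -
 assume F: "continuous_on {0..1} F"
 have "compact (F ` {0..1})" by (intro compact_continuous_image F compact_Icc)
 then obtain C where "ALL x:F ` {0..1}. \<bar>x\<bar> <= C" using compact_imp_bounded bounded_real by metis
 then show ?thesis using in01 by (intro bdcI[of _ C]) auto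
qed

lemma hv_cont1: "continuous_on S (%t. hv t es j)"
proof -
 have "continuous_on S (%t. (t, es))" by (intro continuous_intros)
 from continuous_on_compose2[OF continuous_on_hv[of j] this] show ?thesis by simp
qed

lemma unif0_hh: "unif0 (%d n. hh d n j - hv (real n / real d) es j)"
 using unif0_uniformly_continuous[OF continuous_on_hv[of j]] by (simp add: hh_def)

lemma unif0_bc: "unif0 (%d n. bc d p j - bcoef es 0 p j)"
proof (rule unif0_seq)
 have "isCont (%z. bcoef (fst z) (snd z) p j) (es, 0)"
  using continuous_on_bcoef continuous_on_eq_continuous_at[of UNIV] by blast
 moreover have "(%d. (ed d, 1 / real d)) ----> (es, 0)"
  by (intro tendsto_Pair ed_lim lim_1_over_n)
 ultimately have "(%d. bcoef (ed d) (1 / real d) p j) ----> bcoef es 0 p j"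
  using isCont_tendsto_compose by fastforce
 then show "(%d. bc d p j - bcoef es 0 p j) ----> 0"
  unfolding bc_def by (rule LIM_zero)
qed

lemma bdc_hv: "bdc (%d n. hv (real n / real d) es j)"
 by (rule bdc_cont1) (rule hv_cont1)

lemma unif0_prod_diff:
 assumes "bdc a" "bdc b'" "unif0 (%d n. a d n - a' d n)" "unif0 (%d n. b d n - b' d n)"
 shows "unif0 (%d n. a d n * b d n - a' d n * b' d n)"
proof -
 have "(%d n. a d n * b d n - a' d n * b' d n) = (%d n. a d n * (b d n - b' d n) + b' d n * (a d n - a' d n))"
  by (simp add: fun_eq_iff algebra_simps)
 then show ?thesis using unif0_add[OF unif0_mult[OF assms(1,4)] unif0_mult[OF assms(2,3)]] by simp
qed

lemma unif0_Bm: "unif0 (%d n. Bm d n p q - Bs es (real n / real d) p q)"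
proof -
 have "unif0 (%d n. 1 / real q * (\<Sum>j\<in>{q..p}. bc d p j * hh d n (j - q) - bcoef es 0 p j * hv (real n / real d) es (j - q)))"
  by (intro unif0_mult bdc_const unif0_sum unif0_prod_diff bdc_bc bdc_hv unif0_bc unif0_hh)
 then show ?thesis by (simp add: Bm_def Bs_def sum_subtractf diff_divide_distrib)
qed

lemma unif0_Sm: "unif0 (%d n. Sm d n p q - Ss es (real n / real d) p q)"
 unfolding Sm_def Ss_def sum_subtractf[symmetric]
proof (intro unif0_sum unif0_prod_diff bdc_mult bdc_bc bdc_const unif0_bc)
 fix j l
 show "bdc (%d n. hv (real n / real d) es (j + l) - hv (real n / real d) es j * hv (real n / real d) es l)"
  by (rule bdc_cont1) (intro continuous_intros hv_cont1)
 have "unif0 (%d n. (hh d n (j + l) - hv (real n / real d) es (j + l))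
   - (hh d n j * hh d n l - hv (real n / real d) es j * hv (real n / real d) es l))"
  by (intro unif0_diff unif0_hh unif0_prod_diff bdc_hh bdc_hv)
 then show "unif0 (%d n. (hh d n (j + l) - hh d n j * hh d n l)
   - (hv (real n / real d) es (j + l) - hv (real n / real d) es j * hv (real n / real d) es l))"
  by (simp add: algebra_simps)
qed

context
 fixes s :: "nat => real" and P :: nat
begin

text \<open>Coefficients of the test functional, transported backwards so that they absorb the linear drift.\<close>

primrec sv :: "nat => nat => nat => real" where
 "sv d 0 q = s q"
| "sv d (Suc k) q = sv d k q + (1 / real d) * (\<Sum>p=2..P. sv d k p * Bm d (d - Suc k) p q)"

text \<open>\<open>sv\<close> counts steps backwards from \<open>d\<close>, \<open>st\<close> is
  indexed by the number of boxes; \<open>sn d n\<close> belongs to n + 1 boxes, and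
  \<open>us\<close> is d times the difference of the two.\<close>

definition st :: "nat => nat => nat => real" where
 "st d n q = sv d (d - n) q"

definition sn :: "nat => nat => nat => real" where
 "sn d n q = st d (Suc n) q"

definition us :: "nat => nat => nat => real" where
 "us d n q = (\<Sum>p=2..P. sn d n p * Bm d n p q)"

lemma st_step: "n < d ==> st d n q = sn d n q + (1 / real d) * us d n q"
proof -
 assume n: "n < d"
 then have "d - n = Suc (d - Suc n)" "d - Suc (d - Suc n) = n" by auto
 then show ?thesis unfolding st_def us_def sn_def by (simp only: sv.simps)
qed

lemma st_end: "st d d q = s q" by (simp add: st_def)

text \<open>Discrete Gronwall: each step back multiplies the bound by at most 1 + P K / d, hence all
  of them by at most exp (P K).\<close>

lemma sv_bound: "EX C. ALL d>=1. ALL k<=d. ALL q:{2..P}. \<bar>sv d k q\<bar> <= C"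
proof -
 have "ALL p q. EX C. ALL d>=1. ALL n<d. \<bar>Bm d n p q\<bar> <= C" using bdc_Bm unfolding bdc_def by blast
 then obtain CB where CB: "!!p q d n. d >= 1 ==> n < d ==> \<bar>Bm d n p q\<bar> <= CB p q" by metis
 define K where "K = (\<Sum>p=2..P. \<Sum>q=2..P. \<bar>CB p q\<bar>)"
 define S where "S = (\<Sum>q=2..P. \<bar>s q\<bar>)"
 have K: "\<bar>Bm d n p q\<bar> <= K" if "d >= 1" "n < d" "p \<in> {2..P}" "q \<in> {2..P}" for d n p q
 proof -
  have "\<bar>Bm d n p q\<bar> <= \<bar>CB p q\<bar>" using CB[OF that(1,2), of p q] by linarith
  also have "... <= (\<Sum>q=2..P. \<bar>CB p q\<bar>)" by (rule member_le_sum) (use that in auto)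
  also have "... <= K" unfolding K_def by (rule member_le_sum[of p _ "%p. \<Sum>q=2..P. \<bar>CB p q\<bar>"]) (use that in "auto intro: sum_nonneg")
  finally show ?thesis .
 qed
 have K0: "K >= 0" "S >= 0" unfolding K_def S_def by (auto intro!: sum_nonneg)
 let ?R = "real P * K"
 have b: "\<bar>sv d k q\<bar> <= S * (1 + ?R / real d) ^ k" if "d >= 1" "k <= d" "q \<in> {2..P}" for d k q
  using that(2,3)
 proof (induction k arbitrary: q)
  case 0
  have "\<bar>s q\<bar> <= S" unfolding S_def by (rule member_le_sum[of q _ "%q. \<bar>s q\<bar>"]) (use 0 in auto)
  then show ?case by simp
 next
  case (Suc k)
  let ?X = "S * (1 + ?R / real d) ^ k"
  have X0: "?X >= 0" using K0 by (intro mult_nonneg_nonneg zero_le_power) auto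
  have "\<bar>\<Sum>p=2..P. sv d k p * Bm d (d - Suc k) p q\<bar> <= (\<Sum>p=2..P. ?X * K)"
  proof (rule order_trans[OF sum_abs], rule sum_mono)
   fix p assume p: "p \<in> {2..P}"
   show "\<bar>sv d k p * Bm d (d - Suc k) p q\<bar> <= ?X * K" unfolding abs_mult
    using Suc p that(1) X0 by (intro mult_mono Suc.IH K) auto
  qed
  also have "... <= real P * (?X * K)" using X0 K0 by (simp add: mult_right_mono)
  finally have "\<bar>(1 / real d) * (\<Sum>p=2..P. sv d k p * Bm d (d - Suc k) p q)\<bar> <= (1 / real d) * (real P * (?X * K))"
   unfolding abs_mult by (intro mult_mono) auto
  moreover have "\<bar>sv d k q\<bar> <= ?X" using Suc by auto
  ultimately have "\<bar>sv d (Suc k) q\<bar> <= ?X + (1 / real d) * (real P * (?X * K))" unfolding sv.simps by linarith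
  also have "... = S * (1 + ?R / real d) ^ Suc k" by (simp add: algebra_simps)
  finally show ?case .
 qed
 have "\<bar>sv d k q\<bar> <= S * exp ?R" if A: "d >= 1" "k <= d" "q \<in> {2..P}" for d k q
 proof -
  have "(1 + ?R / real d) ^ k <= (1 + ?R / real d) ^ d" using A K0 by (intro power_increasing) auto
  also have "... <= exp (?R / real d) ^ d" using K0 by (intro power_mono exp_ge_add_one_self) (auto intro: add_nonneg_nonneg)
  also have "... = exp ?R" using A by (simp flip: exp_of_nat_mult)
  finally show ?thesis using b[OF A] K0 by (meson mult_left_mono order_trans)
 qed
 then show ?thesis by blast
qed

lemma bdc_sn: "q \<in> {2..P} ==> bdc (%d n. sn d n q)"
proof -
 assume q: "q \<in> {2..P}"
 obtain C where "ALL d>=1. ALL k<=d. ALL q:{2..P}. \<bar>sv d k q\<bar> <= C" using sv_bound by blast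
 then show ?thesis using q by (intro bdcI[of _ C]) (auto simp: sn_def st_def)
qed

lemma bdc_us: "bdc (%d n. us d n q)"
 unfolding us_def by (intro bdc_sum bdc_mult bdc_sn bdc_Bm)

definition sg :: "nat => nat => real" where
 "sg d n = (\<Sum>p=2..P. \<Sum>q=2..P. sn d n p * sn d n q * Sm d n p q)"

lemma bdc_Sm: "bdc (%d n. Sm d n p q)"
proof -
 have "bdc (%d n. hh d n (j + l) - hh d n j * hh d n l)" for j l
  using bdc_add[OF bdc_hh bdc_uminus[OF bdc_mult[OF bdc_hh bdc_hh]]] by simp
 then show ?thesis unfolding Sm_def by (intro bdc_sum bdc_mult bdc_bc)
qed

lemma bdc_sg: "bdc sg"
proof -
 have "bdc (%d n. sg d n)" unfolding sg_def by (intro bdc_sum bdc_mult bdc_sn bdc_Sm)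
 then show ?thesis by simp
qed

end

end

context jp_clt
begin

lemma unif0_deriv:
 assumes F: "!!t. (F has_real_derivative F' t) (at t)" and F': "continuous_on {0..1} F'"
 shows "unif0 (%d n. real d * (F (real (Suc n) / real d) - F (real n / real d)) - F' (real n / real d))"
 unfolding unif0_def
proof (intro allI impI)
 fix eps :: real assume "eps > 0"
 then obtain eta where eta: "eta > 0" "!!x y. x \<in> {0..1} ==> y \<in> {0..1} ==> dist y x < eta ==> dist (F' y) (F' x) < eps"
  using compact_uniformly_continuous[OF F' compact_Icc] unfolding uniformly_continuous_on_def by metis
 obtain N where N: "N > 0" "1 / real N < eta" using eta(1) real_arch_inverse[of eta] by (auto simp: inverse_eq_divide)
 have "\<bar>real d * (F (real (Suc n) / real d) - F (real n / real d)) - F' (real n / real d)\<bar> < eps" if A: "d >= N" "n < d" for d n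
 proof -
  let ?t = "real n / real d" and ?u = "real (Suc n) / real d"
  have d: "real d > 0" using A by simp
  have tu: "0 <= ?t" "?t < ?u" "?u <= 1" "?u - ?t = 1 / real d" using A by (auto simp: field_simps)
  have "1 / real d <= 1 / real N" using A N(1) by (intro divide_left_mono) auto
  then have sm: "?u - ?t < eta" using N(2) tu(4) by linarith
  obtain z where z: "?t < z" "z < ?u" "F ?u - F ?t = (?u - ?t) * F' z" using MVT2[OF tu(2) F] by blast
  have "dist (F' z) (F' ?t) < eps"
   by (rule eta(2)) (use z tu sm less_imp_le[OF le_less_trans[OF tu(1) z(1)]] in "auto simp: dist_real_def")
  then show ?thesis unfolding z(3) tu(4) using d by (simp add: dist_real_def)
 qed
 then show "EX N. ALL d>=N. ALL n<d. \<bar>real d * (F (real (Suc n) / real d) - F (real n / real d)) - F' (real n / real d)\<bar> < eps" by blast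
qed

lemma unif0_telescope:
 assumes "unif0 eta" and V: "!!d n. n < d ==> V d (Suc n) - V d n = (1 / real d) * eta d n"
 shows "unif0 (%d n. V d d - V d n)" "(%d. V d d - V d 0) ----> 0"
proof -
 have *: "\<bar>V d d - V d n\<bar> <= eps" if "ALL n<d. \<bar>eta d n\<bar> < eps" "n <= d" "d > 0" for d n eps
 proof -
  have "V d d - V d n = (\<Sum>k=n..<d. V d (Suc k) - V d k)" using that(2) by (rule sum_Suc_diff'[symmetric])
  then have "\<bar>V d d - V d n\<bar> = \<bar>\<Sum>k=n..<d. (1 / real d) * eta d k\<bar>" by (simp add: V)
  also have "... <= (\<Sum>k=n..<d. (1 / real d) * eps)"
   by (rule order_trans[OF sum_abs], rule sum_mono) (use that in "auto simp: abs_mult divide_right_mono less_imp_le")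
  also have "... = (real (d - n) / real d) * eps" by simp
  also have "... <= 1 * eps" using that by (intro mult_right_mono) (auto intro: less_imp_le[OF le_less_trans[OF abs_ge_zero]])
  finally show ?thesis by simp
 qed
 have **: "EX N. ALL d>=N. ALL n<=d. \<bar>V d d - V d n\<bar> < eps" if "eps > 0" for eps
 proof -
  obtain N where N: "ALL d>=N. ALL n<d. \<bar>eta d n\<bar> < eps / 2"
   using assms(1)[unfolded unif0_def, rule_format, of "eps / 2"] \<open>eps > 0\<close> by auto
  have "\<bar>V d d - V d n\<bar> < eps" if "d >= Suc N" "n <= d" for d n
  proof -
   have "\<bar>V d d - V d n\<bar> <= eps / 2" by (rule *) (use N that in auto)
   then show ?thesis using \<open>eps > 0\<close> by simp
  qed
  then show ?thesis by blast
 qed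
 show "unif0 (%d n. V d d - V d n)" using ** unfolding unif0_def by (meson less_imp_le)
 show "(%d. V d d - V d 0) ----> 0"
 proof (rule LIMSEQ_I)
  fix eps :: real assume "eps > 0"
  from **[OF this] obtain N where "ALL d>=N. ALL n<=d. \<bar>V d d - V d n\<bar> < eps" ..
  then show "EX N. ALL d>=N. norm (V d d - V d 0 - 0) < eps" by (intro exI[of _ N]) simp
 qed
qed

context
 fixes s :: "nat => real" and P :: nat
begin

text \<open>The transport of the coefficients is dual to the evolution of \<^const>\<open>dv\<close>, so their pairing is almost constant.\<close>

lemma sg_limit:
 "(%d. (\<Sum>n<d. sg s P d n) / real d) ----> (\<Sum>p=2..P. \<Sum>q=2..P. s p * s q * cov es 1 p q)"
proof -
 let ?I = "{2..P}" and ?t = "%d n. real n / real d"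
 define B where "B q m t = (\<Sum>r\<in>?I. Bs es t q r * dv t es r m)" for q m t
 have dv: "((%t. dv t es q m) has_real_derivative B q m t) (at t)" if "q \<in> ?I" for q m t
 proof -
  have "(\<Sum>r=2..q. Bs es t q r * dv t es r m) = B q m t"
   unfolding B_def by (rule sum.mono_neutral_left) (use that in "auto simp: Bs_eq_0")
  then show ?thesis using dv_deriv[of es q m t] by simp
 qed
 have dc: "continuous_on S (%t. dv t es q m)" for S q m
  using dv_deriv[of es q m] by (intro continuous_at_imp_continuous_on ballI DERIV_isCont)
 have Bc: "continuous_on {0..1} (B q m)" for q m
  unfolding B_def Bs_def divide_inverse by (intro continuous_intros hv_cont1 dc)
 define \<delta> where "\<delta> q m d n = real d * (dv (?t d (Suc n)) es q m - dv (?t d n) es q m) - B q m (?t d n)" for q m d n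
 define eta where "eta m d n = (\<Sum>q\<in>?I. sn s P d n q * (\<delta> q m d n - (\<Sum>r\<in>?I. dv (?t d n) es r m * (Bm d n q r - Bs es (?t d n) q r))))" for m d n
 have u\<delta>: "unif0 (%d n. \<delta> q m d n)" if "q \<in> ?I" for q m unfolding \<delta>_def by (rule unif0_deriv[OF dv[OF that] Bc])
 have ueta: "unif0 (eta m)" for m
 proof -
  have "unif0 (%d n. eta m d n)"
   unfolding eta_def by (intro unif0_sum unif0_mult unif0_diff bdc_sn u\<delta> unif0_Bm bdc_cont1[OF dc])
  then show ?thesis by simp
 qed
 \<comment> \<open>\<open>U\<close> pairs coefficients and \<open>dv\<close> at equal times;
   \<open>V\<close> is off by one step, the form in which \<open>sg\<close> contains the
   pairing.\<close>
 define U where "U m d n = (\<Sum>q\<in>?I. st s P d n q * dv (?t d n) es q m)" for m d n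
 define V where "V m d n = (\<Sum>q\<in>?I. sn s P d n q * dv (?t d n) es q m)" for m d n
 define w where "w m d n = (\<Sum>q\<in>?I. us s P d n q * dv (?t d n) es q m)" for m d n
 have UV: "U m d n = V m d n + (1 / real d) * w m d n" if "n < d" for m d n
  unfolding U_def V_def w_def st_step[OF that] by (simp add: distrib_right sum.distrib sum_distrib_left)
 \<comment> \<open>Discrete product rule: the drift of \<open>dv\<close> and the backward drift of
   the coefficients cancel, leaving only the discretisation error \<open>eta\<close>.\<close>
 have "U m d (Suc n) - U m d n = (1 / real d) * eta m d n" if n: "n < d" for m d n
 proof -
  have e: "dv (?t d (Suc n)) es q m = dv (?t d n) es q m + (1 / real d) * (B q m (?t d n) + \<delta> q m d n)" for q
   using n by (simp add: \<delta>_def)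
  have "U m d (Suc n) = V m d n + (1 / real d) * (\<Sum>q\<in>?I. sn s P d n q * (B q m (?t d n) + \<delta> q m d n))"
   unfolding U_def V_def sn_def[symmetric] e by (simp add: distrib_left sum.distrib sum_distrib_left mult.left_commute)
  moreover have "w m d n = (\<Sum>q\<in>?I. sn s P d n q * (\<Sum>r\<in>?I. dv (?t d n) es r m * Bm d n q r))"
   unfolding w_def us_def sum_distrib_left sum_distrib_right by (subst sum.swap) (simp add: mult_ac)
  moreover have "eta m d n = (\<Sum>q\<in>?I. sn s P d n q * (B q m (?t d n) + \<delta> q m d n)) - (\<Sum>q\<in>?I. sn s P d n q * (\<Sum>r\<in>?I. dv (?t d n) es r m * Bm d n q r))"
   unfolding eta_def B_def sum_subtractf[symmetric] right_diff_distrib by (intro sum.cong refl) (simp add: algebra_simps sum_subtractf)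
  ultimately show ?thesis unfolding UV[OF n] by (simp add: right_diff_distrib)
 qed
 note tele = unif0_telescope(1)[OF ueta this]
 define u where "u m = (\<Sum>q\<in>?I. s q * dv 1 es q m)" for m
 have bV: "bdc (%d n. V m d n)" for m unfolding V_def by (intro bdc_sum bdc_mult bdc_sn bdc_cont1[OF dc])
 have bw: "bdc (%d n. w m d n)" for m unfolding w_def by (intro bdc_sum bdc_mult bdc_us bdc_cont1[OF dc])
 have u1: "unif0 (%d n. 1 / real d)" by (rule unif0_seq) (rule lim_1_over_n)
 have uV: "unif0 (%d n. V m d n - u m)" for m
 proof -
  have "unif0 (%d n. - (U m d d - U m d n) - w m d n * (1 / real d))"
   by (intro unif0_diff unif0_uminus unif0_mult bw u1 tele)
  moreover have "- (U m d d - U m d n) - w m d n * (1 / real d) = V m d n - u m" if "n < d" for d n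
   using that unfolding UV[OF that] by (simp add: U_def u_def st_end)
  ultimately show ?thesis unfolding unif0_def by metis
 qed
 \<comment> \<open>An antiderivative of the limiting one-step variance \<open>W'\<close>;
   \<open>W 1\<close> is the asserted limit, and the normalised sum of \<open>sg\<close> is compared
   with it as a Riemann sum.\<close>
 define W where "W t = (\<Sum>m=1..P. t ^ Suc m / real (Suc m) * (u m)^2)" for t
 define W' where "W' t = (\<Sum>m=1..P. t ^ m * (u m)^2)" for t
 have "(W has_real_derivative W' t) (at t)" for t
  unfolding W_def W'_def
 proof (intro DERIV_sum)
  fix m
  have "((%t. t ^ Suc m) has_real_derivative real (Suc m) * t ^ m) (at t)" using DERIV_pow[of "Suc m" t] by simp
  from DERIV_cmult_right[OF DERIV_cdivide[OF this, of "real (Suc m)"], of "(u m)^2"]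
  show "((%t. t ^ Suc m / real (Suc m) * (u m)^2) has_real_derivative t ^ m * (u m)^2) (at t)"
   by (simp del: power_Suc of_nat_Suc)
 qed
 then have uW: "unif0 (%d n. real d * (W (?t d (Suc n)) - W (?t d n)) - W' (?t d n))"
  by (rule unif0_deriv) (unfold W'_def, intro continuous_intros)
 define r where "r d n = (\<Sum>p\<in>?I. \<Sum>q\<in>?I. sn s P d n p * sn s P d n q * (Sm d n p q - Ss es (?t d n) p q))" for d n
 have sg: "sg s P d n = r d n + (\<Sum>m=1..P. ?t d n ^ m * (V m d n * V m d n))" for d n
 proof -
  have "(\<Sum>p\<in>?I. \<Sum>q\<in>?I. sn s P d n p * sn s P d n q * Ss es (?t d n) p q) = (\<Sum>m=1..P. ?t d n ^ m * (V m d n)^2)"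
   unfolding V_def sum_quadratic[symmetric] by (intro sum.cong refl) (simp add: Ss_eq_le[of _ P])
  then show ?thesis by (simp add: sg_def r_def right_diff_distrib sum_subtractf power2_eq_square)
 qed
 have "unif0 (%d n. r d n + (\<Sum>m=1..P. ?t d n ^ m * (V m d n * V m d n - u m * u m))
   - (real d * (W (?t d (Suc n)) - W (?t d n)) - W' (?t d n)))"
  unfolding r_def
  by (intro unif0_diff[OF unif0_add uW] unif0_sum unif0_mult unif0_prod_diff bdc_mult bdc_sn unif0_Sm uV bV bdc_const bdc_cont1 continuous_intros)
 moreover have "r d n + (\<Sum>m=1..P. ?t d n ^ m * (V m d n * V m d n - u m * u m))
   - (real d * (W (?t d (Suc n)) - W (?t d n)) - W' (?t d n)) = sg s P d n - real d * (W (?t d (Suc n)) - W (?t d n))" for d n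
  unfolding sg W'_def by (simp add: right_diff_distrib sum_subtractf power2_eq_square)
 ultimately have u: "unif0 (%d n. sg s P d n - real d * (W (?t d (Suc n)) - W (?t d n)))" by (simp only:)
 define Z where "Z d n = (\<Sum>k<n. sg s P d k) / real d - W (?t d n)" for d n
 have "(%d. Z d d - Z d 0) ----> 0"
 proof (rule unif0_telescope(2)[OF u])
  fix d n :: nat assume "n < d"
  then show "Z d (Suc n) - Z d n = (1 / real d) * (sg s P d n - real d * (W (?t d (Suc n)) - W (?t d n)))"
   by (simp add: Z_def add_divide_distrib right_diff_distrib)
 qed
 moreover have "W 1 = (\<Sum>p\<in>?I. \<Sum>q\<in>?I. s p * s q * cov es 1 p q)"
  unfolding W_def u_def sum_quadratic[symmetric] by (intro sum.cong refl) (simp add: cov_eq[of _ P])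
 then have "ALL d>=1. Z d d - Z d 0 = (\<Sum>n<d. sg s P d n) / real d - (\<Sum>p\<in>?I. \<Sum>q\<in>?I. s p * s q * cov es 1 p q)"
  by (simp add: Z_def W_def)
 ultimately have "(%d. (\<Sum>n<d. sg s P d n) / real d - (\<Sum>p\<in>?I. \<Sum>q\<in>?I. s p * s q * cov es 1 p q)) ----> 0"
  by (elim Lim_transform_eventually) (auto simp: eventually_sequentially)
 then show ?thesis by (rule LIM_zero_cancel)
qed

end

section \<open>One step of the characteristic function\<close>

lemma TT_cmultc: "TT d n f (%x. c * F x) = c * TT d n f F" for c :: complex
 by (simp add: TT_def sum_distrib_left)

lemma TT_of_real: "TT d n f (%x. complex_of_real (F x)) = complex_of_real (TT d n f F)"
 by (simp add: TT_def scaleR_conv_of_real)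

context
 fixes s :: "nat => real" and P :: nat
begin

definition Zn :: "nat => nat => (nat => nat) => real" where
 "Zn d n f = (\<Sum>q=2..P. st s P d n q * Y d n q f)"

text \<open>The increment of \<open>Zn\<close> divided by \<open>ep d\<close>: passing from the
  coefficients \<open>st\<close> to \<open>sn\<close> absorbs the linear drift, which is why the sum
  over \<open>Bm\<close> is subtracted.\<close>

definition zeta :: "nat => nat => (nat => nat) => real => real" where
 "zeta d n f x = (\<Sum>p=2..P. sn s P d n p * (D d n p x + (- ep d) * (\<Sum>q=2..P. Bm d n p q * Y d n q f)))"

lemma Zn_Suc:
 assumes "d >= 1" "n < d" "f \<in> diagrams n"
 shows "Zn d (Suc n) (add_box f i) = Zn d n f + ep d * zeta d n f (xc (ad d) (bd d) f i)"
proof -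
 let ?I = "{2..P}" and ?x = "xc (ad d) (bd d) f i"
 have "Zn d (Suc n) (add_box f i) = (\<Sum>p\<in>?I. sn s P d n p * Y d n p f) + ep d * (\<Sum>p\<in>?I. sn s P d n p * D d n p ?x)"
  unfolding Zn_def Y_Suc[OF assms(1,3)] sn_def[symmetric]
  by (simp add: distrib_left sum.distrib sum_distrib_left mult.left_commute)
 moreover have "Zn d n f = (\<Sum>q\<in>?I. sn s P d n q * Y d n q f) + (ep d * ep d) * (\<Sum>p\<in>?I. sn s P d n p * (\<Sum>q\<in>?I. Bm d n p q * Y d n q f))"
 proof -
  have "Zn d n f = (\<Sum>q\<in>?I. sn s P d n q * Y d n q f) + (ep d * ep d) * (\<Sum>q\<in>?I. us s P d n q * Y d n q f)"
   unfolding Zn_def st_step[OF assms(2)] ep(4) by (simp add: distrib_right sum.distrib sum_distrib_left)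
  also have "(\<Sum>q\<in>?I. us s P d n q * Y d n q f) = (\<Sum>q\<in>?I. \<Sum>p\<in>?I. sn s P d n p * (Bm d n p q * Y d n q f))"
   by (simp add: us_def sum_distrib_right mult.assoc)
  also have "... = (\<Sum>p\<in>?I. sn s P d n p * (\<Sum>q\<in>?I. Bm d n p q * Y d n q f))"
   unfolding sum_distrib_left by (rule sum.swap)
  finally show ?thesis .
 qed
 moreover have "ep d * zeta d n f ?x = ep d * (\<Sum>p\<in>?I. sn s P d n p * D d n p ?x)
   - (ep d * ep d) * (\<Sum>p\<in>?I. sn s P d n p * (\<Sum>q\<in>?I. Bm d n p q * Y d n q f))"
 proof -
  define b where "b p = (\<Sum>q\<in>?I. Bm d n p q * Y d n q f)" for p
  show ?thesis unfolding zeta_def b_def[symmetric] sum_distrib_left sum_subtractf[symmetric]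
   by (intro sum.cong refl) (simp add: algebra_simps)
 qed
 ultimately show ?thesis by linarith
qed

lemma Q_zeta: "Q P zeta"
proof -
 have "Q P (%d n f x. zeta d n f x)" unfolding zeta_def
 proof (intro Q_sum Q_cmult bdc_sn Q_add bdc_uminus bdc_ep bdc_Bm)
  fix p assume "p \<in> {2..P}"
  then show "Q P (%d n f x. D d n p x)" by (intro Q_mono[OF Q_D]) auto
 next
  fix q assume "q \<in> {2..P}"
  then show "Q P (%d n f x. Y d n q f)" by (intro Q_Y) auto
 qed
 then show ?thesis by simp
qed

lemma Bm_sum: "p <= P ==> (\<Sum>q=2..P. Bm d n p q * y q) = (\<Sum>q=2..p. Bm d n p q * y q)"
 by (rule sum.mono_neutral_right) (auto simp: Bm_def)

text \<open>With the linear drift absorbed, the conditional mean is only of second order in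
  \<open>ep d\<close>, so on average a step moves \<open>Zn\<close> by third order.\<close>

lemma TT_zeta:
 "EX w G. Q w (%d n f x. G d n f) & (ALL d>=1. ALL n<d. ALL f:diagrams n. TT d n f (zeta d n f) = ep d * ep d * G d n f)"
proof -
 have "ALL p:{2..P}. EX G. Q (p - 2) (%d n f x. G d n f) & (ALL d>=1. ALL n<d. ALL f:diagrams n.
   TT d n f (D d n p) = ep d * (\<Sum>q=2..p. Bm d n p q * Y d n q f) + ep d * ep d * G d n f)"
  using TT_D by auto
 from bchoice[OF this] obtain g where g: "ALL p:{2..P}. Q (p - 2) (%d n f x. g p d n f) & (ALL d>=1. ALL n<d. ALL f:diagrams n.
   TT d n f (D d n p) = ep d * (\<Sum>q=2..p. Bm d n p q * Y d n q f) + ep d * ep d * g p d n f)" ..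
 define G where "G d n f = (\<Sum>p=2..P. sn s P d n p * g p d n f)" for d n f
 have "Q P (%d n f x. G d n f)" unfolding G_def
 proof (intro Q_sum Q_cmult bdc_sn)
  fix p assume p: "p \<in> {2..P}"
  then have "Q (p - 2) (%d n f x. g p d n f)" using g by blast
  then show "Q P (%d n f x. g p d n f)" by (rule Q_mono) (use p in auto)
 qed
 moreover have "TT d n f (zeta d n f) = ep d * ep d * G d n f" if A: "d >= 1" "n < d" "f \<in> diagrams n" for d n f
 proof -
  have "TT d n f (zeta d n f) = (\<Sum>p=2..P. sn s P d n p * (TT d n f (D d n p) + (- ep d) * (\<Sum>q=2..P. Bm d n p q * Y d n q f)))"
   unfolding zeta_def TT_sum TT_cmult TT_add TT_const[OF A(1,3)] ..
  also have "... = (\<Sum>p=2..P. sn s P d n p * (ep d * ep d * g p d n f))"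
  proof (rule sum.cong[OF refl])
   fix p assume p: "p \<in> {2..P}"
   then have "TT d n f (D d n p) = ep d * (\<Sum>q=2..p. Bm d n p q * Y d n q f) + ep d * ep d * g p d n f"
    using g A by blast
   moreover have "(\<Sum>q=2..P. Bm d n p q * Y d n q f) = (\<Sum>q=2..p. Bm d n p q * Y d n q f)"
    using p by (intro Bm_sum) auto
   ultimately show "sn s P d n p * (TT d n f (D d n p) + (- ep d) * (\<Sum>q=2..P. Bm d n p q * Y d n q f))
     = sn s P d n p * (ep d * ep d * g p d n f)" by simp
  qed
  also have "... = ep d * ep d * G d n f" by (simp add: G_def sum_distrib_left mult_ac)
  finally show ?thesis .
 qed
 ultimately show ?thesis by blast
qed

lemma TT_zeta2:
 "EX w G. Q w (%d n f x. G d n f) & (ALL d>=1. ALL n<d. ALL f:diagrams n.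
   TT d n f (%x. zeta d n f x * zeta d n f x) = sg s P d n + ep d * G d n f)"
proof -
 let ?I = "{2..P}"
 have "ALL z:?I \<times> ?I. EX w G. Q w (%d n f x. G d n f) & (ALL d>=1. ALL n<d. ALL f:diagrams n.
   TT d n f (%x. D d n (fst z) x * D d n (snd z) x) = Sm d n (fst z) (snd z) + ep d * G d n f)"
  using TT_DD by auto
 from bchoice[OF this] obtain wf where "ALL z:?I \<times> ?I. EX G. Q (wf z) (%d n f x. G d n f) & (ALL d>=1. ALL n<d. ALL f:diagrams n.
   TT d n f (%x. D d n (fst z) x * D d n (snd z) x) = Sm d n (fst z) (snd z) + ep d * G d n f)" ..
 from bchoice[OF this] obtain g where g: "ALL z:?I \<times> ?I. Q (wf z) (%d n f x. g z d n f) & (ALL d>=1. ALL n<d. ALL f:diagrams n.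
   TT d n f (%x. D d n (fst z) x * D d n (snd z) x) = Sm d n (fst z) (snd z) + ep d * g z d n f)" ..
 define w where "w = P + P + (\<Sum>z\<in>?I \<times> ?I. wf z)"
 have wle: "wf z <= w" if "z \<in> ?I \<times> ?I" for z
 proof -
  have "wf z <= (\<Sum>z\<in>?I \<times> ?I. wf z)" using that by (intro member_le_sum) auto
  then show ?thesis by (simp add: w_def)
 qed
 define b where "b d n f p = (\<Sum>q\<in>?I. Bm d n p q * Y d n q f)" for d n f p
 have Qb: "Q P (%d n f x. b d n f p)" for p unfolding b_def
 proof (intro Q_sum Q_cmult bdc_Bm)
  fix q assume "q \<in> ?I"
  then show "Q P (%d n f x. Y d n q f)" by (intro Q_Y) auto
 qed
 have QD: "Q P (%d n f x. D d n p x)" if "p \<in> ?I" for p by (rule Q_mono[OF Q_D]) (use that in auto)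
 define R where "R p q d n f x = - (b d n f p * D d n q x) - b d n f q * D d n p x + ep d * (b d n f p * b d n f q)" for p q d n f x
 have QR: "Q w (%d n f x. R p q d n f x)" if "p \<in> ?I" "q \<in> ?I" for p q
 proof -
  have "Q w (%d n f x. (- 1) * (b d n f p * D d n q x) - b d n f q * D d n p x + ep d * (b d n f p * b d n f q))"
   by (intro Q_add Q_diff Q_cmult bdc_ep bdc_const Q_mult[OF Qb QD[OF that(1)]] Q_mult[OF Qb QD[OF that(2)]] Q_mult[OF Qb Qb])
     (auto simp: w_def)
  then show ?thesis unfolding R_def by simp
 qed
 define G where "G d n f = (\<Sum>p\<in>?I. \<Sum>q\<in>?I. sn s P d n p * sn s P d n q * (g (p, q) d n f + TT d n f (R p q d n f)))" for d n f
 have "Q w (%d n f x. G d n f)" unfolding G_def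
 proof (intro Q_sum Q_cmult bdc_mult bdc_sn Q_add Q_TT QR)
  fix p q assume pq: "p \<in> ?I" "q \<in> ?I"
  then have "Q (wf (p, q)) (%d n f x. g (p, q) d n f)" using g by blast
  then show "Q w (%d n f x. g (p, q) d n f)" by (rule Q_mono) (use wle pq in auto)
 qed
 moreover have "TT d n f (%x. zeta d n f x * zeta d n f x) = sg s P d n + ep d * G d n f"
  if A: "d >= 1" "n < d" "f \<in> diagrams n" for d n f
 proof -
  have "zeta d n f x * zeta d n f x = (\<Sum>p\<in>?I. \<Sum>q\<in>?I. (sn s P d n p * sn s P d n q) * (D d n p x * D d n q x + ep d * R p q d n f x))" for x
   unfolding zeta_def b_def[symmetric] sum_product R_def by (intro sum.cong refl) (simp add: algebra_simps)
  then have "TT d n f (%x. zeta d n f x * zeta d n f x)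
   = (\<Sum>p\<in>?I. \<Sum>q\<in>?I. (sn s P d n p * sn s P d n q) * (TT d n f (%x. D d n p x * D d n q x) + ep d * TT d n f (R p q d n f)))"
   by (simp only: TT_sum TT_cmult TT_add)
  also have "... = (\<Sum>p\<in>?I. \<Sum>q\<in>?I. (sn s P d n p * sn s P d n q) * (Sm d n p q + ep d * (g (p, q) d n f + TT d n f (R p q d n f))))"
  proof (intro sum.cong refl)
   fix p q assume pq: "p \<in> ?I" "q \<in> ?I"
   have "TT d n f (%x. D d n p x * D d n q x) = Sm d n p q + ep d * g (p, q) d n f"
    using g[rule_format, of "(p, q)"] pq A by auto
   then show "(sn s P d n p * sn s P d n q) * (TT d n f (%x. D d n p x * D d n q x) + ep d * TT d n f (R p q d n f))
     = (sn s P d n p * sn s P d n q) * (Sm d n p q + ep d * (g (p, q) d n f + TT d n f (R p q d n f)))"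
    by (simp add: distrib_left)
  qed
  also have "... = sg s P d n + ep d * G d n f"
   unfolding sg_def G_def sum_distrib_left sum.distrib[symmetric] by (intro sum.cong refl) (simp add: algebra_simps)
  finally show ?thesis .
 qed
 ultimately show ?thesis by blast
qed

text \<open>Second order Taylor expansion. The mean, the correction to the variance and the cubic
  remainder each contribute order ep^3, while \<open>sg\<close> does not depend on the diagram; so
  the step multiplies the characteristic function by 1 - sg / (2 d), and d errors of order ep^3 add
  up to order ep.\<close>

lemma EE_cis_step:
 "EX C. ALL d>=1. ALL n<d. norm (EE d (Suc n) (%f. cis (Zn d (Suc n) f))
   - EE d n (%f. cis (Zn d n f)) * of_real (1 - sg s P d n / (2 * real d))) <= C * ep d ^ 3"
proof -
 obtain w1 G1 where G1: "Q w1 (%d n f x. G1 d n f)" "ALL d>=1. ALL n<d. ALL f:diagrams n. TT d n f (zeta d n f) = ep d * ep d * G1 d n f"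
  using TT_zeta by blast
 obtain w2 G2 where G2: "Q w2 (%d n f x. G2 d n f)" "ALL d>=1. ALL n<d. ALL f:diagrams n.
   TT d n f (%x. zeta d n f x * zeta d n f x) = sg s P d n + ep d * G2 d n f"
  using TT_zeta2 by blast
 \<comment> \<open>1 + zeta^4 dominates |zeta|^3 and, unlike it, is a polynomial covered by the
   moment bounds.\<close>
 define G4 where "G4 d n f = TT d n f (%x. 1 + (zeta d n f x * zeta d n f x) * (zeta d n f x * zeta d n f x))" for d n f
 have z2: "Q (P + P) (%d n f x. zeta d n f x * zeta d n f x)" by (rule Q_mult[OF Q_zeta Q_zeta]) simp
 have z4: "Q ((P + P) + (P + P)) (%d n f x. G4 d n f)" unfolding G4_def
  by (intro Q_TT Q_add Q_const bdc_const Q_mult[OF z2 z2] order_refl)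
 obtain C1 where C1: "ALL d>=1. ALL n<d. EE d n (%f. \<bar>G1 d n f\<bar>) <= C1" using Q_abs_bounded[OF G1(1)] by blast
 obtain C2 where C2: "ALL d>=1. ALL n<d. EE d n (%f. \<bar>G2 d n f\<bar>) <= C2" using Q_abs_bounded[OF G2(1)] by blast
 obtain C4 where C4: "ALL d>=1. ALL n<d. EE d n (%f. \<bar>G4 d n f\<bar>) <= C4" using Q_abs_bounded[OF z4] by blast
 have "norm (EE d (Suc n) (%f. cis (Zn d (Suc n) f))
   - EE d n (%f. cis (Zn d n f)) * of_real (1 - sg s P d n / (2 * real d))) <= (C1 + C2 + C4) * ep d ^ 3"
  if A: "d >= 1" "n < d" for d n
 proof -
  let ?e = "ep d"
  have e0: "0 <= ?e" using ep(2) by simp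
  have loc: "norm (TT d n f (%x. cis (Zn d n f + ?e * zeta d n f x)) - cis (Zn d n f) * of_real (1 - sg s P d n / (2 * real d)))
    <= ?e ^ 3 * (\<bar>G1 d n f\<bar> + \<bar>G2 d n f\<bar> + \<bar>G4 d n f\<bar>)" if f: "f \<in> diagrams n" for f
  proof -
   define z where "z = zeta d n f"
   define r where "r x = cis (?e * z x) - (1 + \<i> * of_real (?e * z x) - of_real ((?e * z x)^2 / 2))" for x
   have "cis (Zn d n f + ?e * z x) = cis (Zn d n f) * (r x + (of_real (1 + (- (?e * ?e / 2)) * (z x * z x)) + \<i> * of_real (?e * z x)))" for x
    by (simp add: cis_mult[symmetric] r_def power2_eq_square mult_ac)
   then have "TT d n f (%x. cis (Zn d n f + ?e * z x))
    = cis (Zn d n f) * (TT d n f r + (of_real (1 + (- (?e * ?e / 2)) * TT d n f (%x. z x * z x)) + \<i> * of_real (?e * TT d n f z)))"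
    by (simp only: TT_cmultc TT_add TT_of_real TT_cmult TT_const[OF A(1) f])
   also have "TT d n f (%x. z x * z x) = sg s P d n + ?e * G2 d n f" using G2(2) A f by (simp add: z_def)
   also have "TT d n f z = ?e * ?e * G1 d n f" using G1(2) A f by (simp add: z_def)
   finally have "TT d n f (%x. cis (Zn d n f + ?e * z x)) - cis (Zn d n f) * of_real (1 - (?e * ?e) * sg s P d n / 2)
    = cis (Zn d n f) * (TT d n f r - of_real (?e ^ 3 * G2 d n f / 2) + \<i> * of_real (?e ^ 3 * G1 d n f))"
    by (simp add: algebra_simps power3_eq_cube add_divide_distrib)
   then have "norm (TT d n f (%x. cis (Zn d n f + ?e * z x)) - cis (Zn d n f) * of_real (1 - (?e * ?e) * sg s P d n / 2))
    = norm (TT d n f r - of_real (?e ^ 3 * G2 d n f / 2) + \<i> * of_real (?e ^ 3 * G1 d n f))"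
    by (simp add: norm_mult)
   also have "... <= norm (TT d n f r) + norm (complex_of_real (?e ^ 3 * G2 d n f / 2)) + norm (\<i> * complex_of_real (?e ^ 3 * G1 d n f))"
    by (meson norm_triangle_ineq norm_triangle_ineq4 add_mono order_refl order_trans)
   also have "norm (complex_of_real (?e ^ 3 * G2 d n f / 2)) = ?e ^ 3 * (\<bar>G2 d n f\<bar> / 2)"
    using e0 by (simp only: norm_of_real abs_mult abs_divide) simp
   also have "norm (\<i> * complex_of_real (?e ^ 3 * G1 d n f)) = ?e ^ 3 * \<bar>G1 d n f\<bar>"
    using e0 by (simp only: norm_mult norm_of_real abs_mult norm_ii) simp
   also have "norm (TT d n f r) <= ?e ^ 3 * \<bar>G4 d n f\<bar>"
   proof -
    have "norm (TT d n f r) <= TT d n f (%x. norm (r x))" by (rule norm_TT_le[OF A(1) f])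
    also have "... <= TT d n f (%x. ?e ^ 3 * (1 + (z x * z x) * (z x * z x)))"
    proof (rule TT_mono[OF A(1) f])
     fix x
     have "norm (r x) <= \<bar>?e * z x\<bar> ^ 3" unfolding r_def by (rule norm_cis_taylor2)
     also have "... = ?e ^ 3 * \<bar>z x\<bar> ^ 3" using e0 by (simp add: abs_mult power_mult_distrib)
     also have "\<bar>z x\<bar> ^ 3 <= 1 + (z x * z x) * (z x * z x)"
     proof (cases "\<bar>z x\<bar> <= 1")
      case True
      then have "\<bar>z x\<bar> ^ 3 <= 1" by (simp add: power_le_one)
      moreover have "0 <= (z x * z x) * (z x * z x)" by simp
      ultimately show ?thesis by linarith
     next
      case False
      then have "\<bar>z x\<bar> ^ 3 <= \<bar>z x\<bar> ^ 4" by (intro power_increasing) auto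
      also have "\<bar>z x\<bar> ^ 4 = (z x * z x) * (z x * z x)" by (simp add: power4_eq_xxxx)
      finally show ?thesis by linarith
     qed
     finally show "norm (r x) <= ?e ^ 3 * (1 + (z x * z x) * (z x * z x))" using e0 by (simp add: mult_left_mono)
    qed
    also have "... = ?e ^ 3 * G4 d n f" unfolding TT_cmult by (simp add: G4_def z_def)
    also have "... <= ?e ^ 3 * \<bar>G4 d n f\<bar>" using e0 by (intro mult_left_mono) auto
    finally show ?thesis .
   qed
   finally have "norm (TT d n f (%x. cis (Zn d n f + ?e * z x)) - cis (Zn d n f) * of_real (1 - (?e * ?e) * sg s P d n / 2))
     <= ?e ^ 3 * \<bar>G4 d n f\<bar> + ?e ^ 3 * (\<bar>G2 d n f\<bar> / 2) + ?e ^ 3 * \<bar>G1 d n f\<bar>" by simp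
   also have "... <= ?e ^ 3 * (\<bar>G1 d n f\<bar> + \<bar>G2 d n f\<bar> + \<bar>G4 d n f\<bar>)"
    unfolding distrib_left[symmetric] using e0 by (intro mult_left_mono) auto
   finally have "norm (TT d n f (%x. cis (Zn d n f + ?e * z x)) - cis (Zn d n f) * of_real (1 - (?e * ?e) * sg s P d n / 2))
     <= ?e ^ 3 * (\<bar>G1 d n f\<bar> + \<bar>G2 d n f\<bar> + \<bar>G4 d n f\<bar>)" .
   moreover have "(?e * ?e) * sg s P d n / 2 = sg s P d n / (2 * real d)" unfolding ep(4) by simp
   ultimately show ?thesis unfolding z_def by simp
  qed
  have "EE d (Suc n) (%f. cis (Zn d (Suc n) f)) = EE d n (%f. TT d n f (%x. cis (Zn d n f + ?e * zeta d n f x)))"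
   by (rule EE_Suc[OF A(1)]) (simp only: Zn_Suc[OF A])
  moreover have "EE d n (%f. cis (Zn d n f)) * of_real (1 - sg s P d n / (2 * real d))
    = EE d n (%f. cis (Zn d n f) * of_real (1 - sg s P d n / (2 * real d)))"
   unfolding mult.commute[of _ "of_real _"] EE_cmult ..
  ultimately have "norm (EE d (Suc n) (%f. cis (Zn d (Suc n) f))
    - EE d n (%f. cis (Zn d n f)) * of_real (1 - sg s P d n / (2 * real d)))
    = norm (EE d n (%f. TT d n f (%x. cis (Zn d n f + ?e * zeta d n f x)) - cis (Zn d n f) * of_real (1 - sg s P d n / (2 * real d))))"
   by (simp only: EE_diff)
  also have "... <= EE d n (%f. norm (TT d n f (%x. cis (Zn d n f + ?e * zeta d n f x)) - cis (Zn d n f) * of_real (1 - sg s P d n / (2 * real d))))"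
   by (rule norm_EE_le[OF A(1)])
  also have "... <= EE d n (%f. ?e ^ 3 * (\<bar>G1 d n f\<bar> + \<bar>G2 d n f\<bar> + \<bar>G4 d n f\<bar>))"
   by (rule EE_mono[OF A(1) loc])
  also have "... = ?e ^ 3 * (EE d n (%f. \<bar>G1 d n f\<bar>) + EE d n (%f. \<bar>G2 d n f\<bar>) + EE d n (%f. \<bar>G4 d n f\<bar>))"
   unfolding EE_cmult EE_add ..
  also have "... <= ?e ^ 3 * (C1 + C2 + C4)"
   using C1 C2 C4 A e0 by (intro mult_left_mono add_mono) auto
  finally show ?thesis by (simp only: mult.commute)
 qed
 then show ?thesis by blast
qed

lemma EE_cis_limit:
 "(%d. EE d d (%f. cis (\<Sum>p=2..P. s p * Y d d p f)))
   ----> of_real (exp (- (\<Sum>p=2..P. \<Sum>q=2..P. s p * s q * cov es 1 p q) / 2))"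
proof -
 define ph where "ph d n = EE d n (%f. cis (Zn d n f))" for d n
 obtain C1 where C1: "!!d n. d >= 1 ==> n < d ==>
   norm (ph d (Suc n) - ph d n * of_real (1 - sg s P d n / (2 * real d))) <= C1 * ep d ^ 3"
  using EE_cis_step unfolding ph_def by blast
 obtain C2 where C2: "!!d n. d >= 1 ==> n < d ==> \<bar>sg s P d n\<bar> <= C2" by (fact bdcE[OF bdc_sg])
 have C20: "C2 >= 0" using C2[of 1 0] by linarith
 have C10: "C1 >= 0"
 proof -
  have "0 <= norm (ph 1 (Suc 0) - ph 1 0 * of_real (1 - sg s P 1 0 / (2 * real 1)))" by simp
  also have "... <= C1 * ep 1 ^ 3" by (rule C1) auto
  finally show ?thesis by (simp add: ep_def)
 qed
 have ph1: "norm (ph d n) <= 1" if "d >= 1" for d n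
  unfolding ph_def using norm_EE_le[OF that, of n "%f. cis (Zn d n f)"] EE_1[OF that] by simp
 \<comment> \<open>Reciprocal of the product of the factors 1 - sg / (2 d) to leading order, written
   as an exponential; multiplying by it makes \<open>ph\<close> nearly constant in
   \<open>n\<close>.\<close>
 define E where "E d n = exp ((\<Sum>k<n. sg s P d k) / (2 * real d))" for d n
 have Eb: "0 < E d n" "E d n <= exp C2" "exp (- C2) <= E d n" if "d >= 1" "n <= d" for d n
 proof -
  have "\<bar>\<Sum>k<n. sg s P d k\<bar> <= (\<Sum>k<n. C2)"
   by (rule order_trans[OF sum_abs], rule sum_mono) (use C2 that in auto)
  also have "... = real n * C2" by simp
  also have "... <= real d * C2" using that C20 by (intro mult_right_mono) auto
  finally have "\<bar>\<Sum>k<n. sg s P d k\<bar> <= real d * C2" .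
  then have "\<bar>(\<Sum>k<n. sg s P d k) / (2 * real d)\<bar> <= C2 / 2" using that by (simp add: abs_divide field_simps)
  then have "- C2 <= (\<Sum>k<n. sg s P d k) / (2 * real d)" "(\<Sum>k<n. sg s P d k) / (2 * real d) <= C2"
   using C20 by linarith+
  then show "0 < E d n" "E d n <= exp C2" "exp (- C2) <= E d n"
   unfolding E_def by (simp_all only: exp_le_cancel_iff exp_gt_zero)
 qed
 have ep2: "ep d ^ 3 = ep d / real d" for d
  using ep(4)[of d] by (simp add: power3_eq_cube)
 define K where "K = exp C2 * C1 + exp C2 * (C2^2 * exp C2)"
 have step: "norm (ph d (Suc n) * of_real (E d (Suc n)) - ph d n * of_real (E d n)) <= K * (ep d / real d)"
  if A: "d >= 1" "n < d" for d n
 proof -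
  define x where "x = sg s P d n / (2 * real d)"
  have ES: "E d n = E d (Suc n) * exp (- x)"
   unfolding E_def exp_add[symmetric] by (simp add: x_def add_divide_distrib)
  have bx: "\<bar>x\<bar> <= C2 / real d"
  proof -
   have "\<bar>x\<bar> <= C2 / (2 * real d)" using C2[OF A] A by (simp add: x_def abs_divide divide_right_mono)
   also have "... <= C2 / real d" using A C20 by (intro divide_left_mono) auto
   finally show ?thesis .
  qed
  have xC: "\<bar>x\<bar> <= C2"
  proof -
   have "C2 / real d <= C2 / 1" using A C20 by (intro divide_left_mono) auto
   then show ?thesis using bx by simp
  qed
  have ex: "\<bar>1 - x - exp (- x)\<bar> <= C2^2 * exp C2 * (ep d / real d)"
  proof -
   have "\<bar>exp (- x) - (1 - x)\<bar> <= exp \<bar>x\<bar> * x^2"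
   proof -
    obtain t where t: "\<bar>t\<bar> <= \<bar>- x\<bar>" "exp (- x) = (\<Sum>m<2. (- x) ^ m / fact m) + exp t / fact 2 * (- x) ^ 2"
     using Maclaurin_exp_le[of "- x" 2] by auto
    have "exp (- x) - (1 - x) = exp t / 2 * x^2" unfolding t(2) by (simp add: numeral_2_eq_2)
    moreover have "exp t / 2 * x^2 <= exp \<bar>x\<bar> * x^2"
    proof (rule mult_right_mono)
     have "exp t <= exp \<bar>x\<bar>" using t(1) by simp
     moreover have "exp t > 0" by simp
     ultimately show "exp t / 2 <= exp \<bar>x\<bar>" by linarith
    qed simp
    moreover have "0 <= exp t / 2 * x^2" by simp
    ultimately show ?thesis by linarith
   qed
   also have "... <= exp C2 * (C2 / real d)^2"
    using bx xC by (intro mult_mono) (auto simp: abs_le_square_iff[symmetric] intro: order_trans[OF bx] simp: C20)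
   also have "... = C2^2 * exp C2 * (1 / real d / real d)" by (simp add: power_divide power2_eq_square)
   also have "... <= C2^2 * exp C2 * (ep d / real d)"
   proof (intro mult_left_mono divide_right_mono)
    have "1 / real d = ep d * ep d" by (simp add: ep(4))
    also have "... <= ep d * 1" using ep(1,3)[OF A(1)] by (intro mult_left_mono) auto
    finally show "1 / real d <= ep d" by simp
   qed auto
   finally show ?thesis by (simp add: abs_minus_commute)
  qed
  have n1: "Suc n <= d" using A by simp
  have "ph d (Suc n) * of_real (E d (Suc n)) - ph d n * of_real (E d n)
    = of_real (E d (Suc n)) * ((ph d (Suc n) - ph d n * of_real (1 - x)) + ph d n * of_real (1 - x - exp (- x)))"
   unfolding ES by (simp add: algebra_simps)
  also have "norm ... = E d (Suc n) * norm ((ph d (Suc n) - ph d n * of_real (1 - x)) + ph d n * of_real (1 - x - exp (- x)))"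
   using Eb(1)[OF A(1) n1] by (simp add: norm_mult)
  also have "... <= exp C2 * (C1 * ep d ^ 3 + 1 * (C2^2 * exp C2 * (ep d / real d)))"
  proof (rule mult_mono)
   have "norm (ph d n * of_real (1 - x - exp (- x))) <= 1 * (C2^2 * exp C2 * (ep d / real d))"
    unfolding norm_mult using ph1[OF A(1)] ex by (intro mult_mono) (auto simp del: of_real_diff simp: norm_of_real)
   then show "norm ((ph d (Suc n) - ph d n * of_real (1 - x)) + ph d n * of_real (1 - x - exp (- x)))
     <= C1 * ep d ^ 3 + 1 * (C2^2 * exp C2 * (ep d / real d))"
    using C1[OF A] unfolding x_def by (intro order_trans[OF norm_triangle_ineq] add_mono)
  qed (use Eb[OF A(1) n1] in auto)
  also have "... = K * (ep d / real d)" unfolding ep2 K_def by (simp add: algebra_simps add_divide_distrib)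
  finally show ?thesis .
 qed
 have ph0: "ph d 0 = 1" if "d >= 1" for d
  unfolding ph_def EE_0 Zn_def using Y_0[OF that] by simp
 have tot: "norm (ph d d * of_real (E d d) - 1) <= K * ep d" if d: "d >= 1" for d
 proof -
  have "ph d d * of_real (E d d) - ph d 0 * of_real (E d 0)
    = (\<Sum>n<d. ph d (Suc n) * of_real (E d (Suc n)) - ph d n * of_real (E d n))"
   by (rule sum_lessThan_telescope[symmetric])
  moreover have "ph d 0 * of_real (E d 0) = 1" using ph0[OF d] by (simp add: E_def)
  ultimately have "norm (ph d d * of_real (E d d) - 1)
    = norm (\<Sum>n<d. ph d (Suc n) * of_real (E d (Suc n)) - ph d n * of_real (E d n))" by simp
  also have "... <= (\<Sum>n<d. K * (ep d / real d))"
   by (rule order_trans[OF norm_sum], rule sum_mono) (use step d in simp)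
  also have "... = K * ep d" using d by simp
  finally show ?thesis .
 qed
 have "(%d. ep d) ----> 0"
 proof -
  have "(%d. sqrt (1 / real d)) ----> sqrt 0" by (intro tendsto_real_sqrt lim_1_over_n)
  then show ?thesis by (simp add: ep_def real_sqrt_divide)
 qed
 then have K0: "(%d. K * ep d) ----> 0" by (auto intro: tendsto_mult_right_zero)
 have "(%d. ph d d * of_real (E d d) - 1) ----> 0"
  by (rule Lim_null_comparison[OF _ K0]) (use tot in "auto intro!: eventually_sequentiallyI[of 1]")
 then have l1: "(%d. ph d d * of_real (E d d)) ----> 1" by (simp add: LIM_zero_iff)
 let ?q = "\<Sum>p=2..P. \<Sum>q=2..P. s p * s q * cov es 1 p q"
 have "(%d. exp (- ((\<Sum>k<d. sg s P d k) / real d) / 2)) ----> exp (- ?q / 2)"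
  by (intro tendsto_intros sg_limit) auto
 then have l2: "(%d. complex_of_real (exp (- ((\<Sum>k<d. sg s P d k) / real d) / 2))) ----> of_real (exp (- ?q / 2))"
  by (rule tendsto_of_real)
 have l3: "(%d. (ph d d * of_real (E d d)) * complex_of_real (exp (- ((\<Sum>k<d. sg s P d k) / real d) / 2))) ----> 1 * of_real (exp (- ?q / 2))"
  by (rule tendsto_mult[OF l1 l2])
 have eq: "(ph d d * of_real (E d d)) * complex_of_real (exp (- ((\<Sum>k<d. sg s P d k) / real d) / 2)) = ph d d" for d
 proof -
  have "E d d * exp (- ((\<Sum>k<d. sg s P d k) / real d) / 2) = 1"
   unfolding E_def exp_add[symmetric] by simp
  then show ?thesis by (metis mult.assoc mult.right_neutral of_real_1 of_real_mult)
 qed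
 show ?thesis using l3 unfolding eq mult_1_left unfolding ph_def Zn_def st_end .
qed

end

end

section \<open>Pairings of piecewise linear functions\<close>

lemma vector_derivative2:
 assumes "!!x. (phi has_vector_derivative phi' x) (at x)" "!!x. (phi' has_vector_derivative phi'' x) (at x)"
 shows "vector_derivative (%x. vector_derivative phi (at x)) (at c) = phi'' c"
proof -
 have "(%x. vector_derivative phi (at x)) = phi'" using assms(1) vector_derivative_at by blast
 then show ?thesis using assms(2) vector_derivative_at by metis
qed

lemma has_integral_abs_second_derivative:
 fixes phi :: "real => 'a::banach"
 assumes d1: "!!x. (phi has_vector_derivative phi' x) (at x)" and d2: "!!x. (phi' has_vector_derivative phi'' x) (at x)"
  and a: "-L <= a" "a <= L"
 shows "((%c. \<bar>c - a\<bar> *\<^sub>R phi'' c) has_integral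
   (2 *\<^sub>R phi a + (L - a) *\<^sub>R phi' L - phi L - (L + a) *\<^sub>R phi' (-L) - phi (-L))) {-L..L}"
proof -
 have 1: "((%c. (c - a) *\<^sub>R phi'' c) has_integral
   (((L - a) *\<^sub>R phi' L - phi L) - ((a - a) *\<^sub>R phi' a - phi a))) {a..L}"
  by (rule fundamental_theorem_of_calculus[OF a(2)])
    (auto intro!: derivative_eq_intros has_vector_derivative_at_within[OF d1] has_vector_derivative_at_within[OF d2])
 have 2: "((%c. (a - c) *\<^sub>R phi'' c) has_integral
   (((a - a) *\<^sub>R phi' a + phi a) - ((a - (-L)) *\<^sub>R phi' (-L) + phi (-L)))) {-L..a}"
  by (rule fundamental_theorem_of_calculus[OF a(1)])
    (auto intro!: derivative_eq_intros has_vector_derivative_at_within[OF d1] has_vector_derivative_at_within[OF d2])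
 have i1: "((%c. \<bar>c - a\<bar> *\<^sub>R phi'' c) has_integral
   (((L - a) *\<^sub>R phi' L - phi L) - ((a - a) *\<^sub>R phi' a - phi a))) {a..L}"
  by (rule has_integral_eq[OF _ 1]) auto
 have i2: "((%c. \<bar>c - a\<bar> *\<^sub>R phi'' c) has_integral
   (((a - a) *\<^sub>R phi' a + phi a) - ((a - (-L)) *\<^sub>R phi' (-L) + phi (-L)))) {-L..a}"
  by (rule has_integral_eq[OF _ 2]) auto
 show ?thesis using has_integral_combine[OF a i2 i1]
  by (simp add: scaleR_2 algebra_simps)
qed

text \<open>The two balance conditions make the function vanish outside a bounded interval and also
  cancel the boundary terms of the double integration by parts.\<close>

lemma half_dd_abs_sum:
 fixes phi :: "real => 'a::euclidean_space"
 assumes d1: "!!x. (phi has_vector_derivative phi' x) (at x)" and d2: "!!x. (phi' has_vector_derivative phi'' x) (at x)"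
  and c: "continuous_on UNIV phi''" and I: "finite I" and m: "(\<Sum>i\<in>I. m i) = 0" "(\<Sum>i\<in>I. m i * a i) = 0"
 shows "half_dd (%c. \<Sum>i\<in>I. m i * \<bar>c - a i\<bar>) phi = (\<Sum>i\<in>I. m i *\<^sub>R phi (a i))"
proof -
 define L where "L = (\<Sum>i\<in>I. \<bar>a i\<bar>)"
 have L: "\<bar>a i\<bar> <= L" if "i \<in> I" for i unfolding L_def using that I by (intro member_le_sum) auto
 define g where "g c = (\<Sum>i\<in>I. m i * \<bar>c - a i\<bar>)" for c
 have g0: "g c = 0" if "c ~: {-L..L}" for c
 proof -
  have "g c = (\<Sum>i\<in>I. m i * (sgn c * (c - a i)))" unfolding g_def
  proof (rule sum.cong[OF refl])
   fix i assume "i \<in> I"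
   then show "m i * \<bar>c - a i\<bar> = m i * (sgn c * (c - a i))" using L[of i] that by (auto simp: sgn_real_def abs_if)
  qed
  also have "... = sgn c * ((\<Sum>i\<in>I. m i) * c - (\<Sum>i\<in>I. m i * a i))"
   unfolding sum_distrib_left sum_distrib_right sum_subtractf[symmetric] by (rule sum.cong) (auto simp: algebra_simps)
  finally show ?thesis using m by simp
 qed
 have cont: "continuous_on {-L..L} (%c. g c *\<^sub>R phi'' c)"
  unfolding g_def by (intro continuous_intros continuous_on_subset[OF c]) auto
 have "(\<integral>c. g c *\<^sub>R phi'' c \<partial>lborel) = (LINT c:{-L..L}|lborel. g c *\<^sub>R phi'' c)"
  unfolding set_lebesgue_integral_def
 proof (rule Bochner_Integration.integral_cong[OF refl])
  fix c show "g c *\<^sub>R phi'' c = indicator {-L..L} c *\<^sub>R g c *\<^sub>R phi'' c"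
   using g0[of c] by (cases "c \<in> {-L..L}") simp_all
 qed
 also have "... = integral {-L..L} (%c. g c *\<^sub>R phi'' c)"
  by (rule set_borel_integral_eq_integral(2)[OF borel_integrable_atLeastAtMost'[OF cont]])
 also have "... = (\<Sum>i\<in>I. m i *\<^sub>R (2 *\<^sub>R phi (a i) + (L - a i) *\<^sub>R phi' L - phi L - (L + a i) *\<^sub>R phi' (-L) - phi (-L)))"
 proof (rule integral_unique)
  have "((%c. \<Sum>i\<in>I. m i *\<^sub>R (\<bar>c - a i\<bar> *\<^sub>R phi'' c)) has_integral
    (\<Sum>i\<in>I. m i *\<^sub>R (2 *\<^sub>R phi (a i) + (L - a i) *\<^sub>R phi' L - phi L - (L + a i) *\<^sub>R phi' (-L) - phi (-L)))) {-L..L}"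
  proof (intro has_integral_sum[OF I] has_integral_scaleR_left has_integral_cmul has_integral_abs_second_derivative d1 d2)
   fix i assume "i \<in> I" then show "- L <= a i" "a i <= L" using L[of i] by auto
  qed
  then show "((%c. g c *\<^sub>R phi'' c) has_integral
    (\<Sum>i\<in>I. m i *\<^sub>R (2 *\<^sub>R phi (a i) + (L - a i) *\<^sub>R phi' L - phi L - (L + a i) *\<^sub>R phi' (-L) - phi (-L)))) {-L..L}"
   by (simp add: g_def scaleR_sum_left)
 qed
 also have "... = 2 *\<^sub>R (\<Sum>i\<in>I. m i *\<^sub>R phi (a i)) + (\<Sum>i\<in>I. m i) *\<^sub>R (L *\<^sub>R phi' L - phi L - L *\<^sub>R phi' (-L) - phi (-L))
   - (\<Sum>i\<in>I. m i * a i) *\<^sub>R (phi' L + phi' (-L))"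
  unfolding scaleR_sum_right scaleR_sum_left sum.distrib[symmetric] sum_subtractf[symmetric]
  by (rule sum.cong) (auto simp: algebra_simps)
 finally have "(\<integral>c. g c *\<^sub>R phi'' c \<partial>lborel) = 2 *\<^sub>R (\<Sum>i\<in>I. m i *\<^sub>R phi (a i))" using m by simp
 then show ?thesis unfolding half_dd_def vector_derivative2[OF d1 d2] g_def by simp
qed

lemma pow_vector_derivs:
 "((%c::real. c ^ p) has_vector_derivative real p * x ^ (p - 1)) (at x)"
 "((%c::real. real p * c ^ (p - 1)) has_vector_derivative real p * (real p - 1) * x ^ (p - 2)) (at x)"
proof -
 show "((%c::real. c ^ p) has_vector_derivative real p * x ^ (p - 1)) (at x)"
  unfolding has_real_derivative_iff_has_vector_derivative[symmetric] by (auto intro!: derivative_eq_intros)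
 show "((%c::real. real p * c ^ (p - 1)) has_vector_derivative real p * (real p - 1) * x ^ (p - 2)) (at x)"
  unfolding has_real_derivative_iff_has_vector_derivative[symmetric]
  by (cases p) (auto intro!: derivative_eq_intros simp: numeral_2_eq_2)
qed

lemma half_dd_pow:
 "half_dd g (%c::real. c ^ p) = (1/2) * (\<integral>c. g c * (real p * (real p - 1) * c ^ (p - 2)) \<partial>lborel)"
 unfolding half_dd_def vector_derivative2[OF pow_vector_derivs] by simp

lemma half_dd_linear_statistic:
 "half_dd g (%c::real. c ^ p) = linear_statistic p (%q. \<integral>c. c ^ q * g c \<partial>lborel)"
proof -
 have "(\<integral>c. g c * (real p * (real p - 1) * c ^ (p - 2)) \<partial>lborel)
  = (\<integral>c. (real p * (real p - 1)) * (c ^ (p - 2) * g c) \<partial>lborel)" by (simp add: mult_ac)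
 then show ?thesis unfolding half_dd_pow linear_statistic_def by simp
qed

text \<open>For nonreal u the value 1 / (u - c) is never real, so the principal logarithm is smooth
  along the whole real line.\<close>

lemma log_kernel_derivs:
 fixes u :: complex
 assumes u: "u ~: \<real>"
 shows "((%c. Ln (1 / (u - complex_of_real c))) has_vector_derivative 1 / (u - complex_of_real x)) (at x)"
  "((%c. 1 / (u - complex_of_real c)) has_vector_derivative 1 / (u - complex_of_real x)^2) (at x)"
proof -
 have nz: "u - complex_of_real x ~= 0" using u by auto
 have "1 / (u - complex_of_real x) ~: \<real>"
 proof
  assume "1 / (u - complex_of_real x) \<in> \<real>"
  then have "u - complex_of_real x \<in> \<real>" by (metis Reals_inverse inverse_inverse_eq inverse_eq_divide)
  then have "u - complex_of_real x + complex_of_real x \<in> \<real>" by (intro Reals_add) auto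
  then show False using u by simp
 qed
 then have np: "1 / (u - complex_of_real x) ~: \<real>\<^sub>\<le>\<^sub>0" using nonpos_Reals_subset_Reals by blast
 have inv: "((%z. 1 / (u - z)) has_field_derivative 1 / (u - complex_of_real x)^2) (at (complex_of_real x))"
  using nz by (auto intro!: derivative_eq_intros simp: power2_eq_square)
 have "((%z. Ln (1 / (u - z))) has_field_derivative inverse (1 / (u - complex_of_real x)) * (1 / (u - complex_of_real x)^2))
   (at (complex_of_real x))"
  by (rule DERIV_chain2[OF has_field_derivative_Ln[OF np] inv])
 then have "((%z. Ln (1 / (u - z))) has_field_derivative 1 / (u - complex_of_real x)) (at (complex_of_real x))"
  by (rule DERIV_cong) (use nz in "simp add: power2_eq_square")
 from has_vector_derivative_real_field[OF this]
 show "((%c. Ln (1 / (u - complex_of_real c))) has_vector_derivative 1 / (u - complex_of_real x)) (at x)" .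
 from has_vector_derivative_real_field[OF inv]
 show "((%c. 1 / (u - complex_of_real c)) has_vector_derivative 1 / (u - complex_of_real x)^2) (at x)" .
qed

lemma half_dd_log:
 "u ~: \<real> ==> half_dd g (%c. Ln (1 / (u - complex_of_real c)))
   = (1/2) *\<^sub>R (\<integral>c. g c *\<^sub>R (1 / (u - complex_of_real c)^2) \<partial>lborel)"
 unfolding half_dd_def vector_derivative2[OF log_kernel_derivs] ..

section \<open>Uniqueness of the action profile\<close>

lemma integrable_cauchy: "integrable lborel (%s::real. 1 / (1 + s^2))"
 using integrable_I0i_1_div_plus_square integrable_inverse_1_plus_square
 by (simp add: set_integrable_def einterval_def inverse_eq_divide)

lemma integral_cauchy: "(\<integral>s. 1 / (1 + s^2) \<partial>(lborel :: real measure)) = pi"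
 using LBINT_inverse_1_plus_square
 by (simp add: interval_lebesgue_integral_def set_lebesgue_integral_def einterval_def inverse_eq_divide)

lemma integrable_cauchy_affine:
 assumes "y ~= 0" shows "integrable lborel (%c::real. 1 / ((x - c)^2 + y^2))"
proof -
 have "1 / ((x - (x + y * s))^2 + y^2) = 1 / y^2 * (1 / (1 + s^2))" for s by (simp add: power_mult_distrib distrib_left add.commute)
 then have "integrable lborel (%s. 1 / ((x - (x + y * s))^2 + y^2))"
  using integrable_mult_right[OF integrable_cauchy, of "1 / y^2"] by (simp only:)
 then show ?thesis using lborel_integrable_real_affine_iff[OF assms, of "%c. 1 / ((x - c)^2 + y^2)" x] by simp
qed

lemma real_borel_continuous: "continuous_on UNIV (f :: real => 'a::euclidean_space) ==> f \<in> borel_measurable borel"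
 by (rule borel_measurable_continuous_onI)

lemma dct_cauchy:
 fixes F :: "nat => real => real"
 assumes F: "!!n. F n \<in> borel_measurable borel" "!!n s. \<bar>F n s\<bar> <= G"
  and f: "AE s in lborel. (%n. F n s) ----> l"
 shows "(%n. \<integral>s. F n s * (1 / (1 + s^2)) \<partial>lborel) ----> pi * l"
proof -
 have "(%n. \<integral>s. F n s * (1 / (1 + s^2)) \<partial>lborel) ----> (\<integral>s. l * (1 / (1 + s^2)) \<partial>lborel)"
 proof (rule integral_dominated_convergence)
  show "integrable lborel (%s. G * (1 / (1 + s^2)))" by (intro integrable_mult_right integrable_cauchy)
  show "(%s. F n s * (1 / (1 + s^2))) \<in> borel_measurable lborel" for n using F(1)[of n] by simp
  show "AE s in lborel. (%n. F n s * (1 / (1 + s^2))) ----> l * (1 / (1 + s^2))"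
   using f by eventually_elim (intro tendsto_intros)
  show "AE s in lborel. norm (F n s * (1 / (1 + s^2))) <= G * (1 / (1 + s^2))" for n
   using F(2)[of n] by (auto simp: abs_mult divide_right_mono)
 qed simp
 then show ?thesis by (simp only: integral_mult_right_zero integral_cauchy mult.commute)
qed

locale decaying =
 fixes g :: "real => real"
 assumes cont: "continuous_on UNIV g" and top: "(g \<longlongrightarrow> 0) at_top" and bot: "(g \<longlongrightarrow> 0) at_bot"
begin

lemma bounded: "EX G. ALL c. \<bar>g c\<bar> <= G"
proof -
 obtain a where a: "!!c. c >= a ==> \<bar>g c\<bar> < 1"
  using tendstoD[OF top, of 1] by (auto simp: eventually_at_top_linorder dist_real_def)
 obtain b where b: "!!c. c <= b ==> \<bar>g c\<bar> < 1"
  using tendstoD[OF bot, of 1] by (auto simp: eventually_at_bot_linorder dist_real_def)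
 have "compact (g ` {b..a})" by (intro compact_continuous_image continuous_on_subset[OF cont]) auto
 then obtain G where G: "ALL x:g ` {b..a}. \<bar>x\<bar> <= G" using compact_imp_bounded bounded_real by metis
 have "\<bar>g c\<bar> <= max G 1" for c
  using a[of c] b[of c] G by (cases "c >= a"; cases "c <= b") (auto intro: order_trans[OF _ max.cobounded1])
 then show ?thesis by blast
qed

lemma affine_lim:
 assumes "s ~= 0" "filterlim y at_top sequentially"
 shows "(%n. g (x + y n * s)) ----> 0"
proof (cases "s > 0")
 case True
 have "filterlim (%n. x + y n * s) at_top sequentially"
  by (rule filterlim_tendsto_add_at_top[OF tendsto_const filterlim_at_top_mult_tendsto_pos[OF tendsto_const True assms(2)]])
 then show ?thesis by (rule filterlim_compose[OF top])
next
 case False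
 then have "s < 0" using assms by simp
 have "filterlim (%n. (- x) + y n * (- s)) at_top sequentially"
  by (rule filterlim_tendsto_add_at_top[OF tendsto_const filterlim_at_top_mult_tendsto_pos[OF tendsto_const _ assms(2)]])
    (use \<open>s < 0\<close> in simp)
 then have "filterlim (%n. - (x + y n * s)) at_top sequentially" by simp
 then have "filterlim (%n. x + y n * s) at_bot sequentially" by (simp only: filterlim_uminus_at_bot)
 then show ?thesis by (rule filterlim_compose[OF bot])
qed

lemma meas: "(%s. g (x + y * s)) \<in> borel_measurable borel"
 by (intro borel_measurable_continuous_onI continuous_on_compose2[OF cont]) (auto intro!: continuous_intros)

lemma kernel_integrable:
 assumes "u ~: \<real>" shows "integrable lborel (%c. g c *\<^sub>R (1 / (u - complex_of_real c)^2))"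
proof -
 have y: "Im u ~= 0" using assms by (simp add: complex_is_Real_iff)
 obtain G where G: "!!c. \<bar>g c\<bar> <= G" using bounded by blast
 have nz: "u - complex_of_real c ~= 0" for c using assms by (metis Reals_of_real eq_iff_diff_eq_0)
 show ?thesis
 proof (rule Bochner_Integration.integrable_bound)
  show "integrable lborel (%c. G * (1 / ((Re u - c)^2 + (Im u)^2)))"
   by (intro integrable_mult_right integrable_cauchy_affine y)
  show "(%c. g c *\<^sub>R (1 / (u - complex_of_real c)^2)) \<in> borel_measurable lborel"
   using nz by (auto intro!: real_borel_continuous continuous_intros cont)
  have "norm (g c *\<^sub>R (1 / (u - complex_of_real c)^2)) = \<bar>g c\<bar> * (1 / ((Re u - c)^2 + (Im u)^2))" for c
   by (simp add: norm_divide norm_power cmod_power2)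
  also have "... c <= \<bar>G * (1 / ((Re u - c)^2 + (Im u)^2))\<bar>" for c
   using G[of c] by (intro order_trans[OF mult_right_mono abs_ge_self]) auto
  finally show "AE c in lborel. norm (g c *\<^sub>R (1 / (u - complex_of_real c)^2)) <= norm (G * (1 / ((Re u - c)^2 + (Im u)^2)))"
   by simp
 qed
qed

text \<open>For positive y this is pi times the harmonic extension of \<open>g\<close> to the upper
  half-plane.\<close>

definition poisson :: "real => real => real" where
 "poisson x y = (\<integral>c. g c * (y / ((x - c)^2 + y^2)) \<partial>lborel)"

lemma poisson_scale:
 assumes "y > 0" shows "poisson x y = (\<integral>s. g (x + y * s) * (1 / (1 + s^2)) \<partial>lborel)"
proof -
 have 1: "poisson x y = y * (\<integral>s. g (x + y * s) * (y / ((x - (x + y * s))^2 + y^2)) \<partial>lborel)"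
  unfolding poisson_def
  by (subst lborel_integral_real_affine[of y _ x]) (use assms in auto)
 have "g (x + y * s) * (y / ((x - (x + y * s))^2 + y^2)) = 1 / y * (g (x + y * s) * (1 / (1 + s^2)))" for s
 proof -
  have "(x - (x + y * s))^2 + y^2 = y * (y * (1 + s^2))" by (simp add: power2_eq_square algebra_simps)
  then show ?thesis using assms by simp
 qed
 then have 2: "(\<integral>s. g (x + y * s) * (y / ((x - (x + y * s))^2 + y^2)) \<partial>lborel) = 1 / y * (\<integral>s. g (x + y * s) * (1 / (1 + s^2)) \<partial>lborel)"
  by (simp only: integral_mult_right_zero)
 show ?thesis unfolding 1 2 using assms by simp
qed

lemma poisson_lim0: "(%n. poisson x (1 / real (Suc n))) ----> pi * g x"
proof -
 obtain G where G: "!!c. \<bar>g c\<bar> <= G" using bounded by blast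
 have "isCont g x" using cont continuous_on_eq_continuous_at[of UNIV] by blast
 moreover have "(%n. x + 1 / real (Suc n) * s) ----> x + 0 * s" for s
  by (intro tendsto_intros LIMSEQ_Suc[OF lim_1_over_n])
 ultimately have "(%n. g (x + 1 / real (Suc n) * s)) ----> g x" for s
  using isCont_tendsto_compose by fastforce
 then show ?thesis by (simp only: poisson_scale of_nat_0_less_iff zero_less_Suc zero_less_divide_1_iff)
  (rule dct_cauchy[OF meas G AE_I2])
qed

lemma poisson_lim_inf: "(%n. poisson x (real (Suc n))) ----> pi * 0"
proof -
 obtain G where G: "!!c. \<bar>g c\<bar> <= G" using bounded by blast
 have "filterlim (%n. real (Suc n)) at_top sequentially"
  using filterlim_compose[OF filterlim_real_sequentially filterlim_Suc] by simp
 moreover have "AE s in lborel. s ~= (0::real)" by (rule AE_lborel_singleton)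
 ultimately have "AE s in lborel. (%n. g (x + real (Suc n) * s)) ----> 0"
  by (auto elim!: eventually_mono intro: affine_lim simp del: of_nat_Suc)
 then show ?thesis by (simp only: poisson_scale of_nat_0_less_iff zero_less_Suc) (rule dct_cauchy[OF meas G])
qed

text \<open>\<open>Re (1 / (u - c)^2)\<close> is the derivative of the Poisson kernel in \<open>Im u\<close>.\<close>

lemma poisson_const:
 assumes J: "!!y. y > 0 ==> (\<integral>c. g c * (((x - c)^2 - y^2) / ((x - c)^2 + y^2)^2) \<partial>lborel) = 0" and ab: "0 < a" "a <= b"
 shows "poisson x a = poisson x b"
proof -
 obtain G where G: "!!c. \<bar>g c\<bar> <= G" using bounded by blast
 define q where "q c y = ((x - c)^2 - y^2) / ((x - c)^2 + y^2)^2" for c y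
 define f where "f c y = g c * (q c y * indicator {a..b} y)" for c y
 \<comment> \<open>Dominating function for Fubini: for y >= a the kernel \<open>q\<close> is at most
   1 / ((x - c)^2 + a^2) in absolute value.\<close>
 define B where "B = (%(c, y). (G * (1 / ((x - c)^2 + a^2))) * indicator {a..b} y)"
 have gm: "g \<in> borel_measurable borel" by (rule real_borel_continuous[OF cont])
 have i: "integrable lborel (%c. G * (1 / ((x - c)^2 + a^2)))"
  using ab by (intro integrable_mult_right integrable_cauchy_affine) simp
 have "integrable (lborel \<Otimes>\<^sub>M lborel) B"
 proof (rule lborel_pair.Fubini_integrable)
  have "(\<integral>y. norm (B (c, y)) \<partial>lborel) = \<bar>G * (1 / ((x - c)^2 + a^2))\<bar> * (b - a)" for c
   using ab by (simp add: B_def abs_mult)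
  then show "integrable lborel (%c. \<integral>y. norm (B (c, y)) \<partial>lborel)"
   by (simp only: integrable_mult_left integrable_abs i)
  show "AE c in lborel. integrable lborel (%y. B (c, y))"
   unfolding B_def prod.case using ab by (intro AE_I2 integrable_mult_right integrable_real_indicator) auto
 qed (simp add: B_def)
 then have fi: "integrable (lborel \<Otimes>\<^sub>M lborel) (case_prod f)"
 proof (rule Bochner_Integration.integrable_bound)
  show "case_prod f \<in> borel_measurable (lborel \<Otimes>\<^sub>M lborel)" unfolding f_def q_def using gm by measurable
  have "\<bar>q c y\<bar> <= 1 / ((x - c)^2 + a^2)" if "a <= y" for c y
  proof -
   have p: "(x - c)^2 + y^2 > 0" using that ab by (intro add_nonneg_pos) auto
   have "\<bar>q c y\<bar> <= ((x - c)^2 + y^2) / ((x - c)^2 + y^2)^2"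
    unfolding q_def abs_divide by (simp add: divide_right_mono abs_le_iff)
   also have "... = 1 / ((x - c)^2 + y^2)" using p by (simp add: power2_eq_square)
   also have "... <= 1 / ((x - c)^2 + a^2)"
    using that ab by (intro divide_left_mono add_left_mono power_mono mult_pos_pos add_nonneg_pos) auto
   finally show ?thesis .
  qed
  then have b: "\<bar>g c\<bar> * \<bar>q c y\<bar> <= G * (1 / ((x - c)^2 + a^2))" if "a <= y" for c y
   using G[of c] that by (intro mult_mono) auto
  show "AE z in lborel \<Otimes>\<^sub>M lborel. norm (case_prod f z) <= norm (B z)"
  proof (rule AE_I2)
   fix z :: "real \<times> real"
   obtain c y where "z = (c, y)" by fastforce
   then show "norm (case_prod f z) <= norm (B z)"
    using order_trans[OF b abs_ge_self, of y c] by (cases "y \<in> {a..b}") (auto simp: f_def B_def abs_mult)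
  qed
 qed
 have "(\<integral>y. (\<integral>c. f c y \<partial>lborel) \<partial>lborel) = 0"
 proof -
  have "(\<integral>c. f c y \<partial>lborel) = indicator {a..b} y * (\<integral>c. g c * q c y \<partial>lborel)" for y
   unfolding f_def by (simp add: mult_ac split: split_indicator)
  then have "(\<integral>c. f c y \<partial>lborel) = 0" for y
   using J[of y] ab by (auto simp: q_def split: split_indicator)
  then show ?thesis by simp
 qed
 moreover have "(\<integral>y. f c y \<partial>lborel) = g c * (b / ((x - c)^2 + b^2)) - g c * (a / ((x - c)^2 + a^2))" for c
 proof -
  have p: "(x - c)^2 + y^2 ~= 0" if "a <= y" for y using that ab by (simp add: sum_power2_eq_zero_iff)
  have "(\<integral>y. q c y * indicator {a..b} y \<partial>lborel) = b / ((x - c)^2 + b^2) - a / ((x - c)^2 + a^2)"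
  proof (rule integral_FTC_Icc_real[OF ab(2)])
   fix y assume "a <= y" "y <= b"
   note p = p[OF this(1)]
   show "((%y. y / ((x - c)^2 + y^2)) has_real_derivative q c y) (at y)"
    unfolding q_def using p by (auto intro!: derivative_eq_intros simp: power2_eq_square)
   show "isCont (q c) y" unfolding q_def[abs_def] using p by (intro continuous_intros) auto
  qed
  then show ?thesis unfolding f_def by (simp add: right_diff_distrib)
 qed
 moreover have "integrable lborel (%c. g c * (y / ((x - c)^2 + y^2)))" if "y > 0" for y
 proof (rule Bochner_Integration.integrable_bound)
  show "integrable lborel (%c. (G * y) * (1 / ((x - c)^2 + y^2)))"
   using that by (intro integrable_mult_right integrable_cauchy_affine) simp
  show "AE c in lborel. norm (g c * (y / ((x - c)^2 + y^2))) <= norm ((G * y) * (1 / ((x - c)^2 + y^2)))"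
   using that by (auto simp: abs_mult intro!: divide_right_mono mult_right_mono order_trans[OF G abs_ge_self])
 qed (use gm in measurable)
 ultimately show ?thesis
  using lborel_pair.Fubini_integral[OF fi] ab by (simp add: poisson_def Bochner_Integration.integral_diff)
qed

text \<open>Along the vertical line through x the Poisson integral does not depend on the height; it
  tends to \<open>pi * g x\<close> at height 0 and to 0 at infinity.\<close>

lemma eq_0:
 assumes "!!y. y > 0 ==> Re (\<integral>c. g c *\<^sub>R (1 / (Complex x y - complex_of_real c)^2) \<partial>lborel) = 0"
 shows "g x = 0"
proof -
 have J: "(\<integral>c. g c * (((x - c)^2 - y^2) / ((x - c)^2 + y^2)^2) \<partial>lborel) = 0" if "y > 0" for y
 proof -
  have "Re (1 / (Complex x y - complex_of_real c)^2) = ((x - c)^2 - y^2) / ((x - c)^2 + y^2)^2" for c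
  proof -
   have "1 / (Complex x y - complex_of_real c)^2 = (inverse (Complex (x - c) y))^2"
    by (simp add: power_inverse inverse_eq_divide power_one_over complex_of_real_def complex_diff)
   moreover have "Re ((inverse (Complex p y))^2) = (p / (p^2 + y^2))^2 - (y / (p^2 + y^2))^2" for p
    by (simp add: power2_eq_square)
   ultimately show ?thesis by (simp only: power_divide diff_divide_distrib)
  qed
  moreover have "Complex x y ~: \<real>" using that by (simp add: complex_is_Real_iff)
  ultimately show ?thesis using assms[OF that] by (subst (asm) integral_Re[OF kernel_integrable, symmetric]) simp_all
 qed
 have "(%n. poisson x (real (Suc n))) = (%n. poisson x 1)" "(%n. poisson x (1 / real (Suc n))) = (%n. poisson x 1)"
  by (intro ext, subst poisson_const[OF J, of 1], simp_all) (intro ext poisson_const[OF J], simp_all)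
 then show ?thesis using poisson_lim0[of x] poisson_lim_inf[of x] by (simp add: LIMSEQ_const_iff)
qed

end

lemma decaying_diff: "decaying g ==> decaying h ==> decaying (%c. g c - h c)"
 unfolding decaying_def using tendsto_diff[of g 0 _ h 0] by (auto intro: continuous_on_diff)

text \<open>Equal exponentials fix the exponents only modulo 2 pi i, so only the real parts of the
  pairings are compared; these are what \<open>decaying.eq_0\<close> asks for.\<close>

lemma action_profile_unique:
 assumes f: "is_action_profile v e f" "is_action_profile v e f'"
 shows "f = f'"
proof -
 have dec: "decaying (%c. f c - \<bar>c\<bar>)" if "is_action_profile v e f" for f
  using that unfolding is_action_profile_def decaying_def by (auto intro!: continuous_intros)
 have g: "decaying (%c. (f c - \<bar>c\<bar>) - (f' c - \<bar>c\<bar>))"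
  by (intro decaying_diff dec f)
 have "(f x - \<bar>x\<bar>) - (f' x - \<bar>x\<bar>) = 0" for x
 proof (rule decaying.eq_0[OF g])
  fix y :: real assume "y > 0"
  let ?k = "%c. 1 / (Complex x y - complex_of_real c)^2" and ?phi = "%c. Ln (1 / (Complex x y - complex_of_real c))"
  have u: "Complex x y ~: \<real>" using \<open>y > 0\<close> by (simp add: complex_is_Real_iff)
  have "exp (half_dd_profile f ?phi) = exp (half_dd_profile f' ?phi)" using f u unfolding is_action_profile_def by metis
  then have "exp (Re (half_dd_profile f ?phi)) = exp (Re (half_dd_profile f' ?phi))" unfolding norm_exp_eq_Re[symmetric] by simp
  then have "Re (\<integral>c. (f c - \<bar>c\<bar>) *\<^sub>R ?k c \<partial>lborel) = Re (\<integral>c. (f' c - \<bar>c\<bar>) *\<^sub>R ?k c \<partial>lborel)"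
   unfolding half_dd_profile_def half_dd_log[OF u] by simp
  then show "Re (\<integral>c. ((f c - \<bar>c\<bar>) - (f' c - \<bar>c\<bar>)) *\<^sub>R ?k c \<partial>lborel) = 0"
   unfolding scaleR_left_diff_distrib[of "f x - \<bar>x\<bar>" "f' x - \<bar>x\<bar>" for x]
   by (subst Bochner_Integration.integral_diff[OF decaying.kernel_integrable[OF dec[OF f(1)] u] decaying.kernel_integrable[OF dec[OF f(2)] u]]) simp
 qed
 then show ?thesis by (intro ext) simp
qed

section \<open>Finite Hermitian matrices\<close>

lemma monic_poly_roots:
 fixes p :: "complex poly"
 assumes "lead_coeff p = 1"
 obtains x where "p = (\<Prod>i<degree p. [:- x i, 1:])"
proof -
 obtain A where A: "size A = degree p" "p = smult (lead_coeff p) (\<Prod>x\<in>#A. [:- x, 1:])"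
  using alg_closed_imp_factorization[of p] assms by fastforce
 obtain xs where xs: "mset xs = A" using ex_mset by blast
 have "(\<Prod>x\<in>#A. [:- x, 1:]) = (\<Prod>i<length xs. [:- xs ! i, 1:])"
  unfolding xs[symmetric] mset_map[symmetric] prod_mset_prod_list
  by (simp add: prod.list_conv_set_nth atLeast0LessThan)
 moreover have "length xs = degree p" using A(1) xs by (metis size_mset)
 ultimately show ?thesis using A(2) assms that[of "(!) xs"] by simp
qed

text \<open>The quotient (p(T) - p(u)) / (T - u) under the functional sending T^i to
  \<open>h i\<close>: this is the associated polynomial of p, later the numerator of a
  resolvent.\<close>

lemma synthetic_div_functional:
 fixes p :: "'a::comm_ring_1 poly" and h :: "nat => 'a"
 assumes "degree p <= n"
 shows "EX Q. (ALL u. poly Q u = (\<Sum>i\<le>n. coeff (synthetic_div p u) i * h i)) &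
  (ALL k. coeff Q k = (\<Sum>b\<le>n. coeff p (Suc (k + b)) * h b))"
 using assms
proof (induction p arbitrary: h n rule: pCons_induct)
 case 0 show ?case by (intro exI[of _ 0]) simp
next
 case (pCons a p)
 show ?case
 proof (cases "p = 0")
  case True then show ?thesis by (intro exI[of _ 0]) (simp add: synthetic_div_pCons)
 next
  case False
  then obtain m where n: "n = Suc m" "degree p <= m" using pCons.prems by (cases n) auto
  obtain Q where Q: "!!u. poly Q u = (\<Sum>i\<le>m. coeff (synthetic_div p u) i * h (Suc i))"
   "!!k. coeff Q k = (\<Sum>b\<le>m. coeff p (Suc (k + b)) * h (Suc b))"
   using pCons.IH[OF n(2), of "%i. h (Suc i)"] by auto
  show ?thesis unfolding n(1) sum.atMost_Suc_shift
   by (intro exI[of _ "smult (h 0) p + Q"]) (simp add: Q synthetic_div_pCons mult.commute)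
 qed
qed

lemma homogeneous_system:
 fixes a :: "'b => nat => 'a::field"
 assumes "finite I" "N < card I"
 shows "EX c. (EX i:I. c i ~= 0) & (ALL j<N. (\<Sum>i\<in>I. c i * a i j) = 0)"
 using assms
proof (induction N arbitrary: I a)
 case 0
 then show ?case by (intro exI[of _ "%_. 1"]) (auto simp: card_gt_0_iff)
next
 case (Suc N)
 show ?case
 proof (cases "ALL i:I. a i N = 0")
  case True
  obtain c where "EX i:I. c i ~= 0" "ALL j<N. (\<Sum>i\<in>I. c i * a i j) = 0" using Suc.IH[of I a] Suc.prems by auto
  then show ?thesis using True by (intro exI[of _ c]) (auto simp: less_Suc_eq)
 next
  case False
  then obtain k where k: "k \<in> I" "a k N ~= 0" by blast
  have "N < card (I - {k})" using Suc.prems(2) by (simp add: card_Diff_singleton[OF k(1)])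
  then obtain c where c: "EX i:I - {k}. c i ~= 0"
   "!!j. j < N ==> (\<Sum>i\<in>I - {k}. c i * (a i j - a i N / a k N * a k j)) = 0"
   using Suc.IH[of "I - {k}" "%i j. a i j - a i N / a k N * a k j"] Suc.prems(1) by blast
  define s where "s = (\<Sum>i\<in>I - {k}. c i * (a i N / a k N))"
  have eq: "(\<Sum>i\<in>I. (c(k := - s)) i * a i j) = (\<Sum>i\<in>I - {k}. c i * (a i j - a i N / a k N * a k j))" for j
   using Suc.prems(1) k(1) unfolding sum.remove[OF Suc.prems(1) k(1)]
   by (simp add: s_def right_diff_distrib sum_subtractf sum_distrib_right mult.assoc)
  have "(\<Sum>i\<in>I. (c(k := - s)) i * a i j) = 0" if "j < Suc N" for j
   unfolding eq using c(2)[of j] that k(2) by (cases "j = N") auto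
  then show ?thesis using c(1) by (intro exI[of _ "c(k := - s)"]) auto
 qed
qed

locale hermitian_matrix =
 fixes L :: "nat => nat => complex" and N :: nat
 assumes herm: "L j k = cnj (L k j)" and N: "N > 0"
begin

definition ap :: "(nat => complex) => nat => complex" where
 "ap x j = (if j < N then \<Sum>k<N. L j k * x k else 0)"

definition nn :: "(nat => complex) => real" where
 "nn x = (\<Sum>i<N. (cmod (x i))^2)"

definition kry :: "nat => nat => complex" where
 "kry i = (ap ^^ i) (%j. if j = 0 then 1 else 0)"

definition act :: "complex poly => nat => complex" where
 "act p j = (\<Sum>i\<le>degree p. coeff p i * kry i j)"

lemma ap_cmult: "ap (%j. c * x j) j = c * ap x j"
 by (simp add: ap_def sum_distrib_left mult.left_commute)

lemma ap_add: "ap (%j. x j + y j) j = ap x j + ap y j"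
 by (simp add: ap_def sum.distrib distrib_left)

lemma ap_sum: "ap (%j. \<Sum>i\<in>I. x i j) j = (\<Sum>i\<in>I. ap (x i) j)"
proof -
 have "(\<Sum>k<N. L j k * (\<Sum>i\<in>I. x i k)) = (\<Sum>i\<in>I. \<Sum>k<N. L j k * x i k)"
  unfolding sum_distrib_left by (rule sum.swap)
 then show ?thesis by (simp add: ap_def)
qed

lemma ap_herm: "(\<Sum>j<N. ap x j * cnj (x j)) \<in> \<real>"
proof -
 let ?S = "\<Sum>j<N. \<Sum>k<N. L j k * x k * cnj (x j)"
 have "cnj ?S = (\<Sum>j<N. \<Sum>k<N. L k j * x j * cnj (x k))"
  by (simp add: herm[symmetric] mult_ac)
 also have "... = ?S" by (rule sum.swap)
 finally have "?S \<in> \<real>" by (simp add: Reals_cnj_iff)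
 then show ?thesis by (simp add: ap_def sum_distrib_right)
qed

lemma nn_eq: "(\<Sum>j<N. x j * cnj (x j)) = complex_of_real (nn x)"
 unfolding nn_def of_real_sum by (intro sum.cong refl) (simp add: complex_norm_square[symmetric])

lemma ip_resolvent: "Im (\<Sum>j<N. (u * x j - ap x j) * cnj (x j)) = Im u * nn x"
proof -
 have "(\<Sum>j<N. (u * x j - ap x j) * cnj (x j)) = u * complex_of_real (nn x) - (\<Sum>j<N. ap x j * cnj (x j))"
  unfolding nn_eq[symmetric] sum_distrib_left by (simp add: left_diff_distrib sum_subtractf mult.assoc)
 then show ?thesis using ap_herm[of x] by (simp add: complex_is_Real_iff)
qed

text \<open>The bound 1 / |Im u| on the resolvent, from the imaginary part of <(u - L) x, x> and
  Cauchy-Schwarz, squared to avoid roots.\<close>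

lemma resolvent_bound: "(Im u)^2 * nn x <= nn (%j. u * x j - ap x j)"
proof -
 let ?w = "%j. u * x j - ap x j"
 have nn0: "nn y >= 0" for y unfolding nn_def by (intro sum_nonneg) auto
 have "\<bar>Im u * nn x\<bar> <= cmod (\<Sum>j<N. ?w j * cnj (x j))" unfolding ip_resolvent[symmetric] by (rule abs_Im_le_cmod)
 also have "... <= (\<Sum>j<N. cmod (?w j) * cmod (x j))" using norm_sum[of "%j. ?w j * cnj (x j)" "{..<N}"] by (simp add: norm_mult)
 finally have "(Im u * nn x)^2 <= (\<Sum>j<N. cmod (?w j) * cmod (x j))^2" by (metis abs_ge_zero power2_abs power_mono)
 also have "... <= nn ?w * nn x" unfolding nn_def by (rule Cauchy_Schwarz_ineq_sum)
 finally have "(Im u)^2 * nn x * nn x <= nn ?w * nn x" by (simp add: power_mult_distrib power2_eq_square mult_ac)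
 then show ?thesis using nn0[of x] nn0[of ?w] by (cases "nn x = 0") (auto simp: mult_le_cancel_right)
qed

lemma nn_eq_0: "nn x = 0 ==> j < N ==> x j = 0"
 unfolding nn_def by (subst (asm) sum_nonneg_eq_0_iff) auto

lemma nn_ge: "j < N ==> (cmod (x j))^2 <= nn x"
 unfolding nn_def by (rule member_le_sum) auto

lemma kry_Suc: "kry (Suc i) = ap (kry i)" by (simp add: kry_def)

lemma kry_support: "j >= N ==> kry i j = 0"
 using N by (cases i) (auto simp: kry_Suc ap_def, auto simp: kry_def)

lemma act_deg: "degree p <= n ==> act p j = (\<Sum>i\<le>n. coeff p i * kry i j)"
 unfolding act_def by (rule sum.mono_neutral_left) (auto simp: coeff_eq_0)

lemma act_add: "act (p + q) j = act p j + act q j"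
proof -
 let ?n = "max (degree p) (degree q)"
 show ?thesis using act_deg[of p ?n j] act_deg[of q ?n j] act_deg[OF degree_add_le_max[of p q], of j]
  by (simp add: sum.distrib distrib_right)
qed

lemma act_smult: "act (smult c p) j = c * act p j"
 using act_deg[OF degree_smult_le[of c p], of j] by (simp add: act_def sum_distrib_left mult.assoc)

lemma act_pCons: "act (pCons c p) j = c * kry 0 j + ap (act p) j"
proof -
 have "ap (act p) j = (\<Sum>i\<le>degree p. coeff p i * kry (Suc i) j)"
 proof -
  have "act p = (%j. \<Sum>i\<le>degree p. coeff p i * kry i j)" by (simp add: act_def fun_eq_iff)
  then show ?thesis by (simp only: ap_sum ap_cmult kry_Suc)
 qed
 then show ?thesis using act_deg[OF degree_pCons_le[of c p], of j] by (simp add: sum.atMost_Suc_shift del: sum.atMost_Suc)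
qed

lemma act_linear_mult: "act ([:- c, 1:] * q) j = ap (act q) j - c * act q j"
proof -
 have "[:- c, 1:] * q = smult (- c) q + pCons 0 q" by simp
 then show ?thesis by (simp only: act_add act_smult act_pCons) simp
qed

lemma act_support: "j >= N ==> act p j = 0"
 by (simp add: act_def kry_support)

lemma act_shift_0:
 assumes "act p = (%_. 0)"
 shows "(\<Sum>i\<le>degree p. coeff p i * kry (i + m) j) = 0"
proof (induction m arbitrary: j)
 case 0 show ?case using fun_cong[OF assms, of j] by (simp add: act_def)
next
 case (Suc m)
 have "(\<Sum>i\<le>degree p. coeff p i * kry (i + Suc m) j) = ap (%j. \<Sum>i\<le>degree p. coeff p i * kry (i + m) j) j"
  by (simp only: ap_sum ap_cmult kry_Suc add_Suc_right)
 also have "... = 0" by (simp add: Suc ap_def)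
 finally show ?case .
qed

lemma annihilator_exists: "EX p. p ~= 0 & act p = (%_. 0)"
proof -
 obtain c i where c: "i <= N" "c i ~= 0" "!!j. j < N ==> (\<Sum>i\<le>N. c i * kry i j) = 0"
  using homogeneous_system[of "{..N}" N kry] by auto
 define p where "p = (\<Sum>i\<le>N. monom (c i) i)"
 have cp: "coeff p i = (if i <= N then c i else 0)" for i by (simp add: p_def coeff_sum coeff_monom)
 have "degree p <= N" by (rule degree_le) (simp add: cp)
 then have "act p j = 0" for j using c(3)[of j] act_support[of j p] by (cases "j < N") (auto simp: act_deg cp)
 moreover have "p ~= 0" using c cp[of i] by auto
 ultimately show ?thesis by (intro exI[of _ p]) auto
qed

text \<open>The minimal polynomial p of the vacuum vector replaces the spectral theorem. Since u - L
  maps the synthetic quotient of p at u, applied to psi_0, to p(u) psi_0, the resolvent entry is Q/p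
  with Q the associated polynomial; comparing the same two polynomials as series at infinity gives
  Newton's identities for the Krylov moments. Nonreal roots are excluded by
  \<open>resolvent_bound\<close> for p and by \<open>ip_resolvent\<close> for Q.\<close>

theorem resolvent_roots:
 "EX (n::nat) x b. newton (%j. kry j 0) (%q. complex_of_real ((\<Sum>i<n. x i ^ q) - (\<Sum>i<n. b i ^ q))) &
  (ALL u. Im u ~= 0 --> (EX z. (ALL j>=N. z j = 0) & (ALL j. u * z j - ap z j = (if j = 0 then 1 else 0))
    & z 0 = (\<Prod>i<n. u - complex_of_real (b i)) / (u * (\<Prod>i<n. u - complex_of_real (x i)))))"
proof -
 define P where "P m \<longleftrightarrow> (EX p. p ~= 0 & act p = (%_. 0) & degree p = m)" for m
 obtain m where m: "P m" "!!k. k < m ==> ~ P k" using annihilator_exists exists_least_iff[of P] unfolding P_def by blast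
 then obtain p0 where p0: "p0 ~= 0" "act p0 = (%_. 0)" "degree p0 = m" by (auto simp: P_def)
 define p where "p = smult (inverse (lead_coeff p0)) p0"
 have p: "lead_coeff p = 1" "act p = (%_. 0)" "degree p = m" "p ~= 0"
  using p0 by (auto simp: p_def fun_eq_iff act_smult)
 have min: "act q ~= (%_. 0)" if "q ~= 0" "degree q < m" for q using m(2)[of "degree q"] that by (auto simp: P_def)
 have e0: "kry 0 j = (if j = 0 then 1 else 0)" for j by (simp add: kry_def)
 have m0: "m > 0"
 proof (rule ccontr)
  assume "~ m > 0"
  then obtain c where "p = [:c:]" using p(3) degree_eq_zeroE[of p] by auto
  then have "p = [:1:]" using p(1) by (simp split: if_splits)
  then have "act p 0 = 1" by (simp add: act_def e0)
  then show False using p(2) by simp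
 qed
 obtain l where l: "p = (\<Prod>i<m. [:- l i, 1:])" using monic_poly_roots[OF p(1)] p(3) by metis
 obtain Q where Q: "!!u. poly Q u = (\<Sum>i\<le>m. coeff (synthetic_div p u) i * kry i 0)"
   "!!k. coeff Q k = (\<Sum>b\<le>m. coeff p (Suc (k + b)) * kry b 0)"
  using synthetic_div_functional[of p m "%i. kry i 0"] p(3) by auto
 have Q_act: "poly Q u = act (synthetic_div p u) 0" for u
  unfolding Q by (rule act_deg[symmetric]) (simp add: degree_synthetic_div p(3))
 have res: "u * act (synthetic_div p u) j - ap (act (synthetic_div p u)) j = poly p u * kry 0 j" for u j
 proof -
  have "act p j = act ([:- u, 1:] * synthetic_div p u + [:poly p u:]) j" by (simp only: synthetic_div_correct')
  also have "... = ap (act (synthetic_div p u)) j - u * act (synthetic_div p u) j + poly p u * kry 0 j"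
   unfolding act_add act_linear_mult by (simp add: act_def)
  finally show ?thesis using p(2) by (simp add: algebra_simps)
 qed
 have p_root: "poly p u ~= 0" if "Im u ~= 0" for u
 proof
  assume "poly p u = 0"
  define w where "w = act (synthetic_div p u)"
  have "synthetic_div p u ~= 0" using p(3) m0 synthetic_div_eq_0_iff[of p u] by auto
  \<comment> \<open>The quotient has smaller degree than the minimal polynomial, so it cannot
    annihilate the vacuum vector.\<close>
  then have "w ~= (%_. 0)" unfolding w_def by (rule min) (simp add: degree_synthetic_div p(3) m0)
  then obtain j where j: "w j ~= 0" by blast
  have "(Im u)^2 * nn w <= nn (%j. u * w j - ap w j)" by (rule resolvent_bound)
  also have "... = 0" unfolding w_def res \<open>poly p u = 0\<close> by (simp add: nn_def)
  finally have "nn w <= 0" using that by (simp add: mult_le_0_iff not_le)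
  then have "nn w = 0" unfolding nn_def by (simp add: order_antisym sum_nonneg)
  moreover have "j < N" using j act_support[of j] unfolding w_def by (meson not_le)
  ultimately show False using j nn_eq_0 by blast
 qed
 have Q_root: "poly Q u ~= 0" if "Im u ~= 0" for u
 proof
  assume 0: "poly Q u = 0"
  define w where "w = act (synthetic_div p u)"
  have "(\<Sum>j<N. (u * w j - ap w j) * cnj (w j)) = poly p u * cnj (w 0)"
   unfolding w_def res e0 using N by (simp add: if_distrib[of "%c. _ * c * _"] cong: if_cong)
  moreover have "w 0 = 0" using 0 unfolding Q_act w_def .
  ultimately have "Im u * nn w = 0" using ip_resolvent[of u w] by simp
  then have "nn w = 0" using that by simp
  then have "w j = 0" for j using nn_eq_0[of w j] act_support[of j] unfolding w_def by (cases "j < N") auto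
  then have "u * w 0 - ap w 0 = 0" by (simp add: ap_def)
  then show False using p_root[OF that] unfolding w_def res e0 by simp
 qed
 have cQ: "coeff Q (m - 1) = 1" "!!k. k >= m ==> coeff Q k = 0"
 proof -
  have "coeff Q (m - 1) = (\<Sum>b\<le>m. if b = 0 then 1 else 0)"
   unfolding Q using p m0 e0 by (intro sum.cong) (auto simp: coeff_eq_0)
  then show "coeff Q (m - 1) = 1" by simp
  show "coeff Q k = 0" if "k >= m" for k unfolding Q using that p(3) by (intro sum.neutral) (auto simp: coeff_eq_0)
 qed
 have dQ: "degree Q = m - 1"
  by (rule antisym[OF degree_le le_degree]) (use cQ m0 in "auto simp: not_less")
 obtain b where b: "Q = (\<Prod>i<m - 1. [:- b i, 1:])" using monic_poly_roots[of Q] dQ cQ by metis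
 \<comment> \<open>Q has one root fewer than p; padding with the root 0 is balanced by the factor u
   in the denominator.\<close>
 define b' where "b' i = (if i < m - 1 then b i else 0)" for i
 have real_l: "l i \<in> \<real>" if "i < m" for i
  using p_root[of "l i"] that by (auto simp: l poly_prod complex_is_Real_iff)
 have real_b: "b' i \<in> \<real>" for i
  using Q_root[of "b i"] by (auto simp: b'_def b poly_prod complex_is_Real_iff)
 have ins: "{..<m} = insert (m - 1) {..<m - 1}" using m0 by auto
 have prod_b: "(\<Prod>i<m. g (b' i)) = g 0 * (\<Prod>i<m - 1. g (b i))" for g :: "complex => 'c::comm_monoid_mult"
  unfolding ins by (simp add: b'_def)
 have rev: "fps_of_poly (reflect_poly (\<Prod>i\<in>I. [:- z i, 1:])) = (\<Prod>i\<in>I. 1 - fps_const (z i) * fps_X)"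
  for I and z :: "nat => complex"
 proof -
  have "reflect_poly [:- z i, 1:] = [:1, - z i:]" for i by (rule poly_eqI) (simp add: coeff_reflect_poly coeff_pCons split: nat.split)
  then show ?thesis by (simp add: reflect_poly_prod fps_of_poly_prod_rev del: fps_const_neg)
 qed
 \<comment> \<open>Below order m the coefficients agree by the formula for Q; from order m on they
   vanish because p(L) L^i psi_0 = 0.\<close>
 have "Abs_fps (%j. kry j 0) * fps_of_poly (reflect_poly p) = fps_of_poly (reflect_poly Q)"
 proof (rule fps_ext)
  fix k
  have L: "(Abs_fps (%j. kry j 0) * fps_of_poly (reflect_poly p)) $ k
   = (\<Sum>b=0..k. kry b 0 * (if k - b > m then 0 else coeff p (m - (k - b))))"
   by (simp add: fps_mult_nth coeff_reflect_poly p(3) cong: if_cong sum.cong)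
  show "(Abs_fps (%j. kry j 0) * fps_of_poly (reflect_poly p)) $ k = fps_of_poly (reflect_poly Q) $ k"
  proof (cases "k < m")
   case True
   have "coeff Q (m - 1 - k) = (\<Sum>b\<le>m. coeff p (m - k + b) * kry b 0)"
    unfolding Q
   proof (rule sum.cong[OF refl])
    fix b have "Suc (m - 1 - k + b) = m - k + b" using True by arith
    then show "coeff p (Suc (m - 1 - k + b)) * kry b 0 = coeff p (m - k + b) * kry b 0" by (simp only:)
   qed
   also have "... = (\<Sum>b=0..k. kry b 0 * (if k - b > m then 0 else coeff p (m - (k - b))))"
    by (rule sum.mono_neutral_cong_right) (use True p(3) in "auto simp: coeff_eq_0")
   finally show ?thesis unfolding L using True by (simp add: coeff_reflect_poly dQ)
  next
   case False
   have "(\<Sum>b=0..k. kry b 0 * (if k - b > m then 0 else coeff p (m - (k - b)))) = (\<Sum>b=k - m..k. coeff p (b - (k - m)) * kry b 0)"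
    by (rule sum.mono_neutral_cong_right) (use False in "auto simp: add.commute")
   also have "... = (\<Sum>i\<le>m. coeff p i * kry (i + (k - m)) 0)"
    by (rule sum.reindex_bij_witness[of _ "%i. i + (k - m)" "%b. b - (k - m)"]) (use False in auto)
   also have "... = 0" using act_shift_0[OF p(2)] p(3) by simp
   finally show ?thesis unfolding L using False m0 by (simp add: coeff_reflect_poly dQ)
  qed
 qed
 then have "Abs_fps (%j. kry j 0) * (\<Prod>i<m. 1 - fps_const (l i) * fps_X) = (\<Prod>i<m. 1 - fps_const (b' i) * fps_X)"
  unfolding prod_b[of "%z. 1 - fps_const z * fps_X"] unfolding l b rev by simp
 from newton_quotient[OF finite_lessThan finite_lessThan this]
 have nw: "newton (%j. kry j 0) (%q. (\<Sum>i<m. l i ^ q) - (\<Sum>i<m. b' i ^ q))" .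
 have re: "complex_of_real (Re (l i)) = l i" "complex_of_real (Re (b' i)) = b' i" if "i < m" for i
  using real_l[OF that] real_b by auto
 show ?thesis
 proof (rule exI[of _ m], rule exI[of _ "%i. Re (l i)"], rule exI[of _ "%i. Re (b' i)"], intro conjI allI impI)
  show "newton (%j. kry j 0) (%q. complex_of_real ((\<Sum>i<m. Re (l i) ^ q) - (\<Sum>i<m. Re (b' i) ^ q)))"
   using nw by (simp add: re cong: sum.cong_simp)
  fix u assume u: "Im u ~= 0"
  then have u0: "u ~= 0" by auto
  let ?z = "%j. act (synthetic_div p u) j / poly p u"
  have "u * ?z j - ap ?z j = (if j = 0 then 1 else 0)" for j
   using res[of u j] p_root[OF u] ap_cmult[of "1 / poly p u" "act (synthetic_div p u)" j] e0[of j]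
   by (simp add: diff_divide_distrib[symmetric])
  moreover have "?z 0 = (\<Prod>i<m. u - b' i) / (u * (\<Prod>i<m. u - l i))"
   unfolding Q_act[symmetric] prod_b[of "%z. u - z"] using u0 by (simp add: l b poly_prod)
  ultimately show "EX z. (ALL j>=N. z j = 0) & (ALL j. u * z j - ap z j = (if j = 0 then 1 else 0))
    & z 0 = (\<Prod>i<m. u - complex_of_real (Re (b' i))) / (u * (\<Prod>i<m. u - complex_of_real (Re (l i))))"
   using act_support by (intro exI[of _ ?z]) (simp add: re cong: prod.cong_simp)
 qed
qed

end

section \<open>Profiles of finite Hermitian matrices\<close>

lemma polar_upper_half:
 assumes "y > 0"
 shows "EX \<rho>>0. Complex c y - complex_of_real a = complex_of_real \<rho> * exp (\<i> * complex_of_real (pi / 2 - arctan ((c - a) / y)))"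
proof -
 let ?r = "(c - a) / y"
 have s: "sqrt (1 + ?r^2) > 0" by (intro real_sqrt_gt_zero) (simp add: add_pos_nonneg)
 have "exp (\<i> * complex_of_real (pi / 2 - arctan ?r)) = Complex (sin (arctan ?r)) (cos (arctan ?r))"
  unfolding cis_conv_exp[symmetric] by (simp add: complex_eq_iff sin_diff cos_diff)
 also have "... = Complex ?r 1 / complex_of_real (sqrt (1 + ?r^2))"
  by (simp add: complex_eq_iff sin_arctan cos_arctan Re_divide_of_real Im_divide_of_real)
 finally have "Complex c y - complex_of_real a = complex_of_real (y * sqrt (1 + ?r^2)) * exp (\<i> * complex_of_real (pi / 2 - arctan ?r))"
  using s assms by (simp add: complex_eq_iff)
 then show ?thesis using s assms by (intro exI[of _ "y * sqrt (1 + ?r^2)"]) auto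
qed

lemma integrable_continuous_compact_support:
 fixes f :: "real => real"
 assumes "continuous_on UNIV f" "!!c. c ~: {-L..L} ==> f c = 0"
 shows "integrable lborel f"
proof -
 have "set_integrable lborel {-L..L} f"
  by (intro borel_integrable_atLeastAtMost' continuous_on_subset[OF assms(1)]) auto
 moreover have "(%c. indicator {-L..L} c *\<^sub>R f c) = f" using assms(2) by (auto simp: fun_eq_iff indicator_def)
 ultimately show ?thesis by (simp add: set_integrable_def)
qed

text \<open>The roots \<open>x\<close> and \<open>b\<close> of denominator and numerator of a resolvent; the zero of the numerator
 at the origin is compensated by the factor \<open>u\<close>.\<close>

locale interlaced =
 fixes n :: nat and x b :: "nat => real"
 assumes neg: "!!u. Im u > 0 ==>
   Im ((\<Prod>i<n. u - complex_of_real (b i)) / (u * (\<Prod>i<n. u - complex_of_real (x i)))) < 0"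
  and trace: "(\<Sum>i<n. x i) = (\<Sum>i<n. b i)"
begin

definition gap :: "real => real" where
 "gap c = (\<Sum>i<n. \<bar>c - x i\<bar> - \<bar>c - b i\<bar>)"

text \<open>\<open>winding c y - pi / 2\<close> is a continuous choice of the argument of the
  resolvent at c + i y. Away from the nodes, as y tends to 0, \<open>winding\<close> tends to pi / 2
  times the slope of |c| + gap c.\<close>

definition winding :: "real => real => real" where
 "winding c y = (\<Sum>i<n. arctan ((c - x i) / y) - arctan ((c - b i) / y)) + arctan (c / y)"

lemma cos_winding: "y > 0 ==> cos (winding c y) > 0"
proof -
 assume y: "y > 0"
 obtain \<rho> where \<rho>: "!!a. \<rho> a > 0" "!!a. Complex c y - complex_of_real a =
   complex_of_real (\<rho> a) * exp (\<i> * complex_of_real (pi / 2 - arctan ((c - a) / y)))"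
  using polar_upper_half[OF y] by metis
 let ?P = "(\<Prod>i<n. \<rho> (b i)) / (\<rho> 0 * (\<Prod>i<n. \<rho> (x i)))"
 let ?E = "%z. exp (\<i> * complex_of_real z)"
 have P: "?P > 0" using \<rho>(1) by (intro divide_pos_pos mult_pos_pos prod_pos) auto
 have pr: "(\<Prod>i<n. Complex c y - complex_of_real (a i)) = complex_of_real (\<Prod>i<n. \<rho> (a i)) *
   ?E (\<Sum>i<n. pi / 2 - arctan ((c - a i) / y))" for a
  unfolding \<rho>(2) by (simp add: prod.distrib exp_sum[symmetric] sum_distrib_left)
 have "(\<Prod>i<n. Complex c y - complex_of_real (b i)) / (Complex c y * (\<Prod>i<n. Complex c y - complex_of_real (x i)))
   = complex_of_real ?P * ?E (winding c y - pi / 2)"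
 proof -
  have "Complex c y = complex_of_real (\<rho> 0) * ?E (pi / 2 - arctan (c / y))" using \<rho>(2)[of 0] by simp
  then have "(\<Prod>i<n. Complex c y - complex_of_real (b i)) / (Complex c y * (\<Prod>i<n. Complex c y - complex_of_real (x i)))
   = complex_of_real ?P * (?E (\<Sum>i<n. pi / 2 - arctan ((c - b i) / y)) /
    (?E (pi / 2 - arctan (c / y)) * ?E (\<Sum>i<n. pi / 2 - arctan ((c - x i) / y))))"
   unfolding pr by simp
  also have "... = complex_of_real ?P * ?E (winding c y - pi / 2)"
   unfolding exp_add[symmetric] exp_diff[symmetric]
   by (simp add: winding_def sum_subtractf algebra_simps sum.distrib)
  finally show ?thesis .
 qed
 moreover have "Im (complex_of_real r * z) = r * Im z" for r z by simp
 ultimately have "?P * Im (cis (winding c y - pi / 2)) < 0"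
  using neg[of "Complex c y"] y unfolding cis_conv_exp by (simp only: complex.sel)
 moreover have "r > 0 ==> r * z < 0 ==> z < 0" for r z :: real by (simp add: mult_less_0_iff)
 ultimately have "Im (cis (winding c y - pi / 2)) < 0" using P by blast
 then have "sin (winding c y - pi / 2) < 0" by simp
 then show ?thesis by (simp add: sin_diff)
qed

lemma winding_cont: "continuous_on {0<..} (winding c)"
 unfolding winding_def by (intro continuous_intros) auto

text \<open>The negative imaginary part of the resolvent keeps the cosine positive, so |winding|
  never equals pi / 2; since it tends to 0 as y grows, it cannot leave the central interval.\<close>

lemma winding_bound:
 assumes y: "y > 0" shows "\<bar>winding c y\<bar> < pi / 2"
proof -
 have "((%y. winding c y) \<longlongrightarrow> (\<Sum>i<n. arctan 0 - arctan 0) + arctan 0) at_top"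
  unfolding winding_def
  by (intro tendsto_intros tendsto_divide_0[OF tendsto_const] filterlim_at_top_imp_at_infinity filterlim_ident)
 then have "\<forall>\<^sub>F Y in at_top. \<bar>winding c Y\<bar> < pi / 2" by (auto simp: dist_real_def dest!: tendstoD[of _ 0 _ "pi / 2"])
 then obtain Y where Y: "Y >= y" "\<bar>winding c Y\<bar> < pi / 2"
  by (metis (no_types, lifting) eventually_at_top_linorder linear order_trans)
 have no: "\<bar>winding c z\<bar> ~= pi / 2" if "z >= y" for z
 proof
  assume "\<bar>winding c z\<bar> = pi / 2"
  then have "cos (winding c z) = 0" by (metis cos_abs_real cos_pi_half)
  then show False using cos_winding[of z c] y that by simp
 qed
 have cont: "continuous_on {y..Y} (%z. \<bar>winding c z\<bar>)"
  by (intro continuous_intros continuous_on_subset[OF winding_cont]) (use y in auto)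
 show ?thesis
 proof (rule ccontr)
  assume "~ \<bar>winding c y\<bar> < pi / 2"
  then obtain z where "y <= z" "z <= Y" "\<bar>winding c z\<bar> = pi / 2"
   using IVT2'[of "%z. \<bar>winding c z\<bar>" Y "pi / 2" y] Y cont by auto
  then show False using no by auto
 qed
qed

lemma slope_bound:
 assumes c: "c ~= 0" "!!i. i < n ==> c ~= x i & c ~= b i"
 shows "\<bar>(\<Sum>i<n. sgn (c - x i) - sgn (c - b i)) + sgn c\<bar> <= 1"
proof -
 have pos: "((%y. arctan (r / y)) \<longlongrightarrow> pi / 2) (at_right 0)" if "r > 0" for r :: real
 proof -
  have "filterlim (%y. r * inverse y) at_top (at_right 0)"
   by (rule filterlim_tendsto_pos_mult_at_top[OF tendsto_const that filterlim_inverse_at_top_right])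
  from filterlim_compose[OF tendsto_arctan_at_top this] show ?thesis unfolding divide_inverse .
 qed
 have at: "((%y. arctan (r / y)) \<longlongrightarrow> pi / 2 * sgn r) (at_right 0)" if "r ~= 0" for r :: real
  using that pos[of r] tendsto_minus[OF pos[of "- r"]] by (cases "r > 0") (auto simp: arctan_minus)
 have "((%y. \<bar>winding c y\<bar>) \<longlongrightarrow> \<bar>(\<Sum>i<n. pi / 2 * sgn (c - x i) - pi / 2 * sgn (c - b i)) + pi / 2 * sgn c\<bar>) (at_right 0)"
  unfolding winding_def by (intro tendsto_intros at) (use c in auto)
 moreover have "\<forall>\<^sub>F y in at_right 0. \<bar>winding c y\<bar> <= pi / 2"
  by (rule eventually_mono[OF eventually_at_right_less]) (use winding_bound in "auto simp: less_imp_le")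
 ultimately have "\<bar>(\<Sum>i<n. pi / 2 * sgn (c - x i) - pi / 2 * sgn (c - b i)) + pi / 2 * sgn c\<bar> <= pi / 2"
  by (rule tendsto_upperbound) simp
 also have "(\<Sum>i<n. pi / 2 * sgn (c - x i) - pi / 2 * sgn (c - b i)) + pi / 2 * sgn c
   = pi / 2 * ((\<Sum>i<n. sgn (c - x i) - sgn (c - b i)) + sgn c)"
  by (simp add: sum_distrib_left right_diff_distrib distrib_left)
 finally show ?thesis by (simp add: abs_mult)
qed

lemma gap_lipschitz1: "c <= d ==> \<bar>(gap d + \<bar>d\<bar>) - (gap c + \<bar>c\<bar>)\<bar> <= d - c"
proof -
 assume cd: "c <= d"
 define S where "S = insert 0 (x ` {..<n} \<union> b ` {..<n})"
 define F' where "F' z = (if z \<in> S then 0 else (\<Sum>i<n. sgn (z - x i) - sgn (z - b i)) + sgn z)" for z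
 have ab: "((%z. \<bar>z - a\<bar>) has_vector_derivative sgn (z - a)) (at z)" if "z ~= a" for z a :: real
  unfolding has_real_derivative_iff_has_vector_derivative[symmetric]
 proof (cases "z > a")
  case True
  have "((%z. z - a) has_real_derivative 1) (at z)" by (auto intro!: derivative_eq_intros)
  from has_field_derivative_transform_within_open[OF this open_greaterThan[of a]] True
  show "((%z. \<bar>z - a\<bar>) has_real_derivative sgn (z - a)) (at z)" by simp
 next
  case False
  have "((%z. a - z) has_real_derivative -1) (at z)" by (auto intro!: derivative_eq_intros)
  from has_field_derivative_transform_within_open[OF this open_lessThan[of a]] False that
  show "((%z. \<bar>z - a\<bar>) has_real_derivative sgn (z - a)) (at z)" by simp
 qed
 have "(F' has_integral (gap d + \<bar>d\<bar>) - (gap c + \<bar>c\<bar>)) {c..d}"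
 proof (rule fundamental_theorem_of_calculus_interior_strong[of S])
  fix z assume "z \<in> {c<..<d} - S"
  then show "((%c. gap c + \<bar>c\<bar>) has_vector_derivative F' z) (at z)"
   unfolding gap_def F'_def using ab[of z 0] by (auto simp: S_def intro!: derivative_intros ab)
 next
  show "continuous_on {c..d} (%c. gap c + \<bar>c\<bar>)" unfolding gap_def by (intro continuous_intros)
 qed (auto simp: S_def cd)
 then have "norm ((gap d + \<bar>d\<bar>) - (gap c + \<bar>c\<bar>)) <= 1 * measure lborel (cbox c d)"
  by (intro has_integral_bound[of 1 F']) (use slope_bound in "auto simp: F'_def S_def")
 then show ?thesis using cd by simp
qed

lemma gap_0: "EX L. ALL c. c ~: {-L..L} --> gap c = 0"
proof -
 define L where "L = (\<Sum>i<n. \<bar>x i\<bar> + \<bar>b i\<bar>)"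
 have L: "\<bar>x i\<bar> <= L & \<bar>b i\<bar> <= L" if "i < n" for i
 proof -
  have "\<bar>x i\<bar> + \<bar>b i\<bar> <= L" unfolding L_def using that by (intro member_le_sum) auto
  then show ?thesis by linarith
 qed
 have "gap c = 0" if "c ~: {-L..L}" for c
 proof -
  have "gap c = (\<Sum>i<n. sgn c * (b i - x i))" unfolding gap_def
  proof (rule sum.cong[OF refl])
   fix i assume "i \<in> {..<n}"
   then have "\<bar>x i\<bar> <= L" "\<bar>b i\<bar> <= L" using L[of i] by auto
   moreover have "c > L | c < - L" using that by auto
   ultimately show "\<bar>c - x i\<bar> - \<bar>c - b i\<bar> = sgn c * (b i - x i)" by (cases "c > 0") auto
  qed
  then show ?thesis using trace by (simp add: sum_distrib_left[symmetric] sum_subtractf)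
 qed
 then show ?thesis by blast
qed

lemma gap_lipschitz: "\<bar>gap d - gap c\<bar> <= 2 * \<bar>d - c\<bar>"
 using gap_lipschitz1[of c d] gap_lipschitz1[of d c] abs_triangle_ineq3[of d c]
 by (cases "c <= d") (simp_all add: abs_le_iff abs_real_def split: if_splits)

text \<open>|c| + gap c is 1-Lipschitz and equals |c| far out on both sides, so it cannot drop below
  |c|.\<close>

lemma gap_nonneg: "gap c >= 0"
proof -
 obtain L where L: "!!c. c ~: {-L..L} ==> gap c = 0" using gap_0 by blast
 define T where "T = \<bar>L\<bar> + \<bar>c\<bar> + 1"
 have "gap T = 0" "gap (- T) = 0" "T >= \<bar>c\<bar>"
  unfolding T_def by (intro L; unfold atLeastAtMost_iff; linarith; fail)+ linarith
 then show ?thesis using gap_lipschitz1[of c T] gap_lipschitz1[of "- T" c] by (cases "c >= 0") auto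
qed

lemma gap_cont: "continuous_on UNIV gap"
 unfolding gap_def by (intro continuous_intros)

lemma gap_moment_integrable: "integrable lborel (%c. gap c * c ^ m)"
proof -
 obtain L where L: "!!c. c ~: {-L..L} ==> gap c = 0" using gap_0 by blast
 show ?thesis by (rule integrable_continuous_compact_support[of _ L]) (use L gap_cont in "auto intro!: continuous_intros")
qed

lemma half_dd_gap:
 fixes phi :: "real => 'a::euclidean_space"
 assumes "!!x. (phi has_vector_derivative phi' x) (at x)" "!!x. (phi' has_vector_derivative phi'' x) (at x)"
  "continuous_on UNIV phi''"
 shows "half_dd gap phi = (\<Sum>i<n. phi (x i) - phi (b i))"
proof -
 let ?I = "{..<n} <+> {..<n}" and ?m = "case_sum (%_. 1) (%_. -1 :: real)" and ?a = "case_sum x b"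
 have "half_dd (%c. \<Sum>i\<in>?I. ?m i * \<bar>c - ?a i\<bar>) phi = (\<Sum>i\<in>?I. ?m i *\<^sub>R phi (?a i))"
  by (rule half_dd_abs_sum[OF assms]) (simp_all add: sum.Plus trace sum_negf)
 moreover have "gap = (%c. \<Sum>i\<in>?I. ?m i * \<bar>c - ?a i\<bar>)" by (simp add: gap_def fun_eq_iff sum.Plus sum_subtractf sum_negf)
 ultimately show ?thesis by (simp add: sum.Plus sum_subtractf sum_negf)
qed

lemma half_dd_gap_pow: "half_dd gap (%c. c ^ p) = (\<Sum>i<n. x i ^ p) - (\<Sum>i<n. b i ^ p)"
 by (subst half_dd_gap[OF pow_vector_derivs]) (auto intro!: continuous_intros simp: sum_subtractf)

lemma exp_half_dd_gap_log:
 assumes u: "u ~: \<real>"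
 shows "exp (Ln (1 / u) + half_dd gap (%c. Ln (1 / (u - complex_of_real c))))
  = (\<Prod>i<n. u - complex_of_real (b i)) / (u * (\<Prod>i<n. u - complex_of_real (x i)))"
proof -
 have nz: "u - complex_of_real r ~= 0" "u ~= 0" for r using u by auto
 have e: "exp (Ln (1 / (u - complex_of_real r))) = 1 / (u - complex_of_real r)" "exp (Ln (1 / u)) = 1 / u" for r
  using nz by (auto intro!: exp_Ln)
 have "half_dd gap (%c. Ln (1 / (u - complex_of_real c)))
   = (\<Sum>i<n. Ln (1 / (u - complex_of_real (x i))) - Ln (1 / (u - complex_of_real (b i))))"
  by (rule half_dd_gap[OF log_kernel_derivs[OF u]]) (use nz in "auto intro!: continuous_intros")
 then show ?thesis
  by (simp add: exp_add exp_sum exp_diff e prod_dividef nz)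
qed

end

text \<open>To the right of c the function stays above \<open>g c / 2\<close> over a length
  \<open>g c / 4\<close> while the weight only grows, so the moment is at least an eighth of the
  left side.\<close>

lemma decay_from_moment_pos:
 fixes g :: "real => real"
 assumes g: "!!c. g c >= 0" "!!c d. \<bar>g d - g c\<bar> <= 2 * \<bar>d - c\<bar>" and i: "integrable lborel (%c. g c * c ^ (2 * m))"
  and c: "c >= 0"
 shows "(g c)^2 * c ^ (2 * m) <= 8 * (\<integral>c. g c * c ^ (2 * m) \<partial>lborel)"
proof -
 let ?J = "{c..c + g c / 4}"
 have "(LINT z|lborel. indicator ?J z * (g c / 2 * c ^ (2 * m))) <= (\<integral>c. g c * c ^ (2 * m) \<partial>lborel)"
 proof (rule integral_mono[OF _ i])
  show "integrable lborel (%z. indicator ?J z * (g c / 2 * c ^ (2 * m)))"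
   by (intro integrable_mult_left) (use g(1)[of c] in "auto intro!: integrable_real_indicator")
  fix z
  show "indicator ?J z * (g c / 2 * c ^ (2 * m)) <= g z * z ^ (2 * m)"
  proof (cases "z \<in> ?J")
   case True
   then have "g c / 2 <= g z" "c ^ (2 * m) <= z ^ (2 * m)" using g(2)[of z c] c by (auto intro: power_mono)
   then have "g c / 2 * c ^ (2 * m) <= g z * z ^ (2 * m)" using g(1)[of z] c by (intro mult_mono) auto
   then show ?thesis using True by simp
  next
   case False
   have "z ^ (2 * m) >= 0" by (simp add: zero_le_even_power)
   then show ?thesis using False g(1)[of z] by simp
  qed
 qed
 moreover have "(LINT z|lborel. indicator ?J z * (g c / 2 * c ^ (2 * m))) = (g c)^2 * c ^ (2 * m) / 8"
  using g(1)[of c] by (simp add: power2_eq_square)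
 ultimately show ?thesis by linarith
qed

lemma decay_from_moment:
 fixes g :: "real => real"
 assumes g: "!!c. g c >= 0" "!!c d. \<bar>g d - g c\<bar> <= 2 * \<bar>d - c\<bar>" and i: "integrable lborel (%c. g c * c ^ (2 * m))"
 shows "(g c)^2 * c ^ (2 * m) <= 8 * (\<integral>c. g c * c ^ (2 * m) \<partial>lborel)"
proof (cases "c >= 0")
 case False
 have "(g (- (- c)))^2 * (- c) ^ (2 * m) <= 8 * (\<integral>c. g (- c) * c ^ (2 * m) \<partial>lborel)"
 proof (rule decay_from_moment_pos)
  show "\<bar>g (- d) - g (- c)\<bar> <= 2 * \<bar>d - c\<bar>" for c d using g(2)[of "- d" "- c"] by (simp add: abs_minus_commute)
  show "integrable lborel (%c. g (- c) * c ^ (2 * m))"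
   using lborel_integrable_real_affine[OF i, of "-1" 0] by simp
 qed (use g False in auto)
 also have "(\<integral>c. g (- c) * c ^ (2 * m) \<partial>lborel) = (\<integral>c. g c * c ^ (2 * m) \<partial>lborel)"
  using lborel_integral_real_affine[of "-1" "%c. g c * c ^ (2 * m)" 0] by simp
 finally show ?thesis by simp
qed (use decay_from_moment_pos[OF assms] in blast)

text \<open>Arzela-Ascoli: a subsequence converging at all rationals converges everywhere because
  the Lipschitz constant is common.\<close>

lemma equilipschitz_subsequence:
 fixes g :: "nat => real => real"
 assumes lip: "!!N c d. \<bar>g N d - g N c\<bar> <= 2 * \<bar>d - c\<bar>" and bd: "!!N c. \<bar>g N c\<bar> <= B"
 obtains G r where "strict_mono (r :: nat => nat)" "!!c. (%N. g (r N) c) ----> G c"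
proof -
 obtain r where r: "strict_mono (r :: nat => nat)" "!!q. q \<in> \<rat> ==> EX l. (%N. g (r N) q) ----> l"
  using function_convergent_subsequence[of "\<rat> :: real set" g B] bd countable_rat by auto
 have "Cauchy (%N. g (r N) c)" for c
 proof (rule CauchyI)
  fix eps :: real assume eps: "eps > 0"
  obtain q where q: "q \<in> \<rat>" "c < q" "q < c + eps / 8" using Rats_dense_in_real[of c "c + eps / 8"] eps by auto
  then have "Cauchy (%N. g (r N) q)" using r(2) LIMSEQ_imp_Cauchy by blast
  then obtain M where M: "!!m n. m >= M ==> n >= M ==> \<bar>g (r m) q - g (r n) q\<bar> < eps / 2"
   using CauchyD[of _ "eps / 2"] eps by (metis half_gt_zero real_norm_def)
  have "\<bar>g (r m) c - g (r n) c\<bar> < eps" if "m >= M" "n >= M" for m n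
  proof -
   have "2 * \<bar>c - q\<bar> < eps / 4" using q by (simp add: abs_real_def)
   then show ?thesis using M[OF that] lip[of "r m" c q] lip[of "r n" c q] by linarith
  qed
  then show "EX M. ALL m>=M. ALL n>=M. norm (g (r m) c - g (r n) c) < eps" by auto
 qed
 then have "EX l. (%N. g (r N) c) ----> l" for c using Cauchy_convergent convergent_def by blast
 then obtain G where "!!c. (%N. g (r N) c) ----> G c" by metis
 with r(1) show ?thesis by (rule that)
qed

text \<open>Bounds of every order, each valid from an index that may depend on the order, give
  common integrable majorants and hence convergence of all pairings along one subsequence.\<close>

locale tight_gaps =
 fixes g :: "nat => real => real"
 assumes nonneg: "!!N c. g N c >= 0" and lip: "!!N c d. \<bar>g N d - g N c\<bar> <= 2 * \<bar>d - c\<bar>"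
  and mom: "!!m. EX C N0. ALL N>=N0. ALL c. (g N c)^2 * c ^ (2 * m) <= C"
begin

lemma dominated: "EX A N0. ALL N>=N0. ALL c. g N c * \<bar>c\<bar> ^ p <= A * (1 / (1 + c^2))"
proof -
 have root: "EX A N0. ALL N>=N0. ALL c. g N c * \<bar>c\<bar> ^ m <= A" for m
 proof -
  obtain C N0 where C: "!!N c. N >= N0 ==> (g N c)^2 * c ^ (2 * m) <= C" using mom[of m] by blast
  have "g N c * \<bar>c\<bar> ^ m <= sqrt C" if "N >= N0" for N c
  proof (rule real_le_rsqrt)
   have "(g N c * \<bar>c\<bar> ^ m)^2 = (g N c)^2 * c ^ (2 * m)" by (simp add: power_mult_distrib power_even_abs power_mult[symmetric] mult.commute)
   then show "(g N c * \<bar>c\<bar> ^ m)^2 <= C" using C[OF that] by simp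
  qed
  then show ?thesis by blast
 qed
 obtain A N0 where A: "!!N c. N >= N0 ==> g N c * \<bar>c\<bar> ^ p <= A" using root[of p] by blast
 obtain A' N0' where A': "!!N c. N >= N0' ==> g N c * \<bar>c\<bar> ^ (p + 2) <= A'" using root[of "p + 2"] by blast
 have "g N c * \<bar>c\<bar> ^ p <= (A + A') * (1 / (1 + c^2))" if "N >= max N0 N0'" for N c
 proof -
  have pos: "1 + c^2 > 0" by (simp add: add_pos_nonneg)
  have "g N c * \<bar>c\<bar> ^ p * (1 + c^2) = g N c * \<bar>c\<bar> ^ p + g N c * \<bar>c\<bar> ^ (p + 2)" by (simp add: power_add power2_eq_square distrib_left)
  also have "... <= A + A'" using A A' that by (intro add_mono) auto
  finally show ?thesis using pos by (simp add: pos_le_divide_eq)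
 qed
 then show ?thesis by blast
qed

lemma limit_exists:
 obtains G r where "strict_mono (r :: nat => nat)" "!!c. (%N. g (r N) c) ----> G c" "decaying G"
proof -
 obtain A N0 where A: "!!N c. N >= N0 ==> g N c <= A * (1 / (1 + c^2))" using dominated[of 0] by auto
 have "A >= 0" using A[of N0 0] nonneg[of N0 0] by simp
 have "g (N + N0) c <= A" for N c
 proof -
  have "A * (1 / (1 + c^2)) <= A * 1" using \<open>A >= 0\<close> by (intro mult_left_mono) (auto simp: divide_le_eq_1 add_pos_nonneg)
  then show ?thesis using A[of "N + N0" c] by simp
 qed
 then have bd: "\<bar>g (N + N0) c\<bar> <= A" for N c using nonneg by simp
 obtain G r where r: "strict_mono (r :: nat => nat)" "!!c. (%N. g (r N + N0) c) ----> G c"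
  using equilipschitz_subsequence[of "%N. g (N + N0)", OF lip bd] by metis
 have G: "0 <= G c" "G c <= A * (1 / (1 + c^2))" for c
  by (rule LIMSEQ_le_const[OF r(2)] LIMSEQ_le_const2[OF r(2)], use nonneg A in force)+
 have "\<bar>G d - G c\<bar> <= 2 * \<bar>d - c\<bar>" for c d
  by (rule LIMSEQ_le_const2[OF tendsto_rabs[OF tendsto_diff[OF r(2) r(2)]]]) (use lip in auto)
 then have "2-lipschitz_on UNIV G" by (intro lipschitz_onI) (auto simp: dist_real_def)
 then have cont: "continuous_on UNIV G" by (rule lipschitz_on_continuous_on)
 have lim: "((%c::real. A * (1 / (1 + c^2))) \<longlongrightarrow> 0) at_top" "((%c::real. A * (1 / (1 + c^2))) \<longlongrightarrow> 0) at_bot"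
  by real_asymp+
 have "(G \<longlongrightarrow> 0) at_top" "(G \<longlongrightarrow> 0) at_bot"
  by (rule tendsto_sandwich[OF _ _ tendsto_const lim(1)] tendsto_sandwich[OF _ _ tendsto_const lim(2)]; use G in simp)+
 then have "decaying G" using cont by unfold_locales
 moreover have "strict_mono (%N. r N + N0)" using r(1) by (simp add: strict_mono_def)
 ultimately show ?thesis using that r(2) by blast
qed

lemma integral_limit:
 fixes k :: "real => 'a::euclidean_space"
 assumes r: "strict_mono (r :: nat => nat)" "!!c. (%N. g (r N) c) ----> G c" and G: "decaying G"
  and k: "continuous_on UNIV k" "!!c. norm (k c) <= a * \<bar>c\<bar> ^ p"
 shows "(%N. \<integral>c. g (r N) c *\<^sub>R k c \<partial>lborel) ----> (\<integral>c. G c *\<^sub>R k c \<partial>lborel)"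
proof -
 obtain A N0 where A: "!!N c. N >= N0 ==> g N c * \<bar>c\<bar> ^ p <= A * (1 / (1 + c^2))" using dominated by blast
 have a: "a >= 0" using order_trans[OF norm_ge_zero k(2)[of 1]] by simp
 have km: "k \<in> borel_measurable borel" by (rule real_borel_continuous[OF k(1)])
 have gm: "g N \<in> borel_measurable borel" for N
 proof (rule real_borel_continuous)
  have "2-lipschitz_on UNIV (g N)" by (intro lipschitz_onI) (auto simp: dist_real_def lip)
  then show "continuous_on UNIV (g N)" by (rule lipschitz_on_continuous_on)
 qed
 have Gm: "G \<in> borel_measurable borel" using G by (intro real_borel_continuous) (simp add: decaying_def)
 have "(%N. \<integral>c. g (r (N + N0)) c *\<^sub>R k c \<partial>lborel) ----> (\<integral>c. G c *\<^sub>R k c \<partial>lborel)"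
 proof (rule integral_dominated_convergence)
  show "integrable lborel (%c. a * (A * (1 / (1 + c^2))))" by (intro integrable_mult_right integrable_cauchy)
  show "(%c. G c *\<^sub>R k c) \<in> borel_measurable lborel" using Gm km by simp
  show "(%c. g (r (N + N0)) c *\<^sub>R k c) \<in> borel_measurable lborel" for N using gm[of "r (N + N0)"] km by simp
  show "AE c in lborel. (%N. g (r (N + N0)) c *\<^sub>R k c) ----> G c *\<^sub>R k c"
   by (intro AE_I2 tendsto_intros LIMSEQ_ignore_initial_segment[OF r(2)])
  show "AE c in lborel. norm (g (r (N + N0)) c *\<^sub>R k c) <= a * (A * (1 / (1 + c^2)))" for N
  proof (rule AE_I2)
   fix c
   have "norm (g (r (N + N0)) c *\<^sub>R k c) <= g (r (N + N0)) c * (a * \<bar>c\<bar> ^ p)"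
    using nonneg k(2) by (simp add: mult_left_mono)
   also have "... = a * (g (r (N + N0)) c * \<bar>c\<bar> ^ p)" by simp
   also have "... <= a * (A * (1 / (1 + c^2)))"
    using seq_suble[OF r(1), of "N + N0"] by (intro mult_left_mono a A) auto
   finally show "norm (g (r (N + N0)) c *\<^sub>R k c) <= a * (A * (1 / (1 + c^2)))" .
  qed
 qed
 then show ?thesis by (rule LIMSEQ_offset)
qed

end

section \<open>Resolvents of banded Lax matrices\<close>

lemma lax_herm: "lax v e j k = cnj (lax v e k j)"
 by (simp add: lax_def)

lemma hermitian_lax: "N > 0 ==> hermitian_matrix (lax v e) N"
 unfolding hermitian_matrix_def using lax_herm[of v e] by blast

text \<open>Finitely many Fourier coefficients: this covers \<open>v_PL\<close> and its variation in
  one mode, on which the Wirtinger derivatives are computed.\<close>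

locale banded =
 fixes v :: "nat => complex" and e :: real and K :: nat
 assumes band: "!!j. j > K ==> v j = 0" and K: "K > 0"
begin

abbreviation vacuum :: "nat => complex" where "vacuum \<equiv> %j. if j = 0 then 1 else 0"

definition LL :: "(nat => complex) => nat => complex" where
 "LL x j = (\<Sum>k\<le>j + K. lax v e j k * x k)"

primrec vac :: "nat => nat => complex" where
 "vac 0 = vacuum"
| "vac (Suc i) = LL (vac i)"

abbreviation tr :: "nat => (nat => complex) => nat => complex" where
 "tr N \<equiv> hermitian_matrix.ap (lax v e) N"

lemma lax_0: "k > j + K ==> lax v e j k = 0" "j > k + K ==> lax v e j k = 0"
 by (auto simp: lax_def band)

lemma LL_support:
 assumes x: "!!k. k >= n ==> x k = 0"
 shows "LL x j = (\<Sum>k<n. lax v e j k * x k)"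
proof -
 have "LL x j = (\<Sum>k\<in>{..j + K} \<union> {..<n}. lax v e j k * x k)"
  unfolding LL_def by (rule sum.mono_neutral_left) (auto simp: lax_0(1))
 also have "... = (\<Sum>k<n. lax v e j k * x k)"
  by (rule sum.mono_neutral_right) (auto simp: x)
 finally show ?thesis .
qed

lemma LL_support_0:
 assumes x: "!!k. k >= n ==> x k = 0" and j: "j >= n + K"
 shows "LL x j = 0"
proof -
 have "lax v e j k * x k = 0" if "k < n" for k using lax_0(2)[of k j] that j by simp
 then show ?thesis by (simp only: LL_support[OF x], intro sum.neutral) auto
qed

lemma tr_eq_LL:
 assumes "!!k. k >= n ==> x k = 0" "n + K <= N"
 shows "tr N x = LL x"
proof
 fix j
 have N: "N > 0" using assms(2) K by simp
 interpret hermitian_matrix "lax v e" N by (rule hermitian_lax[OF N])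
 have "!!k. k >= N ==> x k = 0" using assms by auto
 from LL_support[OF this] have "LL x j = (\<Sum>k<N. lax v e j k * x k)" by simp
 moreover have "LL x j = 0" if "j >= N" using LL_support_0[OF assms(1)] that assms(2) by simp
 ultimately show "ap x j = LL x j" by (simp add: ap_def)
qed

lemma vac_support: "j > K * i ==> vac i j = 0"
proof (induction i arbitrary: j)
 case (Suc i)
 show ?case unfolding vac.simps
  by (rule LL_support_0[of "Suc (K * i)"]) (use Suc in auto)
qed simp

text \<open>L enlarges the support by at most K rows, so low powers do not see the
  truncation.\<close>

lemma kry_vac: "K * i < N ==> hermitian_matrix.kry (lax v e) N i = vac i"
proof (induction i)
 case (Suc i)
 then have N: "N > 0" by simp
 interpret hermitian_matrix "lax v e" N by (rule hermitian_lax[OF N])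
 have "tr N (vac i) = LL (vac i)"
  by (rule tr_eq_LL[of "Suc (K * i)"]) (use Suc.prems vac_support in auto)
 then show ?case using Suc by (simp add: kry_Suc)
next
 case 0
 interpret hermitian_matrix "lax v e" N by (rule hermitian_lax) (use 0 in simp)
 show ?case by (simp add: kry_def)
qed

lemma LL_cmult: "LL (%k. c * x k) j = c * LL x j"
 by (simp add: LL_def sum_distrib_left mult.left_commute)

lemma LL_sum: "LL (%k. \<Sum>i\<in>I. x i k) j = (\<Sum>i\<in>I. LL (x i) j)"
 unfolding LL_def sum_distrib_left by (rule sum.swap)

section \<open>Residuals and averaged truncations\<close>

definition defect :: "complex => (nat => complex) => nat => complex" where
 "defect u y j = vacuum j - (u * y j - LL y j)"

context
 fixes u :: complex and z :: "nat => nat => complex"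
 assumes u: "Im u ~= 0" and z0: "!!N j. N > 0 ==> j >= N ==> z N j = 0"
  and z: "!!N j. N > 0 ==> u * z N j - tr N (z N) j = vacuum j"
begin

text \<open>A finitely supported \<open>y\<close> is compared with the truncated solution through
  its residual in the infinite matrix, which can be bounded independently of
  \<open>N\<close>.\<close>

lemma approximation:
 assumes y: "!!k. k >= n ==> y k = 0" and le: "n + K <= N"
 shows "(Im u)^2 * (\<Sum>j<N. (cmod (z N j - y j))^2) <= (\<Sum>j<N. (cmod (defect u y j))^2)"
proof -
 have N0: "N > 0" using le K by simp
 interpret hermitian_matrix "lax v e" N by (rule hermitian_lax[OF N0])
 have "u * (z N j - y j) - ap (%j. z N j - y j) j = defect u y j" for j
 proof -
  have "ap (%j. z N j + (-1) * y j) j = ap (z N) j + (-1) * ap y j" by (simp only: ap_add ap_cmult)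
  moreover have "ap y j = LL y j" using tr_eq_LL[of n y N] y le by simp
  ultimately show ?thesis using z[OF N0, of j] by (simp add: defect_def algebra_simps)
 qed
 then show ?thesis using resolvent_bound[of u "%j. z N j - y j"] by (simp add: nn_def)
qed

lemma z_bound: "N > 0 ==> cmod (z N j) <= 1 / \<bar>Im u\<bar>"
proof -
 assume N0: "N > 0"
 interpret hermitian_matrix "lax v e" N by (rule hermitian_lax[OF N0])
 show ?thesis
 proof (cases "j < N")
  case True
  have "(Im u)^2 * (cmod (z N j))^2 <= (Im u)^2 * nn (z N)" by (intro mult_left_mono nn_ge True) auto
  also have "... <= nn vacuum" using resolvent_bound[of u "z N"] by (simp only: z[OF N0])
  also have "nn vacuum = (\<Sum>i<N. if i = 0 then 1 else 0)" unfolding nn_def by (intro sum.cong) auto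
  also have "... = 1" using N0 by simp
  finally have "(\<bar>Im u\<bar> * cmod (z N j))^2 <= 1^2" by (simp add: power_mult_distrib)
  then have "\<bar>Im u\<bar> * cmod (z N j) <= 1" by (rule power2_le_imp_le) simp
  then show ?thesis using u by (simp add: pos_le_divide_eq mult.commute)
 qed (simp add: z0 N0)
qed

lemma defect_z:
 assumes "N > 0"
 shows "j < N | j >= N + K ==> defect u (z N) j = 0"
  "cmod (defect u (z N) j) <= (\<Sum>i\<le>K. cmod (v i)) / \<bar>Im u\<bar>"
proof -
 interpret hermitian_matrix "lax v e" N by (rule hermitian_lax[OF assms])
 have LL_z: "LL (z N) j = (\<Sum>k<N. lax v e j k * z N k)" for j by (rule LL_support) (rule z0[OF assms])
 have lt: "defect u (z N) j = 0" if "j < N" for j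
  using z[OF assms, of j] that LL_z[of j] by (simp add: defect_def ap_def)
 have ge: "defect u (z N) j = LL (z N) j" if "j >= N" for j
  using that assms z0[OF assms that] by (simp add: defect_def)
 show "defect u (z N) j = 0" if "j < N | j >= N + K"
  using that lt ge LL_support_0[of N "z N" j] z0[OF assms] by (cases "j < N") auto
 have V: "(\<Sum>i\<le>K. cmod (v i)) / \<bar>Im u\<bar> >= 0" by (intro divide_nonneg_nonneg sum_nonneg) auto
 show "cmod (defect u (z N) j) <= (\<Sum>i\<le>K. cmod (v i)) / \<bar>Im u\<bar>"
 proof (cases "j < N")
  case True then show ?thesis using V lt by simp
 next
  case False
  then have "defect u (z N) j = (\<Sum>k<N. v (j - k) * z N k)" unfolding ge[OF leI[OF False]] LL_z
   by (intro sum.cong) (auto simp: lax_def)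
  also have "cmod ... <= (\<Sum>k<N. cmod (v (j - k)) * (1 / \<bar>Im u\<bar>))"
   by (rule sum_norm_le, unfold norm_mult, intro mult_left_mono z_bound assms norm_ge_zero)
  also have "... = (\<Sum>k<N. cmod (v (j - k))) / \<bar>Im u\<bar>" by (simp add: sum_divide_distrib)
  also have "... <= (\<Sum>i\<le>K. cmod (v i)) / \<bar>Im u\<bar>"
  proof (intro divide_right_mono)
   have "(\<Sum>k<N. cmod (v (j - k))) = (\<Sum>i\<in>(%k. j - k) ` {..<N}. cmod (v i))"
    using False by (subst sum.reindex) (auto simp: inj_on_def)
   also have "... = (\<Sum>i\<in>(%k. j - k) ` {..<N} \<inter> {..K}. cmod (v i))"
    by (rule sum.mono_neutral_right) (auto simp: band not_le)
   also have "... <= (\<Sum>i\<le>K. cmod (v i))" by (rule sum_mono2) auto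
   finally show "(\<Sum>k<N. cmod (v (j - k))) <= (\<Sum>i\<le>K. cmod (v i))" .
  qed simp
  finally show ?thesis .
 qed
qed

definition avg :: "nat => nat => complex" where
 "avg M j = (1 / of_nat M) * (\<Sum>N\<in>{M..<2 * M}. z N j)"

lemma avg_support: "M > 0 ==> j >= 2 * M ==> avg M j = 0"
 unfolding avg_def by (simp add: z0)

text \<open>The defects of consecutive truncations overlap in at most \<open>K\<close> rows, so averaging makes them small.\<close>

lemma defect_avg:
 assumes M: "M > 0"
 shows "j >= 2 * M + K ==> defect u (avg M) j = 0"
  "cmod (defect u (avg M) j) <= real K * ((\<Sum>i\<le>K. cmod (v i)) / \<bar>Im u\<bar>) / real M"
proof -
 let ?c = "(\<Sum>i\<le>K. cmod (v i)) / \<bar>Im u\<bar>"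
 have c: "?c >= 0" by (intro divide_nonneg_nonneg sum_nonneg) auto
 have eq: "defect u (avg M) j = (1 / of_nat M) * (\<Sum>N\<in>{M..<2 * M}. defect u (z N) j)" for j
 proof -
  have "LL (avg M) j = (1 / of_nat M) * (\<Sum>N\<in>{M..<2 * M}. LL (z N) j)"
   unfolding avg_def[abs_def] LL_cmult LL_sum ..
  then show ?thesis using M unfolding defect_def avg_def
   by (simp add: sum_subtractf sum_distrib_left[symmetric] sum.distrib field_simps)
 qed
 show "defect u (avg M) j = 0" if "j >= 2 * M + K"
  unfolding eq using that M by (simp add: defect_z(1))
 have "cmod (\<Sum>N\<in>{M..<2 * M}. defect u (z N) j) <= (\<Sum>N\<in>{M..<2 * M} \<inter> {Suc j - K..j}. ?c)"
 proof -
  have "(\<Sum>N\<in>{M..<2 * M}. defect u (z N) j) = (\<Sum>N\<in>{M..<2 * M} \<inter> {Suc j - K..j}. defect u (z N) j)"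
   by (rule sum.mono_neutral_right) (use M in "auto intro!: defect_z(1)")
  also have "cmod ... <= (\<Sum>N\<in>{M..<2 * M} \<inter> {Suc j - K..j}. ?c)"
   by (rule sum_norm_le) (use M in "auto intro!: defect_z(2)")
  finally show ?thesis .
 qed
 also have "... <= real K * ?c"
 proof -
  have "card ({M..<2 * M} \<inter> {Suc j - K..j}) <= card {Suc j - K..j}" by (intro card_mono) auto
  also have "... <= K" by simp
  finally show ?thesis unfolding sum_constant using c by (intro mult_right_mono) auto
 qed
 finally show "cmod (defect u (avg M) j) <= real K * ?c / real M"
  using divide_right_mono[of _ _ "real M"] unfolding eq norm_mult by (fastforce simp: norm_divide)
qed

lemma defect_avg_sum: "EX \<delta>. \<delta> ----> 0 & (ALL M>0. ALL N. (\<Sum>j<N. (cmod (defect u (avg M) j))^2) <= \<delta> M)"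
proof -
 define c where "c = real K * ((\<Sum>i\<le>K. cmod (v i)) / \<bar>Im u\<bar>)"
 \<comment> \<open>At most 2 M + K rows carry a residual, each of size at most c / M: the squared
   norm is of order 1 / M, whereas for a single truncation only boundedness of the entries is
   known.\<close>
 have "(\<Sum>j<N. (cmod (defect u (avg M) j))^2) <= real (2 * M + K) * (c / real M)^2" if M: "M > 0" for M N
 proof -
  have "(\<Sum>j<N. (cmod (defect u (avg M) j))^2) = (\<Sum>j\<in>{..<N} \<inter> {..<2 * M + K}. (cmod (defect u (avg M) j))^2)"
   using defect_avg(1)[OF M] by (intro sum.mono_neutral_right) (force simp: not_less)+
  also have "... <= (\<Sum>j<2 * M + K. (cmod (defect u (avg M) j))^2)" by (rule sum_mono2) auto
  also have "... <= (\<Sum>j<2 * M + K. (c / real M)^2)"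
   unfolding c_def by (intro sum_mono power_mono defect_avg(2) M) auto
  finally show ?thesis by simp
 qed
 moreover have "(%M. real (2 * M + K) * (c / real M)^2) ----> 0"
 proof -
  have "(%M. c^2 * ((2 * real M + k) / (real M)^2)) ----> c^2 * 0" for k
   by (intro tendsto_mult tendsto_const) real_asymp
  from this[of "real K"] show ?thesis by (simp add: power_divide mult.commute)
 qed
 ultimately show ?thesis by blast
qed

text \<open>The estimate against arbitrary finitely supported \<open>y\<close> has two uses: with
  the averages it gives convergence, with approximants of another solution it gives
  uniqueness.\<close>

lemma truncation_limit:
 "EX x. (ALL j. (%N. z N j) ----> x j) &
  (ALL n y J B. (ALL k>=n. y k = 0) --> (ALL N. (\<Sum>j<N. (cmod (defect u y j))^2) <= B) -->
    (\<Sum>j<J. (cmod (x j - y j))^2) <= B / (Im u)^2)"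
proof -
 have u2: "(Im u)^2 > 0" using u by simp
 have ap: "(\<Sum>j<J. (cmod (z N j - y j))^2) <= B / (Im u)^2"
  if y: "!!k. k >= n ==> y k = 0" and B: "!!N. (\<Sum>j<N. (cmod (defect u y j))^2) <= B" and N: "N >= n + K + J" for n y B N J
 proof -
  have "(\<Sum>j<J. (cmod (z N j - y j))^2) <= (\<Sum>j<N. (cmod (z N j - y j))^2)"
   by (rule sum_mono2) (use N in auto)
  also have "... <= B / (Im u)^2"
   using order_trans[OF approximation[of n y N] B] y N u2 by (simp add: pos_le_divide_eq mult.commute)
  finally show ?thesis .
 qed
 obtain \<delta> where \<delta>: "\<delta> ----> 0" "!!M N. M > 0 ==> (\<Sum>j<N. (cmod (defect u (avg M) j))^2) <= \<delta> M"
  using defect_avg_sum by blast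
 have "Cauchy (%N. z N j)" for j
 proof (rule CauchyI)
  fix eps :: real assume eps: "eps > 0"
  have "\<forall>\<^sub>F M in sequentially. \<delta> M < (eps / 2)^2 * (Im u)^2 & M > 0"
   using order_tendstoD(2)[OF \<delta>(1), of "(eps / 2)^2 * (Im u)^2"] eps u2 by (intro eventually_conj) auto
  then obtain M where M: "\<delta> M < (eps / 2)^2 * (Im u)^2" "M > 0" by (auto simp: eventually_sequentially)
  have close: "cmod (z N j - avg M j) < eps / 2" if "N >= 2 * M + K + Suc j" for N
  proof -
   have "(cmod (z N j - avg M j))^2 <= (\<Sum>i<Suc j. (cmod (z N i - avg M i))^2)" by (rule member_le_sum) auto
   also have "... <= \<delta> M / (Im u)^2" by (rule ap[OF avg_support[OF M(2)] \<delta>(2)[OF M(2)] that])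
   also have "... < (eps / 2)^2" using M(1) u2 by (simp add: pos_divide_less_eq)
   finally show ?thesis by (rule power2_less_imp_less) (use eps in simp)
  qed
  have "cmod (z m j - z n j) < eps" if "m >= 2 * M + K + Suc j" "n >= 2 * M + K + Suc j" for m n
   using norm_triangle_ineq4[of "z m j - avg M j" "z n j - avg M j"] close[OF that(1)] close[OF that(2)] by simp
  then show "EX M. ALL m>=M. ALL n>=M. cmod (z m j - z n j) < eps" by blast
 qed
 then have "EX l. (%N. z N j) ----> l" for j using Cauchy_convergent convergent_def by blast
 then obtain x where x: "!!j. (%N. z N j) ----> x j" by metis
 show ?thesis
 proof (intro exI[of _ x] conjI allI impI x)
  fix n y J B assume "ALL k>=n. y k = 0" "ALL N. (\<Sum>j<N. (cmod (defect u y j))^2) <= B"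
  then have yB: "!!k. k >= n ==> y k = 0" "!!N. (\<Sum>j<N. (cmod (defect u y j))^2) <= B" by blast+
  have "(%N. \<Sum>j<J. (cmod (z N j - y j))^2) ----> (\<Sum>j<J. (cmod (x j - y j))^2)"
   by (intro tendsto_intros x)
  then show "(\<Sum>j<J. (cmod (x j - y j))^2) <= B / (Im u)^2"
   by (rule LIMSEQ_le_const2) (use ap[OF yB] in blast)
 qed
qed

text \<open>\<open>resolvent00\<close> is a definite description, so the limit of the truncations
  must lie in the domain of the closure and be the only solution there. Approximants of a second
  solution have defects tending to 0, hence approach the same limit; the averages approximate the
  limit in the graph norm.\<close>

lemma resolvent00_limit: "(%N. z N 0) ----> resolvent00 v e u"
proof -
 obtain x where xx: "(ALL j. (%N. z N j) ----> x j) &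
  (ALL n y J B. (ALL k>=n. y k = 0) --> (ALL N. (\<Sum>j<N. (cmod (defect u y j))^2) <= B) -->
    (\<Sum>j<J. (cmod (x j - y j))^2) <= B / (Im u)^2)"
  using truncation_limit ..
 have x: "!!j. (%N. z N j) ----> x j"
  "!!n y J B. [|!!k. k >= n ==> y k = 0; !!N. (\<Sum>j<N. (cmod (defect u y j))^2) <= B|] ==>
    (\<Sum>j<J. (cmod (x j - y j))^2) <= B / (Im u)^2"
  using xx by (fast, blast)
 let ?y = "%w j. u * w j - vacuum j"
 have act_eq: "(\<Sum>k | y k ~= 0. lax v e j k * y k) = LL y j" if "finite {k. y k ~= 0}" for y j
  unfolding LL_def by (rule sum.mono_neutral_cong) (use that lax_0(1) in "auto simp: not_le")
 have sq: "(cmod (a + b))^2 <= 2 * (cmod a)^2 + 2 * (cmod b)^2" for a b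
 proof -
  have "(cmod (a + b))^2 <= (cmod a + cmod b)^2" by (intro power_mono norm_triangle_ineq) auto
  then show ?thesis using sum_squares_bound[of "cmod a" "cmod b"] by (simp add: power2_sum)
 qed
 have uniq: "w = x" if w: "(w, ?y w) \<in> lax_closure v e" for w
 proof
  fix j
  obtain xs where xs: "ALL n. finite {k. xs n k ~= 0}" "ell2_tendsto xs w"
   "ell2_tendsto (%n j. LL (xs n) j) (?y w)"
   using w act_eq unfolding lax_closure_def by auto
  define a b where "a n j = (cmod (LL (xs n) j - ?y w j))^2" and "b n j = (cmod (xs n j - w j))^2" for n j
  have sm: "summable (a n)" "summable (b n)" and lim: "(%n. suminf (a n)) ----> 0" "(%n. suminf (b n)) ----> 0" for n
   using xs(2,3) unfolding ell2_tendsto_def a_def[abs_def] b_def[abs_def] by auto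
  define B where "B n = 2 * suminf (a n) + 2 * ((cmod u)^2 * suminf (b n))" for n
  have "(%n. B n) ----> 2 * 0 + 2 * ((cmod u)^2 * 0)" unfolding B_def by (intro tendsto_intros lim)
  then have B0: "(%n. B n / (Im u)^2) ----> 0" by (simp add: tendsto_divide_zero)
  have bj: "b n j <= suminf (b n)" for n using sum_le_suminf[OF sm(2), of "{j}" n] by (simp add: b_def)
  have D: "(\<Sum>j<N. (cmod (defect u (xs n) j))^2) <= B n" for n N
  proof -
   have "(\<Sum>j<N. (cmod (defect u (xs n) j))^2) <= (\<Sum>j<N. 2 * a n j + 2 * ((cmod u)^2 * b n j))"
   proof (rule sum_mono)
    fix j
    have "defect u (xs n) j = (LL (xs n) j - ?y w j) + u * (w j - xs n j)"
     by (simp add: defect_def algebra_simps)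
    then have "(cmod (defect u (xs n) j))^2 <= 2 * a n j + 2 * (cmod (u * (w j - xs n j)))^2"
     using sq by (simp only: a_def)
    then show "(cmod (defect u (xs n) j))^2 <= 2 * a n j + 2 * ((cmod u)^2 * b n j)"
     by (simp add: b_def norm_mult power_mult_distrib norm_minus_commute)
   qed
   also have "... = 2 * (\<Sum>j<N. a n j) + 2 * ((cmod u)^2 * (\<Sum>j<N. b n j))"
    by (simp add: sum.distrib sum_distrib_left)
   also have "... <= B n" unfolding B_def
    by (intro add_mono mult_left_mono sum_le_suminf sm) (auto simp: a_def b_def)
   finally show ?thesis .
  qed
  have "(cmod (x j - w j))^2 <= 2 * (B n / (Im u)^2) + 2 * suminf (b n)" for n
  proof -
   obtain m where m: "!!k. k >= m ==> xs n k = 0"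
    using finite_nat_bounded[OF xs(1)[rule_format, of n]] by (metis (mono_tags, lifting) lessThan_iff linorder_not_less mem_Collect_eq subsetD)
   have "(cmod (x j - xs n j))^2 <= (\<Sum>i<Suc j. (cmod (x i - xs n i))^2)" by (rule member_le_sum) auto
   also have "... <= B n / (Im u)^2" by (rule x(2)[OF m D])
   finally show ?thesis using sq[of "x j - xs n j" "xs n j - w j"] bj[of n] by (simp add: b_def)
  qed
  moreover have "(%n. 2 * (B n / (Im u)^2) + 2 * suminf (b n)) ----> 2 * 0 + 2 * 0" by (intro tendsto_intros B0 lim(2))
  ultimately have "(cmod (x j - w j))^2 <= 0" by (intro LIMSEQ_le_const) auto
  then show "w j = x j" by simp
 qed
 obtain \<delta> where \<delta>: "\<delta> ----> 0" "!!M N. M > 0 ==> (\<Sum>j<N. (cmod (defect u (avg M) j))^2) <= \<delta> M"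
  using defect_avg_sum by blast
 \<comment> \<open>The averages serve as approximants; \<open>Suc\<close> skips the empty
   average.\<close>
 define xs where "xs n = avg (Suc n)" for n
 define eta where "eta n = \<delta> (Suc n)" for n
 have eta: "eta ----> 0" unfolding eta_def[abs_def] by (rule LIMSEQ_Suc[OF \<delta>(1)])
 have D: "(\<Sum>j<N. (cmod (defect u (xs n) j))^2) <= eta n" for n N unfolding xs_def eta_def by (rule \<delta>(2)) simp
 have supp: "xs n k = 0" if "k >= 2 * Suc n" for n k unfolding xs_def using that by (intro avg_support) auto
 have X: "(\<Sum>j<J. (cmod (x j - xs n j))^2) <= eta n / (Im u)^2" for n J by (rule x(2)[OF supp D])
 have ell2: "ell2_tendsto f g" if "!!n N. (\<Sum>j<N. (cmod (f n j - g j))^2) <= c n" "c ----> 0" for f g and c :: "nat => real"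
 proof -
  have s: "summable (%j. (cmod (f n j - g j))^2)" for n
   by (rule summableI_nonneg_bounded[OF _ that(1)]) simp
  have "(%n. \<Sum>j. (cmod (f n j - g j))^2) ----> 0"
   by (rule tendsto_sandwich[OF _ _ tendsto_const that(2)])
     (auto intro!: always_eventually suminf_nonneg s suminf_le_const that(1))
  with s show ?thesis by (simp add: ell2_tendsto_def)
 qed
 have fin: "finite {k. xs n k ~= 0}" for n
  by (rule finite_subset[of _ "{..<2 * Suc n}"]) (use supp in "force simp: not_le")+
 have e1: "ell2_tendsto xs x"
 proof (rule ell2)
  show "(\<Sum>j<N. (cmod (xs n j - x j))^2) <= eta n / (Im u)^2" for n N using X[of n N] by (simp add: norm_minus_commute)
  show "(%n. eta n / (Im u)^2) ----> 0" by (rule tendsto_divide_zero[OF eta])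
 qed
 have e2: "ell2_tendsto (%n j. LL (xs n) j) (?y x)"
 proof (rule ell2)
  show "(\<Sum>j<N. (cmod (LL (xs n) j - ?y x j))^2) <= 2 * eta n + 2 * ((cmod u)^2 * (eta n / (Im u)^2))" for n N
  proof -
   have "(\<Sum>j<N. (cmod (LL (xs n) j - ?y x j))^2)
     <= (\<Sum>j<N. 2 * (cmod (defect u (xs n) j))^2 + 2 * ((cmod u)^2 * (cmod (x j - xs n j))^2))"
   proof (rule sum_mono)
    fix j
    have "LL (xs n) j - ?y x j = defect u (xs n) j + (- u) * (x j - xs n j)" by (simp add: defect_def algebra_simps)
    then have "(cmod (LL (xs n) j - ?y x j))^2 <= 2 * (cmod (defect u (xs n) j))^2 + 2 * (cmod ((- u) * (x j - xs n j)))^2"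
     using sq by (simp only:)
    then show "(cmod (LL (xs n) j - ?y x j))^2 <= 2 * (cmod (defect u (xs n) j))^2 + 2 * ((cmod u)^2 * (cmod (x j - xs n j))^2)"
     by (simp add: norm_mult power_mult_distrib)
   qed
   also have "... = 2 * (\<Sum>j<N. (cmod (defect u (xs n) j))^2) + 2 * ((cmod u)^2 * (\<Sum>j<N. (cmod (x j - xs n j))^2))"
    by (simp add: sum.distrib sum_distrib_left)
   also have "... <= 2 * eta n + 2 * ((cmod u)^2 * (eta n / (Im u)^2))"
    by (intro add_mono mult_left_mono D X) auto
   finally show ?thesis .
  qed
  have "(%n. 2 * eta n + 2 * ((cmod u)^2 * (eta n / (Im u)^2))) ----> 2 * 0 + 2 * ((cmod u)^2 * (0 / (Im u)^2))"
   by (intro tendsto_intros eta) (use u in simp)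
  then show "(%n. 2 * eta n + 2 * ((cmod u)^2 * (eta n / (Im u)^2))) ----> 0" by simp
 qed
 have sx: "summable (%j. (cmod (x j))^2)"
 proof (rule summableI_nonneg_bounded)
  have "(\<Sum>j<N. (cmod (defect u (%_. 0) j))^2) <= 1" for N
  proof -
   have "(\<Sum>j<N. (cmod (defect u (%_. 0) j))^2) = (\<Sum>j<N. if j = 0 then 1 else 0)"
    by (intro sum.cong) (auto simp: defect_def LL_def)
   then show ?thesis by simp
  qed
  then show "(\<Sum>j<J. (cmod (x j))^2) <= 1 / (Im u)^2" for J
   using x(2)[of 0 "%_. 0" 1 J] by simp
 qed simp
 have sy: "summable (%j. (cmod (?y x j))^2)"
 proof -
  have "summable (%j. (cmod u)^2 * (cmod (x (Suc j)))^2)"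
   using sx by (intro summable_mult) (simp add: summable_Suc_iff[of "%j. (cmod (x j))^2"])
  then have "summable (%j. (cmod (?y x (Suc j)))^2)" by (simp add: norm_mult power_mult_distrib)
  then show ?thesis by (subst (asm) summable_Suc_iff[of "%j. (cmod (?y x j))^2"])
 qed
 have "(x, ?y x) \<in> lax_closure v e"
  unfolding lax_closure_def using sx sy fin e1 e2 act_eq by (auto intro!: exI[of _ xs])
 then have "(THE x. (x, ?y x) \<in> lax_closure v e) = x" by (rule the_equality[where P = "%w. (w, ?y w) \<in> lax_closure v e"]) (rule uniq)
 then show ?thesis unfolding resolvent00_def using x(1)[of 0] by simp
qed

end

end

section \<open>Existence of action profiles\<close>

context banded
begin

definition hmom :: "nat => real" where
 "hmom j = Re (vac j 0)"

theorem truncated_profiles: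
 obtains g :: "nat => real => real" where "tight_gaps g"
  "!!u. u ~: \<real> ==> (%N. exp (Ln (1 / u) + half_dd (g N) (%c. Ln (1 / (u - complex_of_real c))))) ----> resolvent00 v e u"
  "!!p. p >= 1 ==> eventually (%N. half_dd (g N) (%c. c ^ p) = pow_of_hom hmom p) sequentially"
proof -
 define good where "good N (n::nat) x b \<longleftrightarrow>
  newton (%j. hermitian_matrix.kry (lax v e) N j 0) (%q. complex_of_real ((\<Sum>i<n. x i ^ q) - (\<Sum>i<n. b i ^ q))) &
  (ALL u. Im u ~= 0 --> (EX z. (ALL j>=N. z j = 0) & (ALL j. u * z j - tr N z j = vacuum j)
    & z 0 = (\<Prod>i<n. u - complex_of_real (b i)) / (u * (\<Prod>i<n. u - complex_of_real (x i)))))" for N n x b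
 have "EX (n::nat) x b. good N n x b" if "N > 0" for N
  unfolding good_def by (rule hermitian_matrix.resolvent_roots[OF hermitian_lax[OF that]])
 then obtain n x b where good: "!!N. N > 0 ==> good N (n N) (x N) (b N)" by metis
 define sol where "sol N u z \<longleftrightarrow> (ALL j>=N. z j = 0) & (ALL j. u * z j - tr N z j = vacuum j)
   & z 0 = (\<Prod>i<n N. u - complex_of_real (b N i)) / (u * (\<Prod>i<n N. u - complex_of_real (x N i)))" for N u z
 have ex: "EX z. sol N u z" if "N > 0" "Im u ~= 0" for N u
  using good[OF that(1)] that(2) unfolding good_def sol_def by blast
 define z where "z u N = (SOME z. sol N u z)" for u N
 have "sol N u (z u N)" if "N > 0" "Im u ~= 0" for N u
  using someI_ex[of "sol N u", OF ex[OF that]] by (simp add: z_def)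
 then have z: "!!N u j. N > 0 ==> Im u ~= 0 ==> j >= N ==> z u N j = 0"
  "!!N u j. N > 0 ==> Im u ~= 0 ==> u * z u N j - tr N (z u N) j = vacuum j"
  "!!N u. N > 0 ==> Im u ~= 0 ==>
    z u N 0 = (\<Prod>i<n N. u - complex_of_real (b N i)) / (u * (\<Prod>i<n N. u - complex_of_real (x N i)))"
  unfolding sol_def by blast+
 have newt: "newton (%j. hermitian_matrix.kry (lax v e) N j 0) (%q. complex_of_real ((\<Sum>i<n N. x N i ^ q) - (\<Sum>i<n N. b N i ^ q)))"
  if "N > 0" for N using good[OF that] unfolding good_def by blast
 have real_newton: "newton (%j. Re (hermitian_matrix.kry (lax v e) N j 0)) (%q. (\<Sum>i<n N. x N i ^ q) - (\<Sum>i<n N. b N i ^ q))"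
  if "N > 0" for N
  unfolding newton_def
 proof (intro conjI allI)
  note nw = newt[OF that, unfolded newton_def]
  show "Re (hermitian_matrix.kry (lax v e) N 0 0) = 1" using nw by simp
  fix k
  have "Re (of_nat k * hermitian_matrix.kry (lax v e) N k 0) =
    Re (\<Sum>q=1..k. complex_of_real ((\<Sum>i<n N. x N i ^ q) - (\<Sum>i<n N. b N i ^ q)) * hermitian_matrix.kry (lax v e) N (k - q) 0)"
   using nw by metis
  then show "of_nat k * Re (hermitian_matrix.kry (lax v e) N k 0) =
    (\<Sum>q=1..k. ((\<Sum>i<n N. x N i ^ q) - (\<Sum>i<n N. b N i ^ q)) * Re (hermitian_matrix.kry (lax v e) N (k - q) 0))"
   by (simp del: of_real_diff)
 qed
 have h0: "hmom 0 = 1" by (simp add: hmom_def)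
 have powers: "(\<Sum>i<n N. x N i ^ p) - (\<Sum>i<n N. b N i ^ p) = pow_of_hom hmom p" if "N > K * p" "p >= 1" for N p
 proof (rule newton_pow_unique[OF real_newton newton_pow_of_hom[of hmom, OF h0] _ that(2), of N p])
  fix j assume "j <= p"
  then have "K * j < N" using that by (meson le_less_trans mult_le_mono2)
  then show "Re (hermitian_matrix.kry (lax v e) N j 0) = hmom j" by (simp add: kry_vac hmom_def)
 qed (use that in auto)
 have inter: "interlaced (n N) (x N) (b N)" if "N > K" for N
 proof
  have N0: "N > 0" using that by simp
  show "(\<Sum>i<n N. x N i) = (\<Sum>i<n N. b N i)"
  proof -
   have "hmom 1 = 0"
   proof -
    have "vac 1 0 = 0" unfolding One_nat_def vac.simps LL_def by (rule sum.neutral) (auto simp: lax_def)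
    then show ?thesis by (simp add: hmom_def)
   qed
   then have "pow_of_hom hmom 1 = 0" by (subst pow_of_hom.simps) simp
   then show ?thesis using powers[of 1 N] that by simp
  qed
  fix u :: complex assume u: "Im u > 0"
  interpret hermitian_matrix "lax v e" N by (rule hermitian_lax[OF N0])
  let ?z = "z u N"
  \<comment> \<open>The resolvent entry maps the upper half-plane to the lower one: its imaginary
    part is minus Im u times the squared norm of the solution.\<close>
  have "Im (\<Sum>j<N. (u * ?z j - ap ?z j) * cnj (?z j)) = Im (cnj (?z 0))"
  proof -
   have "(\<Sum>j<N. (u * ?z j - ap ?z j) * cnj (?z j)) = (\<Sum>j<N. if j = 0 then cnj (?z 0) else 0)"
    using z(2)[OF N0, of u] u by (intro sum.cong) auto
   then show ?thesis using N0 by simp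
  qed
  then have "Im (?z 0) = - (Im u * nn ?z)" unfolding ip_resolvent by simp
  moreover have "nn ?z > 0"
  proof (rule ccontr)
   assume "~ nn ?z > 0"
   then have "nn ?z = 0" unfolding nn_def by (simp add: order_antisym sum_nonneg not_less)
   then have "?z j = 0" if "j < N" for j using nn_eq_0 that by blast
   then have "u * ?z 0 - ap ?z 0 = 0" using N0 by (simp add: ap_def)
   then show False using z(2)[OF N0, of u 0] u by simp
  qed
  ultimately show "Im ((\<Prod>i<n N. u - complex_of_real (b N i)) / (u * (\<Prod>i<n N. u - complex_of_real (x N i)))) < 0"
   using z(3)[OF N0, of u] u by simp
 qed
 \<comment> \<open>The shift by K + 1 makes every truncation large enough for its first moment to
   vanish, which gives the equality of traces in \<open>interlaced\<close>.\<close>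
 define g where "g N = interlaced.gap (n (N + Suc K)) (x (N + Suc K)) (b (N + Suc K))" for N
 have gi: "interlaced (n (N + Suc K)) (x (N + Suc K)) (b (N + Suc K))" for N by (rule inter) simp
 have gpow: "half_dd (g N) (%c. c ^ p) = pow_of_hom hmom p" if "p >= 1" "N >= K * p" for N p
 proof -
  have "half_dd (g N) (%c. c ^ p) = (\<Sum>i<n (N + Suc K). x (N + Suc K) i ^ p) - (\<Sum>i<n (N + Suc K). b (N + Suc K) i ^ p)"
   unfolding g_def by (rule interlaced.half_dd_gap_pow[OF gi])
  also have "... = pow_of_hom hmom p" by (rule powers) (use that in auto)
  finally show ?thesis .
 qed
 show ?thesis
 proof (rule that[of g])
  show "tight_gaps g"
  proof
   show "g N c >= 0" for N c unfolding g_def by (rule interlaced.gap_nonneg[OF gi])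
   show "\<bar>g N d - g N c\<bar> <= 2 * \<bar>d - c\<bar>" for N c d unfolding g_def by (rule interlaced.gap_lipschitz[OF gi])
   fix m :: nat
   \<comment> \<open>Two differentiations of c^(2m + 2) leave a multiple of c^(2m), so this power
     sum is the moment required by \<open>decay_from_moment\<close>.\<close>
   let ?p = "2 * m + 2"
   have "(g N c)^2 * c ^ (2 * m) <= 8 * (2 * pow_of_hom hmom ?p / (real ?p * (real ?p - 1)))" if N: "N >= K * ?p" for N c
   proof -
    have "(g N c)^2 * c ^ (2 * m) <= 8 * (\<integral>c. g N c * c ^ (2 * m) \<partial>lborel)"
     unfolding g_def
     by (rule decay_from_moment[OF interlaced.gap_nonneg[OF gi] interlaced.gap_lipschitz[OF gi] interlaced.gap_moment_integrable[OF gi]])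
    moreover have "pow_of_hom hmom ?p = (1/2) * (real ?p * (real ?p - 1) * (\<integral>c. g N c * c ^ (2 * m) \<partial>lborel))"
    proof -
     have "(\<integral>c. g N c * (r * c ^ (2 * m)) \<partial>lborel) = r * (\<integral>c. g N c * c ^ (2 * m) \<partial>lborel)" for r
      unfolding mult.left_commute[of _ r] by simp
     from this[of "real ?p * (real ?p - 1)"]
     have "(\<integral>c. g N c * (real ?p * (real ?p - 1) * c ^ (?p - 2)) \<partial>lborel) = real ?p * (real ?p - 1) * (\<integral>c. g N c * c ^ (2 * m) \<partial>lborel)"
      by simp
     then show ?thesis using gpow[of ?p N] N unfolding half_dd_pow by simp
    qed
    moreover have "r ~= 0 ==> P = (1/2) * (r * I) ==> 2 * P / r = I" for r P I :: real by (simp add: field_simps)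
    moreover have "real ?p * (real ?p - 1) ~= 0" by simp
    ultimately show ?thesis by (metis (no_types, lifting))
   qed
   then show "EX C N0. ALL N>=N0. ALL c. (g N c)^2 * c ^ (2 * m) <= C" by blast
  qed
  show "(%N. exp (Ln (1 / u) + half_dd (g N) (%c. Ln (1 / (u - complex_of_real c))))) ----> resolvent00 v e u"
   if u: "u ~: \<real>" for u
  proof -
   have Im: "Im u ~= 0" using u by (simp add: complex_is_Real_iff)
   have "(%N. z u N 0) ----> resolvent00 v e u" by (rule resolvent00_limit[OF Im]) (use z Im in auto)
   then have "(%N. z u (N + Suc K) 0) ----> resolvent00 v e u" by (rule LIMSEQ_ignore_initial_segment)
   moreover have "exp (Ln (1 / u) + half_dd (g N) (%c. Ln (1 / (u - complex_of_real c)))) = z u (N + Suc K) 0" for N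
    unfolding g_def interlaced.exp_half_dd_gap_log[OF gi u] using z(3)[of "N + Suc K" u] Im by simp
   ultimately show ?thesis by simp
  qed
  show "eventually (%N. half_dd (g N) (%c. c ^ p) = pow_of_hom hmom p) sequentially" if "p >= 1" for p
   using gpow[OF that] unfolding eventually_sequentially by blast
 qed
qed

text \<open>A limit G of truncated gaps along a subsequence makes |c| + G an action profile, and
  uniqueness identifies it with the definite description. At p = 0 the moment is the total mass 1,
  whereas \<open>pow_of_hom\<close> returns 0 there.\<close>

theorem action_moment_eq: "action_moment e p v = (if p = 0 then 1 else pow_of_hom hmom p)"
proof -
 obtain g where g: "tight_gaps g"
  "!!u. u ~: \<real> ==> (%N. exp (Ln (1 / u) + half_dd (g N) (%c. Ln (1 / (u - complex_of_real c))))) ----> resolvent00 v e u"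
  "!!p. p >= 1 ==> eventually (%N. half_dd (g N) (%c. c ^ p) = pow_of_hom hmom p) sequentially"
  using truncated_profiles by blast
 interpret tight_gaps g by (rule g(1))
 obtain G r where r: "strict_mono (r :: nat => nat)" "!!c. (%N. g (r N) c) ----> G c" and G: "decaying G"
  using limit_exists by blast
 have sub: "filterlim r sequentially sequentially" by (rule filterlim_subseq[OF r(1)])
 let ?f = "%c. \<bar>c\<bar> + G c"
 have "is_action_profile v e ?f"
  unfolding is_action_profile_def
 proof (intro conjI allI impI)
  show "continuous_on UNIV ?f" using G unfolding decaying_def by (intro continuous_intros) auto
  show "((%c. ?f c - \<bar>c\<bar>) \<longlongrightarrow> 0) at_top" "((%c. ?f c - \<bar>c\<bar>) \<longlongrightarrow> 0) at_bot"
   using G by (simp_all add: decaying_def)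
  fix u :: complex assume u: "u ~: \<real>"
  have nz: "u - complex_of_real c ~= 0" for c using u by auto
  have "(%N. half_dd (g (r N)) (%c. Ln (1 / (u - complex_of_real c)))) ----> half_dd G (%c. Ln (1 / (u - complex_of_real c)))"
   unfolding half_dd_log[OF u]
  proof (intro tendsto_scaleR tendsto_const integral_limit[OF r G, where p = 0 and a = "1 / (Im u)^2"])
   show "continuous_on UNIV (%c. 1 / (u - complex_of_real c)^2)" by (intro continuous_intros) (use nz in simp)
   fix c
   have "\<bar>Im u\<bar> <= cmod (u - complex_of_real c)" using abs_Im_le_cmod[of "u - complex_of_real c"] by simp
   then have "\<bar>Im u\<bar>^2 <= (cmod (u - complex_of_real c))^2" by (intro power_mono) auto
   moreover have "(Im u)^2 > 0" using u by (simp add: complex_is_Real_iff)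
   ultimately show "norm (1 / (u - complex_of_real c)^2) <= 1 / (Im u)^2 * \<bar>c\<bar> ^ 0"
    by (simp add: norm_divide norm_power frac_le)
  qed
  then have "(%N. exp (Ln (1 / u) + half_dd (g (r N)) (%c. Ln (1 / (u - complex_of_real c)))))
    ----> exp (Ln (1 / u) + half_dd G (%c. Ln (1 / (u - complex_of_real c))))" by (intro tendsto_intros)
  moreover have "(%N. exp (Ln (1 / u) + half_dd (g (r N)) (%c. Ln (1 / (u - complex_of_real c))))) ----> resolvent00 v e u"
   by (rule filterlim_compose[OF g(2)[OF u] sub])
  ultimately show "resolvent00 v e u = exp (half_dd_profile ?f (%c. Ln (1 / (u - complex_of_real c))))"
   unfolding half_dd_profile_def using LIMSEQ_unique by fastforce
 qed
 then have ap: "action_profile v e = ?f"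
  unfolding action_profile_def by (intro the_equality) (auto intro: action_profile_unique)
 have am: "action_moment e p v = 0 ^ p + half_dd G (%c. c ^ p)"
  unfolding action_moment_def ap half_dd_profile_def by simp
 show ?thesis
 proof (cases "p = 0")
  case True
  have "half_dd G (%c. c ^ 0) = 0" unfolding half_dd_pow by simp
  then show ?thesis using True am by simp
 next
  case False
  have "(%N. half_dd (g (r N)) (%c. c ^ p)) ----> half_dd G (%c. c ^ p)"
   unfolding half_dd_pow
  proof (intro tendsto_mult tendsto_const)
   have "(%N. \<integral>c. g (r N) c *\<^sub>R (real p * (real p - 1) * c ^ (p - 2)) \<partial>lborel) ----> (\<integral>c. G c *\<^sub>R (real p * (real p - 1) * c ^ (p - 2)) \<partial>lborel)"
    by (rule integral_limit[OF r G, where a = "\<bar>real p * (real p - 1)\<bar>" and p = "p - 2"])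
      (auto intro!: continuous_intros simp: abs_mult power_abs)
   then show "(%N. \<integral>c. g (r N) c * (real p * (real p - 1) * c ^ (p - 2)) \<partial>lborel) ----> (\<integral>c. G c * (real p * (real p - 1) * c ^ (p - 2)) \<partial>lborel)"
    by simp
  qed
  moreover have "(%N. half_dd (g (r N)) (%c. c ^ p)) ----> pow_of_hom hmom p"
  proof (rule tendsto_eventually)
   show "\<forall>\<^sub>F N in sequentially. half_dd (g (r N)) (%c. c ^ p) = pow_of_hom hmom p"
    by (rule eventually_compose_filterlim[OF g(3) sub]) (use False in simp)
  qed
  ultimately show ?thesis unfolding am using False LIMSEQ_unique by fastforce
 qed
qed

end

section \<open>Derivatives of the moments in the Fourier coefficients\<close>

text \<open>L^j psi_0 shifted down by k rows, paired with L^b psi_0, at t = 1 where L is symmetric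
  without weights.\<close>

definition pairing :: "real => nat => nat => nat => real" where
 "pairing e k j b = (\<Sum>m<Suc (j + b). wv 1 e j (m + k) * wv 1 e b m)"

lemma pairing_eq: "M >= Suc (j + b) ==> pairing e k j b = (\<Sum>m<M. wv 1 e j (m + k) * wv 1 e b m)"
 unfolding pairing_def by (rule sum.mono_neutral_left) (auto simp: wv_support)

text \<open>L commutes with the shift by k rows up to its diagonal part, which contributes e k, and
  a boundary term from row k - 1.\<close>

lemma pairing_step:
 assumes k: "k >= 1"
 shows "pairing e k (Suc j) b = pairing e k j (Suc b) + e * real k * pairing e k j b + wv 1 e j (k - 1) * hv 1 e b"
proof -
 let ?M = "j + b + 3" and ?x = "%m. wv 1 e j (m + k)"
 have eq: "wv 1 e (Suc j) (m + k) = lop 1 e ?x m + e * real k * ?x m + (if m = 0 then wv 1 e j (k - 1) else 0)" for m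
  using k by (cases m) (auto simp: lop_def algebra_simps)
 have "pairing e k (Suc j) b = (\<Sum>m<?M. wv 1 e (Suc j) (m + k) * wv 1 e b m)" by (rule pairing_eq) simp
 also have "... = (\<Sum>m<?M. lop 1 e ?x m * wv 1 e b m + e * real k * (?x m * wv 1 e b m)
   + (if m = 0 then wv 1 e j (k - 1) * wv 1 e b 0 else 0))"
  by (intro sum.cong refl) (simp only: eq, simp add: distrib_right)
 finally have "pairing e k (Suc j) b = (\<Sum>m<?M. lop 1 e ?x m * wv 1 e b m) + e * real k * pairing e k j b
   + (\<Sum>m<?M. if m = 0 then wv 1 e j (k - 1) * wv 1 e b 0 else 0)"
  unfolding pairing_eq[of j b ?M, simplified] by (simp only: sum.distrib sum_distrib_left)
 moreover have "(\<Sum>m<?M. lop 1 e ?x m * wv 1 e b m) = (\<Sum>m<?M. ?x m * lop 1 e (wv 1 e b) m)"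
  using lop_sym[of ?x ?M "wv 1 e b" 1 e] by (simp add: wv_support)
 ultimately show ?thesis unfolding wv_lop[symmetric] using pairing_eq[of j "Suc b" ?M] by (simp add: hv_def)
qed

lemma continuous_vanish_0:
 fixes f :: "real => real"
 assumes "continuous_on UNIV f" "!!e. e ~= 0 ==> f e = 0"
 shows "f e = 0"
proof (cases "e = 0")
 case True
 have "f \<midarrow>0\<rightarrow> f 0" using assms(1) by (simp add: continuous_on_eq_continuous_at isCont_def)
 moreover have "f \<midarrow>0\<rightarrow> 0" by (rule Lim_transform_eventually[OF tendsto_const]) (auto simp: eventually_at_filter assms(2))
 ultimately show ?thesis using LIM_unique True by blast
qed (rule assms(2))

text \<open>Summed over a, \<open>pairing_step\<close> telescopes and, compared with
  \<open>wv_shift\<close>, yields e times the claim; the case e = 0 follows by continuity.\<close>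

lemma pairing_sum:
 assumes k: "k >= 1"
 shows "real k * (\<Sum>a<n. pairing e k a (n - 1 - a)) = (\<Sum>a<n. hv 1 e a * rv 1 e (n - 1 - a) (k - 1))"
proof -
 define f where "f e = real k * (\<Sum>a<n. pairing e k a (n - 1 - a)) - (\<Sum>a<n. hv 1 e a * rv 1 e (n - 1 - a) (k - 1))" for e
 have ef: "e * f e = 0" for e
 proof -
  have "(\<Sum>a<n. pairing e k (Suc a) (n - Suc a) - pairing e k a (n - a)) = pairing e k n 0 - pairing e k 0 n"
   using sum_lessThan_telescope[of "%a. pairing e k a (n - a)" n] by simp
  moreover have "pairing e k (Suc a) (n - Suc a) - pairing e k a (n - a)
    = e * (real k * pairing e k a (n - 1 - a)) + wv 1 e a (k - 1) * hv 1 e (n - 1 - a)" if "a < n" for a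
   using pairing_step[OF k, of e a "n - 1 - a"] that by (simp add: Suc_diff_Suc)
  moreover have "pairing e k n 0 = wv 1 e n k"
  proof -
   have "pairing e k n 0 = (\<Sum>m<Suc n. if m = 0 then wv 1 e n k else 0)" unfolding pairing_def by (intro sum.cong) auto
   then show ?thesis by simp
  qed
  moreover have "pairing e k 0 n = 0" unfolding pairing_def using k by (intro sum.neutral) auto
  ultimately have "wv 1 e n k = (\<Sum>a<n. e * (real k * pairing e k a (n - 1 - a)) + wv 1 e a (k - 1) * hv 1 e (n - 1 - a))"
   by simp
  also have "... = e * (real k * (\<Sum>a<n. pairing e k a (n - 1 - a))) + (\<Sum>a<n. hv 1 e a * wv 1 e (n - 1 - a) (k - 1))"
  proof -
   have "(\<Sum>a<n. wv 1 e a (k - 1) * hv 1 e (n - 1 - a)) = (\<Sum>a<n. hv 1 e a * wv 1 e (n - 1 - a) (k - 1))"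
    by (rule sum.reindex_bij_witness[of _ "%a. n - 1 - a" "%a. n - 1 - a"]) auto
   then show ?thesis by (simp add: sum.distrib sum_distrib_left)
  qed
  finally have "wv 1 e n k = ..." .
  moreover have "wv 1 e n k = (\<Sum>a<n. hv 1 e a * (wv 1 e (n - 1 - a) (k - 1) + e * rv 1 e (n - 1 - a) (k - 1)))"
   using wv_shift[of 1 e n "k - 1"] k by simp
  ultimately show ?thesis unfolding f_def
   by (simp add: distrib_left sum.distrib sum_distrib_left mult.left_commute right_diff_distrib)
 qed
 have "continuous_on UNIV f"
 proof -
  have "continuous_on UNIV (%e. wv 1 e j m)" for j m
   using continuous_on_compose2[OF continuous_on_wv, of UNIV "%e. (1, e)"] by (simp add: continuous_on_Pair)
  moreover have "continuous_on UNIV (%e. rv 1 e j m)" for j m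
   using continuous_on_compose2[OF continuous_on_rv, of UNIV "%e. (1, e)"] by (simp add: continuous_on_Pair)
  ultimately show ?thesis unfolding f_def pairing_def hv_def by (intro continuous_intros)
 qed
 then have "f e = 0"
 proof (rule continuous_vanish_0)
  show "f e = 0" if "e ~= 0" for e using ef[of e] that by simp
 qed
 then show ?thesis by (simp add: f_def)
qed

text \<open>Derivative of L^n psi_0 at \<open>v_PL\<close> when the coefficient V_k moves with real
  speed 1: both k-th off-diagonals are perturbed.\<close>

primrec pert :: "real => nat => nat => nat => real" where
 "pert e k 0 = (%_. 0)"
| "pert e k (Suc n) = (%j. lop 1 e (pert e k n) j + (if j >= k then wv 1 e n (j - k) else 0) + wv 1 e n (j + k))"

text \<open>The remaining powers of L are moved to the other side by symmetry; the two off-diagonals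
  then contribute the same sum in opposite order, whence the factor 2.\<close>

lemma pert_0: "pert e k n 0 = 2 * (\<Sum>a<n. pairing e k a (n - 1 - a))"
proof -
 have step: "(\<Sum>j<M. wv 1 e r j * pert e k (Suc n) j) = (\<Sum>j<M. wv 1 e (Suc r) j * pert e k n j) + pairing e k r n + pairing e k n r"
  if M: "M >= Suc (Suc (r + n + k))" for r n M
 proof -
  have "(\<Sum>j<M. lop 1 e (wv 1 e r) j * pert e k n j) = (\<Sum>j<M. wv 1 e r j * lop 1 e (pert e k n) j)"
   using lop_sym[of "wv 1 e r" M "pert e k n" 1 e] M by (simp add: wv_support)
  moreover have "(\<Sum>j<M. wv 1 e r j * (if j >= k then wv 1 e n (j - k) else 0)) = pairing e k r n"
  proof -
   have "(\<Sum>j<M. wv 1 e r j * (if j >= k then wv 1 e n (j - k) else 0)) = (\<Sum>j\<in>{k..<M}. wv 1 e r j * wv 1 e n (j - k))"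
    by (rule sum.mono_neutral_cong_right) auto
   also have "... = (\<Sum>m<M - k. wv 1 e r (m + k) * wv 1 e n m)"
    by (rule sum.reindex_bij_witness[of _ "%m. m + k" "%j. j - k"]) auto
   also have "... = pairing e k r n" by (rule pairing_eq[symmetric]) (use M in auto)
   finally show ?thesis .
  qed
  moreover have "(\<Sum>j<M. wv 1 e r j * wv 1 e n (j + k)) = pairing e k n r"
   using pairing_eq[of n r M] M by (simp add: mult.commute add.commute)
  ultimately show ?thesis unfolding wv_lop by (simp add: distrib_left sum.distrib)
 qed
 have main: "(\<Sum>j<Suc (Suc (r + n + k)). wv 1 e r j * pert e k n j) = (\<Sum>a<n. pairing e k (r + a) (n - 1 - a) + pairing e k (n - 1 - a) (r + a))" for r
 proof (induction n arbitrary: r)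
  case (Suc n)
  show ?case using Suc[of "Suc r"] step[of r n "Suc (Suc (r + Suc n + k))"] unfolding sum.lessThan_Suc_shift by simp
 qed simp
 have "pert e k n 0 = (\<Sum>a<n. pairing e k a (n - 1 - a)) + (\<Sum>a<n. pairing e k (n - 1 - a) a)"
 proof -
  have "(\<Sum>j<Suc (Suc (0 + n + k)). wv 1 e 0 j * pert e k n j) = pert e k n 0"
   unfolding sum.lessThan_Suc_shift by simp
  then show ?thesis using main[of 0] by (simp only: sum.distrib add_0)
 qed
 moreover have "(\<Sum>a<n. pairing e k (n - 1 - a) a) = (\<Sum>a<n. pairing e k a (n - 1 - a))"
  by (rule sum.reindex_bij_witness[of _ "%a. n - 1 - a" "%a. n - 1 - a"]) auto
 ultimately show ?thesis by simp
qed

context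
 fixes e :: real and k :: nat and c :: complex
 assumes k: "k >= 1"
begin

definition vs :: "real => nat => complex" where
 "vs s = v_PL(k := v_PL k + c * complex_of_real s)"

lemma banded_vs: "banded (vs s) k"
 using k by unfold_locales (auto simp: vs_def v_PL_def)

lemma LL_vs: "banded.LL (vs s) e k x j = x (Suc j) + (if j = 0 then 0 else x (j - 1)) + complex_of_real (e * real j) * x j
  + complex_of_real s * ((if j >= k then c * x (j - k) else 0) + cnj c * x (j + k))"
proof -
 interpret banded "vs s" e k by (rule banded_vs)
 have "lax (vs s) e j i * x i = (if i = Suc j then x (Suc j) else 0) + (if j = Suc i then x i else 0) + (if i = j then complex_of_real (e * real j) * x j else 0)
   + (if j = i + k then complex_of_real s * (c * x i) else 0) + (if i = j + k then complex_of_real s * (cnj c * x (j + k)) else 0)" for i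
  using k by (auto simp: lax_def vs_def v_PL_def distrib_right)
 moreover have "(\<Sum>i\<le>j + k. if j = Suc i then x i else 0) = (if j = 0 then 0 else x (j - 1))"
  using sum.delta[of "{..j + k}" "j - 1" x] by (cases j) (auto cong: if_cong)
 moreover have "(\<Sum>i\<le>j + k. if j = i + k then complex_of_real s * (c * x i) else 0) = (if j >= k then complex_of_real s * (c * x (j - k)) else 0)"
 proof -
  have "(\<Sum>i\<le>j + k. if j = i + k then complex_of_real s * (c * x i) else 0)
    = (\<Sum>i\<le>j + k. if i = j - k then (if j >= k then complex_of_real s * (c * x (j - k)) else 0) else 0)"
   by (intro sum.cong) auto
  moreover have "j - k <= j + k" by arith
  ultimately show ?thesis by simp
 qed
 moreover have "Suc j <= j + k" using k by simp
 ultimately show ?thesis unfolding LL_def by (simp add: sum.distrib distrib_left)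
qed

lemma vac_vs_0: "banded.vac (vs 0) e k n j = complex_of_real (wv 1 e n j)"
proof -
 interpret banded "vs 0" e k by (rule banded_vs)
 show ?thesis by (induction n arbitrary: j) (auto simp: LL_vs)
qed

text \<open>At s = 0 all vectors are real, so the factors c and its conjugate on the two
  off-diagonals enter the real part only through Re c.\<close>

lemma vac_vs_deriv:
 "EX z. ((%s. banded.vac (vs s) e k n j) has_vector_derivative z) (at 0) & Re z = Re c * pert e k n j"
proof (induction n arbitrary: j)
 case 0
 have "banded.vac (vs s) e k 0 j = (if j = 0 then 1 else 0)" for s
  using banded.vac.simps(1)[OF banded_vs] by (simp add: fun_eq_iff)
 then show ?case by (auto intro!: exI[of _ 0])
next
 case (Suc n)
 let ?v = "%s. banded.vac (vs s) e k n"
 obtain z where z: "!!j. ((%s. ?v s j) has_vector_derivative z j) (at 0)" "!!j. Re (z j) = Re c * pert e k n j"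
  using Suc.IH by metis
 have eq: "banded.vac (vs s) e k (Suc n) j = banded.LL (vs s) e k (?v s) j" for s
  using banded.vac.simps(2)[OF banded_vs] by simp
 let ?E = "%x. (if j >= k then c * x (j - k) else 0) + cnj c * x (j + k)"
 let ?z = "z (Suc j) + (if j = 0 then 0 else z (j - 1)) + complex_of_real (e * real j) * z j + ?E (?v 0)"
 have dE: "((%s. ?E (?v s)) has_vector_derivative ?E z) (at 0)"
  using z(1) by (auto intro!: derivative_eq_intros has_vector_derivative_mult_right)
 have "((%s. complex_of_real s * ?E (?v s)) has_vector_derivative ?E (?v 0)) (at 0)"
 proof -
  have "((%s. s *\<^sub>R ?E (?v s)) has_vector_derivative 0 *\<^sub>R ?E z + 1 *\<^sub>R ?E (?v 0)) (at 0)"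
   by (rule has_vector_derivative_scaleR[OF _ dE]) (auto intro!: derivative_eq_intros)
  then show ?thesis by (simp add: scaleR_conv_of_real)
 qed
 moreover have "((%s. ?v s (Suc j) + (if j = 0 then 0 else ?v s (j - 1)) + complex_of_real (e * real j) * ?v s j)
   has_vector_derivative z (Suc j) + (if j = 0 then 0 else z (j - 1)) + complex_of_real (e * real j) * z j) (at 0)"
  using z(1) by (cases j) (auto intro!: derivative_intros has_vector_derivative_mult_right)
 ultimately have "((%s. banded.vac (vs s) e k (Suc n) j) has_vector_derivative ?z) (at 0)"
  unfolding eq LL_vs by (rule has_vector_derivative_add[rotated])
 moreover have "Re ?z = Re c * pert e k (Suc n) j"
  by (auto simp: z(2) vac_vs_0 lop_def algebra_simps)
 ultimately show ?case by blast
qed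

lemma action_moment_vs_deriv:
 "((%s. action_moment e p (vs s)) has_real_derivative 2 * Re c / real k * dv 1 e p (k - 1)) (at 0)"
proof (cases "p = 0")
 case True
 then have "action_moment e p (vs s) = 1" for s using banded.action_moment_eq[OF banded_vs] by simp
 then show ?thesis using True by (simp add: dv_support)
next
 case False
 define h where "h s = banded.hmom (vs s) e k" for s
 define r where "r = 2 * Re c / real k"
 define R where "R = Abs_fps (%q. if q = 0 then 0 else r * rv 1 e (q - 1) (k - 1))"
 have h: "h s j = Re (banded.vac (vs s) e k j 0)" for s j
  using banded.hmom_def[OF banded_vs] by (simp add: h_def)
 have h0: "h s 0 = 1" for s using banded.vac.simps(1)[OF banded_vs] by (simp add: h)
 have hh: "h 0 = hv 1 e" by (simp add: fun_eq_iff h vac_vs_0 hv_def)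
 have d: "((%s. h s n) has_real_derivative r * (\<Sum>a<n. hv 1 e a * rv 1 e (n - 1 - a) (k - 1))) (at 0)" for n
 proof -
  obtain z where z: "((%s. banded.vac (vs s) e k n 0) has_vector_derivative z) (at 0)" "Re z = Re c * pert e k n 0"
   using vac_vs_deriv by blast
  have "((%s. Re (banded.vac (vs s) e k n 0)) has_vector_derivative Re z) (at 0)"
   by (rule bounded_linear.has_vector_derivative[OF bounded_linear_Re z(1)])
  moreover have "Re z = r * (real k * (\<Sum>a<n. pairing e k a (n - 1 - a)))"
   using k unfolding z(2) pert_0 r_def by simp
  ultimately show ?thesis unfolding pairing_sum[OF k] h has_real_derivative_iff_has_vector_derivative by simp
 qed
 have "((%s. pow_of_hom (h s) p) has_real_derivative real p * R $ p) (at 0)"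
 proof (rule newton_deriv[OF newton_pow_of_hom[of "h _", OF h0] d])
  show "Abs_fps (%n. r * (\<Sum>a<n. hv 1 e a * rv 1 e (n - 1 - a) (k - 1))) = Abs_fps (h 0) * R"
  proof (rule fps_ext)
   fix n
   have "r * (\<Sum>a<n. hv 1 e a * rv 1 e (n - 1 - a) (k - 1)) = (\<Sum>i=0..n. hv 1 e i * R $ (n - i))"
    unfolding sum_distrib_left by (rule sum.mono_neutral_cong_left) (auto simp: R_def)
   then show "Abs_fps (%n. r * (\<Sum>a<n. hv 1 e a * rv 1 e (n - 1 - a) (k - 1))) $ n = (Abs_fps (h 0) * R) $ n"
    by (simp add: fps_mult_nth hh)
  qed
 qed (use False in simp)
 moreover have "action_moment e p (vs s) = pow_of_hom (h s) p" for s
  using banded.action_moment_eq[OF banded_vs] False by (simp add: h_def)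
 ultimately show ?thesis using False by (auto simp: R_def r_def dv_rv elim!: DERIV_cong)
qed

lemma action_moment_PL: "action_moment e p v_PL = (if p = 0 then 1 else ov 1 e p)"
proof -
 have "banded.hmom (vs 0) e k = hv 1 e"
  using banded.hmom_def[OF banded_vs] by (simp add: fun_eq_iff vac_vs_0 hv_def)
 moreover have "vs 0 = v_PL" by (simp add: vs_def)
 ultimately show ?thesis using banded.action_moment_eq[OF banded_vs, of e p 0] by (simp add: ov_def)
qed

end

text \<open>The derivative in the imaginary direction vanishes, so both Wirtinger derivatives are
  half of the derivative in the real direction.\<close>

lemma wirtinger_PL:
 assumes "k >= 1"
 shows "wirtinger (action_moment e p) k v_PL = complex_of_real (dv 1 e p (k - 1) / real k)"
  "wirtinger_bar (action_moment e p) k v_PL = complex_of_real (dv 1 e p (k - 1) / real k)"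
 using DERIV_imp_deriv[OF action_moment_vs_deriv[OF assms, where c = 1 and e = e and p = p]]
  DERIV_imp_deriv[OF action_moment_vs_deriv[OF assms, where c = \<i> and e = e and p = p]]
 by (simp_all add: wirtinger_def wirtinger_bar_def vs_def[OF assms])

text \<open>Index k is the mode m = k - 1, and k (dv / k)^2 leaves the factor 1 / (m + 1). In
  contrast to \<open>cov\<close>, the mode m = 0 is present.\<close>

lemma covariance_PL:
 "(\<Sum>k. of_nat k * wirtinger_bar (action_moment e p) k v_PL * wirtinger (action_moment e q) k v_PL)
   = complex_of_real (\<Sum>m<p. dv 1 e p m * dv 1 e q m / real (Suc m))"
proof -
 let ?f = "%k. of_nat k * wirtinger_bar (action_moment e p) k v_PL * wirtinger (action_moment e q) k v_PL"
 have f: "?f (Suc m) = complex_of_real (dv 1 e p m * dv 1 e q m / real (Suc m))" for m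
 proof -
  have "1 <= Suc m" by simp
  note w = wirtinger_PL[OF this, unfolded diff_Suc_1]
  have "real (Suc m) * (a / real (Suc m)) * (b / real (Suc m)) = a * b / real (Suc m)" for a b by simp
  then show ?thesis
   unfolding w of_real_of_nat_eq[where 'a = complex and n = "Suc m", symmetric] of_real_mult[symmetric] by (simp only:)
 qed
 have "suminf ?f = (\<Sum>k<Suc p. ?f k)"
 proof (rule suminf_finite)
  fix k assume "k ~: {..<Suc p}"
  then obtain m where "k = Suc m" "p <= Suc m" by (cases k) auto
  moreover have "complex_of_real (0 * x / y) = 0" for x y by simp
  ultimately show "?f k = 0" using f by (simp only: dv_support)
 qed simp
 also have "... = (\<Sum>m<p. ?f (Suc m))" unfolding sum.lessThan_Suc_shift by simp
 finally show ?thesis by (simp only: f of_real_sum)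
qed

section \<open>Gaussian laws on sequences\<close>

abbreviation "stdn \<equiv> density lborel (%x. ennreal (std_normal_density x))"

definition gspace :: "(nat => real) measure" where
 "gspace = (\<Pi>\<^sub>M k\<in>UNIV. stdn)"

lemma prob_stdn: "prob_space stdn" by (rule prob_space_normal_density) simp

interpretation gspace: prob_space gspace
 unfolding gspace_def by (intro prob_space_PiM prob_stdn)

lemma sets_gspace: "sets gspace = sets borel"
 unfolding gspace_def sets_PiM_equal_borel[symmetric] by (intro sets_PiM_cong) auto

lemma space_gspace [simp]: "space gspace = UNIV"
 using sets_eq_imp_space_eq[OF sets_gspace] by simp

lemma gspace_UNIV [simp]: "measure gspace UNIV = 1"
 using gspace.prob_space by simp

lemma continuous_coordinate: "continuous_on UNIV (%x :: nat => real. x k)"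
 by (rule continuous_on_product_coordinates)

lemma borel_gspace: "f \<in> borel_measurable borel ==> f \<in> borel_measurable gspace"
 using measurable_cong_sets[OF sets_gspace refl] by blast

lemma coordinate_measurable: "(%x. x k) \<in> borel_measurable (borel :: (nat => real) measure)"
 by (rule borel_measurable_continuous_onI[OF continuous_coordinate])

lemma distributed_coordinate: "distributed gspace lborel (%xi. xi k) std_normal_density"
proof -
 have "distr gspace stdn (%xi. xi k) = stdn"
  unfolding gspace_def by (rule distr_PiM_component) (auto intro: prob_stdn)
 moreover have "distr gspace lborel (%xi. xi k) = distr gspace stdn (%xi. xi k)" by (rule distr_cong) auto
 moreover have "(%xi. xi k) \<in> measurable gspace lborel" using borel_gspace[OF coordinate_measurable] by simp
 ultimately show ?thesis unfolding distributed_def by simp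
qed

lemma indep_coordinates: "gspace.indep_vars (%_. borel) (%k xi. xi k) UNIV"
proof (subst gspace.indep_vars_iff_distr_eq_PiM')
 have "distr gspace borel (%xi. xi k) = stdn" for k
 proof -
  have "distr gspace borel (%xi. xi k) = distr gspace lborel (%xi. xi k)" by (rule distr_cong) auto
  then show ?thesis using distributed_coordinate by (simp add: distributed_def)
 qed
 moreover have "distr gspace (\<Pi>\<^sub>M i\<in>UNIV. borel) (%x. \<lambda>i\<in>UNIV. x i) = distr gspace gspace (%x. x)"
  by (rule distr_cong) (auto simp: gspace_def intro!: sets_PiM_cong)
 ultimately show "distr gspace (\<Pi>\<^sub>M i\<in>UNIV. borel) (%x. \<lambda>i\<in>UNIV. x i) = (\<Pi>\<^sub>M i\<in>UNIV. distr gspace borel (%xi. xi i))"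
  by (simp add: distr_id gspace_def)
qed (use borel_gspace[OF coordinate_measurable] in auto)

lemma lin_measurable: "(%xi :: nat => real. \<Sum>k<M. c k * xi k) \<in> borel_measurable borel"
 using coordinate_measurable by (intro borel_measurable_sum borel_measurable_times) auto

lemma gauss_sum: "distr gspace borel (%xi. \<Sum>k<M. c k * xi k) = normal_law 0 (\<Sum>k<M. (c k)^2)"
proof -
 \<comment> \<open>Vanishing coefficients are dropped because a normal density requires positive
   variance.\<close>
 define I where "I = {k. k < M & c k ~= 0}"
 have I: "finite I" "!!k. k \<in> I ==> c k ~= 0" by (auto simp: I_def)
 have s: "(\<Sum>k<M. c k * xi k) = (\<Sum>k\<in>I. c k * xi k)" "(\<Sum>k<M. (c k)^2) = (\<Sum>k\<in>I. (c k)^2)" for xi :: "nat => real"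
  unfolding I_def by (intro sum.mono_neutral_right; auto)+
 show ?thesis
 proof (cases "I = {}")
  case True
  have "distr gspace borel (%_. 0 :: real) = return borel 0"
   by (intro gspace.distr_const) simp
  then show ?thesis unfolding s True by (simp add: normal_law_def)
 next
  case False
  have "gspace.indep_vars (%_. borel) (%k xi. c k * xi k) I"
   by (rule gspace.indep_vars_compose2[OF gspace.indep_vars_subset[OF indep_coordinates]]) auto
  moreover have "distributed gspace lborel (%xi. c k * xi k) (normal_density 0 \<bar>c k\<bar>)" if "k \<in> I" for k
   using gspace.normal_density_affine[OF distributed_coordinate, of "c k" 0 k] I that by simp
  ultimately have "distributed gspace lborel (%xi. \<Sum>k\<in>I. c k * xi k)
    (normal_density (\<Sum>k\<in>I. 0) (sqrt (\<Sum>k\<in>I. \<bar>c k\<bar>^2)))"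
   using I False by (intro gspace.sum_indep_normal) auto
  moreover have "distr gspace borel (%xi. \<Sum>k\<in>I. c k * xi k) = distr gspace lborel (%xi. \<Sum>k\<in>I. c k * xi k)"
   by (rule distr_cong) auto
  moreover have "(\<Sum>k\<in>I. (c k)^2) ~= 0" using I False by (simp add: sum_nonneg_eq_0_iff)
  ultimately show ?thesis unfolding s by (simp add: normal_law_def distributed_def)
 qed
qed

lemma gauss_integral:
 fixes f :: "real => 'a::{banach, second_countable_topology}"
 assumes f: "f \<in> borel_measurable borel"
 shows "(\<integral>xi. f (\<Sum>k<M. c k * xi k) \<partial>gspace) = (\<integral>x. f (sqrt (\<Sum>k<M. (c k)^2) * x) \<partial>stdn)"
  "integrable gspace (%xi. f (\<Sum>k<M. c k * xi k)) = integrable stdn (%x. f (sqrt (\<Sum>k<M. (c k)^2) * x))"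
proof -
 let ?v = "\<Sum>k<M. (c k)^2" and ?X = "%xi :: nat => real. \<Sum>k<M. c k * xi k" and ?Y = "%xi :: nat => real. \<Sum>k<1. sqrt (\<Sum>k<M. (c k)^2) * xi k"
 have eq: "distr gspace borel ?X = distr gspace borel ?Y"
  unfolding gauss_sum by (simp add: sum_nonneg)
 have m: "?X \<in> measurable gspace borel" "?Y \<in> measurable gspace borel"
  by (intro borel_gspace lin_measurable)+
 have d0: "distr gspace lborel (%xi. xi 0) = stdn" "(%xi. xi 0) \<in> measurable gspace lborel"
  using distributed_coordinate by (auto simp: distributed_def)
 have g: "(%x. f (sqrt ?v * x)) \<in> borel_measurable lborel" using f by simp
 have "(\<integral>xi. f (?X xi) \<partial>gspace) = (\<integral>xi. f (?Y xi) \<partial>gspace)"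
  using integral_distr[OF m(1) f] integral_distr[OF m(2) f] eq by simp
 also have "... = (\<integral>x. f (sqrt ?v * x) \<partial>stdn)" using integral_distr[OF d0(2) g] d0(1) by simp
 finally show "(\<integral>xi. f (?X xi) \<partial>gspace) = (\<integral>x. f (sqrt ?v * x) \<partial>stdn)" .
 have "integrable gspace (%xi. f (?X xi)) = integrable gspace (%xi. f (?Y xi))"
  using integrable_distr_eq[OF m(1) f] integrable_distr_eq[OF m(2) f] eq by simp
 also have "... = integrable stdn (%x. f (sqrt ?v * x))" using integrable_distr_eq[OF d0(2) g] d0(1) by simp
 finally show "integrable gspace (%xi. f (?X xi)) = integrable stdn (%x. f (sqrt ?v * x))" .
qed

lemma gauss_cis: "(\<integral>xi. cis (\<Sum>k<M. c k * xi k) \<partial>gspace) = complex_of_real (exp (- (\<Sum>k<M. (c k)^2) / 2))"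
proof -
 have "cis \<in> borel_measurable borel" by (intro borel_measurable_continuous_onI continuous_intros)
 then have "(\<integral>xi. cis (\<Sum>k<M. c k * xi k) \<partial>gspace) = (\<integral>x. cis (sqrt (\<Sum>k<M. (c k)^2) * x) \<partial>stdn)"
  by (rule gauss_integral)
 also have "... = char stdn (sqrt (\<Sum>k<M. (c k)^2))" by (simp add: char_def cis_conv_exp)
 finally show ?thesis unfolding char_std_normal_distribution by (simp add: sum_nonneg)
qed

lemma gauss_square:
 "(\<integral>xi. (\<Sum>k<M. c k * xi k)^2 \<partial>gspace) = (\<Sum>k<M. (c k)^2)" "integrable gspace (%xi. (\<Sum>k<M. c k * xi k)^2)"
proof -
 have m: "(%x :: real. x^2) \<in> borel_measurable borel" by simp
 have "(\<integral>x. x^2 \<partial>stdn) = 1" using std_normal_distribution_even_moments(1)[of 1] by (simp add: fact_numeral)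
 then show "(\<integral>xi. (\<Sum>k<M. c k * xi k)^2 \<partial>gspace) = (\<Sum>k<M. (c k)^2)"
  unfolding gauss_integral(1)[OF m] by (simp add: power_mult_distrib sum_nonneg)
 show "integrable gspace (%xi. (\<Sum>k<M. c k * xi k)^2)"
  unfolding gauss_integral(2)[OF m] power_mult_distrib
  by (intro integrable_mult_right integrable_std_normal_distribution_moment)
qed

text \<open>Lower triangular, so every coordinate is a finite combination of independent normals,
  and coordinate 0 depends on \<open>xi 0\<close> alone.\<close>

definition gmap :: "(nat => nat => real) => (nat => real) => nat => real" where
 "gmap A xi q = (\<Sum>k\<le>q. A q k * xi k)"

definition glaw :: "(nat => nat => real) => (nat => real) measure" where
 "glaw A = distr gspace borel (gmap A)"

lemma gmap_cont: "continuous_on UNIV (gmap A)"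
 unfolding gmap_def[abs_def]
 by (intro continuous_on_coordinatewise_then_product continuous_intros continuous_coordinate)

lemma gmap_measurable: "gmap A \<in> measurable gspace borel"
 by (intro borel_gspace borel_measurable_continuous_onI gmap_cont)

lemma gmap_lin:
 assumes J: "finite J" "!!q. q \<in> J ==> q < M"
 shows "(\<Sum>q\<in>J. a q * gmap A xi q) = (\<Sum>k<M. (\<Sum>q\<in>J. if k <= q then a q * A q k else 0) * xi k)"
proof -
 have "gmap A xi q = (\<Sum>k<M. if k <= q then A q k * xi k else 0)" if "q \<in> J" for q
  unfolding gmap_def by (rule sum.mono_neutral_cong_left) (use J(2)[OF that] in auto)
 then have "(\<Sum>q\<in>J. a q * gmap A xi q) = (\<Sum>q\<in>J. \<Sum>k<M. (if k <= q then a q * A q k else 0) * xi k)"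
  by (auto simp: sum_distrib_left intro!: sum.cong)
 then show ?thesis unfolding sum_distrib_right by (subst (asm) sum.swap)
qed

lemma prob_glaw: "prob_space (glaw A)" unfolding glaw_def by (rule gspace.prob_space_distr[OF gmap_measurable])

lemma sets_glaw: "sets (glaw A) = sets borel" by (simp add: glaw_def)

lemma glaw_integral:
 fixes f :: "(nat => real) => 'a::{banach, second_countable_topology}"
 assumes "f \<in> borel_measurable borel"
 shows "(\<integral>g. f g \<partial>glaw A) = (\<integral>xi. f (gmap A xi) \<partial>gspace)"
 unfolding glaw_def by (rule integral_distr[OF gmap_measurable assms])

lemma finite_bound: "finite J ==> EX M. ALL q:J. q < (M::nat)"
 using finite_nat_bounded by (meson lessThan_iff subsetD)

lemma lin_coord_measurable: "(%g :: nat => real. \<Sum>q\<in>J. a q * g q) \<in> borel_measurable borel"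
 using coordinate_measurable by (intro borel_measurable_sum borel_measurable_times) auto

lemma centered_gaussian_glaw: "centered_gaussian (glaw A)"
 unfolding centered_gaussian_def
proof (intro conjI allI impI prob_glaw sets_glaw)
 fix J a assume J: "finite (J :: nat set)"
 obtain M where M: "!!q. q \<in> J ==> q < M" using finite_bound[OF J] by blast
 have "distr (glaw A) borel (%g. \<Sum>q\<in>J. a q * g q) = distr gspace borel (%xi. \<Sum>q\<in>J. a q * gmap A xi q)"
  unfolding glaw_def by (subst distr_distr[OF lin_coord_measurable gmap_measurable]) (simp add: comp_def)
 also have "... = normal_law 0 (\<Sum>k<M. (\<Sum>q\<in>J. if k <= q then a q * A q k else 0)^2)"
 proof -
  have "(%xi. \<Sum>q\<in>J. a q * gmap A xi q) = (%xi. \<Sum>k<M. (\<Sum>q\<in>J. if k <= q then a q * A q k else 0) * xi k)"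
   by (rule ext) (rule gmap_lin[OF J M])
  then show ?thesis by (simp only: gauss_sum)
 qed
 finally show "EX var>=0. distr (glaw A) borel (%g. \<Sum>q\<in>J. a q * g q) = normal_law 0 var"
  by (intro exI[of _ "\<Sum>k<M. (\<Sum>q\<in>J. if k <= q then a q * A q k else 0)^2"]) (auto intro: sum_nonneg)
qed

text \<open>Polarisation reduces the product to \<open>gauss_square\<close>.\<close>

lemma gmap_product:
 "(\<integral>xi. gmap A xi p * gmap A xi q \<partial>gspace) = (\<Sum>k\<le>p. if k <= q then A p k * A q k else 0)"
proof -
 let ?M = "Suc (max p q)"
 define b where "b p k = (if k <= p then A p k else 0)" for p k
 have g: "gmap A xi p = (\<Sum>k<?M. b p k * xi k)" "gmap A xi q = (\<Sum>k<?M. b q k * xi k)" for xi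
  unfolding gmap_def b_def by (intro sum.mono_neutral_cong_left; auto)+
 have s: "gmap A xi p + r * gmap A xi q = (\<Sum>k<?M. (b p k + r * b q k) * xi k)" for xi r
  unfolding g by (simp add: sum.distrib sum_distrib_left distrib_right mult.assoc del: sum.lessThan_Suc)
 have "(\<integral>xi. gmap A xi p * gmap A xi q \<partial>gspace) = (\<integral>xi. ((gmap A xi p + 1 * gmap A xi q)^2 - (gmap A xi p + (-1) * gmap A xi q)^2) / 4 \<partial>gspace)"
  by (rule Bochner_Integration.integral_cong) (simp_all add: power2_eq_square algebra_simps)
 also have "... = ((\<Sum>k<?M. (b p k + 1 * b q k)^2) - (\<Sum>k<?M. (b p k + (-1) * b q k)^2)) / 4"
  unfolding s by (simp add: gauss_square del: sum.lessThan_Suc)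
 also have "... = (\<Sum>k<?M. b p k * b q k)"
  unfolding sum_subtractf[symmetric] sum_divide_distrib by (intro sum.cong refl) (simp add: power2_eq_square algebra_simps)
 also have "... = (\<Sum>k\<le>p. if k <= q then A p k * A q k else 0)"
  by (rule sum.mono_neutral_cong_right) (auto simp: b_def)
 finally show ?thesis .
qed

lemma glaw_product:
 "(\<integral>g. g p * g q \<partial>glaw A) = (\<Sum>k\<le>p. if k <= q then A p k * A q k else 0)"
proof -
 have "(%g :: nat => real. g p * g q) \<in> borel_measurable borel"
  using coordinate_measurable by (intro borel_measurable_times)
 then show ?thesis by (simp add: glaw_integral gmap_product)
qed

section \<open>Conditioning on the first coordinate\<close>

lemma gspace_fubini:
 fixes F :: "(nat => real) => real"
 assumes F: "F \<in> borel_measurable borel" "!!xi. \<bar>F xi\<bar> <= B"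
 shows "(\<integral>xi. F xi \<partial>gspace) = (\<integral>x. (\<integral>xi. F (xi(0 := x)) \<partial>gspace) \<partial>stdn)"
proof -
 interpret S: prob_space stdn by (rule prob_stdn)
 interpret P: pair_prob_space stdn gspace ..
 have upd: "(%(x, X). X(0 := x)) \<in> measurable (stdn \<Otimes>\<^sub>M gspace) gspace"
  unfolding gspace_def case_prod_beta by (rule measurable_fun_upd[where J = UNIV]) auto
 have eq: "distr (stdn \<Otimes>\<^sub>M gspace) gspace (%(x, X). X(0 := x)) = gspace"
  using distr_pair_PiM_eq_PiM[of UNIV "%_. stdn" 0] prob_stdn by (simp add: gspace_def)
 have Fg: "F \<in> borel_measurable gspace" by (rule borel_gspace[OF F(1)])
 have "(\<integral>xi. F xi \<partial>gspace) = (\<integral>z. F (case z of (x, X) => X(0 := x)) \<partial>(stdn \<Otimes>\<^sub>M gspace))"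
  by (subst eq[symmetric]) (rule integral_distr[OF upd Fg])
 also have "... = (\<integral>x. (\<integral>xi. F (xi(0 := x)) \<partial>gspace) \<partial>stdn)"
 proof -
  have "integrable (stdn \<Otimes>\<^sub>M gspace) (%z. F (case z of (x, X) => X(0 := x)))"
   by (rule P.integrable_const_bound[of _ B]) (use F(2) measurable_compose[OF upd Fg] in auto)
  from P.integral_fst'[OF this] show ?thesis by simp
 qed
 finally show ?thesis .
qed

definition cut0 :: "(nat => nat => real) => nat => nat => real" where
 "cut0 A q k = (if k = 0 then 0 else A q k)"

lemma gmap_cut0: "gmap (cut0 A) xi = gmap A (xi(0 := 0))"
 unfolding gmap_def[abs_def] cut0_def by (intro ext sum.cong) auto

lemma restrict_cont: "continuous_on UNIV (phi :: (nat => real) => real) ==> continuous_on UNIV (%x. phi (%p. if p \<in> J then x p else 0))"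
proof (rule continuous_on_compose2[of UNIV phi UNIV "%x p. if p \<in> J then x p else 0"])
 show "continuous_on UNIV (%(x :: nat => real) p. if p \<in> J then x p else 0)"
 proof (rule continuous_on_coordinatewise_then_product)
  show "continuous_on UNIV (%x :: nat => real. if p \<in> J then x p else 0)" for p
   by (cases "p \<in> J") (auto intro: continuous_coordinate)
 qed
qed auto

lemma stdn_interval_pos: "\<delta> > 0 ==> measure stdn {x. \<bar>a * x\<bar> < \<delta>} > 0" if "a ~= 0"
proof -
 assume \<delta>: "\<delta> > 0"
 interpret S: prob_space stdn by (rule prob_stdn)
 let ?r = "\<delta> / \<bar>a\<bar>"
 have r: "?r > 0" using \<delta> that by simp
 have "\<bar>a * x\<bar> < \<delta> \<longleftrightarrow> \<bar>x\<bar> < ?r" for x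
  using that by (simp add: abs_mult pos_less_divide_eq mult.commute)
 then have "{x. \<bar>a * x\<bar> < \<delta>} = {x. \<bar>x\<bar> < ?r}" by (simp only:)
 also have "... = {- ?r<..<?r}" by (intro set_eqI) (simp only: mem_Collect_eq abs_less_iff greaterThanLessThan_iff minus_less_iff conj_commute)
 finally have U: "{x. \<bar>a * x\<bar> < \<delta>} = {- ?r<..<?r}" .
 show ?thesis
 proof (rule ccontr)
  assume "~ measure stdn {x. \<bar>a * x\<bar> < \<delta>} > 0"
  then have "measure stdn {- ?r<..<?r} = 0"
   using measure_nonneg[of stdn "{- ?r<..<?r}"] unfolding U by linarith
  then have "emeasure stdn {- ?r<..<?r} = 0" by (simp add: S.emeasure_eq_measure)
  then have "AE x in stdn. x ~: {- ?r<..<?r}" by (intro AE_not_in) (simp add: null_sets_def)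
  then have "AE x in lborel. 0 < ennreal (std_normal_density x) --> x ~: {- ?r<..<?r}"
   by (subst (asm) AE_density) simp_all
  then have "AE x in lborel. x ~: {- ?r<..<?r}" by eventually_elim (simp add: normal_density_pos)
  then have "{- ?r<..<?r} \<in> null_sets lborel" by (subst (asm) AE_iff_null_sets[symmetric]) simp_all
  then have "emeasure lborel {- ?r<..<?r} = 0" by (simp add: null_sets_def)
  moreover have "emeasure lborel {- ?r<..<?r} = ennreal (2 * ?r)" using r \<delta> by (subst emeasure_lborel_Ioo) simp_all
  ultimately show False using r by (simp only: ennreal_eq_0_iff)
 qed
qed

lemma integral_uniform_measure:
 fixes f :: "'a => real"
 assumes "prob_space M" "E \<in> sets M" "measure M E > 0" "f \<in> borel_measurable M"
 shows "(\<integral>x. f x \<partial>uniform_measure M E) = (\<integral>x. indicator E x * f x \<partial>M) / measure M E"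
proof -
 interpret prob_space M by fact
 have "uniform_measure M E = density M (%x. ennreal (indicator E x / measure M E))"
  unfolding uniform_measure_def emeasure_eq_measure
 proof (intro arg_cong[of _ _ "density M"] ext)
  fix x show "indicator E x / ennreal (measure M E) = ennreal (indicator E x / measure M E)"
   using divide_ennreal[of 1 "measure M E"] assms(3) by (cases "x \<in> E") simp_all
 qed
 then have "(\<integral>x. f x \<partial>uniform_measure M E) = (\<integral>x. (indicator E x / measure M E) *\<^sub>R f x \<partial>M)"
  using assms by (simp only:, intro integral_density) auto
 then show ?thesis unfolding real_scaleR_def times_divide_eq_left by simp
qed

text \<open>Since \<open>g 0\<close> is \<open>A 0 0 * xi 0\<close>, the event confines
  \<open>xi 0\<close> to a shrinking interval and leaves the other normals untouched; the
  conditional mean is an average of the continuous function \<Psi> near 0, and its value at 0 is the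
  mean for \<open>cut0 A\<close>.\<close>

theorem conditioned_glaw:
 assumes a: "A 0 0 ~= 0"
 shows "conditioned_on_zero_integral (glaw A) (glaw (cut0 A))"
 unfolding conditioned_on_zero_integral_def joint_weak_conv_def
proof (intro conjI allI impI prob_glaw sets_glaw, elim conjE)
 fix J and phi :: "(nat => real) => real"
 assume phi: "continuous_on UNIV phi" "bounded (range phi)"
 interpret S: prob_space stdn by (rule prob_stdn)
 obtain B where B: "!!x. \<bar>phi x\<bar> <= B" using phi(2) by (auto simp: bounded_iff)
 define psi where "psi x = phi (%p. if p \<in> J then x p else 0)" for x
 define E where "E \<delta> = {g \<in> space (glaw A). \<bar>g 0\<bar> < \<delta>}" for \<delta>
 have psi: "continuous_on UNIV psi" "!!x. \<bar>psi x\<bar> <= B" unfolding psi_def using restrict_cont[OF phi(1)] B by auto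
 then have psim: "psi \<in> borel_measurable borel" by (intro borel_measurable_continuous_onI)
 have sp: "space (glaw A) = UNIV" using sets_eq_imp_space_eq[OF sets_glaw] by simp
 have Em: "E \<delta> \<in> sets borel" for \<delta>
 proof -
  have "open {g :: nat => real. \<bar>g 0\<bar> < \<delta>}" by (intro open_Collect_less continuous_intros continuous_coordinate)
  then show ?thesis by (simp add: E_def sp)
 qed
 define \<Psi> where "\<Psi> x = (\<integral>xi. psi (gmap A (xi(0 := x))) \<partial>gspace)" for x
 have upd: "continuous_on UNIV (%x. xi(0 := x))" for xi :: "nat => real"
 proof (rule continuous_on_coordinatewise_then_product)
  show "continuous_on UNIV (%x. (xi(0 := x)) i)" for i by (cases "i = 0") (auto intro!: continuous_intros)
 qed
 have hc: "continuous_on UNIV (%x. psi (gmap A (xi(0 := x))))" for xi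
  by (rule continuous_on_compose2[OF psi(1) continuous_on_compose2[OF gmap_cont upd]]) auto
 have hm: "(%xi. psi (gmap A (xi(0 := x)))) \<in> borel_measurable gspace" for x
 proof (intro borel_gspace borel_measurable_continuous_onI)
  have "continuous_on UNIV (%xi :: nat => real. xi(0 := x))"
  proof (rule continuous_on_coordinatewise_then_product)
   show "continuous_on UNIV (%xi :: nat => real. (xi(0 := x)) i)" for i
    by (cases "i = 0") (auto intro: continuous_coordinate)
  qed
  then show "continuous_on UNIV (%xi. psi (gmap A (xi(0 := x))))"
   by (intro continuous_on_compose2[OF psi(1) continuous_on_compose2[OF gmap_cont]]) auto
 qed
 have \<Psi>_cont: "continuous (at x) \<Psi>" for x
  unfolding continuous_at_sequentially comp_def \<Psi>_def
 proof (intro allI impI)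
  fix y assume y: "y ----> x"
  show "(%n. \<integral>xi. psi (gmap A (xi(0 := y n))) \<partial>gspace) ----> (\<integral>xi. psi (gmap A (xi(0 := x))) \<partial>gspace)"
  proof (rule integral_dominated_convergence[where w = "%_. B"])
   show "AE xi in gspace. (%n. psi (gmap A (xi(0 := y n)))) ----> psi (gmap A (xi(0 := x)))"
    using continuous_on_tendsto_compose[OF hc y] by (intro AE_I2) auto
  qed (use hm psi(2) in auto)
 qed
 have \<Psi>m: "\<Psi> \<in> borel_measurable borel"
  using \<Psi>_cont by (intro borel_measurable_continuous_onI continuous_at_imp_continuous_on) auto
 have \<Psi>B: "\<bar>\<Psi> x\<bar> <= B" for x
 proof -
  have "\<bar>\<Psi> x\<bar> <= (\<integral>xi. B \<partial>gspace)" unfolding \<Psi>_def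
   by (intro integral_abs_bound[THEN order_trans] integral_mono gspace.integrable_const_bound[of _ B])
    (use hm psi(2) order_trans[OF abs_ge_zero B] in auto)
  then show ?thesis using gspace.prob_space by simp
 qed
 have fub: "(\<integral>g. indicator (E \<delta>) g * f g \<partial>glaw A) = (\<integral>x. indicator {x. \<bar>A 0 0 * x\<bar> < \<delta>} x * (\<integral>xi. f (gmap A (xi(0 := x))) \<partial>gspace) \<partial>stdn)"
  if f: "f \<in> borel_measurable borel" "!!g. \<bar>f g\<bar> <= C" for f :: "(nat => real) => real" and \<delta> C
 proof -
  have C: "C >= 0" using order_trans[OF abs_ge_zero f(2)] .
  have m: "(%g. indicator (E \<delta>) g * f g) \<in> borel_measurable borel" using f Em by simp
  have g0: "gmap A (xi(0 := x)) 0 = A 0 0 * x" for xi x by (simp add: gmap_def)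
  have "(\<integral>g. indicator (E \<delta>) g * f g \<partial>glaw A) = (\<integral>xi. indicator (E \<delta>) (gmap A xi) * f (gmap A xi) \<partial>gspace)"
   by (rule glaw_integral[OF m])
  also have "... = (\<integral>x. (\<integral>xi. indicator (E \<delta>) (gmap A (xi(0 := x))) * f (gmap A (xi(0 := x))) \<partial>gspace) \<partial>stdn)"
  proof (rule gspace_fubini)
   show "(%xi. indicator (E \<delta>) (gmap A xi) * f (gmap A xi)) \<in> borel_measurable borel"
    using measurable_compose[OF borel_measurable_continuous_onI[OF gmap_cont] m] .
   show "\<bar>indicator (E \<delta>) (gmap A xi) * f (gmap A xi)\<bar> <= C" for xi
    using f(2)[of "gmap A xi"] C by (simp add: abs_mult indicator_def)
  qed
  also have "... = (\<integral>x. indicator {x. \<bar>A 0 0 * x\<bar> < \<delta>} x * (\<integral>xi. f (gmap A (xi(0 := x))) \<partial>gspace) \<partial>stdn)"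
   by (intro Bochner_Integration.integral_cong refl) (auto simp: E_def sp g0 indicator_def)
  finally show ?thesis .
 qed
 have Um: "{x. \<bar>A 0 0 * x\<bar> < \<delta>} \<in> sets stdn" for \<delta> by simp
 have m: "measure (glaw A) (E \<delta>) = measure stdn {x. \<bar>A 0 0 * x\<bar> < \<delta>}" for \<delta>
 proof -
  interpret G: prob_space "glaw A" by (rule prob_glaw)
  have "measure (glaw A) (E \<delta>) = (\<integral>g. indicator (E \<delta>) g * 1 \<partial>glaw A)" using Em sets_glaw by simp
  also have "... = measure stdn {x. \<bar>A 0 0 * x\<bar> < \<delta>}" using fub[of "%_. 1" 1 \<delta>] Um by (simp add: gspace.prob_space)
  finally show ?thesis .
 qed
 have N: "(\<integral>x. psi x \<partial>glaw (cut0 A)) = \<Psi> 0" by (simp add: glaw_integral[OF psim] gmap_cut0 \<Psi>_def)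
 have "((%\<delta>. \<integral>x. psi x \<partial>uniform_measure (glaw A) (E \<delta>)) \<longlongrightarrow> \<Psi> 0) (at_right 0)"
 proof (rule tendstoI)
  fix eps :: real assume eps: "eps > 0"
  obtain r where r: "r > 0" "!!x. \<bar>x\<bar> < r ==> \<bar>\<Psi> x - \<Psi> 0\<bar> < eps / 2"
  proof -
   have "EX r>0. ALL x. \<bar>x - 0\<bar> < r --> \<bar>\<Psi> x - \<Psi> 0\<bar> < eps / 2"
    using \<Psi>_cont[of 0, unfolded continuous_at_eps_delta, rule_format, of "eps / 2"] eps by (simp add: dist_real_def)
   then show ?thesis using that by auto
  qed
  have "dist (\<integral>x. psi x \<partial>uniform_measure (glaw A) (E \<delta>)) (\<Psi> 0) < eps" if \<delta>: "0 < \<delta>" "\<delta> < r * \<bar>A 0 0\<bar>" for \<delta>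
  proof -
   let ?U = "{x. \<bar>A 0 0 * x\<bar> < \<delta>}"
   have pos: "measure stdn ?U > 0" by (rule stdn_interval_pos[OF a \<delta>(1)])
   have int1: "integrable stdn (%x. indicator ?U x * f x)" if "f \<in> borel_measurable borel" "!!x. \<bar>f x\<bar> <= C" for f :: "real => real" and C
   proof (rule S.integrable_const_bound[of _ C])
    show "AE x in stdn. norm (indicator ?U x * f x) <= C"
     using that(2) order_trans[OF abs_ge_zero that(2)] by (intro AE_I2) (simp add: indicator_def)
   qed (use that(1) in simp)
   note int = int1[OF \<Psi>m \<Psi>B] int1[OF borel_measurable_const order_refl]
   have eq: "(\<integral>x. psi x \<partial>uniform_measure (glaw A) (E \<delta>)) = (\<integral>x. indicator ?U x * \<Psi> x \<partial>stdn) / measure stdn ?U"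
    using integral_uniform_measure[OF prob_glaw, of "E \<delta>" A psi] Em sets_glaw psim pos fub[OF psim psi(2), of \<delta>]
    by (simp add: m \<Psi>_def measurable_cong_sets[OF sets_glaw refl])
   have "\<bar>(\<integral>x. indicator ?U x * \<Psi> x \<partial>stdn) - (\<integral>x. indicator ?U x * \<Psi> 0 \<partial>stdn)\<bar>
     <= (\<integral>x. indicator ?U x * (eps / 2) \<partial>stdn)"
    unfolding Bochner_Integration.integral_diff[OF int(1) int(2), symmetric]
   proof (intro integral_abs_bound[THEN order_trans] integral_mono int integrable_abs Bochner_Integration.integrable_diff)
    fix x
    have "\<bar>x\<bar> < r" if "x \<in> ?U"
    proof -
     have "\<bar>A 0 0\<bar> * \<bar>x\<bar> < \<bar>A 0 0\<bar> * r" using that \<delta>(2) by (simp add: abs_mult mult.commute)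
     then show ?thesis using a by simp
    qed
    then show "\<bar>indicator ?U x * \<Psi> x - indicator ?U x * \<Psi> 0\<bar> <= indicator ?U x * (eps / 2)"
     using r(2)[of x] by (auto simp: indicator_def)
   qed
   then have "\<bar>(\<integral>x. indicator ?U x * \<Psi> x \<partial>stdn) - measure stdn ?U * \<Psi> 0\<bar> <= measure stdn ?U * (eps / 2)" using Um by simp
   then have "\<bar>(\<integral>x. indicator ?U x * \<Psi> x \<partial>stdn) / measure stdn ?U - \<Psi> 0\<bar> <= eps / 2"
    using pos by (simp add: abs_le_iff field_simps)
   then show ?thesis unfolding eq dist_real_def using eps by linarith
  qed
  moreover have "r * \<bar>A 0 0\<bar> > 0" using r a by simp
  ultimately show "\<forall>\<^sub>F \<delta> in at_right 0. dist (\<integral>x. psi x \<partial>uniform_measure (glaw A) (E \<delta>)) (\<Psi> 0) < eps"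
   unfolding eventually_at_right[OF zero_less_one] by blast
 qed
 then show "((%\<delta>. \<integral>x. phi (%p. if p \<in> J then x p else 0) \<partial>uniform_measure (glaw A) {g \<in> space (glaw A). \<bar>g 0\<bar> < \<delta>})
   \<longlongrightarrow> (\<integral>x. phi (%p. if p \<in> J then x p else 0) \<partial>glaw (cut0 A))) (at_right 0)"
  unfolding N[symmetric] psi_def E_def .
qed

section \<open>Weak convergence from characteristic functions\<close>

inductive trig :: "nat set => ((nat => real) => real) => bool" for J where
 trig_base: "trig J (%x. Re (c * cis (\<Sum>p\<in>J. s p * x p)))"
| trig_add: "trig J f ==> trig J g ==> trig J (%x. f x + g x)"

lemma trig_mult: "trig J f ==> trig J g ==> trig J (%x. f x * g x)"
proof (induction f rule: trig.induct)
 case (trig_base c s)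
 show ?case using trig_base
 proof (induction g rule: trig.induct)
  case (trig_base c' s')
  let ?S = "%s (x :: nat => real). \<Sum>p\<in>J. s p * x p"
  have re: "Re a * Re b = Re (a * b / 2) + Re (a * cnj b / 2)" for a b by (simp add: field_simps)
  have "Re (c * cis (?S s x)) * Re (c' * cis (?S s' x))
   = Re (c * c' / 2 * cis (?S (%p. s p + s' p) x)) + Re (c * cnj c' / 2 * cis (?S (%p. s p - s' p) x))" for x
  proof -
   have "?S (%p. s p + s' p) x = ?S s x + ?S s' x" "?S (%p. s p - s' p) x = ?S s x + - ?S s' x"
    by (simp_all add: distrib_right left_diff_distrib sum.distrib sum_subtractf)
   then show ?thesis unfolding re by (simp only: cis_mult[symmetric] cis_cnj[symmetric] complex_cnj_mult) (simp add: mult_ac)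
  qed
  then show ?case by (simp only: trig.intros)
 next
  case (trig_add f g)
  then show ?case unfolding distrib_left by (intro trig.trig_add)
 qed
next
 case (trig_add f g)
 then show ?case unfolding distrib_right by (intro trig.trig_add) auto
qed

lemma trig_limit:
 assumes pm: "!!d. prob_space (\<mu> d)" "!!d. sets (\<mu> d) = sets borel" "prob_space \<nu>" "sets \<nu> = sets borel"
  and cf: "!!s. (%d. \<integral>x. cis (\<Sum>p\<in>J. s p * x p) \<partial>\<mu> d) ----> (\<integral>x. cis (\<Sum>p\<in>J. s p * x p) \<partial>\<nu>)"
  and "trig J g"
 shows "g \<in> borel_measurable borel & (EX B. ALL x. \<bar>g x\<bar> <= B) & (%d. \<integral>x. g x \<partial>\<mu> d) ----> (\<integral>x. g x \<partial>\<nu>)"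
 using assms(6)
proof (induction g rule: trig.induct)
 case (trig_base c s)
 let ?f = "%x :: nat => real. cis (\<Sum>p\<in>J. s p * x p)"
 have m: "?f \<in> borel_measurable borel"
  by (rule measurable_compose[OF lin_coord_measurable]) (intro borel_measurable_continuous_onI continuous_intros)
 have i: "(\<integral>x. Re (c * ?f x) \<partial>M) = Re (c * (\<integral>x. ?f x \<partial>M))" if "prob_space M" "sets M = sets borel" for M
 proof -
  interpret prob_space M by fact
  have "integrable M ?f" using m measurable_cong_sets[OF that(2) refl] by (intro integrable_const_bound[of _ 1]) auto
  then have "integrable M (%x. c * ?f x)" by simp
  then show ?thesis by (subst integral_Re) simp_all
 qed
 have "\<bar>Re (c * ?f x)\<bar> <= cmod c" for x using abs_Re_le_cmod[of "c * ?f x"] by (simp add: norm_mult)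
 moreover have "(%d. Re (c * (\<integral>x. ?f x \<partial>\<mu> d))) ----> Re (c * (\<integral>x. ?f x \<partial>\<nu>))" by (intro tendsto_intros cf)
 moreover have "(%x. Re (c * ?f x)) \<in> borel_measurable borel" using m by measurable
 ultimately show ?case unfolding i[OF pm(1,2)] i[OF pm(3,4)] by blast
next
 case (trig_add f g)
 obtain B B' where B: "!!x. \<bar>f x\<bar> <= B" "!!x. \<bar>g x\<bar> <= B'" using trig_add.IH by auto
 have "(\<integral>x. f x + g x \<partial>M) = (\<integral>x. f x \<partial>M) + (\<integral>x. g x \<partial>M)" if "prob_space M" "sets M = sets borel" for M
 proof -
  interpret prob_space M by fact
  show ?thesis
   by (intro Bochner_Integration.integral_add integrable_const_bound[of _ B] integrable_const_bound[of _ B'])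
     (use B trig_add.IH measurable_cong_sets[OF that(2) refl] in auto)
 qed
 note i = this[OF pm(1,2)] this[OF pm(3,4)]
 have "\<bar>f x + g x\<bar> <= B + B'" for x using B[of x] by linarith
 then show ?case using trig_add.IH unfolding i by (auto intro!: tendsto_add)
qed

text \<open>Second moments make the laws tight, and on a cube test functions are uniform limits of
  trigonometric polynomials. To control these outside the cube, only those invariant under a folding
  of space onto the cube are used, so that a bound on the cube is a bound everywhere.\<close>

theorem joint_weak_conv_cis:
 assumes pm: "!!d. prob_space (\<mu> d)" "!!d. sets (\<mu> d) = sets borel" "prob_space \<nu>" "sets \<nu> = sets borel"
  and cf: "!!J s. finite J ==> (%d. \<integral>x. cis (\<Sum>p\<in>J. s p * x p) \<partial>\<mu> d) ----> (\<integral>x. cis (\<Sum>p\<in>J. s p * x p) \<partial>\<nu>)"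
  and sm: "!!p. EX C. ALL d. integrable (\<mu> d) (%x. (x p)^2) & (\<integral>x. (x p)^2 \<partial>\<mu> d) <= C"
  and sn: "!!p. integrable \<nu> (%x. (x p)^2)"
 shows "joint_weak_conv \<mu> \<nu> sequentially"
 unfolding joint_weak_conv_def
proof (intro allI impI, elim conjE)
 fix J :: "nat set" and phi :: "(nat => real) => real"
 assume J: "finite J" and phi: "continuous_on UNIV phi" "bounded (range phi)"
 obtain B where B: "!!x. \<bar>phi x\<bar> <= B" using phi(2) by (auto simp: bounded_iff)
 have B0: "B >= 0" using order_trans[OF abs_ge_zero B] .
 define cutJ where "cutJ x = (%p. if p \<in> J then x p else (0::real))" for x :: "nat => real"
 define psi where "psi x = phi (cutJ x)" for x
 have psim: "psi \<in> borel_measurable borel"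
  unfolding psi_def cutJ_def by (intro borel_measurable_continuous_onI restrict_cont phi(1))
 obtain C where C: "!!p d. integrable (\<mu> d) (%x. (x p)^2)" "!!p d. (\<integral>x. (x p)^2 \<partial>\<mu> d) <= C p" using sm by metis
 define D where "D p = max (C p) (\<integral>x. (x p)^2 \<partial>\<nu>)" for p
 define T where "T = (\<Sum>p\<in>J. D p)"
 have D0: "D p >= 0" for p unfolding D_def by (rule max.coboundedI2) simp
 have T0: "T >= 0" unfolding T_def using D0 by (intro sum_nonneg) auto
 show "(%i. \<integral>x. phi (%p. if p \<in> J then x p else 0) \<partial>\<mu> i) ----> (\<integral>x. phi (%p. if p \<in> J then x p else 0) \<partial>\<nu>)"
  unfolding cutJ_def[symmetric] psi_def[symmetric]
 proof (rule tendstoI)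
  fix eps' :: real assume "eps' > 0"
  \<comment> \<open>Two comparisons cost \<open>2 * eps\<close> each and the convergence of the
    trigonometric polynomial one more; the minimum with 1 gives the bound B + 1 for it.\<close>
  define eps where "eps = min 1 (eps' / 5)"
  have eps: "eps > 0" "eps <= 1" "5 * eps <= eps'" using \<open>eps' > 0\<close> by (auto simp: eps_def)
  \<comment> \<open>Chosen so that the Chebyshev tail is at most \<open>eps\<close>; the summand 1
    keeps R positive.\<close>
  define R where "R = sqrt ((2 * B + 1) * T / eps + 1)"
  have R2: "R^2 = (2 * B + 1) * T / eps + 1" and Rpos: "R > 0"
   using eps(1) B0 T0 by (auto simp: R_def intro!: add_nonneg_pos real_sqrt_gt_zero)
  have tail: "(2 * B + 1) * T / R^2 <= eps"
  proof -
   have "(2 * B + 1) * T <= eps * R^2" unfolding R2 using eps(1) by (simp add: distrib_left)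
   then show ?thesis using Rpos by (simp add: pos_divide_le_eq)
  qed
  \<comment> \<open>R becomes a quarter period, so \<open>sin (\<kappa> * y)\<close> separates
    points of [-R, R].\<close>
  define \<kappa> where "\<kappa> = pi / (2 * R)"
  have \<kappa>: "\<kappa> > 0" "\<kappa> * R = pi / 2" using Rpos by (auto simp: \<kappa>_def)
  \<comment> \<open>Reflects each coordinate in J back into [-R, R]; functions of the values
    \<open>sin (\<kappa> * x p)\<close> are unchanged by it.\<close>
  define fold where "fold x p = (if p \<in> J then arcsin (sin (\<kappa> * x p)) / \<kappa> else 0)" for x p
  define S where "S = (\<Pi>\<^sub>E p\<in>UNIV. if p \<in> J then {-R..R} else {0})"
  have inS: "x \<in> S \<longleftrightarrow> (ALL p. if p \<in> J then \<bar>x p\<bar> <= R else x p = 0)" for x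
   by (auto simp: S_def PiE_iff abs_le_iff split: if_splits)
  have "compact S"
  proof -
   have "compactin (product_topology (%_. euclideanreal) UNIV) S"
    unfolding S_def compactin_PiE by auto
   then show ?thesis by (simp add: euclidean_product_topology)
  qed
  have small: "\<bar>\<kappa> * y\<bar> <= pi / 2" if "\<bar>y\<bar> <= R" for y
   using mult_left_mono[OF that, of \<kappa>] \<kappa> by (simp add: abs_mult)
  have fold_cut: "fold x = cutJ x" if "!!p. p \<in> J ==> \<bar>x p\<bar> <= R" for x
  proof
   fix p
   have "arcsin (sin (\<kappa> * x p)) = \<kappa> * x p" if "p \<in> J"
    using small[OF \<open>!!p. p \<in> J ==> \<bar>x p\<bar> <= R\<close>[OF that]] by (intro arcsin_sin) linarith+
   then show "fold x p = cutJ x p" using \<kappa>(1) by (simp add: fold_def cutJ_def)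
  qed
  have fold_S: "fold x \<in> S" for x
  proof -
   have "\<bar>arcsin y / \<kappa>\<bar> <= R" if "\<bar>y\<bar> <= 1" for y
   proof -
    have "\<bar>arcsin y\<bar> <= R * \<kappa>" using arcsin_bounded[of y] that \<kappa>(2) by (simp add: abs_le_iff mult.commute minus_le_iff)
    then show ?thesis using \<kappa>(1) by (simp add: abs_divide pos_divide_le_eq)
   qed
   then have "\<bar>fold x p\<bar> <= R" if "p \<in> J" for p
    using that by (simp only: fold_def if_True abs_sin_le_one)
   moreover have "fold x p = 0" if "p ~: J" for p using that by (simp only: fold_def if_False)
   ultimately show ?thesis unfolding inS by simp
  qed
  define F where "F = {g. trig J g & continuous_on UNIV g & (ALL x. g x = g (fold x))}"
  interpret function_ring_on F S
  proof
   show "(%_. c) \<in> F" for c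
    using trig_base[of J "complex_of_real c" "%_. 0"] by (simp add: F_def)
   fix x y assume xy: "x \<in> S" "y \<in> S" "x ~= y"
   then obtain p where p: "p \<in> J" "x p ~= y p" unfolding inS by (metis ext)
   let ?s = "%q. if q = p then \<kappa> else 0"
   have sum: "(\<Sum>q\<in>J. ?s q * z q) = \<kappa> * z p" for z :: "nat => real"
    using p(1) J by (simp add: if_distrib[of "%c. c * _"] cong: if_cong)
   have "Re (- \<i> * cis y) = sin y" for y by simp
   then have "trig J (%z. sin (\<kappa> * z p))" using trig_base[of J "- \<i>" ?s] by (simp only: sum)
   moreover have "continuous_on UNIV (%z :: nat => real. sin (\<kappa> * z p))"
    by (intro continuous_intros continuous_coordinate)
   moreover have "sin (\<kappa> * z p) = sin (\<kappa> * fold z p)" for z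
    using p(1) \<kappa>(1) by (simp add: fold_def)
   ultimately have "(%z. sin (\<kappa> * z p)) \<in> F" by (simp add: F_def)
   moreover have "sin (\<kappa> * x p) ~= sin (\<kappa> * y p)"
   proof
    assume "sin (\<kappa> * x p) = sin (\<kappa> * y p)"
    moreover have "\<bar>\<kappa> * x p\<bar> <= pi / 2" "\<bar>\<kappa> * y p\<bar> <= pi / 2"
     using xy p(1) unfolding inS by (metis small)+
    ultimately have "\<kappa> * x p = \<kappa> * y p"
     by - (rule sin_inj_pi; linarith)
    then show False using p \<kappa>(1) by simp
   qed
   ultimately show "EX f:F. f x ~= f y" by (intro bexI[of _ "%z. sin (\<kappa> * z p)"])
  next
   show "compact S" using \<open>compact S\<close> .
   show "continuous_on S f" if "f \<in> F" for f
    using that unfolding F_def by (auto intro: continuous_on_subset)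
   show "(%x. f x + g x) \<in> F" if "f \<in> F" "g \<in> F" for f g
    using that by (auto simp: F_def trig_add intro!: continuous_on_add)
   show "(%x. f x * g x) \<in> F" if "f \<in> F" "g \<in> F" for f g
    using that by (auto simp: F_def trig_mult intro!: continuous_on_mult)
  qed
  obtain g where g: "g \<in> F" "!!x. x \<in> S ==> \<bar>phi x - g x\<bar> < eps"
   using Stone_Weierstrass_basic[OF continuous_on_subset[OF phi(1)] eps(1)] by auto
  have gt: "trig J g" "!!x. g x = g (fold x)" using g(1) by (auto simp: F_def)
  have lim: "g \<in> borel_measurable borel" "(%d. \<integral>x. g x \<partial>\<mu> d) ----> (\<integral>x. g x \<partial>\<nu>)"
   using trig_limit[OF pm cf[OF J] gt(1)] by auto
  have gB: "\<bar>g x\<bar> <= B + 1" for x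
   using gt(2)[of x] g(2)[OF fold_S[of x]] B[of "fold x"] eps(2) by linarith
  have pt: "\<bar>psi x - g x\<bar> <= eps + (2 * B + 1) * ((\<Sum>p\<in>J. (x p)^2) / R^2)" for x
  proof (cases "ALL p:J. \<bar>x p\<bar> <= R")
   case True
   then have "cutJ x \<in> S" "g x = g (cutJ x)" using fold_cut[of x] fold_S[of x] gt(2)[of x] by auto
   then have "\<bar>psi x - g x\<bar> < eps" using g(2) by (simp add: psi_def)
   moreover have "0 <= (2 * B + 1) * ((\<Sum>p\<in>J. (x p)^2) / R^2)"
    using B0 by (intro mult_nonneg_nonneg divide_nonneg_nonneg sum_nonneg) auto
   ultimately show ?thesis by linarith
  next
   case False
   then obtain p where p: "p \<in> J" "R < \<bar>x p\<bar>" by auto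
   have "R^2 <= (x p)^2" using p(2) Rpos by (metis abs_ge_zero less_imp_le power2_abs power_mono)
   also have "... <= (\<Sum>p\<in>J. (x p)^2)" using p(1) J by (intro member_le_sum) auto
   finally have "2 * B + 1 <= (2 * B + 1) * ((\<Sum>p\<in>J. (x p)^2) / R^2)"
    using Rpos B0 mult_left_mono[of 1 "(\<Sum>p\<in>J. (x p)^2) / R^2" "2 * B + 1"] by (simp add: pos_le_divide_eq)
   moreover have "\<bar>psi x - g x\<bar> <= 2 * B + 1" unfolding psi_def using B[of "cutJ x"] gB[of x] by linarith
   ultimately show ?thesis by (intro add_increasing[OF less_imp_le[OF eps(1)]]) (rule order_trans)
  qed
  have approx: "\<bar>(\<integral>x. psi x \<partial>M) - (\<integral>x. g x \<partial>M)\<bar> <= 2 * eps"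
   if M: "prob_space M" "sets M = sets borel" and s: "!!p. integrable M (%x. (x p)^2)" "!!p. (\<integral>x. (x p)^2 \<partial>M) <= D p" for M
  proof -
   interpret prob_space M by fact
   have mM: "psi \<in> borel_measurable M" "g \<in> borel_measurable M"
    using psim lim(1) measurable_cong_sets[OF M(2) refl] by auto
   have i: "integrable M psi" "integrable M g"
    using mM B gB by (auto intro!: integrable_const_bound[of _ B] integrable_const_bound[of g "B + 1"] simp: psi_def)
   have isum: "integrable M (%x. eps + (2 * B + 1) * ((\<Sum>p\<in>J. (x p)^2) / R^2))" using s(1) by simp
   have "\<bar>(\<integral>x. psi x \<partial>M) - (\<integral>x. g x \<partial>M)\<bar> <= (\<integral>x. eps + (2 * B + 1) * ((\<Sum>p\<in>J. (x p)^2) / R^2) \<partial>M)"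
    unfolding Bochner_Integration.integral_diff[OF i, symmetric]
    by (intro integral_abs_bound[THEN order_trans] integral_mono isum integrable_abs Bochner_Integration.integrable_diff i pt)
   also have "... = eps + (2 * B + 1) * ((\<Sum>p\<in>J. (\<integral>x. (x p)^2 \<partial>M)) / R^2)"
    using s(1) by (simp add: prob_space)
   also have "... <= eps + (2 * B + 1) * (T / R^2)"
    unfolding T_def using B0 s(2) by (intro add_left_mono mult_left_mono divide_right_mono sum_mono) auto
   also have "... <= eps + eps" using tail by simp
   finally show ?thesis by simp
  qed
  have "\<forall>\<^sub>F d in sequentially. \<bar>(\<integral>x. g x \<partial>\<mu> d) - (\<integral>x. g x \<partial>\<nu>)\<bar> < eps"
   using tendstoD[OF lim(2) eps(1)] by (simp add: dist_real_def)
  then show "\<forall>\<^sub>F d in sequentially. dist (\<integral>x. psi x \<partial>\<mu> d) (\<integral>x. psi x \<partial>\<nu>) < eps'"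
  proof eventually_elim
   case (elim d)
   have "\<bar>(\<integral>x. psi x \<partial>\<mu> d) - (\<integral>x. g x \<partial>\<mu> d)\<bar> <= 2 * eps"
    by (rule approx[OF pm(1,2)]) (use C in "auto simp: D_def le_max_iff_disj")
   moreover have "\<bar>(\<integral>x. psi x \<partial>\<nu>) - (\<integral>x. g x \<partial>\<nu>)\<bar> <= 2 * eps"
    by (rule approx[OF pm(3,4)]) (use sn in "auto simp: D_def")
   ultimately show ?case using elim eps(3) unfolding dist_real_def by linarith
  qed
 qed
qed

section \<open>Moments of anisotropic profiles\<close>

lemma finite_boxes: "finite (boxes l)"
proof (rule finite_subset)
 show "boxes l \<subseteq> (\<Union>i \<in> {1..length l}. {i} \<times> {1..row l i})" by (auto simp: boxes_def)
qed auto

text \<open>At fixed c the region above |c| is a union of vertical segments, at most one for each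
  box, overlapping in at most finitely many points. The length of a segment is a trapezoidal
  function of c with kinks at the four corners of the box.\<close>

lemma profile_tents:
 fixes c e h :: real
 assumes h: "h > 0" and l: "l \<in> partitions d"
 defines "a \<equiv> eps1 e h" and "b \<equiv> eps2 e h"
 defines "s \<equiv> %z :: nat \<times> nat. c - (b * (real (fst z) - 1) + a * (real (snd z) - 1))"
 shows "profile l e h c - \<bar>c\<bar> = (\<Sum>z\<in>boxes l. \<bar>s z - a\<bar> + \<bar>s z - b\<bar> - \<bar>s z\<bar> - \<bar>s z - a - b\<bar>)"
proof -
 have p: "b < 0" "a > 0" using eps_unique[OF h, of b a e] by (auto simp: a_def b_def)
 define lo hi where "lo z = max (c - 2 * b * (real (fst z) - 1)) (2 * a * (real (snd z) - 1) - c)"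
  and "hi z = min (c - 2 * b * real (fst z)) (2 * a * real (snd z) - c)" for z :: "nat \<times> nat"
 have slice: "(c, y) \<in> box_rectangle e h (fst z) (snd z) \<longleftrightarrow> y \<in> {lo z..hi z}" for y z
  unfolding box_rectangle_iff[OF h] a_def[symmetric] b_def[symmetric] lo_def hi_def
  using p pos_le_divide_eq[of "-2 * b"] pos_divide_le_eq[of "-2 * b"] pos_le_divide_eq[of "2 * a"] pos_divide_le_eq[of "2 * a"]
  by (simp add: algebra_simps del: minus_mult_left)  linarith
 have region: "\<bar>c\<bar> <= y & y <= profile l e h c \<longleftrightarrow> y = \<bar>c\<bar> | (EX z:boxes l. y \<in> {lo z..hi z})" for y
  using arg_cong[OF profile_region[OF h l, of e], of "%S. (c, y) \<in> S"] by (simp add: case_prod_beta slice)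
 have len: "measure lebesgue {lo z..hi z} = \<bar>s z - a\<bar> + \<bar>s z - b\<bar> - \<bar>s z\<bar> - \<bar>s z - a - b\<bar>" for z
 proof -
  have "measure lebesgue {lo z..hi z} = max 0 (hi z - lo z)" by simp
  also have "hi z - lo z = min (2 * s z - 2 * b) (2 * a) - max (2 * s z) 0"
   unfolding hi_def lo_def s_def by (simp add: min_def max_def algebra_simps)
  also have "max 0 ... = \<bar>s z - a\<bar> + \<bar>s z - b\<bar> - \<bar>s z\<bar> - \<bar>s z - a - b\<bar>"
   using p by (auto simp: min_def max_def abs_if)
  finally show ?thesis .
 qed
 have "profile l e h c - \<bar>c\<bar> = measure lebesgue {\<bar>c\<bar>..profile l e h c}" using region[of "\<bar>c\<bar>"] by simp
 also have "... = measure lebesgue (\<Union>z\<in>boxes l. {lo z..hi z})"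
 proof (rule measure_negligible_symdiff)
  show "(\<Union>z\<in>boxes l. {lo z..hi z}) \<in> lmeasurable" using finite_boxes by (intro fmeasurable.finite_UN) auto
  have "(\<Union>z\<in>boxes l. {lo z..hi z}) - {\<bar>c\<bar>..profile l e h c} \<union>
   ({\<bar>c\<bar>..profile l e h c} - (\<Union>z\<in>boxes l. {lo z..hi z})) \<subseteq> {\<bar>c\<bar>}" using region by auto
  then show "negligible ((\<Union>z\<in>boxes l. {lo z..hi z}) - {\<bar>c\<bar>..profile l e h c} \<union>
   ({\<bar>c\<bar>..profile l e h c} - (\<Union>z\<in>boxes l. {lo z..hi z})))" by (rule negligible_subset[rotated]) simp
 qed
 also have "... = (\<Sum>z\<in>boxes l. measure lebesgue {lo z..hi z})"
 proof (rule measure_negligible_finite_Union_image[OF finite_boxes])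
  show "pairwise (%z z'. negligible ({lo z..hi z} \<inter> {lo z'..hi z'})) (boxes l)"
  proof (rule pairwiseI)
   fix z z' :: "nat \<times> nat" assume "z ~= z'"
   \<comment> \<open>Two different cells of a grid of mesh k share at most an end point.\<close>
   have gap: "x = k * real m" if "k * (real m - 1) <= x" "x <= k * real m" "k * (real n - 1) <= x" "x <= k * real n" "m < n" "k > 0"
    for x k :: real and m n
   proof -
    have "k * real m <= k * (real n - 1)" using that by (intro mult_left_mono) auto
    then show ?thesis using that(2,3) by linarith
   qed
   have "y \<in> {c - 2 * b * real (fst z), c - 2 * b * real (fst z'), 2 * a * real (snd z) - c, 2 * a * real (snd z') - c}"
    if y: "y \<in> {lo z..hi z}" "y \<in> {lo z'..hi z'}" for y
   proof -
    have y1: "- 2 * b * (real (fst z) - 1) <= y - c" "y - c <= - 2 * b * real (fst z)"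
     "- 2 * b * (real (fst z') - 1) <= y - c" "y - c <= - 2 * b * real (fst z')"
     and y2: "2 * a * (real (snd z) - 1) <= y + c" "y + c <= 2 * a * real (snd z)"
     "2 * a * (real (snd z') - 1) <= y + c" "y + c <= 2 * a * real (snd z')"
     using y by (auto simp: lo_def hi_def)
    have "fst z < fst z' | fst z' < fst z | snd z < snd z' | snd z' < snd z"
     using \<open>z ~= z'\<close> by (metis nat_neq_iff prod.expand)
    then show ?thesis
    proof (elim disjE)
     assume "fst z < fst z'" then show ?thesis using gap[OF y1] p by (auto simp: algebra_simps)
    next
     assume "fst z' < fst z" then show ?thesis using gap[OF y1(3,4,1,2)] p by (auto simp: algebra_simps)
    next
     assume "snd z < snd z'" then show ?thesis using gap[OF y2] p by (auto simp: algebra_simps)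
    next
     assume "snd z' < snd z" then show ?thesis using gap[OF y2(3,4,1,2)] p by (auto simp: algebra_simps)
    qed
   qed
   then have "{lo z..hi z} \<inter> {lo z'..hi z'} \<subseteq>
    {c - 2 * b * real (fst z), c - 2 * b * real (fst z'), 2 * a * real (snd z) - c, 2 * a * real (snd z') - c}" by blast
   then show "negligible ({lo z..hi z} \<inter> {lo z'..hi z'})" by (rule negligible_subset[rotated]) simp
  qed
 qed simp
 finally show ?thesis by (simp only: len)
qed

definition pad :: "nat list => nat => nat" where
 "pad l i = (if i < length l then l ! i else 0)"

lemma sum_boxes: "(\<Sum>z\<in>boxes l. F (fst z) (snd z)) = (\<Sum>i<length l. \<Sum>j<pad l i. F (Suc i) (Suc j))"
proof -
 have "(\<Sum>z\<in>boxes l. F (fst z) (snd z)) = (\<Sum>z\<in>(SIGMA i:{..<length l}. {..<pad l i}). F (Suc (fst z)) (Suc (snd z)))"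
  by (rule sum.reindex_bij_witness[of _ "%z. (Suc (fst z), Suc (snd z))" "%z. (fst z - 1, snd z - 1)"])
    (auto simp: boxes_def row_def pad_def)
 then show ?thesis by (simp add: sum.Sigma case_prod_beta)
qed

theorem profile_moment:
 assumes h: "h > 0" and l: "l \<in> partitions d"
 shows "half_dd_profile (profile l e h) (%c. c ^ p) = shape_moment (eps1 e h) (eps2 e h) (pad l) p"
proof -
 define a b where "a = eps1 e h" and "b = eps2 e h"
 \<comment> \<open>The pair of booleans names a corner of the box: the first adds a, the second adds
   b, and \<open>m\<close> is the sign of the corner in \<open>box_pow\<close>.\<close>
 define I where "I = boxes l \<times> (UNIV :: (bool \<times> bool) set)"
 define m where "m = (%(z :: nat \<times> nat, u :: bool, v). if u = v then -1 else 1 :: real)"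
 define x where "x = (%(z, u, v). b * (real (fst z) - 1) + a * (real (snd z) - 1) + (if u then a else 0) + (if v then b else 0))"
 have sum: "(\<Sum>i\<in>I. m i * F (x i)) = (\<Sum>z\<in>boxes l. let c = b * (real (fst z) - 1) + a * (real (snd z) - 1) in
   F (c + a) + F (c + b) - F c - F (c + a + b))" for F :: "real => real"
  unfolding I_def UNIV_Times_UNIV[symmetric] sum.cartesian_product' Let_def
  by (simp add: m_def x_def UNIV_bool algebra_simps)
 have "profile l e h c - \<bar>c\<bar> = (\<Sum>i\<in>I. m i * \<bar>c - x i\<bar>)" for c
  unfolding profile_tents[OF h l] sum[of "%u. \<bar>c - u\<bar>"] Let_def a_def b_def
  by (intro sum.cong refl) (simp add: algebra_simps)
 then have "half_dd_profile (profile l e h) (%c. c ^ p) = 0 ^ p + half_dd (%c. \<Sum>i\<in>I. m i * \<bar>c - x i\<bar>) (%c. c ^ p)"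
  by (simp add: half_dd_profile_def)
 also have "half_dd (%c. \<Sum>i\<in>I. m i * \<bar>c - x i\<bar>) (%c. c ^ p) = (\<Sum>i\<in>I. m i *\<^sub>R x i ^ p)"
  by (rule half_dd_abs_sum[OF pow_vector_derivs])
    (use sum[of "%_. 1"] sum[of "%c. c"] finite_boxes in "auto simp: I_def Let_def intro!: continuous_intros")
 also have "... = (\<Sum>z\<in>boxes l. box_pow a b p (b * (real (fst z) - 1) + a * (real (snd z) - 1)))"
  unfolding real_scaleR_def sum[of "%u. u ^ p"] by (simp add: box_pow_def Let_def)
 also have "... = (\<Sum>i<length l. \<Sum>j<pad l i. box_pow a b p (b * real i + a * real j))"
  by (subst sum_boxes[of "%i j. box_pow a b p (b * (real i - 1) + a * (real j - 1))"]) simp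
 finally show ?thesis by (subst shape_moment_N[of "length l"]) (auto simp: pad_def a_def b_def)
qed

section \<open>From integer lists to diagrams\<close>

lemma colf_pad: "col l (Suc j) = colf (pad l) j"
proof -
 have "{i. 1 <= i & i <= length l & Suc j <= row l i} = Suc ` {i. j < pad l i}"
 proof (intro set_eqI iffI)
  fix i assume "i \<in> {i. 1 <= i & i <= length l & Suc j <= row l i}"
  then show "i \<in> Suc ` {i. j < pad l i}" by (intro image_eqI[of _ _ "i - 1"]) (auto simp: pad_def row_def)
 qed (auto simp: pad_def row_def split: if_splits)
 then show ?thesis by (simp add: col_def colf_def card_image)
qed

lemma jack_plancherel_weight_pad:
 assumes "h > 0" "length l <= d"
 shows "jack_plancherel_weight e h d l = jp_weight (eps1 e h) (eps2 e h) d (pad l)"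
proof -
 define a b where "a = eps1 e h" and "b = eps2 e h"
 let ?f = "%i j. 1 / ((- b * (real (col l j) - real i) + a * (real (row l i) - real j) + a)
     * (- b * (real (col l j) - real i) + a * (real (row l i) - real j) - b))"
 have "(\<Prod>i = 1..length l. \<Prod>j = 1..row l i. ?f i j) = (\<Prod>i<length l. \<Prod>j<pad l i. ?f (Suc i) (Suc j))"
  unfolding image_Suc_lessThan[symmetric] by (simp add: prod.reindex row_def pad_def)
 also have "... = (\<Prod>i<length l. \<Prod>j<pad l i. 1 / hookf a b (pad l) i j)"
  by (intro prod.cong refl) (simp add: hookf_def colf_pad row_def pad_def algebra_simps)
 also have "... = 1 / hooks a b (length l) (pad l)" by (simp add: hooks_def prod_dividef)
 also have "hooks a b (length l) (pad l) = hooks a b d (pad l)"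
  by (rule hooks_N[symmetric]) (use assms(2) in "auto simp: pad_def")
 finally show ?thesis using eps_unique[OF assms(1), of "eps2 e h" "eps1 e h" e]
  unfolding jack_plancherel_weight_def jp_weight_def a_def b_def by simp
qed

lemma length_partition:
 assumes "l \<in> partitions d" shows "length l <= d"
proof -
 have "length l <= sum_list l" if "0 ~: set l" for l :: "nat list"
  using that by (induction l) auto
 then show ?thesis using assms by (auto simp: partitions_def)
qed

lemma bij_betw_pad: "bij_betw pad (partitions d) (diagrams d)"
proof (rule bij_betw_imageI)
 show "inj_on pad (partitions d)"
 proof (rule inj_onI)
  fix l l' assume l: "l \<in> partitions d" "l' \<in> partitions d" and eq: "pad l = pad l'"
  have z: "pad k i = 0 \<longleftrightarrow> length k <= i" if "k \<in> partitions d" for k i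
   using that unfolding pad_def partitions_def by (metis (mono_tags, lifting) mem_Collect_eq not_le nth_mem)
  have "length l = length l'" using z[OF l(1)] z[OF l(2)] unfolding eq by (metis dual_order.antisym order_refl)
  then show "l = l'"
   by (rule nth_equalityI) (use fun_cong[OF eq] \<open>length l = length l'\<close> in "metis pad_def")
 qed
 show "pad ` partitions d = diagrams d"
 proof (intro set_eqI iffI)
  fix f assume "f \<in> pad ` partitions d"
  then obtain l where l: "l \<in> partitions d" and f: "f = pad l" by auto
  have "antimono (pad l)"
  proof (rule antimonoI)
   fix i j :: nat assume "i <= j"
   then show "pad l j <= pad l i"
    using l sorted_wrt_nth_less[of "(>=)" l i j] by (cases "i = j") (auto simp: pad_def partitions_def)
  qed
  moreover have "sum (pad l) {..<d} = sum (pad l) {..<length l}"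
   using length_partition[OF l] by (intro sum.mono_neutral_right) (auto simp: pad_def)
  moreover have "sum (pad l) {..<length l} = sum_list l"
   unfolding sum_list_sum_nth atLeast0LessThan by (simp add: pad_def)
  ultimately show "f \<in> diagrams d"
   using l length_partition[OF l] by (auto simp: diagrams_def f partitions_def pad_def)
 next
  fix f assume f: "f \<in> diagrams d"
  define n where "n = (LEAST i. f i = 0)"
  have n0: "f n = 0" unfolding n_def by (rule LeastI[of _ d]) (use f in "auto simp: diagrams_def")
  have nd: "n <= d" unfolding n_def by (rule Least_le) (use f in "auto simp: diagrams_def")
  have nz: "f i ~= 0" if "i < n" for i using not_less_Least that unfolding n_def by blast
  have anti: "f j <= f i" if "i <= j" for i j using f that by (auto simp: diagrams_def antimono_def)
  have ge: "f i = 0" if "n <= i" for i using anti[OF that] n0 by simp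
  have "f = pad (map f [0..<n])" using ge by (auto simp: pad_def fun_eq_iff)
  moreover have "map f [0..<n] \<in> partitions d"
  proof -
   have "sorted_wrt (>=) (map f [0..<n])"
    unfolding sorted_wrt_map by (rule sorted_wrt_mono_rel[OF _ sorted_wrt_upt]) (use anti in auto)
   moreover have "sum_list (map f [0..<n]) = sum f {..<n}"
    by (simp add: sum_list_distinct_conv_sum_set atLeast0LessThan[symmetric])
   moreover have "sum f {..<n} = sum f {..<d}"
    using nd ge by (intro sum.mono_neutral_left) auto
   ultimately show ?thesis using f nz by (fastforce simp: partitions_def diagrams_def)
  qed
  ultimately show "f \<in> pad ` partitions d" by blast
 qed
qed

lemma finite_partitions: "finite (partitions d)"
 using bij_betw_finite[OF bij_betw_pad] finite_diagrams by blast

lemma jack_plancherel_weight_nonneg: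
 assumes "h > 0" "l \<in> partitions d" shows "jack_plancherel_weight e h d l >= 0"
proof -
 have "eps1 e h > 0" "eps2 e h < 0" using eps_unique[OF assms(1), of "eps2 e h" "eps1 e h" e] by auto
 then show ?thesis unfolding jack_plancherel_weight_pad[OF assms(1) length_partition[OF assms(2)]]
  using jp_weight_pos bij_betw_apply[OF bij_betw_pad assms(2)] less_imp_le by blast
qed

lemma integral_jack_plancherel:
 fixes F :: "_ => 'b :: {banach, second_countable_topology}"
 assumes "h > 0" "!!l. l \<in> partitions d ==> G l = F (pad l)"
 shows "(\<integral>l. G l \<partial>jack_plancherel e h d) = jp_sum (eps1 e h) (eps2 e h) d F"
proof -
 have "(\<integral>l. G l \<partial>jack_plancherel e h d) = (\<Sum>l\<in>partitions d. jack_plancherel_weight e h d l *\<^sub>R G l)"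
  unfolding jack_plancherel_def
  by (rule lebesgue_integral_point_measure_finite[OF finite_partitions jack_plancherel_weight_nonneg[OF assms(1)]])
 also have "... = (\<Sum>l\<in>partitions d. jp_weight (eps1 e h) (eps2 e h) d (pad l) *\<^sub>R F (pad l))"
  by (intro sum.cong refl) (simp add: jack_plancherel_weight_pad[OF assms(1) length_partition] assms(2))
 also have "... = jp_sum (eps1 e h) (eps2 e h) d F"
  unfolding jp_sum_def by (rule sum.reindex_bij_betw[OF bij_betw_pad])
 finally show ?thesis .
qed

text \<open>Total mass 1 is carried up from the empty diagram by the growth; as \<open>d\<close> is
  fixed, a constant parameter sequence serves for the chain.\<close>

lemma prob_space_jack_plancherel:
 assumes "d >= 1" shows "prob_space (jack_plancherel e (1 / real d) d)"
proof
 interpret jp_chain "%_. e" "\<bar>e\<bar>" by unfold_locales auto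
 let ?M = "jack_plancherel e (1 / real d) d"
 have f: "finite_measure ?M"
  by (rule finite_measureI) (simp add: jack_plancherel_def emeasure_point_measure_finite[OF finite_partitions] space_point_measure finite_partitions)
 have "measure ?M (space ?M) = (\<integral>l. 1 \<partial>?M)" by simp
 also have "... = EE d d (%f. 1 :: real)"
  unfolding EE_def ad_def bd_def by (rule integral_jack_plancherel) (use assms in auto)
 also have "... = 1" by (rule EE_1[OF assms])
 finally show "emeasure ?M (space ?M) = 1" by (simp add: finite_measure.emeasure_eq_measure[OF f])
qed

section \<open>The mean shift\<close>

text \<open>The moments of the semicircle law: Catalan numbers at even orders, as
  \<open>hom0_eq\<close> shows.\<close>

definition hom0 :: "real fps" where "hom0 = Abs_fps (hv 1 0)"

definition shift_fps :: "real fps" where "shift_fps = fps_X ^ 3 * hom0 * inverse (1 - 4 * fps_X^2)"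

lemma hv_1_Suc: "hv 1 e (Suc j) = (\<Sum>a<j. hv 1 e a * (hv 1 e (j - 1 - a) + e * rv 1 e (j - 1 - a) 0))"
 using wv_shift[of 1 e j 0] by (simp add: hv_def)

lemma X2_mult_nth: "(fps_X^2 * (F :: real fps)) $ n = (if n < 2 then 0 else F $ (n - 2))"
 by (rule fps_X_power_mult_nth)

lemma X2_mult_sum: "(fps_X^2 * (F * (G :: real fps))) $ Suc j = (\<Sum>a<j. F $ a * G $ (j - 1 - a))"
 unfolding X2_mult_nth by (cases j) (simp_all add: fps_mult_nth atLeast0AtMost lessThan_Suc_atMost)

lemma hom0_eq: "hom0 = 1 + fps_X^2 * (hom0 * hom0)"
proof (rule fps_ext)
 fix n show "hom0 $ n = (1 + fps_X^2 * (hom0 * hom0)) $ n"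
 proof (cases n)
  case (Suc j)
  then show ?thesis by (simp add: X2_mult_sum del: fps_mult_nth_1') (simp add: hom0_def hv_1_Suc)
 qed (simp add: X2_mult_nth hom0_def)
qed

text \<open>Differentiating \<open>hv_1_Suc\<close> in e at 0 leads to the first identity for R, the
  derivative of the logarithm of the series. With s = 1 - 2 X^2 H one has s^2 = 1 - 4 X^2, s H = 2 -
  H and A' s = H, whence R s = X^3 A' and R = X^3 H / (1 - 4 X^2), the closed form taken as
  definition.\<close>

lemma shift_fps_eqs:
 defines "A' \<equiv> fps_deriv (fps_X * hom0)"
 shows "hom0 * shift_fps = fps_X^2 * (hom0 * (2 * (hom0 * shift_fps) + fps_X * A'))"
  and "shift_fps * (1 - 4 * fps_X^2) = fps_X ^ 3 * hom0"
  and "(2 * shift_fps + fps_X * fps_const (1/2) * (hom0 + A')) * (1 - 4 * fps_X^2) = fps_X"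
proof -
 define X H R s where "X = (fps_X :: real fps)" and "H = hom0" and "R = shift_fps" and "s = 1 - 2 * (X^2 * H)"
 have H: "H = 1 + X^2 * (H * H)" unfolding H_def X_def by (rule hom0_eq)
 have s2: "s * s = 1 - 4 * X^2"
 proof -
  have "s * s = 1 - 4 * X^2 * (H - X^2 * (H * H))" unfolding s_def by (simp add: algebra_simps)
  also have "H - X^2 * (H * H) = 1" using H by (simp add: algebra_simps)
  finally show ?thesis by simp
 qed
 have sH: "s * H = 2 - H"
 proof -
  have "s * H = H - 2 * (X^2 * (H * H))" unfolding s_def by (simp add: algebra_simps)
  also have "X^2 * (H * H) = H - 1" using H by (simp add: algebra_simps)
  finally show ?thesis by simp
 qed
 have sA: "A' * s = H"
 proof -
  define A where "A = X * H"
  have "A = X * (1 + A * A)" unfolding A_def using H by (simp add: power2_eq_square mult_ac)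
  then have "fps_deriv A = fps_deriv (X * (1 + A * A))" by (rule arg_cong)
  also have "... = 1 + A * A + 2 * (X * A) * fps_deriv A" by (simp add: X_def algebra_simps)
  finally have "fps_deriv A * (1 - 2 * (X * A)) = 1 + A * A" by (simp add: algebra_simps)
  moreover have "fps_deriv A = A'" by (simp add: A_def A'_def X_def H_def)
  moreover have "1 - 2 * (X * A) = s" "1 + A * A = H"
   using H unfolding A_def s_def by (simp_all add: power2_eq_square mult_ac)
  ultimately show ?thesis by simp
 qed
 have R: "R * (s * s) = X ^ 3 * H"
 proof -
  have "inverse (1 - 4 * fps_X^2) * (1 - 4 * fps_X^2) = (1 :: real fps)"
   by (rule inverse_mult_eq_1) (simp add: X2_mult_nth mult.commute[of 4])
  then show ?thesis unfolding s2 R_def shift_fps_def X_def H_def by (simp add: mult.assoc)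
 qed
 then show "shift_fps * (1 - 4 * fps_X^2) = fps_X ^ 3 * hom0" unfolding s2 by (simp add: R_def X_def H_def)
 have s0: "s ~= 0"
 proof
  assume "s = 0"
  then have "(1 - 2 * (X^2 * H)) $ 0 = 0" unfolding s_def by simp
  then show False by (simp add: X_def X2_mult_nth fps_mult_nth)
 qed
 have "(R * s) * s = (X ^ 3 * A') * s" using R sA by (simp add: mult_ac)
 then have Rs: "R * s = X ^ 3 * A'" using s0 mult_right_cancel by blast
 have "H * R = H * (R * s) + 2 * (X^2 * (H * (H * R)))" unfolding s_def by (simp add: algebra_simps)
 also have "... = X^2 * (H * (2 * (H * R) + X * A'))" unfolding Rs by (simp add: algebra_simps power3_eq_cube power2_eq_square)
 finally show "hom0 * shift_fps = fps_X^2 * (hom0 * (2 * (hom0 * shift_fps) + fps_X * A'))"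
  unfolding H_def R_def X_def .
 have c: "fps_const (1/2) * 2 = (1 :: real fps)" by (simp add: numeral_fps_const)
 have "(2 * R + X * fps_const (1/2) * (H + A')) * (s * s)
   = 2 * (R * (s * s)) + X * fps_const (1/2) * (s * (s * H) + s * (A' * s))" by (simp add: algebra_simps)
 also have "... = 2 * (X ^ 3 * H) + X * (fps_const (1/2) * 2) * s"
 proof -
  have "s * (s * H) + s * (A' * s) = 2 * s" unfolding sH unfolding sA by (simp add: algebra_simps)
  then show ?thesis unfolding R by (simp add: mult_ac)
 qed
 also have "... = X" unfolding c s_def by (simp add: algebra_simps power3_eq_cube power2_eq_square)
 finally show "(2 * shift_fps + fps_X * fps_const (1/2) * (hom0 + A')) * (1 - 4 * fps_X^2) = fps_X"
  unfolding s2 R_def H_def X_def .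
qed

lemma shift_fps_low: "p < 3 ==> shift_fps $ p = 0"
 unfolding shift_fps_def mult.assoc by (simp only: fps_X_power_mult_nth if_True)

text \<open>The third identity evaluates a combination of R and H as X / (1 - 4 X^2), whose
  coefficients are powers of 2; together with the second it eliminates the Catalan numbers.\<close>

lemma shift_fps_rec:
 "real (n + 2) * shift_fps $ (n + 3) = 4 * real (n + 1) * shift_fps $ (n + 1) + (if even n then 2 * 2 ^ n else 0)"
proof -
 let ?G = "Abs_fps (%n. if odd n then 2 ^ (n - 1) else 0) :: real fps"
 have G: "?G * (1 - 4 * fps_X^2) = fps_X"
 proof (rule fps_ext)
  fix n
  have e: "?G * (1 - 4 * fps_X^2) = ?G - fps_const 4 * (fps_X^2 * ?G)" by (simp add: algebra_simps numeral_fps_const)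
  show "(?G * (1 - 4 * fps_X^2)) $ n = fps_X $ n"
  proof (cases "n < 2")
   case True then show ?thesis unfolding e by (auto simp: X2_mult_nth less_2_cases_iff)
  next
   case False
   then obtain m where m: "n = m + 2" using le_Suc_ex by (metis add.commute not_less)
   show ?thesis unfolding e by (cases m) (auto simp: X2_mult_nth m)
  qed
 qed
 have "(1 - 4 * fps_X^2 :: real fps) $ 0 = 1" by (simp add: X2_mult_nth mult.commute[of 4])
 then have nz: "(1 - 4 * fps_X^2 :: real fps) ~= 0" by (metis fps_zero_nth zero_neq_one)
 have "2 * shift_fps + fps_X * fps_const (1/2) * (hom0 + fps_deriv (fps_X * hom0)) = ?G"
  using shift_fps_eqs(3) G nz mult_right_cancel by metis
 then have "(2 * shift_fps + fps_const (1/2) * (fps_X * (hom0 + fps_deriv (fps_X * hom0)))) $ Suc n = ?G $ Suc n"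
  by (simp add: mult_ac del: fps_deriv_mult)
 then have 1: "2 * shift_fps $ Suc n + (1/2) * (hom0 $ n + real (Suc n) * hom0 $ n) = (if even n then 2 ^ n else 0)"
  by (simp add: numeral_fps_const del: fps_deriv_mult)
 have "(shift_fps - fps_const 4 * (fps_X^2 * shift_fps)) $ (n + 3) = (fps_X ^ 3 * hom0) $ (n + 3)"
  unfolding shift_fps_eqs(2)[symmetric] by (simp add: algebra_simps numeral_fps_const)
 then have 2: "shift_fps $ (n + 3) = 4 * shift_fps $ (n + 1) + hom0 $ n"
  by (simp add: X2_mult_nth fps_X_power_mult_nth)
 show ?thesis unfolding 2 using 1 by (simp add: algebra_simps split: if_splits)
qed

lemma ov_deriv_e:
 assumes "p >= 1"
 shows "((%e. ov 1 e p) has_real_derivative real p * shift_fps $ p) (at 0)"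
proof (rule newton_deriv[OF newton_ov _ _ assms])
 define \<delta> where "\<delta> j = (hom0 * shift_fps) $ j" for j
 show "Abs_fps \<delta> = Abs_fps (hv 1 0) * shift_fps"
  unfolding hom0_def[symmetric] by (rule fps_ext) (simp add: \<delta>_def)
 show "((%e. hv 1 e j) has_real_derivative \<delta> j) (at 0)" for j
 proof (induction j rule: less_induct)
  case (less j)
  show ?case
  proof (cases j)
   case 0 then show ?thesis by (simp add: \<delta>_def shift_fps_low)
  next
   case (Suc i)
   have rv0: "rv 1 0 m 0 = (fps_X * fps_deriv (fps_X * hom0)) $ m" for m
   proof (cases m)
    case (Suc n)
    have "rv 1 0 m 0 = (\<Sum>l<n. 0) + real m * hv 1 0 n"
     unfolding rv_def Suc lessThan_Suc by (simp add: hv_def power_0_left)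
    then show ?thesis by (simp add: Suc hom0_def algebra_simps)
   qed (simp add: rv_def)
   \<comment> \<open>At e = 0 the difference quotient is \<open>rv\<close> itself, so continuity of
     \<open>rv\<close> is enough.\<close>
   have er: "((%e. e * rv 1 e m 0) has_real_derivative rv 1 0 m 0) (at 0)" for m
   proof -
    have "continuous_on UNIV (%e. rv 1 e m 0)"
     using continuous_on_compose2[OF continuous_on_rv[of m 0] continuous_on_Pair[OF continuous_on_const continuous_on_id], of 1] by simp
    then have "isCont (%e. rv 1 e m 0) 0" by (simp add: continuous_on_eq_continuous_at)
    then have "(%e. rv 1 e m 0) \<midarrow>0\<rightarrow> rv 1 0 m 0" by (simp add: isCont_def)
    then have "(%e. (e * rv 1 e m 0 - 0 * rv 1 0 m 0) / (e - 0)) \<midarrow>0\<rightarrow> rv 1 0 m 0"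
     by (rule Lim_transform_eventually) (auto simp: eventually_at_filter)
    then show ?thesis by (simp add: has_field_derivative_iff)
   qed
   have "((%e. \<Sum>a<i. hv 1 e a * (hv 1 e (i - 1 - a) + e * rv 1 e (i - 1 - a) 0)) has_real_derivative
    (\<Sum>a<i. \<delta> a * hv 1 0 (i - 1 - a) + hv 1 0 a * (\<delta> (i - 1 - a) + rv 1 0 (i - 1 - a) 0))) (at 0)"
   proof (rule DERIV_sum)
    fix a assume "a \<in> {..<i}"
    then have "a < j" "i - 1 - a < j" using Suc by auto
    note d = less.IH[OF this(1)] DERIV_add[OF less.IH[OF this(2)] er[of "i - 1 - a"]]
    show "((%e. hv 1 e a * (hv 1 e (i - 1 - a) + e * rv 1 e (i - 1 - a) 0)) has_real_derivative
     \<delta> a * hv 1 0 (i - 1 - a) + hv 1 0 a * (\<delta> (i - 1 - a) + rv 1 0 (i - 1 - a) 0)) (at 0)"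
     using DERIV_mult[OF d] by (simp add: algebra_simps)
   qed
   moreover have "(\<Sum>a<i. \<delta> a * hv 1 0 (i - 1 - a) + hv 1 0 a * (\<delta> (i - 1 - a) + rv 1 0 (i - 1 - a) 0)) = \<delta> j"
   proof -
    have "\<delta> j = (fps_X^2 * (hom0 * shift_fps * hom0)) $ Suc i
      + (fps_X^2 * (hom0 * (hom0 * shift_fps + fps_X * fps_deriv (fps_X * hom0)))) $ Suc i"
     unfolding \<delta>_def Suc by (subst shift_fps_eqs(1)) (simp only: mult_2 distrib_left fps_add_nth mult_ac add_ac)
    also have "... = (\<Sum>a<i. \<delta> a * hv 1 0 (i - 1 - a)) + (\<Sum>a<i. hv 1 0 a * (\<delta> (i - 1 - a) + rv 1 0 (i - 1 - a) 0))"
     unfolding X2_mult_sum rv0 fps_add_nth \<delta>_def by (simp add: hom0_def)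
    finally show ?thesis by (simp add: sum.distrib)
   qed
   ultimately show ?thesis unfolding Suc hv_1_Suc by simp
  qed
 qed
qed

text \<open>An explicit candidate, to be identified by its moments. It jumps at c = 2 and c = -2,
  which is harmless because \<open>half_dd\<close> puts both derivatives on the test
  function.\<close>

definition shift_fun :: "real => real" where
 "shift_fun c = indicator {-2..2} c * (arcsin (c / 2) / pi)"

lemma arcsin_half:
 "continuous_on {-2..2} (%c. arcsin (c / 2))"
 "-2 < c ==> c < 2 ==> ((%c. arcsin (c / 2)) has_real_derivative 1 / sqrt (4 - c^2)) (at c)"
 "-2 < c ==> c < 2 ==> ((%c. sqrt (4 - c^2)) has_real_derivative - c / sqrt (4 - c^2)) (at c)"
 "-2 < c ==> c < 2 ==> c^2 < 4"
proof -
 show "continuous_on {-2..2} (%c::real. arcsin (c / 2))" by (intro continuous_intros) auto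
 assume c: "-2 < c" "c < 2"
 have "sqrt (4 - c^2) = sqrt (4 * (1 - (c / 2)^2))" by (simp add: power_divide)
 also have "... = 2 * sqrt (1 - (c / 2)^2)" unfolding real_sqrt_mult by simp
 finally show "((%c. arcsin (c / 2)) has_real_derivative 1 / sqrt (4 - c^2)) (at c)"
  using c by (auto intro!: derivative_eq_intros simp: field_simps)
 show "c^2 < 4" using power_strict_mono[of "\<bar>c\<bar>" 2 2] c by (simp add: abs_less_iff)
 then show "((%c. sqrt (4 - c^2)) has_real_derivative - c / sqrt (4 - c^2)) (at c)"
  by (auto intro!: derivative_eq_intros simp: field_simps)
qed

text \<open>The polynomial in front of the arcsine is chosen so that all square roots cancel in the
  derivative; integration then links the moments n + 1 and n - 1. For n = 0 the truncated exponent n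
  - 1 carries the factor n.\<close>

lemma arcsin_moment_deriv:
 assumes "-2 < c" "c < 2"
 shows "((%c. (real (n + 2) * c ^ (n + 2) - 4 * real (n + 1) * c ^ n) * arcsin (c / 2) + c ^ (n + 1) * sqrt (4 - c^2))
  has_real_derivative ((real (n + 2))^2 * c ^ (n + 1) - 4 * real (n + 1) * (real n * c ^ (n - 1))) * arcsin (c / 2)) (at c)"
proof -
 define s where "s = sqrt (4 - c^2)"
 have s: "s > 0" "s * s = 4 - c * c" using arcsin_half(4)[OF assms] by (auto simp: s_def power2_eq_square)
 have P: "((%c. real (n + 2) * c ^ (n + 2) - 4 * real (n + 1) * c ^ n) has_real_derivative
   real (n + 2) * (real (n + 2) * c ^ (n + 1)) - 4 * real (n + 1) * (real n * c ^ (n - 1))) (at c)"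
  using DERIV_diff[OF DERIV_cmult[OF DERIV_pow[of "n + 2"]] DERIV_cmult[OF DERIV_pow[of n]]] by simp
 have Q: "((%c. c ^ (n + 1)) has_real_derivative real (n + 1) * c ^ n) (at c)"
  using DERIV_pow[of "n + 1"] by simp
 have "(real (n + 2) * c ^ (n + 2) - 4 * real (n + 1) * c ^ n) * (1 / s)
   + (real (n + 1) * c ^ n * s + (- c / s) * c ^ (n + 1)) = 0"
 proof -
  have "real (n + 1) * c ^ n * s = real (n + 1) * c ^ n * (4 - c * c) / s"
   unfolding s(2)[symmetric] using s(1) by simp
  then show ?thesis by (simp add: diff_divide_distrib add_divide_distrib algebra_simps)
 qed
 then show ?thesis
  using DERIV_add[OF DERIV_mult[OF P arcsin_half(2)[OF assms]] DERIV_mult[OF Q arcsin_half(3)[OF assms]]]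
  unfolding s_def[symmetric] by (elim DERIV_cong) (simp add: power2_eq_square algebra_simps)
qed

definition arcsin_moment :: "nat => real" where
 "arcsin_moment m = integral {-2..2} (%c. c ^ m * arcsin (c / 2))"

lemma arcsin_moment: "((%c. c ^ m * arcsin (c / 2)) has_integral arcsin_moment m) {-2..2}"
 unfolding arcsin_moment_def
 by (intro integrable_integral integrable_continuous_interval continuous_intros arcsin_half) auto

lemma arcsin_moment_0: "arcsin_moment 0 = 0"
proof -
 have "((%c. c ^ 0 * arcsin (c / 2)) has_integral (2 * arcsin (2/2) + sqrt (4 - 2^2)) - (-2 * arcsin (-2/2) + sqrt (4 - (-2)^2))) {-2..2::real}"
 proof (rule fundamental_theorem_of_calculus_interior)
  show "continuous_on {-2..2::real} (%c. c * arcsin (c / 2) + sqrt (4 - c^2))" by (intro continuous_intros arcsin_half)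
  fix c :: real assume c: "c \<in> {-2<..<2}"
  have "((%c. c * arcsin (c / 2) + sqrt (4 - c^2)) has_real_derivative arcsin (c / 2)) (at c)"
   by (rule DERIV_cong[OF DERIV_add[OF DERIV_mult[OF DERIV_ident arcsin_half(2)] arcsin_half(3)]]) (use c in auto)
  then show "((%c. c * arcsin (c / 2) + sqrt (4 - c^2)) has_vector_derivative c ^ 0 * arcsin (c / 2)) (at c)"
   by (simp add: has_real_derivative_iff_has_vector_derivative)
 qed simp
 then show ?thesis using has_integral_unique[OF arcsin_moment] by fastforce
qed

lemma arcsin_moment_rec:
 "(real (n + 2))^2 * arcsin_moment (n + 1)
  = 4 * real (n + 1) * (real n * arcsin_moment (n - 1)) + (if even n then 4 * 2 ^ n * pi else 0)"
proof -
 let ?F = "%c. (real (n + 2) * c ^ (n + 2) - 4 * real (n + 1) * c ^ n) * arcsin (c / 2) + c ^ (n + 1) * sqrt (4 - c^2)"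
 have "((%c. ((real (n + 2))^2 * c ^ (n + 1) - 4 * real (n + 1) * (real n * c ^ (n - 1))) * arcsin (c / 2)) has_integral
   (?F 2 - ?F (-2))) {-2..2}"
 proof (rule fundamental_theorem_of_calculus_interior)
  show "continuous_on {-2..2} ?F" by (intro continuous_intros arcsin_half)
  show "(?F has_vector_derivative ((real (n + 2))^2 * c ^ (n + 1) - 4 * real (n + 1) * (real n * c ^ (n - 1))) * arcsin (c / 2)) (at c)"
   if "c \<in> {-2<..<2}" for c
   using arcsin_moment_deriv[of c n] that by (simp only: has_real_derivative_iff_has_vector_derivative greaterThanLessThan_iff)
 qed simp
 moreover have "((%c. (real (n + 2))^2 * (c ^ (n + 1) * arcsin (c / 2)) - 4 * real (n + 1) * (real n * (c ^ (n - 1) * arcsin (c / 2)))) has_integral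
   (real (n + 2))^2 * arcsin_moment (n + 1) - 4 * real (n + 1) * (real n * arcsin_moment (n - 1))) {-2..2}"
  by (intro has_integral_diff has_integral_mult_right arcsin_moment)
 ultimately have "(real (n + 2))^2 * arcsin_moment (n + 1) - 4 * real (n + 1) * (real n * arcsin_moment (n - 1)) = ?F 2 - ?F (-2)"
  by (intro has_integral_unique) (simp_all add: algebra_simps)
 also have "... = (if even n then 4 * 2 ^ n * pi else 0)"
  by (cases "even n") (simp_all add: field_simps)
 finally show ?thesis by simp
qed

lemma integral_shift_fun:
 "integrable lborel (%c. c ^ q * shift_fun c)"
 "(\<integral>c. c ^ q * shift_fun c \<partial>lborel) = arcsin_moment q / pi"
proof -
 have "continuous_on {-2..2} (%c. c ^ q * arcsin (c / 2) / pi)" by (intro continuous_intros arcsin_half) auto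
 from borel_integrable_atLeastAtMost'[OF this]
 have i: "set_integrable lborel {-2..2} (%c. c ^ q * arcsin (c / 2) / pi)" .
 have e: "c ^ q * shift_fun c = indicator {-2..2} c *\<^sub>R (c ^ q * arcsin (c / 2) / pi)" for c by (simp add: shift_fun_def)
 show "integrable lborel (%c. c ^ q * shift_fun c)" using i unfolding set_integrable_def e .
 have "(\<integral>c. c ^ q * shift_fun c \<partial>lborel) = integral {-2..2} (%c. c ^ q * arcsin (c / 2) / pi)"
  unfolding e using set_borel_integral_eq_integral(2)[OF i] by (simp add: set_lebesgue_integral_def)
 then show "(\<integral>c. c ^ q * shift_fun c \<partial>lborel) = arcsin_moment q / pi" by (simp add: arcsin_moment_def)
qed

text \<open>Both sides obey the same two-step recursion, by \<open>shift_fps_rec\<close> and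
  \<open>arcsin_moment_rec\<close>, with the same initial values.\<close>

lemma shift_fps_moment: "2 * pi * shift_fps $ (m + 2) = real (m + 1) * arcsin_moment m"
proof (induction m rule: less_induct)
 case (less m)
 show ?case
 proof (cases m)
  case 0 then show ?thesis by (simp add: arcsin_moment_0 shift_fps_low)
 next
  case (Suc n)
  have IH: "2 * pi * shift_fps $ (n + 1) = real n * arcsin_moment (n - 1)"
  proof (cases n)
   case (Suc k)
   then show ?thesis using less.IH[of k] \<open>m = Suc n\<close> by simp
  qed (simp add: shift_fps_low)
  have "real (n + 2) * (2 * pi * shift_fps $ (n + 3))
   = 4 * real (n + 1) * (2 * pi * shift_fps $ (n + 1)) + (if even n then 4 * 2 ^ n * pi else 0)"
   using arg_cong[OF shift_fps_rec[of n], of "%x. 2 * pi * x"] by (simp add: algebra_simps)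
  also have "... = real (n + 2) * (real (n + 2) * arcsin_moment (n + 1))"
   unfolding IH using arcsin_moment_rec[of n] by (simp add: power2_eq_square mult.assoc)
  finally have "2 * pi * shift_fps $ (n + 3) = real (n + 2) * arcsin_moment (n + 1)" by simp
  then show ?thesis by (simp add: Suc eval_nat_numeral)
 qed
qed

lemma half_dd_shift_fun: "half_dd shift_fun (%c. c ^ p) = real p * shift_fps $ p"
proof (cases "p < 2")
 case True
 then show ?thesis by (auto simp: half_dd_linear_statistic linear_statistic_def shift_fps_low less_2_cases_iff)
next
 case False
 then obtain m where p: "p = m + 2" using le_Suc_ex by (metis add.commute not_less)
 have "shift_fps $ p = real (m + 1) * arcsin_moment m / (2 * pi)"
  using shift_fps_moment[of m] p by (simp add: field_simps)
 then show ?thesis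
  unfolding half_dd_linear_statistic linear_statistic_def integral_shift_fun(2) p by simp
qed

section \<open>Limit theorems\<close>

text \<open>Normalised so that the linear statistics of \<open>gmap (amat e)\<close> have coefficients \<open>dv 1 e p k / sqrt (k + 1)\<close>.\<close>

definition amat :: "real => nat => nat => real" where
 "amat e q k = 2 / (real (q + 2) * real (q + 1)) * dv 1 e (q + 2) k / sqrt (real (Suc k))"

text \<open>Nonzero, as conditioning on \<open>g 0\<close> through \<open>xi 0\<close>
  requires.\<close>

lemma amat_0: "amat e 0 0 = 2"
 by (simp add: amat_def dv_rv rv_def)

lemma statistic_amat:
 "(1/2) * (real p * (real p - 1)) * amat e (p - 2) k * (if k <= p - 2 then 1 else 0) = dv 1 e p k / sqrt (real (Suc k))"
proof (cases "p < 2")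
 case True then show ?thesis using dv_support[of p k] by (auto simp: less_2_cases_iff)
next
 case False
 then obtain q where "p = q + 2" using le_Suc_ex by (metis add.commute not_less)
 then show ?thesis using dv_support[of p k] by (auto simp: amat_def)
qed

lemma statistic_gmap:
 assumes "p <= Suc M"
 shows "linear_statistic p (gmap (cut0 (amat e)) xi) = (\<Sum>k\<in>{1..<M}. dv 1 e p k / sqrt (real (Suc k)) * xi k)"
proof -
 have "linear_statistic p (gmap (cut0 (amat e)) xi)
   = (\<Sum>k\<le>p - 2. if k = 0 then 0 else dv 1 e p k / sqrt (real (Suc k)) * xi k)"
  unfolding linear_statistic_def gmap_def sum_distrib_left statistic_amat[symmetric]
  by (intro sum.cong) (auto simp: cut0_def)
 also have "... = (\<Sum>k\<in>{1..<M}. dv 1 e p k / sqrt (real (Suc k)) * xi k)"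
  using assms by (intro sum.mono_neutral_cong) (auto simp: dv_support not_le not_less)
 finally show ?thesis .
qed

lemma poissonized_gaussian_glaw: "poissonized_gaussian e (glaw (amat e))"
 unfolding poissonized_gaussian_def covariance_PL
proof (intro conjI centered_gaussian_glaw allI arg_cong[of _ _ complex_of_real])
 fix p q
 let ?c = "%p. (1/2) * (real p * (real p - 1))"
 have "(\<integral>g. linear_statistic p g * linear_statistic q g \<partial>glaw (amat e))
   = ?c p * ?c q * (\<integral>g. g (p - 2) * g (q - 2) \<partial>glaw (amat e))"
  unfolding linear_statistic_def integral_mult_right_zero[symmetric] by (simp add: mult_ac)
 also have "... = (\<Sum>k\<le>p - 2. dv 1 e p k / sqrt (real (Suc k)) * (dv 1 e q k / sqrt (real (Suc k))))"
  unfolding glaw_product sum_distrib_left statistic_amat[symmetric] by (intro sum.cong) auto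
 also have "... = (\<Sum>m<p. dv 1 e p m * dv 1 e q m / real (Suc m))"
 proof (rule sum.mono_neutral_cong)
  show "dv 1 e p i / sqrt (real (Suc i)) * (dv 1 e q i / sqrt (real (Suc i))) = dv 1 e p i * dv 1 e q i / real (Suc i)" for i
   by simp
 qed (auto simp: dv_support)
 finally show "(\<integral>g. linear_statistic p g * linear_statistic q g \<partial>glaw (amat e)) = (\<Sum>m<p. dv 1 e p m * dv 1 e q m / real (Suc m))" .
qed

text \<open>The variance of \<open>g 0\<close> separates the two laws: it is 0 after the cut and 4
  before.\<close>

lemma glaw_cut0_neq: "glaw (cut0 (amat e)) ~= glaw (amat e)"
proof
 assume "glaw (cut0 (amat e)) = glaw (amat e)"
 then have "(\<integral>g. g 0 * g 0 \<partial>glaw (cut0 (amat e))) = (\<integral>g. g 0 * g 0 \<partial>glaw (amat e))" by simp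
 then show False unfolding glaw_product by (simp add: cut0_def amat_0)
qed

lemma mean_shift_fun: "mean_shift shift_fun"
 unfolding mean_shift_def
proof (intro conjI allI integral_shift_fun)
 fix p show "((%e. action_moment e p v_PL) has_real_derivative half_dd shift_fun (%c. c ^ p)) (at 0)"
  unfolding half_dd_shift_fun action_moment_PL[OF order_refl] using ov_deriv_e[of p] by (cases "p = 0") auto
qed

lemma statistics_measurable: "(%g p. linear_statistic p g + b p) \<in> measurable borel (borel :: (nat => real) measure)"
 unfolding linear_statistic_def
 by (intro borel_measurable_continuous_onI continuous_on_coordinatewise_then_product continuous_intros continuous_coordinate)

lemma statistics_cis:
 assumes "!!p. p \<in> J ==> p <= P" "finite J"
 shows "(\<integral>x. cis (\<Sum>p\<in>J. s p * x p) \<partial>distr (glaw (cut0 (amat e))) borel (%g p. linear_statistic p g + b p))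
  = of_real (exp (- (\<Sum>p\<in>J. \<Sum>q\<in>J. s p * s q * cov e 1 p q) / 2)) * cis (\<Sum>p\<in>J. s p * b p)"
proof -
 define c where "c k = (if k = 0 then 0 else \<Sum>p\<in>J. s p * (dv 1 e p k / sqrt (real (Suc k))))" for k
 have m: "(%x. cis (\<Sum>p\<in>J. s p * x p)) \<in> borel_measurable (borel :: (nat => real) measure)"
  by (rule measurable_compose[OF lin_coord_measurable]) (intro borel_measurable_continuous_onI continuous_intros)
 have sub: "(\<Sum>k<Suc P. if k = 0 then 0 else F k) = (\<Sum>k\<in>{1..<Suc P}. F k :: real)" for F
  by (intro sum.mono_neutral_cong_right) auto
 have st: "(\<Sum>p\<in>J. s p * linear_statistic p (gmap (cut0 (amat e)) xi)) = (\<Sum>k<Suc P. c k * xi k)" for xi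
 proof -
  have "(\<Sum>p\<in>J. s p * linear_statistic p (gmap (cut0 (amat e)) xi))
   = (\<Sum>p\<in>J. \<Sum>k\<in>{1..<Suc P}. s p * (dv 1 e p k / sqrt (real (Suc k)) * xi k))"
   unfolding sum_distrib_left[symmetric] using assms(1)
   by (intro sum.cong refl arg_cong2[of _ _ _ _ times] statistic_gmap) (simp add: le_Suc_eq)
  also have "... = (\<Sum>k\<in>{1..<Suc P}. \<Sum>p\<in>J. s p * (dv 1 e p k / sqrt (real (Suc k)) * xi k))" by (rule sum.swap)
  also have "... = (\<Sum>k\<in>{1..<Suc P}. (\<Sum>p\<in>J. s p * (dv 1 e p k / sqrt (real (Suc k)))) * xi k)"
   unfolding sum_distrib_right by (simp add: mult.assoc)
  also have "... = (\<Sum>k<Suc P. c k * xi k)"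
   unfolding sub[symmetric] by (intro sum.cong) (auto simp: c_def)
  finally show ?thesis .
 qed
 have var: "(\<Sum>k<Suc P. (c k)^2) = (\<Sum>p\<in>J. \<Sum>q\<in>J. s p * s q * cov e 1 p q)"
 proof -
  have "(\<Sum>p\<in>J. \<Sum>q\<in>J. s p * s q * cov e 1 p q)
   = (\<Sum>k=1..P. 1 ^ Suc k / real (Suc k) * (\<Sum>p\<in>J. s p * dv 1 e p k)^2)"
   unfolding sum_quadratic[symmetric] using assms(1) by (intro sum.cong refl) (simp add: cov_eq[of _ P])
  also have "... = (\<Sum>k\<in>{1..<Suc P}. (\<Sum>p\<in>J. s p * (dv 1 e p k / sqrt (real (Suc k))))^2)"
   by (intro sum.cong) (auto simp: sum_divide_distrib[symmetric] power_divide)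
  also have "... = (\<Sum>k<Suc P. (c k)^2)"
   unfolding sub[symmetric] by (intro sum.cong) (auto simp: c_def)
  finally show ?thesis ..
 qed
 have "(\<integral>x. cis (\<Sum>p\<in>J. s p * x p) \<partial>distr (glaw (cut0 (amat e))) borel (%g p. linear_statistic p g + b p))
   = (\<integral>g. cis (\<Sum>p\<in>J. s p * (linear_statistic p g + b p)) \<partial>glaw (cut0 (amat e)))"
  by (rule integral_distr[OF _ m]) (use statistics_measurable measurable_cong_sets[OF sets_glaw refl] in blast)
 also have "... = (\<integral>xi. cis (\<Sum>p\<in>J. s p * (linear_statistic p (gmap (cut0 (amat e)) xi) + b p)) \<partial>gspace)"
  by (rule glaw_integral[OF measurable_compose[OF statistics_measurable m]])
 also have "... = (\<integral>xi. cis (\<Sum>k<Suc P. c k * xi k) * cis (\<Sum>p\<in>J. s p * b p) \<partial>gspace)"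
  unfolding distrib_left sum.distrib st cis_mult ..
 also have "... = (\<integral>xi. cis (\<Sum>k<Suc P. c k * xi k) \<partial>gspace) * cis (\<Sum>p\<in>J. s p * b p)" by simp
 finally show ?thesis unfolding gauss_cis var .
qed

lemma integrable_jack_plancherel:
 fixes F :: "_ => 'b :: {banach, second_countable_topology}"
 shows "integrable (jack_plancherel e h d) F"
 unfolding jack_plancherel_def by (rule integrable_point_measure_finite[OF finite_partitions])

lemma square_add_le: "(x + y)^2 <= 2 * x^2 + 2 * (y :: real)^2"
 using sum_squares_bound[of x y] unfolding power2_sum by linarith

section \<open>Fluctuations of the Jack-Plancherel moments at size d\<close>

context jp_clt
begin

abbreviation JP :: "nat => nat list measure" where "JP d \<equiv> jack_plancherel (ed d) (1 / real d) d"

abbreviation FL :: "nat => nat list => nat => real" where "FL d \<equiv> fluctuation es (ed d) (1 / real d)"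

text \<open>The chain is centred at the moments for \<open>ed d\<close>, the theorem at those for
  \<open>es\<close>; this is the difference on the scale of the fluctuations.\<close>

definition drift :: "nat => nat => real" where
 "drift d p = (ov 1 (ed d) p - ov 1 es p) * sqrt (real d)"

lemma fluctuation_eq:
 assumes "d >= 1" "l \<in> partitions d"
 shows "FL d l p = (if p < 2 then 0 else Y d d p (pad l) + drift d p)"
proof -
 have m: "half_dd_profile (profile l (ed d) (1 / real d)) (%c. c ^ p) = Om d (pad l) p"
  unfolding Om_def ad_def bd_def by (rule profile_moment[OF _ assms(2)]) (use assms(1) in simp)
 have f: "FL d l p = (Om d (pad l) p - (if p = 0 then 1 else ov 1 es p)) * sqrt (real d)"
  unfolding fluctuation_def m action_moment_def[symmetric] action_moment_PL[OF order_refl] by (simp add: real_sqrt_divide)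
 consider "p = 0" | "p = 1" | "p >= 2" by linarith
 then show ?thesis
 proof cases
  case 1 then show ?thesis unfolding f by (simp add: Om_def shape_moment_def box_pow_def)
 next
  case 2 then show ?thesis unfolding f using shape_moment_1 by (simp add: Om_def ov_1)
 next
  case 3 then show ?thesis unfolding f using assms by (simp add: Y_def drift_def algebra_simps)
 qed
qed

lemma integral_EE:
 fixes F :: "_ => 'b :: {banach, second_countable_topology}"
 assumes "d >= 1" "!!l. l \<in> partitions d ==> G l = F (pad l)"
 shows "(\<integral>l. G l \<partial>JP d) = EE d d F"
 unfolding EE_def ad_def bd_def by (rule integral_jack_plancherel) (use assms in auto)

context
 fixes b :: "nat => real"
 assumes drift_lim: "!!p. p >= 2 ==> (%d. drift d p) ----> b p"
begin

lemma fluctuation_second_moment: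
 "EX C. ALL d>=1. (\<integral>l. (FL d l p)^2 \<partial>JP d) <= C"
proof (cases "p < 2")
 case True
 have "(\<integral>l. (FL d l p)^2 \<partial>JP d) = EE d d (%_. 0)" if "d >= 1" for d
  by (rule integral_EE[OF that]) (use True fluctuation_eq that in auto)
 then show ?thesis by (intro exI[of _ 0]) (simp add: EE_def jp_sum_def)
next
 case False
 obtain C where C: "!!d. d >= 1 ==> EE d d (%f. (Y d d p f)^2) <= C" using Y_second_moment False by (metis not_less)
 obtain B where B: "!!d. \<bar>drift d p\<bar> <= B"
  using convergent_imp_Bseq[OF convergentI[OF drift_lim]] False by (auto simp: Bseq_def not_less)
 have "(\<integral>l. (FL d l p)^2 \<partial>JP d) <= 2 * C + 2 * B^2" if d: "d >= 1" for d
 proof -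
  have "(\<integral>l. (FL d l p)^2 \<partial>JP d) = EE d d (%f. (Y d d p f + drift d p)^2)"
   by (rule integral_EE[OF d]) (use False fluctuation_eq d in auto)
  also have "... <= EE d d (%f. 2 * (Y d d p f)^2 + (2 * B^2) * 1)"
  proof (rule EE_mono[OF d])
   fix f
   have "(drift d p)^2 <= B^2" using B[of d] by (metis abs_ge_zero power2_abs power_mono)
   then show "(Y d d p f + drift d p)^2 <= 2 * (Y d d p f)^2 + (2 * B^2) * 1"
    using square_add_le[of "Y d d p f" "drift d p"] by linarith
  qed
  also have "... = 2 * EE d d (%f. (Y d d p f)^2) + 2 * B^2" unfolding EE_add EE_cmult EE_1[OF d] by simp
  finally show ?thesis using C[OF d] by simp
 qed
 then show ?thesis by blast
qed

text \<open>Chebyshev's inequality: bounded second moments of the rescaled deviations make the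
  unscaled ones of order 1 / d.\<close>

theorem limit_shape: "limit_shape_theorem ed es"
 unfolding limit_shape_theorem_def
proof (intro allI impI)
 fix p and eta :: real assume eta: "eta > 0"
 let ?F = "%d l. FL d l p"
 let ?S = "%d. {l \<in> partitions d. \<bar>half_dd_profile (profile l (ed d) (1 / real d)) (%c. c ^ p)
       - half_dd_profile (action_profile v_PL es) (%c. c ^ p)\<bar> > eta}"
 obtain C where C: "!!d. d >= 1 ==> (\<integral>l. (?F d l)^2 \<partial>JP d) <= C" using fluctuation_second_moment by blast
 have "measure (JP d) (?S d) <= C / (eta^2 * real d)" if d: "d >= 1" for d
 proof -
  have S: "?S d \<subseteq> space (JP d)" "?S d \<in> sets (JP d)" by (auto simp: jack_plancherel_def space_point_measure sets_point_measure)
  have "measure (JP d) (?S d) = (\<integral>l. indicator (?S d) l \<partial>JP d)" using S(1) by (simp add: Int_absorb2)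
  also have "... <= (\<integral>l. (?F d l)^2 / (eta^2 * real d) \<partial>JP d)"
  proof (intro integral_mono integrable_jack_plancherel)
   fix l
   let ?D = "half_dd_profile (profile l (ed d) (1 / real d)) (%c. c ^ p) - half_dd_profile (action_profile v_PL es) (%c. c ^ p)"
   have "(?F d l)^2 / (eta^2 * real d) = ?D^2 / eta^2"
    using d by (simp add: fluctuation_def power_divide)
   moreover have "1 <= ?D^2 / eta^2" if "\<bar>?D\<bar> > eta"
    using eta power_mono[of eta "\<bar>?D\<bar>" 2] that by (simp add: pos_le_divide_eq)
   ultimately show "indicator (?S d) l <= (?F d l)^2 / (eta^2 * real d)" by (simp add: indicator_def)
  qed
  also have "... <= C / (eta^2 * real d)" using C[OF d] by (simp add: divide_right_mono)
  finally show ?thesis .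
 qed
 then have ev: "\<forall>\<^sub>F d in sequentially. measure (JP d) (?S d) <= C / (eta^2 * real d)"
  unfolding eventually_sequentially by blast
 have li: "(%d. C / (eta^2 * real d)) ----> 0"
  using eta by (intro real_tendsto_divide_at_top[OF tendsto_const] filterlim_tendsto_pos_mult_at_top[OF tendsto_const] filterlim_real_sequentially) auto
 show "(%d. measure (JP d) (?S d)) ----> 0" by (rule tendsto_sandwich[OF _ ev tendsto_const li]) simp
qed

lemma fluctuation_cis_limit:
 assumes "finite J" and b: "b 0 = 0" "b 1 = 0"
 shows "(%d. \<integral>l. cis (\<Sum>p\<in>J. s p * FL d l p) \<partial>JP d)
  ----> of_real (exp (- (\<Sum>p\<in>J. \<Sum>q\<in>J. s p * s q * cov es 1 p q) / 2)) * cis (\<Sum>p\<in>J. s p * b p)"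
proof -
 obtain P where P: "!!p. p \<in> J ==> p < P" using finite_bound[OF assms(1)] by blast
 define s' where "s' p = (if p \<in> J then s p else 0)" for p
 have sum: "(\<Sum>p=2..P. s' p * F p) = (\<Sum>p\<in>J. s p * F p)" if "!!p. p < 2 ==> F p = 0" for F
 proof -
  have "(\<Sum>p\<in>J. s p * F p) = (\<Sum>p\<in>J \<inter> {2..P}. s p * F p)"
  proof (rule sum.mono_neutral_right[OF assms(1) Int_lower1 ballI])
   fix p assume "p \<in> J - J \<inter> {2..P}"
   then have "p < 2" using P[of p] by auto
   then show "s p * F p = 0" by (simp add: that)
  qed
  also have "... = (\<Sum>p=2..P. s' p * F p)" by (intro sum.mono_neutral_cong_left) (auto simp: s'_def)
  finally show ?thesis ..
 qed
 have c0: "cov es 1 p q = 0" if "p < 2 | q < 2" for p q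
  using that unfolding cov_def by (intro sum.neutral) (auto simp: dv_support)
 have "(\<Sum>p=2..P. \<Sum>q=2..P. s' p * s' q * cov es 1 p q) = (\<Sum>p=2..P. s' p * (\<Sum>q=2..P. s' q * cov es 1 p q))"
  by (simp add: sum_distrib_left mult.assoc)
 also have "... = (\<Sum>p\<in>J. \<Sum>q\<in>J. s p * s q * cov es 1 p q)"
  by (subst sum) (auto simp: c0 sum sum_distrib_left mult.assoc)
 finally have v: "(\<Sum>p=2..P. \<Sum>q=2..P. s' p * s' q * cov es 1 p q) = (\<Sum>p\<in>J. \<Sum>q\<in>J. s p * s q * cov es 1 p q)" .
 have bs: "(\<Sum>p=2..P. s' p * b p) = (\<Sum>p\<in>J. s p * b p)" by (rule sum) (use b in "auto simp: less_2_cases_iff")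
 have "(%d. EE d d (%f. cis (\<Sum>p=2..P. s' p * Y d d p f)) * cis (\<Sum>p=2..P. s' p * drift d p))
  ----> of_real (exp (- (\<Sum>p=2..P. \<Sum>q=2..P. s' p * s' q * cov es 1 p q) / 2)) * cis (\<Sum>p=2..P. s' p * b p)"
 proof (intro tendsto_mult EE_cis_limit)
  have "(%d. \<Sum>p=2..P. s' p * drift d p) ----> (\<Sum>p=2..P. s' p * b p)"
   by (intro tendsto_sum tendsto_mult tendsto_const, rule drift_lim) simp
  then show "(%d. cis (\<Sum>p=2..P. s' p * drift d p)) ----> cis (\<Sum>p=2..P. s' p * b p)"
   unfolding cis_conv_exp by (intro tendsto_exp tendsto_mult tendsto_const tendsto_of_real)
 qed
 moreover have "EE d d (%f. cis (\<Sum>p=2..P. s' p * Y d d p f)) * cis (\<Sum>p=2..P. s' p * drift d p)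
   = (\<integral>l. cis (\<Sum>p\<in>J. s p * FL d l p) \<partial>JP d)" if d: "d >= 1" for d
 proof -
  have "(\<integral>l. cis (\<Sum>p\<in>J. s p * FL d l p) \<partial>JP d)
   = EE d d (%f. cis (\<Sum>p=2..P. s' p * drift d p) * cis (\<Sum>p=2..P. s' p * Y d d p f))"
  proof (rule integral_EE[OF d])
   fix l assume l: "l \<in> partitions d"
   have "(\<Sum>p\<in>J. s p * FL d l p) = (\<Sum>p=2..P. s' p * FL d l p)"
    by (rule sum[symmetric]) (simp add: fluctuation_eq[OF d l])
   also have "... = (\<Sum>p=2..P. s' p * drift d p) + (\<Sum>p=2..P. s' p * Y d d p (pad l))"
    unfolding fluctuation_eq[OF d l] sum.distrib[symmetric] by (intro sum.cong) (auto simp: distrib_left)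
   finally show "cis (\<Sum>p\<in>J. s p * FL d l p)
     = cis (\<Sum>p=2..P. s' p * drift d p) * cis (\<Sum>p=2..P. s' p * Y d d p (pad l))" by (simp add: cis_mult)
  qed
  then show ?thesis unfolding EE_cmult by simp
 qed
 ultimately show ?thesis unfolding v bs
  by (elim Lim_transform_eventually) (auto simp: eventually_sequentially)
qed

theorem fluctuation_limit:
 assumes b: "!!p. half_dd Y' (%c. c ^ p) = b p"
 shows "fluctuation_theorem ed es (glaw (cut0 (amat es))) Y'"
proof -
 let ?\<nu> = "distr (glaw (cut0 (amat es))) borel (%g p. linear_statistic p g + b p)"
 have b0: "b 0 = 0" "b 1 = 0" unfolding b[symmetric] half_dd_linear_statistic linear_statistic_def by auto
 have F: "FL d \<in> measurable (JP d) borel" for d by (simp add: jack_plancherel_def)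
 have G: "(%g p. linear_statistic p g + b p) \<in> measurable (glaw (cut0 (amat es))) borel"
  using statistics_measurable measurable_cong_sets[OF sets_glaw refl] by blast
 have sq: "(%x. (x p)^2) \<in> borel_measurable (borel :: (nat => real) measure)" for p
  using coordinate_measurable by (rule borel_measurable_power)
 \<comment> \<open>The index is shifted so that only sizes from 1 on occur; at size 0 the parameter
   \<open>1 / real d\<close> would be 0.\<close>
 have "joint_weak_conv (%d. distr (JP (Suc d)) borel (FL (Suc d))) ?\<nu> sequentially"
 proof (rule joint_weak_conv_cis)
  show "prob_space (distr (JP (Suc d)) borel (FL (Suc d)))" for d
   by (rule prob_space.prob_space_distr[OF prob_space_jack_plancherel F]) simp
  show "prob_space ?\<nu>" by (rule prob_space.prob_space_distr[OF prob_glaw G])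
  show "EX C. ALL d. integrable (distr (JP (Suc d)) borel (FL (Suc d))) (%x. (x p)^2) &
    (\<integral>x. (x p)^2 \<partial>distr (JP (Suc d)) borel (FL (Suc d))) <= C" for p
  proof -
   obtain C where C: "!!d. d >= 1 ==> (\<integral>l. (FL d l p)^2 \<partial>JP d) <= C" using fluctuation_second_moment by blast
   show ?thesis unfolding integrable_distr_eq[OF F sq] integral_distr[OF F sq]
    by (intro exI[of _ C] allI conjI integrable_jack_plancherel C) simp
  qed
  show "integrable ?\<nu> (%x. (x p)^2)" for p
  proof -
   have "(%x. (linear_statistic p x + b p)^2) \<in> borel_measurable borel"
    using measurable_compose[OF statistics_measurable sq] .
   moreover have "integrable gspace (%xi. (linear_statistic p (gmap (cut0 (amat es)) xi) + b p)^2)"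
   proof -
    define c where "c k = (if k = 0 then 0 else dv 1 es p k / sqrt (real (Suc k)))" for k
    have st: "linear_statistic p (gmap (cut0 (amat es)) xi) = (\<Sum>k<p. c k * xi k)" for xi
     unfolding statistic_gmap[OF le_SucI[OF order_refl]] by (intro sum.mono_neutral_cong_left) (auto simp: c_def)
    have "integrable gspace (%xi. 2 * (\<Sum>k<p. c k * xi k)^2 + 2 * (b p)^2)"
     by (intro Bochner_Integration.integrable_add integrable_mult_right gauss_square) simp
    then show ?thesis unfolding st
    proof (rule Bochner_Integration.integrable_bound)
     show "(%xi. ((\<Sum>k<p. c k * xi k) + b p)^2) \<in> borel_measurable gspace"
      by (intro borel_measurable_power borel_measurable_add borel_gspace lin_measurable) simp
     show "AE xi in gspace. norm (((\<Sum>k<p. c k * xi k) + b p)^2) <= norm (2 * (\<Sum>k<p. c k * xi k)^2 + 2 * (b p)^2)"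
     proof (rule AE_I2)
      fix xi show "norm (((\<Sum>k<p. c k * xi k) + b p)^2) <= norm (2 * (\<Sum>k<p. c k * xi k)^2 + 2 * (b p)^2)"
       using square_add_le[of "\<Sum>k<p. c k * xi k" "b p"] by simp
     qed
    qed
   qed
   ultimately show ?thesis
    by (subst integrable_distr_eq[OF G sq]) (simp add: glaw_def integrable_distr_eq[OF gmap_measurable])
  qed
  fix J and s :: "nat => real" assume J: "finite (J :: nat set)"
  obtain P where P: "!!p. p \<in> J ==> p < P" using finite_bound[OF J] by blast
  have m: "(%x. cis (\<Sum>p\<in>J. s p * x p)) \<in> borel_measurable (borel :: (nat => real) measure)"
   by (rule measurable_compose[OF lin_coord_measurable]) (intro borel_measurable_continuous_onI continuous_intros)
  have eq: "(\<integral>x. cis (\<Sum>p\<in>J. s p * x p) \<partial>?\<nu>)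
    = of_real (exp (- (\<Sum>p\<in>J. \<Sum>q\<in>J. s p * s q * cov es 1 p q) / 2)) * cis (\<Sum>p\<in>J. s p * b p)"
   by (rule statistics_cis[OF less_imp_le[OF P] J])
  show "(%d. \<integral>x. cis (\<Sum>p\<in>J. s p * x p) \<partial>distr (JP (Suc d)) borel (FL (Suc d))) ----> (\<integral>x. cis (\<Sum>p\<in>J. s p * x p) \<partial>?\<nu>)"
   unfolding eq integral_distr[OF F m]
   by (rule LIMSEQ_Suc[OF fluctuation_cis_limit[OF J b0]])
 qed simp_all
 then show ?thesis
  unfolding fluctuation_theorem_def joint_weak_conv_def b
  by (intro allI impI, subst filterlim_sequentially_Suc[symmetric]) blast
qed

end

end

text \<open>With a constant parameter \<open>drift\<close> is identically 0, so the limit carries no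
  deterministic part.\<close>

lemma fixed_regime:
 "limit_shape_theorem (%d. b) b & (EX N G. centered_gaussian N & poissonized_gaussian b G & N ~= G &
   fluctuation_theorem (%d. b) b N (%c. 0))"
proof -
 interpret jp_clt "%d. b" "\<bar>b\<bar>" b by unfold_locales auto
 have d: "(%d. drift d p) ----> 0" for p by (simp add: drift_def)
 have "half_dd (%c. 0) (%c. c ^ p) = (0 :: real)" for p by (simp add: half_dd_def)
 then show ?thesis
  using limit_shape[OF d] fluctuation_limit[OF d] centered_gaussian_glaw poissonized_gaussian_glaw glaw_cut0_neq by blast
qed

lemma jack_regime:
 assumes \<alpha>: "\<alpha> > 0" "\<gamma> = (sqrt \<alpha> - 1 / sqrt \<alpha>)^2" and e: "!!d. d >= 1 ==> jack_parameter (e d) (1 / real d) = \<alpha>"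
 shows "limit_shape_theorem e 0 & (EX N G X. centered_gaussian N & poissonized_gaussian 0 G & N ~= G &
  conditioned_on_zero_integral G N & mean_shift X & fluctuation_theorem e 0 N (%c. sgn (\<alpha> - 1) * sqrt \<gamma> * X c))"
proof -
 \<comment> \<open>The signed ratio of \<open>e d\<close> to 1 / sqrt d;
   \<open>sqrt \<gamma>\<close> is only its absolute value, whence the factor
   \<open>sgn (\<alpha> - 1)\<close>.\<close>
 define \<kappa> where "\<kappa> = sqrt \<alpha> - 1 / sqrt \<alpha>"
 have \<kappa>: "sgn (\<alpha> - 1) * sqrt \<gamma> = \<kappa>"
 proof -
  have "\<kappa> = (\<alpha> - 1) / sqrt \<alpha>" using \<alpha>(1) by (simp add: \<kappa>_def diff_divide_distrib real_div_sqrt)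
  then have "sgn \<kappa> = sgn (\<alpha> - 1)" using \<alpha>(1) by (simp add: sgn_divide)
  moreover have "sqrt \<gamma> = \<bar>\<kappa>\<bar>" by (simp add: \<alpha>(2) \<kappa>_def)
  ultimately show ?thesis by (metis sgn_mult_abs)
 qed
 have ed: "e d = \<kappa> * (1 / sqrt (real d))" if "d >= 1" for d
  using jack_parameter_rate(2)[of "1 / real d" \<alpha> "e d"] e[OF that] that
  by (simp add: \<kappa>_def real_sqrt_divide field_simps)
 have u: "(%d. 1 / sqrt (real d)) ----> 0"
  by (intro real_tendsto_divide_at_top[OF tendsto_const] filterlim_compose[OF sqrt_at_top filterlim_real_sequentially])
 interpret jp_clt e "\<bar>\<kappa>\<bar>" 0
 proof
  show "\<bar>e d\<bar> <= \<bar>\<kappa>\<bar>" if "d >= 1" for d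
   unfolding ed[OF that] using that mult_left_mono[of "1 / sqrt (real d)" 1 "\<bar>\<kappa>\<bar>"] by (simp add: abs_mult)
  have "(%d. \<kappa> * (1 / sqrt (real d))) ----> 0" using tendsto_mult[OF tendsto_const u] by simp
  then show "e ----> 0"
   by (rule Lim_transform_eventually) (use ed in "auto simp: eventually_sequentially intro!: exI[of _ 1]")
 qed
 \<comment> \<open>\<open>drift d p\<close> is the difference quotient at x = 1 / sqrt d of
   \<open>ov 1 (\<kappa> * x) p\<close>, so it tends to the derivative at x = 0.\<close>
 have d: "(%d. drift d p) ----> \<kappa> * (real p * shift_fps $ p)" if "p >= 2" for p
 proof -
  have "p >= 1" using that by simp
  have "((%x. ov 1 (\<kappa> * x) p) has_real_derivative real p * shift_fps $ p * \<kappa>) (at 0)"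
   by (rule DERIV_chain2[where f = "%e. ov 1 e p"]) (use ov_deriv_e[OF \<open>p >= 1\<close>] in "auto intro!: derivative_eq_intros")
  then have "((%x. (ov 1 (\<kappa> * x) p - ov 1 0 p) / x) \<longlongrightarrow> real p * shift_fps $ p * \<kappa>) (at 0)"
   by (simp add: has_field_derivative_iff)
  moreover have "filterlim (%d. 1 / sqrt (real d)) (at 0) sequentially"
   unfolding filterlim_at using u by (auto simp: eventually_sequentially intro!: exI[of _ 1])
  ultimately have "(%d. (ov 1 (\<kappa> * (1 / sqrt (real d))) p - ov 1 0 p) / (1 / sqrt (real d))) ----> real p * shift_fps $ p * \<kappa>"
   by (rule filterlim_compose)
  then have "(%d. drift d p) ----> real p * shift_fps $ p * \<kappa>"
   by (rule Lim_transform_eventually) (use ed in "auto simp: eventually_sequentially drift_def intro!: exI[of _ 1]")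
  then show ?thesis by (simp add: mult.commute)
 qed
 have "half_dd (%c. \<kappa> * shift_fun c) (%c. c ^ p) = \<kappa> * half_dd shift_fun (%c. c ^ p)" for p
  unfolding half_dd_pow mult.assoc integral_mult_right_zero by simp
 then have "half_dd (%c. sgn (\<alpha> - 1) * sqrt \<gamma> * shift_fun c) (%c. c ^ p) = \<kappa> * (real p * shift_fps $ p)" for p
  unfolding \<kappa> half_dd_shift_fun by simp
 moreover have "conditioned_on_zero_integral (glaw (amat 0)) (glaw (cut0 (amat 0)))"
  by (rule conditioned_glaw) (simp add: amat_0)
 ultimately show ?thesis
  using limit_shape[OF d] fluctuation_limit[OF d] centered_gaussian_glaw poissonized_gaussian_glaw glaw_cut0_neq mean_shift_fun
  by blast
qed

theorem propositionA0p1: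
  shows
    "(\<forall>b::real. b < 0 \<longrightarrow>
        limit_shape_theorem (\<lambda>d. b) b \<and>
        (\<exists>N G. centered_gaussian N \<and> poissonized_gaussian b G \<and> N \<noteq> G \<and>
               fluctuation_theorem (\<lambda>d. b) b N (\<lambda>c. 0)))
   \<and> (\<forall>(\<alpha>::real) (\<gamma>::real) (e::nat \<Rightarrow> real).
        \<alpha> > 0 \<and> \<gamma> = (sqrt \<alpha> - 1 / sqrt \<alpha>)\<^sup>2 \<and>
        (\<forall>d\<ge>1. jack_parameter (e d) (1 / real d) = \<alpha>) \<longrightarrow>
        limit_shape_theorem e 0 \<and>
        (\<exists>N G X. centered_gaussian N \<and> poissonized_gaussian 0 G \<and> N \<noteq> G \<and>
               conditioned_on_zero_integral G N \<and> mean_shift X \<and>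
               fluctuation_theorem e 0 N (\<lambda>c. sgn (\<alpha> - 1) * sqrt \<gamma> * X c)))
   \<and> (\<forall>b::real. b > 0 \<longrightarrow>
        limit_shape_theorem (\<lambda>d. b) b \<and>
        (\<exists>N G. centered_gaussian N \<and> poissonized_gaussian b G \<and> N \<noteq> G \<and>
               fluctuation_theorem (\<lambda>d. b) b N (\<lambda>c. 0)))"
proof (intro conjI[OF _ conjI] allI impI)
  fix \<alpha> \<gamma> :: real and e :: "nat \<Rightarrow> real"
  assume "\<alpha> > 0 \<and> \<gamma> = (sqrt \<alpha> - 1 / sqrt \<alpha>)\<^sup>2 \<and> (\<forall>d\<ge>1. jack_parameter (e d) (1 / real d) = \<alpha>)"
  then show "limit_shape_theorem e 0 \<and> (\<exists>N G X. centered_gaussian N \<and> poissonized_gaussian 0 G \<and> N \<noteq> G \<and>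
      conditioned_on_zero_integral G N \<and> mean_shift X \<and> fluctuation_theorem e 0 N (\<lambda>c. sgn (\<alpha> - 1) * sqrt \<gamma> * X c))"
    by (elim conjE) (rule jack_regime, simp_all)
qed (rule fixed_regime)+

end
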